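(* Let $K$ be a field and let $\mathcal{C}$ be a finite, non-empty, weakly connected, convex collection of cells in $\mathbb{Z}^2$, with adjacent $2$-minor ideal $I_{\mathrm{adj}}(\mathcal{C})\subset S_{\mathcal{C}}=K[x_v\mid v\in V(\mathcal{C})]$. Then $I_{\mathrm{adj}}(\mathcal{C})$ satisfies the following equivalent conditions: (1) $I_{\mathrm{adj}}(\mathcal{C})$ is a complete intersection; (2) $S_{\mathcal{C}}/I_{\mathrm{adj}}(\mathcal{C})$ is Gorenstein; (3) $S_{\mathcal{C}}/I_{\mathrm{adj}}(\mathcal{C})$ is level; (4) $S_{\mathcal{C}}/I_{\mathrm{adj}}(\mathcal{C})$ is Cohen--Macaulay; (5) $I_{\mathrm{adj}}(\mathcal{C})$ is unmixed; if and only if $\mathcal{C}$ contains neither a square tetromino nor an $X$-pentomino.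
   Context: A cell of $\mathbb{Z}^2$ is a set $C=[a,b]=\{a,b,c,d\}$ with $a=(i,j)$ (its lower left corner), $b=a+(1,1)$, $c=(i,j+1)$, $d=(i+1,j)$; $a,b$ are its diagonal corners, $c,d$ its anti-diagonal corners, $V(C)=\{a,b,c,d\}$ its vertices, and $\{a,c\},\{c,b\},\{b,d\},\{a,d\}$ its edges. For a set $\mathcal{C}$ of cells, $V(\mathcal{C})=\bigcup_{C\in\mathcal{C}}V(C)$. $\mathcal{C}$ is weakly connected if any two cells of $\mathcal{C}$ can be joined by a sequence of cells of $\mathcal{C}$ in which consecutive cells share an edge or a vertex. $\mathcal{C}$ is row convex (resp. column convex) if for any two cells of $\mathcal{C}$ lying in the same row (resp. column), all cells between them in that row (resp. column) belong to $\mathcal{C}$; it is convex if it is both row and column convex. $I_{\mathrm{adj}}(\mathcal{C})$ is the ideal of $S_{\mathcal{C}}$ generated by the adjacent $2$-minors $x_ax_b-x_cx_d$, one for each cell of $\mathcal{C}$ (with diagonal corners $a,b$ and anti-diagonal corners $c,d$). A square tetromino is a set of four cells forming a $2\times 2$ block (the four cells containing a given point of $\mathbb{Z}^2$ as a vertex); an $X$-pentomino is a set of five cells consisting of a cell together with its four edge-neighbours; $\mathcal{C}$ contains such a configuration if some such set of cells is a subset of $\mathcal{C}$. An ideal is called unmixed if all its minimal primes have the same height. A standard graded Cohen--Macaulay $K$-algebra is level if its canonical module is generated in a single degree. The five listed conditions are equivalent for every weakly connected collection of cells. *)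

theory Defs
  imports
    "HOL-Library.Poly_Mapping"
    "HOL-Library.Extended_Nat"
    "HOL-Algebra.QuotRing"
    "HOL-Algebra.Module"
    "HOL-Algebra.Ring_Divisibility"
    "Jordan_Normal_Form.Matrix"
begin

section \<open>Collections of cells\<close>

type_synonym point = "int \<times> int"

text \<open>The first coordinate is horizontal, so cells in one row share the second coordinate of
  their lower left corners. The diagonal corners are \<open>(i, j)\<close> and \<open>(i + 1, j + 1)\<close>.\<close>

definition cell :: "point \<Rightarrow> point set" where
  "cell = (\<lambda>(i, j). {(i, j), (i + 1, j + 1), (i, j + 1), (i + 1, j)})"

definition cell_edges :: "point \<Rightarrow> point set set" where
  "cell_edges = (\<lambda>(i, j).
     {{(i, j), (i, j + 1)}, {(i, j + 1), (i + 1, j + 1)},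
      {(i + 1, j + 1), (i + 1, j)}, {(i, j), (i + 1, j)}})"

definition vertices :: "point set set \<Rightarrow> point set" where
  "vertices \<C> = \<Union>\<C>"

definition cell_adjacent :: "point set \<Rightarrow> point set \<Rightarrow> bool" where
  "cell_adjacent A B \<longleftrightarrow>
     (\<exists>p q. A = cell p \<and> B = cell q \<and> (cell_edges p \<inter> cell_edges q \<noteq> {} \<or> cell p \<inter> cell q \<noteq> {}))"

definition weakly_connected :: "point set set \<Rightarrow> bool" where
  "weakly_connected \<C> \<longleftrightarrow>
     (\<forall>A\<in>\<C>. \<forall>B\<in>\<C>. (A, B) \<in> {(X, Y). X \<in> \<C> \<and> Y \<in> \<C> \<and> cell_adjacent X Y}\<^sup>*)"

definition row_convex :: "point set set \<Rightarrow> bool" where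
  "row_convex \<C> \<longleftrightarrow>
     (\<forall>i k l j. cell (i, j) \<in> \<C> \<and> cell (l, j) \<in> \<C> \<and> i \<le> k \<and> k \<le> l \<longrightarrow> cell (k, j) \<in> \<C>)"

definition column_convex :: "point set set \<Rightarrow> bool" where
  "column_convex \<C> \<longleftrightarrow>
     (\<forall>i j k l. cell (i, j) \<in> \<C> \<and> cell (i, l) \<in> \<C> \<and> j \<le> k \<and> k \<le> l \<longrightarrow> cell (i, k) \<in> \<C>)"

definition convex_cells :: "point set set \<Rightarrow> bool" where
  "convex_cells \<C> \<longleftrightarrow> row_convex \<C> \<and> column_convex \<C>"

definition square_tetromino :: "point set set \<Rightarrow> bool" where
  "square_tetromino T \<longleftrightarrow> (\<exists>v. T = {A. (\<exists>p. A = cell p) \<and> v \<in> A})"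

definition X_pentomino :: "point set set \<Rightarrow> bool" where
  "X_pentomino T \<longleftrightarrow>
     (\<exists>i j. T = {cell (i, j), cell (i + 1, j), cell (i - 1, j), cell (i, j + 1), cell (i, j - 1)})"


section \<open>Polynomial rings\<close>

text \<open>A polynomial is a finitely supported function from monomials to coefficients, and a
  monomial is a finitely supported exponent function. The ring \<open>K[x\<^sub>v | v \<in> V]\<close> consists of those
  polynomials in which only variables from \<open>V\<close> occur.\<close>

type_synonym ('v, 'k) mpoly = "('v \<Rightarrow>\<^sub>0 nat) \<Rightarrow>\<^sub>0 'k"

definition Var :: "'v \<Rightarrow> ('v, 'k::field) mpoly" where
  "Var v = Poly_Mapping.single (Poly_Mapping.single v 1) 1"

definition poly_ring :: "'v set \<Rightarrow> ('v, 'k::field) mpoly ring" where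
  "poly_ring V = \<lparr>carrier = {p. \<forall>m\<in>Poly_Mapping.keys p. Poly_Mapping.keys m \<subseteq> V},
     mult = (*), one = 1, zero = 0, add = (+)\<rparr>"

definition monom_deg :: "('v \<Rightarrow>\<^sub>0 nat) \<Rightarrow> nat" where
  "monom_deg m = (\<Sum>v\<in>Poly_Mapping.keys m. Poly_Mapping.lookup m v)"

text \<open>Degrees are integers because twists occur; \<open>0\<close> is homogeneous of every degree, and it is
  the only homogeneous polynomial of a negative degree.\<close>

definition homogeneous :: "int \<Rightarrow> ('v, 'k::field) mpoly \<Rightarrow> bool" where
  "homogeneous t p \<longleftrightarrow> (\<forall>m\<in>Poly_Mapping.keys p. int (monom_deg m) = t)"

definition adj_minor :: "point \<Rightarrow> (point, 'k::field) mpoly" where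
  "adj_minor = (\<lambda>(i, j).
     Var (i, j) * Var (i + 1, j + 1) - Var (i, j + 1) * Var (i + 1, j))"

definition adj_ideal :: "point set set \<Rightarrow> (point, 'k::field) mpoly set" where
  "adj_ideal \<C> = Idl\<^bsub>poly_ring (vertices \<C>)\<^esub> {adj_minor p | p. cell p \<in> \<C>}"


section \<open>Commutative algebra\<close>

subsection \<open>Height, dimension, unmixed ideals\<close>

definition prime_height :: "('a, 'b) ring_scheme \<Rightarrow> 'a set \<Rightarrow> enat" where
  "prime_height R P = Sup {enat n | n. \<exists>Q. (\<forall>i\<le>n. primeideal (Q i) R) \<and>
     (\<forall>i<n. Q i \<subset> Q (Suc i)) \<and> Q n = P}"

definition krull_dim :: "('a, 'b) ring_scheme \<Rightarrow> enat" where
  "krull_dim R = Sup {prime_height R P | P. primeideal P R}"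

definition minimal_prime_over :: "('a, 'b) ring_scheme \<Rightarrow> 'a set \<Rightarrow> 'a set \<Rightarrow> bool" where
  "minimal_prime_over R I P \<longleftrightarrow> primeideal P R \<and> I \<subseteq> P \<and>
     (\<forall>Q. primeideal Q R \<and> I \<subseteq> Q \<and> Q \<subseteq> P \<longrightarrow> Q = P)"

definition unmixed :: "('a, 'b) ring_scheme \<Rightarrow> 'a set \<Rightarrow> bool" where
  "unmixed R I \<longleftrightarrow> (\<forall>P Q. minimal_prime_over R I P \<and> minimal_prime_over R I Q
     \<longrightarrow> prime_height R P = prime_height R Q)"


subsection \<open>Regular sequences, complete intersections, Cohen--Macaulay rings\<close>

definition regular_sequence :: "('a, 'b) ring_scheme \<Rightarrow> 'a list \<Rightarrow> bool" where
  "regular_sequence R xs \<longleftrightarrow> set xs \<subseteq> carrier R \<and> Idl\<^bsub>R\<^esub> (set xs) \<noteq> carrier R \<and>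
     (\<forall>i<length xs. \<forall>y\<in>carrier R.
        xs ! i \<otimes>\<^bsub>R\<^esub> y \<in> Idl\<^bsub>R\<^esub> (set (take i xs)) \<longrightarrow> y \<in> Idl\<^bsub>R\<^esub> (set (take i xs)))"

definition complete_intersection :: "('a, 'b) ring_scheme \<Rightarrow> 'a set \<Rightarrow> bool" where
  "complete_intersection R I \<longleftrightarrow> (\<exists>xs. regular_sequence R xs \<and> I = Idl\<^bsub>R\<^esub> (set xs))"

definition ideal_depth :: "('a, 'b) ring_scheme \<Rightarrow> 'a set \<Rightarrow> enat" where
  "ideal_depth R I = Sup {enat (length xs) | xs. regular_sequence R xs \<and> set xs \<subseteq> I}"

text \<open>The definition for arbitrary (not necessarily local or graded) Noetherian commutative
  rings, as in Eisenbud, \<^emph>\<open>Commutative Algebra\<close>, Section 18.2: depth equals codimension at every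
  maximal ideal.\<close>

definition cohen_macaulay :: "('a, 'b) ring_scheme \<Rightarrow> bool" where
  "cohen_macaulay R \<longleftrightarrow> cring R \<and> noetherian_ring R \<and>
     (\<forall>P. maximalideal P R \<longrightarrow> ideal_depth R P = prime_height R P)"


subsection \<open>Modules\<close>

text \<open>The ring multiplication and unit fields of module records are irrelevant.\<close>

definition quot_module :: "('a, 'm) module \<Rightarrow> 'm set \<Rightarrow> ('a, 'm set) module" (infixl "QuotM" 65) where
  "M QuotM N = \<lparr>carrier = a_rcosets\<^bsub>M\<^esub> N, mult = undefined, one = undefined,
     zero = N, add = set_add M, smult = (\<lambda>a X. \<Union>x\<in>X. N +>\<^bsub>M\<^esub> (a \<odot>\<^bsub>M\<^esub> x))\<rparr>"

definition self_module :: "('a, 'b) ring_scheme \<Rightarrow> ('a, 'a) module" where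
  "self_module R = \<lparr>carrier = carrier R, mult = undefined, one = undefined,
     zero = \<zero>\<^bsub>R\<^esub>, add = add R, smult = mult R\<rparr>"

definition module_isomorphic ::
    "('a, 'b) ring_scheme \<Rightarrow> ('a, 'm) module \<Rightarrow> ('a, 'n) module \<Rightarrow> bool" where
  "module_isomorphic R M N \<longleftrightarrow> (\<exists>f. bij_betw f (carrier M) (carrier N) \<and>
     (\<forall>x\<in>carrier M. \<forall>y\<in>carrier M. f (x \<oplus>\<^bsub>M\<^esub> y) = f x \<oplus>\<^bsub>N\<^esub> f y) \<and>
     (\<forall>a\<in>carrier R. \<forall>x\<in>carrier M. f (a \<odot>\<^bsub>M\<^esub> x) = a \<odot>\<^bsub>N\<^esub> f x))"

definition module_generated_by ::
    "('a, 'b) ring_scheme \<Rightarrow> ('a, 'm) module \<Rightarrow> 'm set \<Rightarrow> bool" where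
  "module_generated_by R M X \<longleftrightarrow> X \<subseteq> carrier M \<and>
     (\<forall>N. submodule N R M \<and> X \<subseteq> N \<longrightarrow> N = carrier M)"


subsection \<open>Graded free resolutions and the canonical module\<close>

text \<open>The free module of rank \<open>n\<close> over \<open>poly_ring V\<close>.\<close>

definition free_module :: "'v set \<Rightarrow> nat \<Rightarrow> (('v, 'k::field) mpoly, ('v, 'k) mpoly vec) module" where
  "free_module V n = (module_vec TYPE(('v, 'k) mpoly) n)
     \<lparr>carrier := {w \<in> carrier_vec n. set\<^sub>v w \<subseteq> carrier (poly_ring V)}\<rparr>"

text \<open>A graded free resolution \<open>\<dots> \<rightarrow> F\<^sub>2 \<rightarrow> F\<^sub>1 \<rightarrow> F\<^sub>0\<close> of \<open>S/I\<close> by finitely generated free modules over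
  \<open>S = poly_ring V\<close>, with \<open>F\<^sub>0 = S\<close>. Here \<open>F\<^sub>i\<close> has rank \<open>b i\<close>, its \<open>s\<close>-th basis vector has degree
  \<open>d i s\<close>, and the matrix \<open>A i\<close> describes the degree-preserving differential from \<open>F\<^sub>i\<^sub>+\<^sub>1\<close> to \<open>F\<^sub>i\<close>.
  Minimality is not required and ranks may vanish.\<close>

definition graded_free_resolution ::
    "'v set \<Rightarrow> ('v, 'k::field) mpoly set \<Rightarrow> (nat \<Rightarrow> nat) \<Rightarrow> (nat \<Rightarrow> nat \<Rightarrow> int) \<Rightarrow>
     (nat \<Rightarrow> ('v, 'k) mpoly mat) \<Rightarrow> bool" where
  "graded_free_resolution V I b d A \<longleftrightarrow>
     b 0 = 1 \<and> d 0 0 = 0 \<and>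
     (\<forall>i. A i \<in> carrier_mat (b i) (b (Suc i)) \<and>
        (\<forall>r<b i. \<forall>s<b (Suc i). A i $$ (r, s) \<in> carrier (poly_ring V) \<and>
           homogeneous (d (Suc i) s - d i r) (A i $$ (r, s)))) \<and>
     (\<lambda>w. A 0 *\<^sub>v w) ` carrier (free_module V (b 1))
       = {w \<in> carrier (free_module V (b 0)). w $ 0 \<in> I} \<and>
     (\<forall>i. (\<lambda>w. A (Suc i) *\<^sub>v w) ` carrier (free_module V (b (Suc (Suc i))))
       = {w \<in> carrier (free_module V (b (Suc i))). A i *\<^sub>v w = 0\<^sub>v (b i)})"

text \<open>Applying \<open>Hom\<^sub>S(_, S)\<close> transposes the differentials; \<open>ext_module V b A c\<close> is the cohomology of
  the dual complex in degree \<open>c\<close>, that is, \<open>Ext\<^sup>c\<^sub>S(S/I, S)\<close>.\<close>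

definition ext_cocycles ::
    "'v set \<Rightarrow> (nat \<Rightarrow> nat) \<Rightarrow> (nat \<Rightarrow> ('v, 'k::field) mpoly mat) \<Rightarrow> nat \<Rightarrow> ('v, 'k) mpoly vec set" where
  "ext_cocycles V b A c = {w \<in> carrier (free_module V (b c)).
     transpose_mat (A c) *\<^sub>v w = 0\<^sub>v (b (Suc c))}"

definition ext_coboundaries ::
    "'v set \<Rightarrow> (nat \<Rightarrow> nat) \<Rightarrow> (nat \<Rightarrow> ('v, 'k::field) mpoly mat) \<Rightarrow> nat \<Rightarrow> ('v, 'k) mpoly vec set" where
  "ext_coboundaries V b A c = (case c of 0 \<Rightarrow> {0\<^sub>v (b 0)}
     | Suc c' \<Rightarrow> (\<lambda>w. transpose_mat (A c') *\<^sub>v w) ` carrier (free_module V (b c')))"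

definition ext_module ::
    "'v set \<Rightarrow> (nat \<Rightarrow> nat) \<Rightarrow> (nat \<Rightarrow> ('v, 'k::field) mpoly mat) \<Rightarrow> nat \<Rightarrow>
     (('v, 'k) mpoly, ('v, 'k) mpoly vec set) module" where
  "ext_module V b A c =
     (free_module V (b c))\<lparr>carrier := ext_cocycles V b A c\<rparr> QuotM ext_coboundaries V b A c"

text \<open>The canonical module of \<open>R = S/I\<close> is \<open>\<omega> = Ext\<^sup>c\<^sub>S(R, S(-n))\<close>, where \<open>n = |V|\<close> is the number of
  variables and \<open>c = n - dim R\<close>. The predicate states that \<open>b\<close>, \<open>d\<close>, \<open>A\<close>, \<open>c\<close> are data from which
  \<open>\<omega>\<close> is computed as \<open>ext_module V b A c\<close>; up to graded isomorphism the result does not depend on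
  the resolution, so the existential quantification over the data below is harmless.\<close>

definition canonical_data ::
    "'v set \<Rightarrow> ('v, 'k::field) mpoly set \<Rightarrow> (nat \<Rightarrow> nat) \<Rightarrow> (nat \<Rightarrow> nat \<Rightarrow> int) \<Rightarrow>
     (nat \<Rightarrow> ('v, 'k) mpoly mat) \<Rightarrow> nat \<Rightarrow> bool" where
  "canonical_data V I b d A c \<longleftrightarrow> graded_free_resolution V I b d A \<and>
     enat c + krull_dim (poly_ring V Quot I) = enat (card V)"

text \<open>The component of \<open>\<omega>\<close> of degree \<open>t\<close>. A homomorphism from \<open>F\<^sub>c\<close> to \<open>S(-n)\<close> of degree \<open>t\<close> sends the
  \<open>s\<close>-th basis vector to an element of \<open>S(-n)\<close> of degree \<open>t + d c s\<close>, i.e. to a polynomial of degree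
  \<open>t + d c s - n\<close>.\<close>

definition canonical_component ::
    "'v set \<Rightarrow> (nat \<Rightarrow> nat) \<Rightarrow> (nat \<Rightarrow> nat \<Rightarrow> int) \<Rightarrow> (nat \<Rightarrow> ('v, 'k::field) mpoly mat) \<Rightarrow> nat \<Rightarrow>
     int \<Rightarrow> ('v, 'k) mpoly vec set set" where
  "canonical_component V b d A c t =
     {ext_coboundaries V b A c +>\<^bsub>free_module V (b c)\<^esub> w | w.
        w \<in> ext_cocycles V b A c \<and> (\<forall>s<b c. homogeneous (t + d c s - int (card V)) (w $ s))}"

definition level_algebra :: "'v set \<Rightarrow> ('v, 'k::field) mpoly set \<Rightarrow> bool" where
  "level_algebra V I \<longleftrightarrow> cohen_macaulay (poly_ring V Quot I) \<and>
     (\<exists>b d A c. canonical_data V I b d A c \<and>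
        (\<exists>t. module_generated_by (poly_ring V) (ext_module V b A c)
               (canonical_component V b d A c t)))"

text \<open>\<open>R = S/I\<close> is Gorenstein if it is Cohen--Macaulay and \<open>\<omega>\<close> is isomorphic to \<open>R\<close> (up to a shift of
  the grading), as in Stanley, \<^emph>\<open>Combinatorics and Commutative Algebra\<close>, Section I.12. Both modules
  are annihilated by \<open>I\<close>, so isomorphisms over \<open>S\<close> and over \<open>R\<close> are the same.\<close>

definition gorenstein_algebra :: "'v set \<Rightarrow> ('v, 'k::field) mpoly set \<Rightarrow> bool" where
  "gorenstein_algebra V I \<longleftrightarrow> cohen_macaulay (poly_ring V Quot I) \<and>
     (\<exists>b d A c. canonical_data V I b d A c \<and>
        module_isomorphic (poly_ring V) (ext_module V b A c) (self_module (poly_ring V) QuotM I))"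

end

theory Submission
  imports Defs "HOL-Library.Product_Lexorder" "HOL-Computational_Algebra.Polynomial"
    "HOL-Computational_Algebra.Fraction_Field"
begin

text \<open>Let \<open>n\<close> and \<open>N\<close> be the numbers of vertices and cells. For a set \<open>W\<close> of vertices, the cells \<open>D\<close> that do
  not meet \<open>W\<close> and the variables in \<open>W\<close> give a toric prime of height \<open>|W| + |D|\<close>, and every prime
  containing adjacent minors contains the one for the set \<open>W\<close> of its variables; moreover each cell
  that meets this \<open>W\<close> has an edge in \<open>W\<close>.

  Without squares and crosses, a matching argument shows that at most \<open>|W|\<close> cells have an edge in
  \<open>W\<close>. So primes containing \<open>k\<close> of the minors have height at least \<open>k\<close>. If a minor were a zero
  divisor modulo the preceding ones, Ischebeck's inequality at an associated prime would yield a
  chain of primes of length more than \<open>n\<close>. Hence the minors form a regular sequence, which gives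
  (1), (4) and (5), while self-duality of the Koszul complex identifies the canonical module with
  the ring and gives (2) and (3).

  Otherwise some \<open>W\<close> (a row of vertices through the square, or the vertices of the central cell)
  meets more than \<open>|W|\<close> cells, each of them in an edge, so that the corresponding prime \<open>Q\<close> contains
  the ideal and has height less than \<open>N\<close>. The toric prime \<open>L\<close> of all cells is a minimal prime of
  height at least \<open>N\<close>, so the ideal is not unmixed. Both \<open>L\<close> and \<open>Q\<close> lie in the maximal ideal of the
  point that vanishes exactly on \<open>W\<close>, where \<open>L\<close> bounds the depth by \<open>n - N\<close> and \<open>Q\<close> forces a larger
  dimension. Finally the \<open>N\<close> independent quadrics need \<open>N\<close> generators, more than the height of \<open>Q\<close>.\<close>

section \<open>Ideals in a subring of a commutative ring\<close>

text \<open>Heights are bounded from above without the principal ideal theorem: chains below a prime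
  (from toric primes or regular sequences) are joined to chains above it (from Ischebeck's
  inequality), and the total is at most n. For this to be sharp, every maximal ideal must contain a
  regular sequence of length n, and shorter ones must extend to that length. The former is the
  Nullstellensatz in Jacobson form, valid over any field, as each variable satisfies a monic
  equation modulo a maximal ideal; the latter is depth sensitivity of the Koszul complex.

  Rings are subsets of one ambient ring, so contraction to fewer variables is intersection;
  quotients appear as congruences, and localisation at P as multipliers outside P.

  The bound by |W| is a Hall condition: each cell with an edge in W must receive a vertex of W of
  its own. Such a cell has an antidiagonal corner in W, and antidiagonal corners of different cells
  collide only where two cells are antidiagonal neighbours. After a reflection if necessary,
  collisions occur only at the two ends of a staircase, where one tail can be switched to diagonal
  corners.\<close>

locale subring_set =
  fixes R :: "'a::comm_ring_1 set"
  assumes one_closed [simp, intro]: "1 \<in> R"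
    and diff_closed [simp, intro]: "a \<in> R \<Longrightarrow> b \<in> R \<Longrightarrow> a - b \<in> R"
    and mult_closed [simp, intro]: "a \<in> R \<Longrightarrow> b \<in> R \<Longrightarrow> a * b \<in> R"
begin

lemma zero_closed [simp, intro]: "0 \<in> R"
  using diff_closed[OF one_closed one_closed] by simp

lemma uminus_closed [simp, intro]: "a \<in> R \<Longrightarrow> - a \<in> R"
  using diff_closed[OF zero_closed, of a] by simp

lemma add_closed [simp, intro]: "a \<in> R \<Longrightarrow> b \<in> R \<Longrightarrow> a + b \<in> R"
  using diff_closed[of a "- b"] by simp

lemma power_closed [simp, intro]: "a \<in> R \<Longrightarrow> a ^ n \<in> R"
  by (induction n) auto

lemma sum_closed [intro]: "(\<And>i. i \<in> A \<Longrightarrow> f i \<in> R) \<Longrightarrow> sum f A \<in> R"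
  by (induction A rule: infinite_finite_induct) auto

lemma prod_closed [intro]: "(\<And>i. i \<in> A \<Longrightarrow> f i \<in> R) \<Longrightarrow> prod f A \<in> R"
  by (induction A rule: infinite_finite_induct) auto

definition idl :: "'a set \<Rightarrow> bool" where
  "idl J \<longleftrightarrow> J \<subseteq> R \<and> 0 \<in> J \<and> (\<forall>a\<in>J. \<forall>b\<in>J. a + b \<in> J) \<and> (\<forall>r\<in>R. \<forall>a\<in>J. r * a \<in> J)"

lemma idlI:
  assumes "J \<subseteq> R" "0 \<in> J" "\<And>a b. a \<in> J \<Longrightarrow> b \<in> J \<Longrightarrow> a + b \<in> J"
    "\<And>r a. r \<in> R \<Longrightarrow> a \<in> J \<Longrightarrow> r * a \<in> J"
  shows "idl J"
  using assms by (auto simp: idl_def)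

lemma idl_sub: "idl J \<Longrightarrow> J \<subseteq> R"
  and idl_zero: "idl J \<Longrightarrow> 0 \<in> J"
  and idl_add: "idl J \<Longrightarrow> a \<in> J \<Longrightarrow> b \<in> J \<Longrightarrow> a + b \<in> J"
  and idl_mult: "idl J \<Longrightarrow> r \<in> R \<Longrightarrow> a \<in> J \<Longrightarrow> r * a \<in> J"
  by (auto simp: idl_def)

lemma idl_mem: "idl J \<Longrightarrow> a \<in> J \<Longrightarrow> a \<in> R"
  using idl_sub by blast

lemma idl_mult2: "idl J \<Longrightarrow> r \<in> R \<Longrightarrow> a \<in> J \<Longrightarrow> a * r \<in> J"
  using idl_mult[of J r a] by (simp add: mult.commute)

lemma idl_uminus: "idl J \<Longrightarrow> a \<in> J \<Longrightarrow> - a \<in> J"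
  using idl_mult[of J "- 1" a] by auto

lemma idl_diff: "idl J \<Longrightarrow> a \<in> J \<Longrightarrow> b \<in> J \<Longrightarrow> a - b \<in> J"
  using idl_add[of J a "- b"] idl_uminus[of J b] by auto

lemma idl_sum: "idl J \<Longrightarrow> (\<And>i. i \<in> A \<Longrightarrow> f i \<in> J) \<Longrightarrow> sum f A \<in> J"
  by (induction A rule: infinite_finite_induct) (auto simp: idl_zero idl_add)

lemma idl_cong_mem: "idl J \<Longrightarrow> a - b \<in> J \<Longrightarrow> a \<in> J \<longleftrightarrow> b \<in> J"
  using idl_diff[of J a "a - b"] idl_add[of J "a - b" b] by auto

lemma idl_zero_set: "idl {0}"
  by (rule idlI) auto

lemma idl_carrier: "idl R"
  by (rule idlI) auto

lemma idl_eq_carrier: "idl J \<Longrightarrow> 1 \<in> J \<Longrightarrow> J = R"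
  using idl_mult[of J _ 1] idl_sub[of J] by auto

definition prime_idl :: "'a set \<Rightarrow> bool" where
  "prime_idl P \<longleftrightarrow> idl P \<and> 1 \<notin> P \<and> (\<forall>a\<in>R. \<forall>b\<in>R. a * b \<in> P \<longrightarrow> a \<in> P \<or> b \<in> P)"

lemma prime_idl_idl: "prime_idl P \<Longrightarrow> idl P"
  and prime_idl_one: "prime_idl P \<Longrightarrow> 1 \<notin> P"
  and prime_idl_mult: "prime_idl P \<Longrightarrow> a \<in> R \<Longrightarrow> b \<in> R \<Longrightarrow> a * b \<in> P \<Longrightarrow> a \<in> P \<or> b \<in> P"
  by (auto simp: prime_idl_def)

lemma prime_idl_power: "prime_idl P \<Longrightarrow> a \<in> R \<Longrightarrow> a ^ n \<in> P \<Longrightarrow> a \<in> P"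
  by (induction n) (use prime_idl_one[of P] prime_idl_mult[of P a] in auto)

lemma prime_idl_prod:
  assumes "prime_idl P" "finite A" "\<And>i. i \<in> A \<Longrightarrow> f i \<in> R" "prod f A \<in> P"
  shows "\<exists>i\<in>A. f i \<in> P"
  using assms(2,3,4)
proof (induction A rule: finite_induct)
  case empty
  then show ?case using prime_idl_one[OF assms(1)] by simp
next
  case (insert x F)
  then have "f x \<in> P \<or> prod f F \<in> P"
    by (intro prime_idl_mult[OF assms(1)]) auto
  then show ?case using insert by auto
qed

text \<open>One multiple is added at a time, so that induction peels off the head of a linear
  combination; explicit finite sums are needed only later, for the Koszul complex.\<close>

inductive_set gen :: "'a set \<Rightarrow> 'a set" for X where
  gen_0: "0 \<in> gen X"
| gen_step: "r \<in> R \<Longrightarrow> x \<in> X \<Longrightarrow> g \<in> gen X \<Longrightarrow> r * x + g \<in> gen X"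

lemma gen_sub: "X \<subseteq> R \<Longrightarrow> gen X \<subseteq> R"
proof
  fix x assume "X \<subseteq> R" "x \<in> gen X"
  from this(2,1) show "x \<in> R" by (induction) auto
qed

lemma gen_superset: "X \<subseteq> gen X"
  using gen_step[OF one_closed _ gen_0] by auto

lemma gen_inc: "x \<in> X \<Longrightarrow> x \<in> gen X"
  using gen_superset by blast

lemma gen_idl: assumes "X \<subseteq> R" shows "idl (gen X)"
proof (rule idlI)
  show "gen X \<subseteq> R" by (rule gen_sub[OF assms])
  show "a + b \<in> gen X" if "a \<in> gen X" "b \<in> gen X" for a b
    using that(1) by (induction) (auto simp: that add.assoc intro: gen_step)
  show "r * a \<in> gen X" if "r \<in> R" "a \<in> gen X" for r a
    using that(2)
  proof (induction)
    case (gen_step s x g)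
    then show ?case using gen.gen_step[of "r * s" x X "r * g"] that(1) by (auto simp: algebra_simps)
  qed (auto intro: gen_0)
qed (rule gen_0)

lemma gen_least: assumes "idl J" "X \<subseteq> J" shows "gen X \<subseteq> J"
proof
  fix x assume "x \<in> gen X"
  then show "x \<in> J"
    by (induction) (use assms idl_zero idl_add idl_mult in auto)
qed

lemma gen_mono: "X \<subseteq> Y \<Longrightarrow> gen X \<subseteq> gen Y"
proof
  fix x assume "X \<subseteq> Y" "x \<in> gen X"
  from this(2,1) show "x \<in> gen Y" by induction (auto intro: gen.intros)
qed

lemma gen_of_idl: "idl J \<Longrightarrow> gen J = J"
  using gen_least[of J J] gen_superset by auto

lemma gen_insert_iff:
  assumes "X \<subseteq> R" "x \<in> R"
  shows "y \<in> gen (insert x X) \<longleftrightarrow> (\<exists>r\<in>R. y - r * x \<in> gen X)"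
proof
  assume "y \<in> gen (insert x X)"
  then show "\<exists>r\<in>R. y - r * x \<in> gen X"
  proof induction
    case gen_0
    show ?case by (rule bexI[of _ 0]) (auto intro: gen.gen_0)
  next
    case (gen_step r z g)
    then obtain s where s: "s \<in> R" "g - s * x \<in> gen X" by auto
    show ?case
    proof (cases "z = x")
      case True
      then show ?thesis using s gen_step by (intro bexI[of _ "r + s"]) (auto simp: algebra_simps)
    next
      case False
      then have "r * z + (g - s * x) \<in> gen X" using gen_step s by (intro gen.gen_step) auto
      then show ?thesis using s by (intro bexI[of _ s]) (auto simp: algebra_simps)
    qed
  qed
next
  assume "\<exists>r\<in>R. y - r * x \<in> gen X"
  then obtain r where r: "r \<in> R" "y - r * x \<in> gen X" by auto
  have "r * x + (y - r * x) \<in> gen (insert x X)"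
    using r gen_mono[of X "insert x X"] by (intro gen_step) auto
  then show "y \<in> gen (insert x X)" by simp
qed

lemma gen_insert_idl_iff:
  assumes "idl J" "x \<in> R"
  shows "y \<in> gen (insert x J) \<longleftrightarrow> (\<exists>r\<in>R. y - r * x \<in> J)"
  using gen_insert_iff[OF idl_sub[OF assms(1)] assms(2)] gen_of_idl[OF assms(1)] by auto

lemma gen_gen_un: assumes "X \<subseteq> R" "Y \<subseteq> R" shows "gen (gen X \<union> Y) = gen (X \<union> Y)"
proof
  show "gen (gen X \<union> Y) \<subseteq> gen (X \<union> Y)"
    using assms gen_mono[of X "X \<union> Y"] gen_superset[of "X \<union> Y"]
    by (intro gen_least gen_idl) auto
  show "gen (X \<union> Y) \<subseteq> gen (gen X \<union> Y)"
    using gen_superset[of X] by (intro gen_mono) auto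
qed

lemma gen_finite_sub:
  assumes "y \<in> gen X" shows "\<exists>Y\<subseteq>X. finite Y \<and> y \<in> gen Y"
  using assms
proof induction
  case gen_0
  show ?case by (rule exI[of _ "{}"]) (auto intro: gen.gen_0)
next
  case (gen_step r x g)
  then obtain Y where "Y \<subseteq> X" "finite Y" "g \<in> gen Y" by auto
  then show ?case using gen_step gen_mono[of Y "insert x Y"]
    by (intro exI[of _ "insert x Y"]) (auto intro!: gen.gen_step)
qed

section \<open>Noetherian subrings, maximal ideals and existence of primes\<close>

definition noeth :: bool where
  "noeth \<longleftrightarrow> (\<forall>J. idl J \<longrightarrow> (\<exists>X. finite X \<and> X \<subseteq> R \<and> J = gen X))"

lemma noethE:
  assumes noeth "idl J"
  obtains X where "finite X" "X \<subseteq> R" "J = gen X"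
proof -
  have "\<exists>X. finite X \<and> X \<subseteq> R \<and> J = gen X"
    by (rule assms(1)[unfolded noeth_def, rule_format, OF assms(2)])
  then show thesis by (elim exE conjE) (rule that)
qed

text \<open>Each member of some finite generating set involves only finitely many elements of
  \<open>X\<close>, so generators can be found inside \<open>X\<close>. The later arguments with
  infinite sequences or families of elements rely on this form.\<close>

lemma noeth_gen_finite:
  assumes noeth "X \<subseteq> R"
  shows "\<exists>Y\<subseteq>X. finite Y \<and> gen X = gen Y"
proof -
  from noethE[OF assms(1) gen_idl[OF assms(2)]]
  obtain Z where Z: "finite Z" "Z \<subseteq> R" "gen X = gen Z" .
  have "\<exists>Y. Y \<subseteq> X \<and> finite Y \<and> z \<in> gen Y" if "z \<in> Z" for z
    using gen_finite_sub[of z X] gen_inc[OF that] Z(3) by auto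
  then obtain Y where Y: "\<And>z. z \<in> Z \<Longrightarrow> Y z \<subseteq> X \<and> finite (Y z) \<and> z \<in> gen (Y z)" by metis
  let ?U = "\<Union>z\<in>Z. Y z"
  have "Z \<subseteq> gen ?U"
  proof
    fix z assume "z \<in> Z"
    then show "z \<in> gen ?U" using Y[of z] gen_mono[of "Y z" ?U] by auto
  qed
  moreover have "?U \<subseteq> X" using Y by auto
  ultimately have "gen X = gen ?U"
    using gen_least[of "gen ?U" Z] gen_idl[of ?U] gen_mono[of ?U X] Z assms by auto
  then show ?thesis using \<open>?U \<subseteq> X\<close> Z Y by (intro exI[of _ ?U]) auto
qed

lemma noeth_max:
  assumes noeth "\<F> \<noteq> {}" "\<And>J. J \<in> \<F> \<Longrightarrow> idl J"
  shows "\<exists>M\<in>\<F>. \<forall>N\<in>\<F>. M \<subseteq> N \<longrightarrow> N = M"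
proof (rule ccontr)
  assume "\<not> ?thesis"
  then have *: "\<forall>M\<in>\<F>. \<exists>N\<in>\<F>. M \<subset> N" by auto
  obtain J0 where "J0 \<in> \<F>" using assms by auto
  then have "\<exists>f. \<forall>n::nat. f n \<in> \<F> \<and> f n \<subset> f (Suc n)"
    using * by (intro dependent_nat_choice) auto
  then obtain f where "\<forall>n::nat. f n \<in> \<F> \<and> f n \<subset> f (Suc n)" ..
  then have f: "f n \<in> \<F>" "f n \<subset> f (Suc n)" for n by simp_all
  have mono: "f m \<subseteq> f n" if "m \<le> n" for m n
    using that by (induction rule: dec_induct) (use f in auto)
  have id: "idl (f n)" for n using f assms by auto
  let ?U = "\<Union>n. f n"
  have "idl ?U"
  proof (rule idlI)
    show "a + b \<in> ?U" if "a \<in> ?U" "b \<in> ?U" for a b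
    proof -
      from that obtain m n where "a \<in> f m" "b \<in> f n" by auto
      then have "a \<in> f (max m n)" "b \<in> f (max m n)" using mono[of m "max m n"] mono[of n "max m n"] by auto
      then show ?thesis using idl_add[OF id] by blast
    qed
  next
    show "?U \<subseteq> R" using idl_sub[OF id] by auto
    show "0 \<in> ?U" using idl_zero[OF id] by auto
    show "r * a \<in> ?U" if "r \<in> R" "a \<in> ?U" for r a using idl_mult[OF id that(1)] that(2) by auto
  qed
  from noethE[OF assms(1) this] obtain X where X: "finite X" "?U = gen X" .
  have "X \<subseteq> ?U" using X(2) gen_superset[of X] by simp
  have "\<exists>m. X \<subseteq> f m" using X(1) \<open>X \<subseteq> ?U\<close>
  proof (induction X rule: finite_induct)
    case (insert x F)
    obtain n where "x \<in> f n" using insert.prems by auto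
    moreover obtain m where "F \<subseteq> f m" using insert.IH insert.prems by auto
    ultimately have "insert x F \<subseteq> f (max m n)" using mono[of m "max m n"] mono[of n "max m n"] by auto
    then show ?case by blast
  qed auto
  then obtain m where m: "X \<subseteq> f m" by auto
  then have "?U \<subseteq> f m" using X(2) gen_least[OF id m] by simp
  then show False using f(2)[of m] by auto
qed

definition max_idl :: "'a set \<Rightarrow> bool" where
  "max_idl M \<longleftrightarrow> idl M \<and> 1 \<notin> M \<and> (\<forall>J. idl J \<and> 1 \<notin> J \<and> M \<subseteq> J \<longrightarrow> J = M)"

lemma max_idl_prime: assumes "max_idl M" shows "prime_idl M"
  unfolding prime_idl_def
proof (intro conjI ballI impI)
  show M: "idl M" "1 \<notin> M" using assms by (auto simp: max_idl_def)
  fix a b assume ab: "a \<in> R" "b \<in> R" "a * b \<in> M"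
  show "a \<in> M \<or> b \<in> M"
  proof (rule ccontr)
    assume n: "\<not> ?thesis"
    have "idl (gen (insert a M))" using ab idl_sub[OF M(1)] by (intro gen_idl) auto
    moreover have "M \<subseteq> gen (insert a M)" "a \<in> gen (insert a M)" using gen_superset[of "insert a M"] by auto
    ultimately have "1 \<in> gen (insert a M)" using assms n unfolding max_idl_def by metis
    then obtain r where r: "r \<in> R" "1 - r * a \<in> M" using gen_insert_idl_iff[OF M(1) ab(1)] by auto
    have "b * (1 - r * a) + r * (a * b) \<in> M"
      by (rule idl_add[OF M(1) idl_mult[OF M(1) ab(2) r(2)] idl_mult[OF M(1) r(1) ab(3)]])
    then show False using n by (simp add: algebra_simps)
  qed
qed

lemma noeth_max_idl:
  assumes noeth "idl J" "1 \<notin> J"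
  shows "\<exists>M. max_idl M \<and> J \<subseteq> M"
proof -
  have "\<exists>M\<in>{I. idl I \<and> 1 \<notin> I \<and> J \<subseteq> I}. \<forall>N\<in>{I. idl I \<and> 1 \<notin> I \<and> J \<subseteq> I}. M \<subseteq> N \<longrightarrow> N = M"
    using assms by (intro noeth_max) auto
  then obtain M where M: "idl M" "1 \<notin> M" "J \<subseteq> M" and
    mx: "\<forall>N\<in>{I. idl I \<and> 1 \<notin> I \<and> J \<subseteq> I}. M \<subseteq> N \<longrightarrow> N = M" by auto
  show ?thesis
  proof (intro exI[of _ M] conjI)
    show "max_idl M" unfolding max_idl_def using M mx subset_trans[of J M] by auto
  qed (rule M)
qed

text \<open>An ideal maximal among those above \<open>J\<close> that miss \<open>T\<close> is prime:
  each of two factors outside it brings an element of \<open>T\<close> into the enlarged ideal, and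
  the product of these two elements of \<open>T\<close> would fall into the ideal itself.\<close>

lemma noeth_prime_disjoint:
  assumes noeth "idl J" "T \<subseteq> R" "1 \<in> T" "\<And>s t. s \<in> T \<Longrightarrow> t \<in> T \<Longrightarrow> s * t \<in> T" "J \<inter> T = {}"
  shows "\<exists>Q. prime_idl Q \<and> J \<subseteq> Q \<and> Q \<inter> T = {}"
proof -
  have "\<exists>M\<in>{I. idl I \<and> J \<subseteq> I \<and> I \<inter> T = {}}. \<forall>N\<in>{I. idl I \<and> J \<subseteq> I \<and> I \<inter> T = {}}. M \<subseteq> N \<longrightarrow> N = M"
    using assms by (intro noeth_max) auto
  then obtain M where M: "idl M" "J \<subseteq> M" "M \<inter> T = {}" and
    mx: "\<And>N. idl N \<Longrightarrow> J \<subseteq> N \<Longrightarrow> N \<inter> T = {} \<Longrightarrow> M \<subseteq> N \<Longrightarrow> N = M" by auto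
  have meet: "\<exists>t\<in>T. \<exists>r\<in>R. t - r * a \<in> M" if "a \<in> R" "a \<notin> M" for a
  proof -
    have i: "idl (gen (insert a M))" using that idl_sub[OF M(1)] by (intro gen_idl) auto
    have "M \<subseteq> gen (insert a M)" "a \<in> gen (insert a M)" using gen_superset[of "insert a M"] by auto
    then have "gen (insert a M) \<inter> T \<noteq> {}" using mx[OF i] M that by auto
    then show ?thesis using gen_insert_idl_iff[OF M(1) that(1)] by auto
  qed
  have "prime_idl M" unfolding prime_idl_def
  proof (intro conjI ballI impI)
    fix a b assume ab: "a \<in> R" "b \<in> R" "a * b \<in> M"
    show "a \<in> M \<or> b \<in> M"
    proof (rule ccontr)
      assume "\<not> ?thesis"
      then obtain t r u s where *: "t \<in> T" "r \<in> R" "t - r * a \<in> M" "u \<in> T" "s \<in> R" "u - s * b \<in> M"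
        using meet[of a] meet[of b] ab by blast
      have "u \<in> R" "r * a \<in> R" "r * s \<in> R" using * ab assms(3) by auto
      then have "u * (t - r * a) + r * a * (u - s * b) + (r * s) * (a * b) \<in> M"
        using idl_mult[OF M(1) _ *(3)] idl_mult[OF M(1) _ *(6)] idl_mult[OF M(1) _ ab(3)]
        by (auto intro!: idl_add[OF M(1)])
      then have "t * u \<in> M" by (simp add: algebra_simps)
      then show False using assms(5)[of t u] * M by auto
    qed
  qed (use M assms in auto)
  then show ?thesis using M by auto
qed

subsection \<open>Associated primes\<close>

text \<open>This is the existence of an associated prime in the localisation at \<open>P\<close>,
  with denominators kept explicit. The set \<open>L r\<close> below is the annihilator of
  \<open>r\<close> modulo \<open>J\<close> up to multipliers outside \<open>P\<close>; the
  assumption on \<open>r0\<close> makes \<open>L r0\<close> proper. A maximal proper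
  \<open>L (c * r0)\<close> is prime, and it becomes a true annihilator after multiplication by
  \<open>t\<close>, the common denominator of its finitely many generators.\<close>

lemma assoc_prime_exists:
  assumes noeth "idl J" "prime_idl P" "r0 \<in> R" and ann: "\<And>s. s \<in> R \<Longrightarrow> s * r0 \<in> J \<Longrightarrow> s \<in> P"
  shows "\<exists>q c. prime_idl q \<and> q \<subseteq> P \<and> c \<in> R \<and> (\<forall>a\<in>R. a * (c * r0) \<in> J \<longleftrightarrow> a \<in> q)"
proof -
  define L where "L r = {a\<in>R. \<exists>s\<in>R. s \<notin> P \<and> s * a * r \<in> J}" for r
  have P: "idl P" "1 \<notin> P" using assms(3) by (auto simp: prime_idl_def)
  have PM: "s * t \<notin> P" if "s \<in> R" "t \<in> R" "s \<notin> P" "t \<notin> P" for s t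
    using that assms(3) by (auto simp: prime_idl_def)
  have Lidl: "idl (L r)" if "r \<in> R" for r
  proof (rule idlI)
    show "0 \<in> L r" unfolding L_def using P idl_zero[OF assms(2)] by (auto intro: bexI[of _ 1])
    fix a b assume "a \<in> L r" "b \<in> L r"
    then obtain s t where *: "a \<in> R" "b \<in> R" "s \<in> R" "t \<in> R" "s \<notin> P" "t \<notin> P" "s * a * r \<in> J" "t * b * r \<in> J"
      unfolding L_def by auto
    have "t * (s * a * r) + s * (t * b * r) \<in> J"
      by (rule idl_add[OF assms(2) idl_mult[OF assms(2) *(4,7)] idl_mult[OF assms(2) *(3,8)]])
    then have "(s * t) * (a + b) * r \<in> J" by (simp add: algebra_simps)
    then show "a + b \<in> L r" unfolding L_def using * PM[of s t] by auto
  next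
    fix x a assume x: "x \<in> R" "a \<in> L r"
    then obtain s where *: "a \<in> R" "s \<in> R" "s \<notin> P" "s * a * r \<in> J" unfolding L_def by auto
    have "x * (s * a * r) \<in> J" by (rule idl_mult[OF assms(2) x(1) *(4)])
    then have "s * (x * a) * r \<in> J" by (simp add: algebra_simps)
    then show "x * a \<in> L r" using * x unfolding L_def by auto
  qed (auto simp: L_def)
  let ?F = "{L (c * r0) | c. c \<in> R \<and> 1 \<notin> L (c * r0)}"
  have "1 \<notin> L (1 * r0)" unfolding L_def using ann by auto
  then have "L (1 * r0) \<in> ?F" by (intro CollectI exI[of _ 1]) simp
  then have "?F \<noteq> {}" by auto
  then have "\<exists>M\<in>?F. \<forall>N\<in>?F. M \<subseteq> N \<longrightarrow> N = M"
    using assms Lidl by (intro noeth_max) auto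
  then obtain M where M: "M \<in> ?F" and mxM: "\<And>N. N \<in> ?F \<Longrightarrow> M \<subseteq> N \<Longrightarrow> N = M" by (elim bexE) simp
  from M obtain c where c: "c \<in> R" "1 \<notin> L (c * r0)" and Mc: "M = L (c * r0)" by (elim CollectE exE conjE) simp
  have mx: "L (d * r0) = L (c * r0)" if "d \<in> R" "1 \<notin> L (d * r0)" "L (c * r0) \<subseteq> L (d * r0)" for d
  proof -
    have "L (d * r0) \<in> ?F" using that by (intro CollectI exI[of _ d]) simp
    then show ?thesis using mxM[of "L (d * r0)"] that Mc by simp
  qed
  let ?q = "L (c * r0)"
  have qidl: "idl ?q" using Lidl[of "c * r0"] c assms by auto
  have prime: "prime_idl ?q" unfolding prime_idl_def
  proof (intro conjI ballI impI)
    fix a b assume ab: "a \<in> R" "b \<in> R" "a * b \<in> ?q"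
    show "a \<in> ?q \<or> b \<in> ?q"
    proof (rule ccontr)
      assume n: "\<not> ?thesis"
      have "1 \<notin> L ((b * c) * r0)" using n ab unfolding L_def by (auto simp: mult_ac)
      moreover have "?q \<subseteq> L ((b * c) * r0)"
      proof
        fix x assume "x \<in> ?q"
        then obtain s where s: "x \<in> R" "s \<in> R" "s \<notin> P" "s * x * (c * r0) \<in> J" unfolding L_def by auto
        have "b * (s * x * (c * r0)) \<in> J" by (rule idl_mult[OF assms(2) ab(2) s(4)])
        then show "x \<in> L ((b * c) * r0)" using s unfolding L_def by (auto simp: mult_ac intro!: bexI[of _ s])
      qed
      ultimately have "L ((b * c) * r0) = ?q" using mx[of "b * c"] ab c by auto
      moreover have "a \<in> L ((b * c) * r0)" using ab unfolding L_def by (auto simp: mult_ac)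
      ultimately show False using n by auto
    qed
  qed (use qidl c in auto)
  have qP: "?q \<subseteq> P"
  proof
    fix a assume "a \<in> ?q"
    then obtain s where s: "a \<in> R" "s \<in> R" "s \<notin> P" "s * a * (c * r0) \<in> J" unfolding L_def by auto
    show "a \<in> P"
    proof (rule ccontr)
      assume "a \<notin> P"
      then have "s * a \<notin> P" using PM s by auto
      then have "1 \<in> ?q" unfolding L_def using s by (auto intro!: bexI[of _ "s * a"])
      then show False using c by auto
    qed
  qed
  from noethE[OF assms(1) qidl] obtain X where X: "finite X" "?q = gen X" .
  have "\<forall>x\<in>X. \<exists>s. s \<in> R \<and> s \<notin> P \<and> s * x * (c * r0) \<in> J"
    using X gen_superset[of X] unfolding L_def by auto
  then obtain s where s: "\<And>x. x \<in> X \<Longrightarrow> s x \<in> R \<and> s x \<notin> P \<and> s x * x * (c * r0) \<in> J" by metis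
  define t where "t = prod s X"
  have t: "t \<in> R" "t \<notin> P" using s prime_idl_prod[OF assms(3) X(1), of s] by (auto simp: t_def)
  define A where "A = {a\<in>R. a * (t * c * r0) \<in> J}"
  have "idl A" unfolding A_def
  proof (rule idlI)
    fix a b assume "a \<in> {a \<in> R. a * (t * c * r0) \<in> J}" "b \<in> {a \<in> R. a * (t * c * r0) \<in> J}"
    then show "a + b \<in> {a \<in> R. a * (t * c * r0) \<in> J}" using idl_add[OF assms(2), of "a * (t * c * r0)" "b * (t * c * r0)"]
      by (auto simp: distrib_right)
  next
    fix x a assume "x \<in> R" "a \<in> {a \<in> R. a * (t * c * r0) \<in> J}"
    then show "x * a \<in> {a \<in> R. a * (t * c * r0) \<in> J}"
      using idl_mult[OF assms(2), of x "a * (t * c * r0)"] by (auto simp: mult.assoc)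
  qed (use idl_zero[OF assms(2)] in auto)
  moreover have "X \<subseteq> A"
  proof
    fix x assume x: "x \<in> X"
    then have "t = s x * prod s (X - {x})" unfolding t_def using X by (simp add: prod.remove)
    moreover have "prod s (X - {x}) * (s x * x * (c * r0)) \<in> J"
      using s x by (intro idl_mult[OF assms(2) prod_closed]) auto
    ultimately have "x * (t * c * r0) \<in> J" by (simp add: mult_ac)
    moreover have "x \<in> R" using x X gen_superset[of X] by (auto simp: L_def)
    ultimately show "x \<in> A" by (auto simp: A_def)
  qed
  ultimately have "?q \<subseteq> A" using X gen_least by auto
  moreover have "A \<subseteq> ?q" unfolding A_def L_def using t by (auto simp: mult_ac intro!: bexI[of _ t])
  ultimately have "\<forall>a\<in>R. a * ((t * c) * r0) \<in> J \<longleftrightarrow> a \<in> ?q" by (auto simp: A_def)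
  then show ?thesis using prime qP t c by (intro exI[of _ ?q] exI[of _ "t * c"]) auto
qed

section \<open>Prime avoidance and ideals of zero divisors\<close>

lemma prime_avoidance:
  assumes "finite \<Q>" "\<And>q. q \<in> \<Q> \<Longrightarrow> prime_idl q"
    and "\<And>q q'. q \<in> \<Q> \<Longrightarrow> q' \<in> \<Q> \<Longrightarrow> q \<subseteq> q' \<Longrightarrow> q = q'"
    and "idl N" "\<And>q. q \<in> \<Q> \<Longrightarrow> \<not> N \<subseteq> q"
  shows "\<exists>x\<in>N. \<forall>q\<in>\<Q>. x \<notin> q"
  using assms
proof (induction \<Q> rule: finite_induct)
  case empty
  then show ?case using idl_zero by auto
next
  case (insert q F)
  have "\<exists>x\<in>N. \<forall>q\<in>F. x \<notin> q"
    by (rule insert.IH) (use insert.prems in \<open>blast+\<close>)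
  then obtain x where x: "x \<in> N" "\<forall>q\<in>F. x \<notin> q" by auto
  show ?case
  proof (cases "x \<in> q")
    case True
    obtain z where z: "z \<in> N" "z \<notin> q" using insert.prems(4)[of q] by auto
    have "\<exists>w. w \<in> q' \<and> w \<notin> q" if "q' \<in> F" for q'
      using insert.prems(2)[of q' q] insert.hyps that by auto
    then obtain w where w: "\<And>q'. q' \<in> F \<Longrightarrow> w q' \<in> q' \<and> w q' \<notin> q" by metis
    have NR: "N \<subseteq> R" using insert idl_sub by auto
    have qid: "idl q'" if "q' \<in> insert q F" for q' using insert.prems that prime_idl_idl by auto
    have wR: "w q' \<in> R" if "q' \<in> F" for q' using qid w that idl_sub by blast
    \<comment> \<open>The correction term: it lies in \<open>N\<close> and in every member of
      \<open>F\<close> but not in \<open>q\<close>, so adding it moves \<open>x\<close> out of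
      \<open>q\<close> without entering a member of \<open>F\<close>.\<close>
    let ?y = "z * prod w F"
    have y: "?y \<in> N" using z wR insert by (intro idl_mult2) auto
    have pq: "prod w F \<in> q'" if "q' \<in> F" for q'
    proof -
      have "prod w F = w q' * prod w (F - {q'})" using that insert by (simp add: prod.remove)
      also have "\<dots> \<in> q'" using w wR that qid by (intro idl_mult2) auto
      finally show ?thesis .
    qed
    have "?y \<notin> q"
    proof
      assume "?y \<in> q"
      moreover have "prod w F \<notin> q"
        using prime_idl_prod[of q F w] w wR insert by blast
      ultimately show False
        using prime_idl_mult[of q z "prod w F"] insert.prems(1)[of q] z NR wR by auto
    qed
    then have "x + ?y \<notin> q" using True idl_diff[OF qid, of q "x + ?y" x] by auto
    moreover have "x + ?y \<notin> q'" if "q' \<in> F" for q'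
    proof -
      have "?y \<in> q'" using pq[OF that] z NR qid that by (intro idl_mult) auto
      then show ?thesis using x that idl_diff[of q' "x + ?y" ?y] qid[of q'] by auto
    qed
    moreover have "x + ?y \<in> N" using x y insert by (intro idl_add) auto
    ultimately show ?thesis by blast
  next
    case False
    then show ?thesis using x by blast
  qed
qed

text \<open>The maximal annihilators modulo \<open>J\<close> are primes, and every zero divisor lies
  in one of them. They are finite in number: finitely many of their witnesses generate the ideal of
  all witnesses, and a product of elements of the corresponding primes would kill the witness of any
  further one. Avoidance then puts \<open>N\<close> inside a single annihilator.\<close>

lemma zero_divisors_common:
  assumes noeth "idl J" "idl N"
    and zd: "\<And>x. x \<in> N \<Longrightarrow> \<exists>y\<in>R. y \<notin> J \<and> x * y \<in> J"
  shows "\<exists>r\<in>R. r \<notin> J \<and> (\<forall>x\<in>N. x * r \<in> J)"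
proof (rule ccontr)
  assume n: "\<not> ?thesis"
  define ann where "ann r = {a\<in>R. a * r \<in> J}" for r
  define \<A> where "\<A> = {ann r | r. r \<in> R \<and> r \<notin> J}"
  have annidl: "idl (ann r)" if "r \<in> R" for r
    unfolding ann_def
  proof (rule idlI)
    fix a b assume "a \<in> {a \<in> R. a * r \<in> J}" "b \<in> {a \<in> R. a * r \<in> J}"
    then show "a + b \<in> {a \<in> R. a * r \<in> J}" using idl_add[OF assms(2), of "a * r" "b * r"]
      by (auto simp: distrib_right)
  next
    fix x a assume "x \<in> R" "a \<in> {a \<in> R. a * r \<in> J}"
    then show "x * a \<in> {a \<in> R. a * r \<in> J}"
      using idl_mult[OF assms(2), of x "a * r"] by (auto simp: mult.assoc)
  qed (use idl_zero[OF assms(2)] in auto)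
  define \<M> where "\<M> = {q\<in>\<A>. \<forall>q'\<in>\<A>. q \<subseteq> q' \<longrightarrow> q' = q}"
  have prime: "prime_idl q" if "q \<in> \<M>" for q
  proof -
    from that obtain r where r: "q = ann r" "r \<in> R" "r \<notin> J" unfolding \<M>_def \<A>_def by auto
    show ?thesis unfolding prime_idl_def
    proof (intro conjI ballI impI)
      fix a b assume ab: "a \<in> R" "b \<in> R" "a * b \<in> q"
      show "a \<in> q \<or> b \<in> q"
      proof (rule ccontr)
        assume nn: "\<not> ?thesis"
        then have "b * r \<notin> J" using r ab by (auto simp: ann_def)
        then have "ann (b * r) \<in> \<A>" using r ab by (auto simp: \<A>_def)
        moreover have "q \<subseteq> ann (b * r)"
        proof
          fix x assume "x \<in> q"
          then have "b * (x * r) \<in> J" "x \<in> R" using r ab idl_mult[OF assms(2)] by (auto simp: ann_def)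
          then show "x \<in> ann (b * r)" by (auto simp: ann_def mult_ac)
        qed
        ultimately have "ann (b * r) = q" using that by (auto simp: \<M>_def)
        moreover have "a \<in> ann (b * r)" using ab r by (auto simp: ann_def mult_ac)
        ultimately show False using nn by auto
      qed
    qed (use r annidl in \<open>auto simp: ann_def\<close>)
  qed
  have above: "\<exists>q\<in>\<M>. ann r \<subseteq> q" if "r \<in> R" "r \<notin> J" for r
  proof -
    have "\<exists>M\<in>{q\<in>\<A>. ann r \<subseteq> q}. \<forall>N\<in>{q\<in>\<A>. ann r \<subseteq> q}. M \<subseteq> N \<longrightarrow> N = M"
      using assms annidl that by (intro noeth_max) (auto simp: \<A>_def)
    then obtain M where "M \<in> \<A>" "ann r \<subseteq> M" and mx: "\<forall>N\<in>{q\<in>\<A>. ann r \<subseteq> q}. M \<subseteq> N \<longrightarrow> N = M" by auto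
    then have "M \<in> \<M>" unfolding \<M>_def by auto
    then show ?thesis using \<open>ann r \<subseteq> M\<close> by auto
  qed
  have "\<forall>q\<in>\<M>. \<exists>r. r \<in> R \<and> r \<notin> J \<and> q = ann r" by (auto simp: \<M>_def \<A>_def)
  then obtain \<rho> where \<rho>: "\<And>q. q \<in> \<M> \<Longrightarrow> \<rho> q \<in> R \<and> \<rho> q \<notin> J \<and> q = ann (\<rho> q)" by metis
  have sub: "\<rho> ` \<M> \<subseteq> R" using \<rho> by auto
  obtain Y where Y: "Y \<subseteq> \<rho> ` \<M>" "finite Y" "gen (\<rho> ` \<M>) = gen Y"
    using noeth_gen_finite[OF assms(1) sub] by auto
  obtain \<M>0 where M0: "\<M>0 \<subseteq> \<M>" "finite \<M>0" "Y = \<rho> ` \<M>0"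
    using finite_subset_image[OF Y(2,1)] by auto
  have eq: "\<M>0 = \<M>"
  proof (rule ccontr)
    assume "\<M>0 \<noteq> \<M>"
    then obtain q where q: "q \<in> \<M>" "q \<notin> \<M>0" using M0 by auto
    have "\<exists>w. w \<in> q' \<and> w \<notin> q" if "q' \<in> \<M>0" for q'
    proof (rule ccontr)
      assume "\<not> ?thesis"
      then have "q' \<subseteq> q" by auto
      moreover have "q' \<in> \<M>" using that M0 by auto
      ultimately have "q = q'" using q by (auto simp: \<M>_def)
      then show False using q that by auto
    qed
    then obtain w where w: "\<And>q'. q' \<in> \<M>0 \<Longrightarrow> w q' \<in> q' \<and> w q' \<notin> q" by metis
    have wR: "w q' \<in> R" if "q' \<in> \<M>0" for q'
      using w[OF that] that M0 prime prime_idl_idl idl_sub by blast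
    have pnq: "prod w \<M>0 \<notin> q" using prime_idl_prod[OF prime[OF q(1)] M0(2), of w] w wR by blast
    have "Y \<subseteq> {y\<in>R. prod w \<M>0 * y \<in> J}"
    proof
      fix y assume "y \<in> Y"
      then obtain q' where q': "q' \<in> \<M>0" "y = \<rho> q'" using M0 by auto
      have "w q' * y \<in> J" "y \<in> R" using w[OF q'(1)] \<rho>[of q'] q' M0 by (auto simp: ann_def)
      then have "prod w (\<M>0 - {q'}) * (w q' * y) \<in> J"
        using wR by (intro idl_mult[OF assms(2) prod_closed]) auto
      moreover have "prod w \<M>0 = w q' * prod w (\<M>0 - {q'})" using q' M0 by (simp add: prod.remove)
      ultimately show "y \<in> {y\<in>R. prod w \<M>0 * y \<in> J}" using \<open>y \<in> R\<close> by (auto simp: mult_ac)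
    qed
    moreover have "idl {y\<in>R. prod w \<M>0 * y \<in> J}"
    proof (rule idlI)
      fix a b assume "a \<in> {y \<in> R. prod w \<M>0 * y \<in> J}" "b \<in> {y \<in> R. prod w \<M>0 * y \<in> J}"
      then show "a + b \<in> {y \<in> R. prod w \<M>0 * y \<in> J}"
        using idl_add[OF assms(2), of "prod w \<M>0 * a" "prod w \<M>0 * b"] by (auto simp: distrib_left)
    next
      fix x a assume "x \<in> R" "a \<in> {y \<in> R. prod w \<M>0 * y \<in> J}"
      then show "x * a \<in> {y \<in> R. prod w \<M>0 * y \<in> J}"
        using idl_mult[OF assms(2), of x "prod w \<M>0 * a"] by (auto simp: mult_ac)
    qed (use idl_zero[OF assms(2)] in auto)
    ultimately have "gen Y \<subseteq> {y\<in>R. prod w \<M>0 * y \<in> J}" by (intro gen_least)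
    moreover have "\<rho> q \<in> gen Y" using Y(3) q gen_superset[of "\<rho> ` \<M>"] by auto
    ultimately have "prod w \<M>0 * \<rho> q \<in> J" by auto
    then have "prod w \<M>0 \<in> ann (\<rho> q)" using wR by (auto simp: ann_def)
    then show False using pnq \<rho>[OF q(1)] by auto
  qed
  have "\<exists>x\<in>N. \<forall>q\<in>\<M>. x \<notin> q"
  proof (rule prime_avoidance)
    show "\<not> N \<subseteq> q" if "q \<in> \<M>" for q
    proof
      assume "N \<subseteq> q"
      then have "\<forall>x\<in>N. x * \<rho> q \<in> J" using \<rho>[OF that] by (auto simp: ann_def)
      then show False using n \<rho>[OF that] by auto
    qed
  qed (use eq M0 prime assms in \<open>auto simp: \<M>_def\<close>)
  then obtain x where x: "x \<in> N" "\<And>q. q \<in> \<M> \<Longrightarrow> x \<notin> q" by auto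
  obtain y where y: "y \<in> R" "y \<notin> J" "x * y \<in> J" using zd[OF x(1)] by auto
  then have "x \<in> ann y" using x idl_sub[OF assms(3)] by (auto simp: ann_def)
  then show False using above[OF y(1,2)] x by auto
qed

end

section \<open>Chains of primes and regular sequences\<close>

context subring_set begin

text \<open>Both ends are recorded so that chains can be concatenated; all height estimates are
  obtained by adding lengths.\<close>

inductive chain :: "nat \<Rightarrow> 'a set \<Rightarrow> 'a set \<Rightarrow> bool" where
  chain_0: "prime_idl P \<Longrightarrow> chain 0 P P"
| chain_Suc: "chain k P Q \<Longrightarrow> prime_idl Q' \<Longrightarrow> Q \<subset> Q' \<Longrightarrow> chain (Suc k) P Q'"

lemma chain_append: "chain l Q T \<Longrightarrow> chain k P Q \<Longrightarrow> chain (k + l) P T"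
  by (induction rule: chain.induct) (auto intro: chain.intros)

lemma chain_primes: "chain k P Q \<Longrightarrow> prime_idl P \<and> prime_idl Q \<and> P \<subseteq> Q"
  by (induction rule: chain.induct) auto

lemma chain_1: "prime_idl P \<Longrightarrow> prime_idl Q \<Longrightarrow> P \<subset> Q \<Longrightarrow> chain (Suc 0) P Q"
  by (intro chain_Suc[OF chain_0])

lemma chain_Cons: "prime_idl P \<Longrightarrow> P \<subset> Q \<Longrightarrow> chain k Q T \<Longrightarrow> chain (Suc k) P T"
  using chain_append[OF _ chain_1, of k Q T P] chain_primes[of k Q T] by simp

lemma chain_end_mono:
  assumes "chain k P Q" "prime_idl Q'" "Q \<subseteq> Q'"
  shows "\<exists>l\<ge>k. chain l P Q'"
proof (cases "Q = Q'")
  case False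
  then have "chain (Suc k) P Q'" using assms by (intro chain_Suc) auto
  then show ?thesis by (intro exI[of _ "Suc k"]) auto
qed (use assms in auto)

text \<open>Regular sequences on \<open>R/J\<close> without the requirement that the generated ideal
  be proper. Where properness matters the sequence lies in a prime ideal, and the condition returns
  in \<open>regular_sequence_iff\<close>.\<close>

primrec regs :: "'a set \<Rightarrow> 'a list \<Rightarrow> bool" where
  "regs J [] \<longleftrightarrow> True"
| "regs J (x # xs) \<longleftrightarrow> x \<in> R \<and> (\<forall>y\<in>R. x * y \<in> J \<longrightarrow> y \<in> J) \<and> regs (gen (insert x J)) xs"

lemma regs_sub: "regs J xs \<Longrightarrow> set xs \<subseteq> R"
  by (induction xs arbitrary: J) auto

lemma gen_Un_insert:
  assumes "J \<subseteq> R" "x \<in> R" "Y \<subseteq> R"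
  shows "gen (gen (insert x J) \<union> Y) = gen (J \<union> insert x Y)"
  using gen_gen_un[of "insert x J" Y] assms by simp

lemma regs_append:
  "idl J \<Longrightarrow> set xs \<subseteq> R \<Longrightarrow> set ys \<subseteq> R \<Longrightarrow> regs J (xs @ ys) \<longleftrightarrow> regs J xs \<and> regs (gen (J \<union> set xs)) ys"
proof (induction xs arbitrary: J)
  case Nil
  then show ?case by (simp add: gen_of_idl)
next
  case (Cons x xs)
  have i: "idl (gen (insert x J))" using Cons idl_sub[of J] by (intro gen_idl) auto
  then show ?case using Cons.IH[OF i] Cons.prems gen_Un_insert[of J x "set xs"] idl_sub[of J] by auto
qed

lemma regs_iff_nth:
  "idl J \<Longrightarrow> set xs \<subseteq> R \<Longrightarrow>
   regs J xs \<longleftrightarrow> (\<forall>i<length xs. \<forall>y\<in>R. xs ! i * y \<in> gen (J \<union> set (take i xs)) \<longrightarrow> y \<in> gen (J \<union> set (take i xs)))"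
proof (induction xs arbitrary: J)
  case (Cons x xs)
  have i: "idl (gen (insert x J))" using Cons idl_sub[of J] by (intro gen_idl) auto
  have *: "gen (gen (insert x J) \<union> set (take i xs)) = gen (J \<union> set (take (Suc i) (x # xs)))" for i
    using gen_Un_insert[of J x "set (take i xs)"] Cons.prems idl_sub[of J] set_take_subset[of i xs] by auto
  have sp: "(\<forall>i<length (x # xs). Q i) \<longleftrightarrow> Q 0 \<and> (\<forall>i<length xs. Q (Suc i))" for Q
    by (auto simp: less_Suc_eq_0_disj)
  show ?case unfolding sp using Cons.IH[OF i] Cons.prems * by (simp add: gen_of_idl)
qed auto

text \<open>The products \<open>s * x ^ n\<close> with \<open>s\<close> outside \<open>Q\<close>
  form a multiplicative set that misses \<open>J\<close>. A prime over \<open>J\<close> missing this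
  set lies inside \<open>Q\<close> and does not contain \<open>x\<close>, so \<open>Q\<close> is not
  minimal over \<open>J\<close>.\<close>

lemma nzd_prime_below:
  assumes noeth "idl J" "x \<in> R" "\<And>y. y \<in> R \<Longrightarrow> x * y \<in> J \<Longrightarrow> y \<in> J" "prime_idl Q" "J \<subseteq> Q" "x \<in> Q"
  shows "\<exists>Q'. prime_idl Q' \<and> J \<subseteq> Q' \<and> Q' \<subset> Q"
proof -
  let ?T = "{s * x ^ n | s n. s \<in> R \<and> s \<notin> Q}"
  have Q: "idl Q" "1 \<notin> Q" using assms(5) by (auto simp: prime_idl_def)
  have pw: "y \<in> J" if "y \<in> R" "x ^ n * y \<in> J" for y n
    using that
  proof (induction n arbitrary: y)
    case (Suc n)
    have "x * (x ^ n * y) \<in> J" using Suc.prems by (simp add: mult.assoc)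
    then have "x ^ n * y \<in> J" using assms(4)[of "x ^ n * y"] assms(3) Suc.prems by auto
    then show ?case using Suc by auto
  qed auto
  have disj: "J \<inter> ?T = {}"
  proof (rule ccontr)
    assume "\<not> ?thesis"
    then obtain s n where "s * x ^ n \<in> J" "s \<in> R" "s \<notin> Q" by auto
    then show False using pw[of s n] assms(6) by (auto simp: mult.commute)
  qed
  have mul: "a * b \<in> ?T" if ab: "a \<in> ?T" "b \<in> ?T" for a b
  proof -
    obtain s n t m where e: "a = s * x ^ n" "b = t * x ^ m" "s \<in> R" "t \<in> R" "s \<notin> Q" "t \<notin> Q"
      using ab by auto
    then have "s * t \<notin> Q" using prime_idl_mult[OF assms(5)] by auto
    moreover have "a * b = (s * t) * x ^ (n + m)" by (simp add: e power_add mult_ac)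
    ultimately show ?thesis using e by blast
  qed
  have T1: "1 \<in> ?T" using Q by (intro CollectI exI[of _ 1] exI[of _ 0]) auto
  have TR: "?T \<subseteq> R" using assms(3) by auto
  obtain Q' where Q': "prime_idl Q'" "J \<subseteq> Q'" "Q' \<inter> ?T = {}"
    using noeth_prime_disjoint[OF assms(1,2) TR T1 mul disj] by auto
  have "Q' \<subseteq> Q"
  proof
    fix a assume a: "a \<in> Q'"
    then have "a \<in> R" using Q'(1) prime_idl_idl idl_mem by blast
    show "a \<in> Q"
    proof (rule ccontr)
      assume "a \<notin> Q"
      then have "a \<in> ?T" using \<open>a \<in> R\<close> by (intro CollectI exI[of _ a] exI[of _ 0]) auto
      then show False using a Q' by auto
    qed
  qed
  moreover have "x \<notin> Q'"
  proof
    assume "x \<in> Q'"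
    moreover have "x \<in> ?T" using Q by (intro CollectI exI[of _ 1]) (auto intro: exI[of _ 1])
    ultimately show False using Q' by auto
  qed
  ultimately show ?thesis using Q' assms(7) by auto
qed

text \<open>Each member of the sequence pushes the prime strictly down, beginning with the last one.
  All lower bounds for heights by regular sequences come from here.\<close>

lemma regs_chain_below:
  assumes noeth
  shows "idl J \<Longrightarrow> regs J xs \<Longrightarrow> prime_idl P \<Longrightarrow> J \<subseteq> P \<Longrightarrow> set xs \<subseteq> P \<Longrightarrow> \<exists>Q. J \<subseteq> Q \<and> chain (length xs) Q P"
proof (induction xs arbitrary: J)
  case Nil
  then show ?case by (intro exI[of _ P]) (auto intro: chain_0)
next
  case (Cons x xs)
  let ?J = "gen (insert x J)"
  have x: "x \<in> R" "\<And>y. y \<in> R \<Longrightarrow> x * y \<in> J \<Longrightarrow> y \<in> J" and xs: "regs ?J xs" using Cons.prems by auto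
  have i: "idl ?J" using Cons.prems idl_sub[of J] by (intro gen_idl) auto
  have "?J \<subseteq> P" using Cons.prems prime_idl_idl by (intro gen_least) auto
  then obtain Q where Q: "?J \<subseteq> Q" "chain (length xs) Q P"
    using Cons.IH[OF i xs Cons.prems(3)] Cons.prems by auto
  have "\<exists>Q'. prime_idl Q' \<and> J \<subseteq> Q' \<and> Q' \<subset> Q"
  proof (rule nzd_prime_below[OF assms Cons.prems(1) x(1)])
    show "y \<in> J" if "y \<in> R" "x * y \<in> J" for y by (rule x(2)[OF that])
    show "prime_idl Q" using chain_primes[OF Q(2)] by simp
    show "J \<subseteq> Q" "x \<in> Q" using Q gen_superset[of "insert x J"] by auto
  qed
  then obtain Q' where "prime_idl Q'" "J \<subseteq> Q'" "Q' \<subset> Q" by auto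
  then show ?case using Q chain_Cons[of Q' Q "length xs" P] by auto
qed

text \<open>A form of Ischebeck's inequality: a regular sequence inside the prime \<open>P\<close> is no longer than
  some chain of primes between an associated prime and \<open>P\<close>. The step replaces Nakayama's lemma by
  an ascending chain of ideals.\<close>

lemma ischebeck_step:
  assumes noeth "idl J" "prime_idl P" "idl p" "p \<subseteq> P" "r \<in> R"
    and pr: "\<And>a. a \<in> p \<Longrightarrow> a * r \<in> J" and ann: "\<And>s. s \<in> R \<Longrightarrow> s * r \<in> J \<Longrightarrow> s \<in> P"
    and x: "x \<in> P" "\<And>y. y \<in> R \<Longrightarrow> x * y \<in> J \<Longrightarrow> y \<in> J"
  shows "\<exists>s\<in>R. (\<forall>a\<in>p. a * s \<in> J) \<and> (\<forall>t\<in>R. t * s \<in> gen (insert x J) \<longrightarrow> t \<in> P)"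
proof (rule ccontr)
  assume n: "\<not> ?thesis"
  have P: "idl P" "1 \<notin> P" using assms(3) by (auto simp: prime_idl_def)
  have xR: "x \<in> R" using x(1) P idl_mem by auto
  have pR: "p \<subseteq> R" using assms(4) idl_sub by auto
  define N where "N = {s\<in>R. \<forall>a\<in>p. a * s \<in> J}"
  have step: "\<exists>s' t. s' \<in> N \<and> t \<in> R \<and> t \<notin> P \<and> t * s - x * s' \<in> J" if "s \<in> N" for s
  proof -
    from that n obtain t where t: "t \<in> R" "t \<notin> P" "t * s \<in> gen (insert x J)" unfolding N_def by auto
    then obtain s' where s': "s' \<in> R" "t * s - s' * x \<in> J" using gen_insert_idl_iff[OF assms(2) xR] by auto
    have "a * s' \<in> J" if a: "a \<in> p" for a
    proof -
      have aR: "a \<in> R" using a pR by auto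
      have "a * s \<in> J" using \<open>s \<in> N\<close> a by (auto simp: N_def)
      then have "t * (a * s) - a * (t * s - s' * x) \<in> J"
        using idl_diff[OF assms(2) idl_mult[OF assms(2) t(1)] idl_mult[OF assms(2) aR s'(2)]] by auto
      then have "x * (a * s') \<in> J" by (simp add: algebra_simps)
      then show ?thesis using x(2)[of "a * s'"] aR s' by auto
    qed
    then have "s' \<in> N" using s' by (auto simp: N_def)
    then show ?thesis using t s' by (intro exI[of _ s'] exI[of _ t]) (auto simp: mult.commute)
  qed
  \<comment> \<open>If the claim fails, every element of \<open>N\<close> has a multiple, by a
    factor outside \<open>P\<close>, that equals \<open>x\<close> times another element of
    \<open>N\<close> modulo \<open>J\<close>. Iteration from \<open>r\<close> yields elements with
    \<open>t i * \<rho> i\<close> congruent to \<open>x * \<rho> (Suc i)\<close>.\<close>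
  have "\<exists>f. \<forall>i::nat. f i \<in> N \<times> R \<and> (i = 0 \<longrightarrow> f i = (r, 1)) \<and> snd (f (Suc i)) \<notin> P \<and>
      snd (f (Suc i)) * fst (f i) - x * fst (f (Suc i)) \<in> J"
  proof -
    have "\<exists>f. \<forall>i::nat. (f i \<in> N \<times> R \<and> (i = 0 \<longrightarrow> f i = (r, 1))) \<and> (snd (f (Suc i)) \<notin> P \<and>
      snd (f (Suc i)) * fst (f i) - x * fst (f (Suc i)) \<in> J)"
    proof (rule dependent_nat_choice)
      show "\<exists>z. z \<in> N \<times> R \<and> (0 = (0::nat) \<longrightarrow> z = (r, 1))"
        using assms by (intro exI[of _ "(r, 1)"]) (auto simp: N_def)
      fix z :: "'a \<times> 'a" and i :: nat
      assume z: "z \<in> N \<times> R \<and> (i = 0 \<longrightarrow> z = (r, 1))"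
      then have "fst z \<in> N" by auto
      from step[OF this] obtain s' t where "s' \<in> N" "t \<in> R" "t \<notin> P" "t * fst z - x * s' \<in> J" by auto
      then show "\<exists>y. (y \<in> N \<times> R \<and> (Suc i = 0 \<longrightarrow> y = (r, 1))) \<and> snd y \<notin> P \<and> snd y * fst z - x * fst y \<in> J"
        by (intro exI[of _ "(s', t)"]) auto
    qed
    then show ?thesis by auto
  qed
  then obtain f where f: "\<forall>i::nat. f i \<in> N \<times> R \<and> (i = 0 \<longrightarrow> f i = (r, 1)) \<and> snd (f (Suc i)) \<notin> P \<and>
      snd (f (Suc i)) * fst (f i) - x * fst (f (Suc i)) \<in> J" ..
  define \<rho> t where "\<rho> i = fst (f i)" and "t i = snd (f (Suc i))" for i
  have \<rho>0: "\<rho> 0 = r" using f by (auto simp: \<rho>_def)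
  have \<rho>R: "\<rho> i \<in> R" for i using f[rule_format, of i] by (auto simp: \<rho>_def N_def mem_Times_iff)
  have tR: "t i \<in> R" "t i \<notin> P" for i using f[rule_format, of "Suc i"] f[rule_format, of i] by (auto simp: t_def mem_Times_iff)
  have rel: "t i * \<rho> i - x * \<rho> (Suc i) \<in> J" for i using f by (auto simp: \<rho>_def t_def)
  define T where "T i = (\<Prod>j<i. t j)" for i
  have TR: "T i \<in> R" for i unfolding T_def using tR by auto
  have TP: "T i \<notin> P" for i
    unfolding T_def using prime_idl_prod[OF assms(3), of "{..<i}" t] tR by auto
  have pw: "x ^ i * \<rho> i - T i * r \<in> J" for i
  proof (induction i)
    case 0
    then show ?case using idl_zero[OF assms(2)] by (simp add: T_def \<rho>0)
  next
    case (Suc i)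
    have "t i * (x ^ i * \<rho> i - T i * r) - x ^ i * (t i * \<rho> i - x * \<rho> (Suc i)) \<in> J"
      by (intro idl_diff[OF assms(2)] idl_mult[OF assms(2) tR(1) Suc] idl_mult[OF assms(2) power_closed[OF xR] rel])
    then show ?case by (simp add: T_def algebra_simps)
  qed
  have sub: "J \<union> range \<rho> \<subseteq> R" using \<rho>R idl_sub[OF assms(2)] by auto
  obtain Y where Y: "Y \<subseteq> J \<union> range \<rho>" "finite Y" "gen (J \<union> range \<rho>) = gen Y"
    using noeth_gen_finite[OF assms(1) sub] by auto
  have "\<exists>m. Y \<subseteq> J \<union> \<rho> ` {..<m}" using Y(2,1)
  proof (induction Y rule: finite_induct)
    case (insert y Y)
    then obtain m where m: "Y \<subseteq> J \<union> \<rho> ` {..<m}" by auto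
    show ?case
    proof (cases "y \<in> J")
      case True
      then show ?thesis using m by (intro exI[of _ m]) auto
    next
      case False
      then obtain i where "y = \<rho> i" using insert by auto
      moreover have "\<rho> ` {..<m} \<subseteq> \<rho> ` {..<max m (Suc i)}" by (intro image_mono) auto
      ultimately show ?thesis using m by (intro exI[of _ "max m (Suc i)"]) auto
    qed
  qed auto
  then obtain m where m: "Y \<subseteq> J \<union> \<rho> ` {..<m}" by auto
  \<comment> \<open>Here the ascending chain of ideals has stopped. Multiplication by
    \<open>x ^ m\<close> turns each earlier \<open>\<rho> i\<close> into
    \<open>x ^ (m - i) * T i * r\<close> modulo \<open>J\<close>, a multiple of
    \<open>x * r\<close>. Comparison with \<open>T m * r\<close> puts \<open>T m - x * c\<close> in
    \<open>P\<close>, although \<open>x\<close> is in \<open>P\<close> and \<open>T m\<close> is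
    not.\<close>
  have "\<rho> m \<in> gen (J \<union> \<rho> ` {..<m})"
    using Y(3) gen_inc[of "\<rho> m" "J \<union> range \<rho>"] gen_mono[OF m] by auto
  moreover have "\<exists>c\<in>R. x ^ m * g - x * c * r \<in> J" if "g \<in> gen (J \<union> \<rho> ` {..<m})" for g
    using that
  proof induction
    case gen_0
    then show ?case using idl_zero[OF assms(2)] by (intro bexI[of _ 0]) auto
  next
    case (gen_step a z g)
    then obtain c where c: "c \<in> R" "x ^ m * g - x * c * r \<in> J" by auto
    have "\<exists>d\<in>R. x ^ m * z - x * d * r \<in> J"
    proof (cases "z \<in> J")
      case True
      then show ?thesis using idl_mult[OF assms(2) power_closed[OF xR] True, of m] by (intro bexI[of _ 0]) auto
    next
      case False
      then obtain i where i: "z = \<rho> i" "i < m" using gen_step by auto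
      have "x ^ m = x ^ (m - i) * x ^ i" using i by (simp flip: power_add)
      moreover have "x ^ (m - i) = x * x ^ (m - i - 1)" using i by (metis Suc_diff_Suc diff_Suc_1 diff_diff_left plus_1_eq_Suc power_Suc add.commute)
      moreover have "x ^ (m - i) * (x ^ i * \<rho> i - T i * r) \<in> J"
        using pw[of i] xR by (intro idl_mult[OF assms(2)]) auto
      ultimately have "x ^ m * z - x * (x ^ (m - i - 1) * T i) * r \<in> J" using i by (simp add: algebra_simps)
      then show ?thesis using xR TR by (intro bexI[of _ "x ^ (m - i - 1) * T i"]) auto
    qed
    then obtain d where d: "d \<in> R" "x ^ m * z - x * d * r \<in> J" by auto
    have "a * (x ^ m * z - x * d * r) + (x ^ m * g - x * c * r) \<in> J"
      by (intro idl_add[OF assms(2) idl_mult[OF assms(2) gen_step(1) d(2)] c(2)])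
    then show ?case using c d gen_step by (intro bexI[of _ "a * d + c"]) (auto simp: algebra_simps)
  qed
  ultimately obtain c where c: "c \<in> R" "x ^ m * \<rho> m - x * c * r \<in> J" by blast
  have "(x ^ m * \<rho> m - x * c * r) - (x ^ m * \<rho> m - T m * r) \<in> J" by (rule idl_diff[OF assms(2) c(2) pw])
  then have "(T m - x * c) * r \<in> J" by (simp add: algebra_simps)
  then have "T m - x * c \<in> P" using ann TR c xR by auto
  moreover have "x * c \<in> P" by (rule idl_mult2[OF P(1) c(1) x(1)])
  ultimately show False using TP[of m] idl_add[OF P(1), of "T m - x * c" "x * c"] by auto
qed

lemma ischebeck:
  assumes noeth "prime_idl P"
  shows "idl J \<Longrightarrow> regs J xs \<Longrightarrow> set xs \<subseteq> P \<Longrightarrow> prime_idl p \<Longrightarrow> p \<subseteq> P \<Longrightarrow> r \<in> R \<Longrightarrow>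
    (\<And>a. a \<in> p \<Longrightarrow> a * r \<in> J) \<Longrightarrow> (\<And>s. s \<in> R \<Longrightarrow> s * r \<in> J \<Longrightarrow> s \<in> P) \<Longrightarrow>
    \<exists>P'. chain (length xs) p P' \<and> P' \<subseteq> P"
proof (induction xs arbitrary: J p r)
  case Nil
  then show ?case by (intro exI[of _ p]) (auto intro: chain_0)
next
  case (Cons x xs)
  let ?J = "gen (insert x J)"
  have x: "x \<in> P" "\<And>y. y \<in> R \<Longrightarrow> x * y \<in> J \<Longrightarrow> y \<in> J" and xs: "regs ?J xs" using Cons.prems by auto
  have xR: "x \<in> R" using Cons.prems by auto
  have i: "idl ?J" using Cons.prems xR idl_sub[of J] by (intro gen_idl) auto
  have "\<exists>s\<in>R. (\<forall>a\<in>p. a * s \<in> J) \<and> (\<forall>t\<in>R. t * s \<in> ?J \<longrightarrow> t \<in> P)"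
    by (rule ischebeck_step[OF assms(1) Cons.prems(1) assms(2) prime_idl_idl[OF Cons.prems(4)] Cons.prems(5-8) x])
  then obtain s where s: "s \<in> R" "\<forall>a\<in>p. a * s \<in> J" "\<And>t. t \<in> R \<Longrightarrow> t * s \<in> ?J \<Longrightarrow> t \<in> P" by auto
  \<comment> \<open>An associated prime of the enlarged ideal. It contains \<open>p\<close> and
    \<open>x\<close>, and \<open>x\<close> is not in \<open>p\<close> because it is a nonzerodivisor
    modulo \<open>J\<close>; so each member of the sequence costs one strict inclusion.\<close>
  obtain q c where q: "prime_idl q" "q \<subseteq> P" "c \<in> R" "\<forall>a\<in>R. a * (c * s) \<in> ?J \<longleftrightarrow> a \<in> q"
    using assoc_prime_exists[OF assms(1) i assms(2) s(1,3)] by auto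
  have JJ: "J \<subseteq> ?J" "x \<in> ?J" using gen_superset[of "insert x J"] by auto
  have mem: "a \<in> q" if "a \<in> R" "a * s \<in> ?J" for a
  proof -
    have "c * (a * s) \<in> ?J" by (rule idl_mult[OF i q(3) that(2)])
    then show ?thesis using q(4) that by (simp add: mult_ac)
  qed
  have pq: "p \<subseteq> q"
  proof
    fix a assume "a \<in> p"
    moreover from this have "a \<in> R" by (rule idl_mem[OF prime_idl_idl[OF Cons.prems(4)]])
    ultimately show "a \<in> q" using mem[of a] s(2) JJ(1) by auto
  qed
  have "x \<in> q" using mem[of x] idl_mult2[OF i s(1) JJ(2)] xR by auto
  moreover have "x \<notin> p"
  proof
    assume "x \<in> p"
    then have "x * r \<in> J" by (rule Cons.prems(7))
    then have "r \<in> J" by (rule x(2)[OF Cons.prems(6)])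
    then have "1 \<in> P" using Cons.prems(8)[of 1] by simp
    then show False using prime_idl_one[OF assms(2)] by simp
  qed
  ultimately have "p \<subset> q" using pq by auto
  have "\<exists>P'. chain (length xs) q P' \<and> P' \<subseteq> P"
  proof (rule Cons.IH[OF i xs _ q(1,2)])
    show "set xs \<subseteq> P" using Cons.prems by auto
    show "c * s \<in> R" using q s by auto
    show "a * (c * s) \<in> ?J" if "a \<in> q" for a
      using q(4) that idl_mem[OF prime_idl_idl[OF q(1)] that] by simp
    show "a \<in> P" if "a \<in> R" "a * (c * s) \<in> ?J" for a using q(2,4) that by blast
  qed
  then obtain P' where "chain (length xs) q P'" "P' \<subseteq> P" by auto
  then show ?case using chain_Cons[OF Cons.prems(4) \<open>p \<subset> q\<close>] by (intro exI[of _ P']) auto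
qed

end

section \<open>The Koszul complex\<close>

definition ksign :: "nat \<Rightarrow> nat set \<Rightarrow> 'a::comm_ring_1" where
  "ksign k T = (- 1) ^ card {l\<in>T. l < k}"

text \<open>The Koszul differential read coefficientwise: a chain is a function on index sets, and
  the value at \<open>T\<close> is the coefficient of the basis element of \<open>T\<close> in the
  image. It depends only on the values at sets with one more element.\<close>

definition kosz :: "(nat \<Rightarrow> 'a::comm_ring_1) \<Rightarrow> nat \<Rightarrow> (nat set \<Rightarrow> 'a) \<Rightarrow> nat set \<Rightarrow> 'a" where
  "kosz p n w T = (\<Sum>k\<in>{..<n} - T. ksign k T * p k * w (insert k T))"

text \<open>Together with \<open>kosz_Suc_insert\<close> this exhibits the complex on
  \<open>Suc n\<close> elements as the mapping cone of multiplication by \<open>p n\<close>, up to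
  sign: the sets containing \<open>n\<close> form one copy of the smaller complex, the remaining
  sets the other. The inductions on \<open>n\<close> use this splitting.\<close>

lemma kosz_Suc:
  assumes "T \<subseteq> {..<n}"
  shows "kosz p (Suc n) w T = kosz p n w T + (- 1) ^ card T * p n * w (insert n T)"
proof -
  have "{..<Suc n} - T = insert n ({..<n} - T)" using assms by auto
  moreover have "{l\<in>T. l < n} = T" using assms by auto
  ultimately show ?thesis by (simp add: kosz_def ksign_def)
qed

lemma kosz_Suc_insert:
  assumes "T \<subseteq> {..<n}"
  shows "kosz p (Suc n) w (insert n T) = kosz p n (\<lambda>U. w (insert n U)) T"
  unfolding kosz_def
proof (rule sum.cong)
  fix k assume "k \<in> {..<n} - T"
  then have "{l \<in> insert n T. l < k} = {l\<in>T. l < k}" by auto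
  then show "ksign k (insert n T) * p k * w (insert k (insert n T)) = ksign k T * p k * w (insert n (insert k T))"
    by (simp add: ksign_def insert_commute)
qed auto

lemma kosz_add: "kosz p n (\<lambda>T. u T + v T) T = kosz p n u T + kosz p n v T"
  by (simp add: kosz_def sum.distrib algebra_simps)

lemma kosz_diff: "kosz p n (\<lambda>T. u T - v T) T = kosz p n u T - kosz p n v T"
  by (simp add: kosz_def sum_subtractf algebra_simps)

lemma kosz_smult: "kosz p n (\<lambda>T. c * u T) T = c * kosz p n u T"
  by (simp add: kosz_def sum_distrib_left algebra_simps)

lemma kosz_cong:
  "(\<And>k. k < n \<Longrightarrow> k \<notin> T \<Longrightarrow> u (insert k T) = v (insert k T)) \<Longrightarrow> kosz p n u T = kosz p n v T"
  by (auto simp: kosz_def intro!: sum.cong)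

lemma kosz_kosz: "T \<subseteq> {..<n} \<Longrightarrow> kosz p n (kosz p n w) T = 0"
proof (induction n arbitrary: T w)
  case 0
  then show ?case by (simp add: kosz_def)
next
  case (Suc n)
  show ?case
  proof (cases "n \<in> T")
    case True
    then obtain U where U: "T = insert n U" "n \<notin> U" by (metis Set.set_insert)
    then have Un: "U \<subseteq> {..<n}" using Suc.prems by (auto simp: less_Suc_eq)
    have "kosz p (Suc n) (kosz p (Suc n) w) T = kosz p n (\<lambda>V. kosz p (Suc n) w (insert n V)) U"
      unfolding U(1) by (rule kosz_Suc_insert[OF Un])
    also have "\<dots> = kosz p n (kosz p n (\<lambda>V. w (insert n V))) U"
      using Un by (intro kosz_cong kosz_Suc_insert) auto
    also have "\<dots> = 0" by (rule Suc.IH[OF Un])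
    finally show ?thesis .
  next
    case False
    then have Tn: "T \<subseteq> {..<n}" using Suc.prems by (auto simp: less_Suc_eq)
    have fin: "finite T" using Tn finite_subset by blast
    let ?wn = "\<lambda>U. w (insert n U)"
    have "kosz p n (kosz p (Suc n) w) T = kosz p n (\<lambda>U. kosz p n w U + ((- 1) ^ Suc (card T) * p n) * ?wn U) T"
    proof (rule kosz_cong)
      fix k assume k: "k < n" "k \<notin> T"
      then show "kosz p (Suc n) w (insert k T) = kosz p n w (insert k T) + (- 1) ^ Suc (card T) * p n * ?wn (insert k T)"
        using kosz_Suc[of "insert k T" n p w] Tn fin by simp
    qed
    also have "\<dots> = (- 1) ^ Suc (card T) * p n * kosz p n ?wn T"
      unfolding kosz_add kosz_smult Suc.IH[OF Tn] by simp
    finally show ?thesis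
      using kosz_Suc[OF Tn, of p "kosz p (Suc n) w"] kosz_Suc_insert[OF Tn, of p w] by simp
  qed
qed

section \<open>Exactness of the Koszul complex and extension of regular sequences\<close>

context subring_set begin

lemma ksign_closed: "ksign k T \<in> R"
  by (simp add: ksign_def)

lemma kosz_closed: "(\<And>k. k < n \<Longrightarrow> p k \<in> R) \<Longrightarrow> range w \<subseteq> R \<Longrightarrow> kosz p n w T \<in> R"
  unfolding kosz_def by (intro sum_closed mult_closed ksign_closed) auto

lemma kosz_mem:
  assumes "idl J" "\<And>k. k < n \<Longrightarrow> p k \<in> R" "\<And>k. k < n \<Longrightarrow> k \<notin> T \<Longrightarrow> w (insert k T) \<in> J"
  shows "kosz p n w T \<in> J"
  unfolding kosz_def using assms by (intro idl_sum idl_mult mult_closed ksign_closed) auto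

lemma gen_Un_image_iff:
  fixes p :: "nat \<Rightarrow> 'a"
  assumes "idl J"
  shows "(\<And>k. k < n \<Longrightarrow> p k \<in> R) \<Longrightarrow>
    y \<in> gen (J \<union> p ` {..<n}) \<longleftrightarrow> (\<exists>c. range c \<subseteq> R \<and> y - (\<Sum>k<n. p k * c k) \<in> J)"
proof (induction n arbitrary: y)
  case 0
  show ?case using gen_of_idl[OF assms(1)] by (auto intro: exI[of _ "\<lambda>_. 0"])
next
  case (Suc n)
  have sub: "J \<union> p ` {..<n} \<subseteq> R" using Suc.prems idl_sub[OF assms(1)] by auto
  have "y \<in> gen (J \<union> p ` {..<Suc n}) \<longleftrightarrow> y \<in> gen (insert (p n) (J \<union> p ` {..<n}))"
    by (simp add: lessThan_Suc)
  also have "\<dots> \<longleftrightarrow> (\<exists>r\<in>R. y - r * p n \<in> gen (J \<union> p ` {..<n}))"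
    using Suc.prems by (intro gen_insert_iff[OF sub]) auto
  also have "\<dots> \<longleftrightarrow> (\<exists>r\<in>R. \<exists>c. range c \<subseteq> R \<and> y - r * p n - (\<Sum>k<n. p k * c k) \<in> J)"
    using Suc.IH Suc.prems by auto
  also have "\<dots> \<longleftrightarrow> (\<exists>c. range c \<subseteq> R \<and> y - (\<Sum>k<Suc n. p k * c k) \<in> J)" (is "?l \<longleftrightarrow> ?r")
  proof
    assume ?l
    then obtain r c where rc: "r \<in> R" "range c \<subseteq> R" "y - r * p n - (\<Sum>k<n. p k * c k) \<in> J" by auto
    have "(\<Sum>k<n. p k * (c(n := r)) k) = (\<Sum>k<n. p k * c k)" by (intro sum.cong) auto
    then have "y - (\<Sum>k<Suc n. p k * (c(n := r)) k) \<in> J" using rc by (simp add: algebra_simps)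
    then show ?r using rc by (intro exI[of _ "c(n := r)"]) auto
  next
    assume ?r
    then obtain c where c: "range c \<subseteq> R" "y - (\<Sum>k<Suc n. p k * c k) \<in> J" by auto
    then show ?l by (intro bexI[of _ "c n"] exI[of _ c]) (auto simp: algebra_simps)
  qed
  finally show ?case .
qed

text \<open>Exactness in homological degree \<open>i\<close> of the complex with coefficients in
  \<open>R/J\<close>, written with representatives and congruences. The condition
  \<open>Suc (card T) = i\<close> makes every function a cycle for \<open>i = 0\<close>.\<close>

definition kexact :: "(nat \<Rightarrow> 'a) \<Rightarrow> 'a set \<Rightarrow> nat \<Rightarrow> nat \<Rightarrow> bool" where
  "kexact p J n i \<longleftrightarrow> (\<forall>w. range w \<subseteq> R \<and> (\<forall>T\<subseteq>{..<n}. Suc (card T) = i \<longrightarrow> kosz p n w T \<in> J) \<longrightarrow>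
     (\<exists>\<xi>. range \<xi> \<subseteq> R \<and> (\<forall>T\<subseteq>{..<n}. card T = i \<longrightarrow> w T - kosz p n \<xi> T \<in> J)))"

lemma kexactD:
  assumes "kexact p J n i" "range w \<subseteq> R" "\<And>T. T \<subseteq> {..<n} \<Longrightarrow> Suc (card T) = i \<Longrightarrow> kosz p n w T \<in> J"
  obtains \<xi> where "range \<xi> \<subseteq> R" "\<And>T. T \<subseteq> {..<n} \<Longrightarrow> card T = i \<Longrightarrow> w T - kosz p n \<xi> T \<in> J"
  using assms unfolding kexact_def by blast

text \<open>The cone argument with explicit elements. The part \<open>\<beta>\<close> of the cycle
  on sets containing \<open>n\<close> is a boundary by induction, and correcting the remaining part
  by a multiple of its primitive \<open>\<gamma>\<close> leaves a cycle \<open>\<alpha>\<close> of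
  the complex on the first \<open>n\<close> elements.\<close>

theorem koszul_exact:
  assumes J: "idl J" and "regs J (map p [0..<n])" "i > 0"
  shows "kexact p J n i"
  using assms(2,3)
proof (induction n arbitrary: i)
  case 0
  show ?case unfolding kexact_def
  proof (intro allI impI)
    fix w :: "nat set \<Rightarrow> 'a"
    show "\<exists>\<xi>. range \<xi> \<subseteq> R \<and> (\<forall>T\<subseteq>{..<0::nat}. card T = i \<longrightarrow> w T - kosz p 0 \<xi> T \<in> J)"
      using 0 by (intro exI[of _ "\<lambda>_. 0"]) auto
  qed
next
  case (Suc n)
  have pR: "set (map p [0..<Suc n]) \<subseteq> R" using regs_sub[OF Suc.prems(1)] .
  then have pR': "p k \<in> R" if "k \<le> n" for k using that by (cases "k = n") auto
  have "regs J (map p [0..<n]) \<and> regs (gen (J \<union> p ` {..<n})) [p n]"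
    using Suc.prems regs_append[OF J, of "map p [0..<n]" "[p n]"] pR by (auto simp: atLeast0LessThan)
  then have reg: "regs J (map p [0..<n])" and
    nzd: "\<And>y. y \<in> R \<Longrightarrow> p n * y \<in> gen (J \<union> p ` {..<n}) \<Longrightarrow> y \<in> gen (J \<union> p ` {..<n})" by auto
  note IH = Suc.IH[OF reg]
  show ?case unfolding kexact_def
  proof (intro allI impI, elim conjE)
    fix w assume wR: "range w \<subseteq> R" and "\<forall>T\<subseteq>{..<Suc n}. Suc (card T) = i \<longrightarrow> kosz p (Suc n) w T \<in> J"
    then have cyc: "kosz p (Suc n) w T \<in> J" if "T \<subseteq> {..<Suc n}" "Suc (card T) = i" for T using that by auto
    define \<beta> where "\<beta> T = w (insert n T)" for T
    have \<beta>R: "range \<beta> \<subseteq> R" using wR by (auto simp: \<beta>_def)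
    have fin: "finite T" if "T \<subseteq> {..<n}" for T :: "nat set" using that finite_subset by blast
    have c1: "kosz p n \<beta> T \<in> J" if T: "T \<subseteq> {..<n}" "Suc (card T) = i - 1" for T
    proof -
      have "n \<notin> T" using T by auto
      then have "kosz p (Suc n) w (insert n T) \<in> J" using T fin[OF T(1)] by (intro cyc) auto
      moreover have "\<beta> = (\<lambda>U. w (insert n U))" by (simp add: fun_eq_iff \<beta>_def)
      ultimately show ?thesis using kosz_Suc_insert[OF T(1), of p w] by simp
    qed
    have c2: "kosz p n w T + (- 1) ^ card T * p n * \<beta> T \<in> J" if T: "T \<subseteq> {..<n}" "Suc (card T) = i" for T
    proof -
      have "T \<subseteq> {..<Suc n}" using T by auto
      then show ?thesis using cyc[of T] kosz_Suc[OF T(1), of p w] T by (simp add: \<beta>_def)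
    qed
    have "\<exists>\<gamma>. range \<gamma> \<subseteq> R \<and> (\<forall>T\<subseteq>{..<n}. card T = i - 1 \<longrightarrow> \<beta> T - kosz p n \<gamma> T \<in> J)"
    proof (cases "i = 1")
      case False
      then have "i - 1 > 0" using Suc.prems by simp
      from kexactD[OF IH[OF this] \<beta>R c1] show ?thesis by metis
    next
      \<comment> \<open>Here \<open>\<beta>\<close> has degree zero, where the smaller complex is
        not exact. Instead the cycle condition places \<open>p n * \<beta> {}\<close> in the ideal
        of \<open>J\<close> and the earlier elements, and regularity cancels
        \<open>p n\<close>.\<close>
      case True
      have ks: "kosz p n u {} = (\<Sum>k<n. p k * u {k})" for u
        by (simp add: kosz_def ksign_def)
      have "kosz p n w {} + p n * \<beta> {} \<in> J" using c2[of "{}"] True by simp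
      then have "p n * \<beta> {} - (\<Sum>k<n. p k * (- w {k})) \<in> J" by (simp add: ks sum_negf add.commute)
      moreover have "range (\<lambda>k. - w {k}) \<subseteq> R" using wR by (auto simp: image_subset_iff)
      ultimately have "\<exists>c. range c \<subseteq> R \<and> p n * \<beta> {} - (\<Sum>k<n. p k * c k) \<in> J" by blast
      then have "p n * \<beta> {} \<in> gen (J \<union> p ` {..<n})"
        using gen_Un_image_iff[OF J, of n p "p n * \<beta> {}"] pR' by simp
      then have "\<beta> {} \<in> gen (J \<union> p ` {..<n})" using nzd[of "\<beta> {}"] \<beta>R by auto
      then obtain c where c: "range c \<subseteq> R" "\<beta> {} - (\<Sum>k<n. p k * c k) \<in> J"
        using gen_Un_image_iff[OF J, of n p "\<beta> {}"] pR' by auto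
      have "\<beta> T - kosz p n (\<lambda>U. c (the_elem U)) T \<in> J" if "T \<subseteq> {..<n}" "card T = i - 1" for T
      proof -
        have "T = {}" using that True fin[of T] by auto
        then show ?thesis using c by (simp add: ks)
      qed
      then show ?thesis using c by (intro exI[of _ "\<lambda>U. c (the_elem U)"]) auto
    qed
    then obtain \<gamma> where \<gamma>: "range \<gamma> \<subseteq> R" "\<And>T. T \<subseteq> {..<n} \<Longrightarrow> card T = i - 1 \<Longrightarrow> \<beta> T - kosz p n \<gamma> T \<in> J" by metis
    define e :: 'a where "e = (- 1) ^ (i - 1)"
    have eR: "e \<in> R" by (simp add: e_def)
    define \<alpha> where "\<alpha> U = w U + (e * p n) * \<gamma> U" for U
    have "range \<alpha> \<subseteq> R" using wR \<gamma>(1) pR'[of n] eR by (auto simp: \<alpha>_def image_subset_iff)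
    moreover have "kosz p n \<alpha> T \<in> J" if T: "T \<subseteq> {..<n}" "Suc (card T) = i" for T
    proof -
      have ct: "card T = i - 1" using T by simp
      have "(kosz p n w T + (- 1) ^ card T * p n * \<beta> T) - (e * p n) * (\<beta> T - kosz p n \<gamma> T) \<in> J"
        using eR pR'[of n] by (intro idl_diff[OF J c2[OF T]] idl_mult[OF J _ \<gamma>(2)[OF T(1) ct]]) auto
      then show ?thesis unfolding \<alpha>_def kosz_add kosz_smult e_def ct by (simp add: algebra_simps)
    qed
    ultimately obtain \<delta> where \<delta>: "range \<delta> \<subseteq> R" "\<And>T. T \<subseteq> {..<n} \<Longrightarrow> card T = i \<Longrightarrow> \<alpha> T - kosz p n \<delta> T \<in> J"
      using kexactD[OF IH[OF Suc.prems(2)], of \<alpha>] by metis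
    define \<xi> where "\<xi> U = (if n \<in> U then \<gamma> (U - {n}) else \<delta> U)" for U
    have "range \<xi> \<subseteq> R" using \<gamma>(1) \<delta>(1) by (auto simp: \<xi>_def image_subset_iff)
    moreover have "w T - kosz p (Suc n) \<xi> T \<in> J" if T: "T \<subseteq> {..<Suc n}" "card T = i" for T
    proof (cases "n \<in> T")
      case True
      then obtain U where U: "T = insert n U" "n \<notin> U" by (metis Set.set_insert)
      then have Un: "U \<subseteq> {..<n}" using T by (auto simp: less_Suc_eq)
      have cU: "card U = i - 1" using T U fin[OF Un] by simp
      have "kosz p (Suc n) \<xi> T = kosz p n (\<lambda>V. \<xi> (insert n V)) U" unfolding U(1) by (rule kosz_Suc_insert[OF Un])
      also have "\<dots> = kosz p n \<gamma> U"
      proof (rule kosz_cong)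
        fix k assume "k < n" "k \<notin> U"
        then have "insert n (insert k U) - {n} = insert k U" using U by auto
        then show "\<xi> (insert n (insert k U)) = \<gamma> (insert k U)" by (simp add: \<xi>_def)
      qed
      finally show ?thesis using \<gamma>(2)[OF Un cU] U by (simp add: \<beta>_def)
    next
      case False
      then have Tn: "T \<subseteq> {..<n}" using T by (auto simp: less_Suc_eq)
      have "kosz p (Suc n) \<xi> T = kosz p n \<xi> T + (- 1) ^ i * p n * \<xi> (insert n T)" using kosz_Suc[OF Tn] T by simp
      also have "kosz p n \<xi> T = kosz p n \<delta> T"
        using False by (intro kosz_cong) (auto simp: \<xi>_def)
      also have "\<xi> (insert n T) = \<gamma> T" using False by (simp add: \<xi>_def)
      also have "(- 1) ^ i = - e" using Suc.prems(2) unfolding e_def by (cases i) auto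
      finally have "w T - kosz p (Suc n) \<xi> T = \<alpha> T - kosz p n \<delta> T" by (simp add: \<alpha>_def)
      then show ?thesis using \<delta>(2)[OF Tn T(2)] by simp
    qed
    ultimately show "\<exists>\<xi>. range \<xi> \<subseteq> R \<and> (\<forall>T\<subseteq>{..<Suc n}. card T = i \<longrightarrow> w T - kosz p (Suc n) \<xi> T \<in> J)" by blast
  qed
qed

text \<open>One step of the long exact homology sequence for multiplication by \<open>x\<close> on
  \<open>R/J\<close>. A cycle modulo the larger ideal has differential \<open>x * \<eta>\<close>
  modulo \<open>J\<close>; cancelling \<open>x\<close> makes \<open>\<eta>\<close> a cycle, hence a
  boundary, and subtracting \<open>x\<close> times its primitive turns the given element into a
  cycle modulo \<open>J\<close>.\<close>

lemma kexact_quotient: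
  assumes J: "idl J" and p: "\<And>k. k < n \<Longrightarrow> p k \<in> R" and x: "x \<in> R" "\<And>y. y \<in> R \<Longrightarrow> x * y \<in> J \<Longrightarrow> y \<in> J"
    and ex: "kexact p J n i" "kexact p J n (Suc i)"
  shows "kexact p (gen (insert x J)) n (Suc i)"
  unfolding kexact_def
proof (intro allI impI, elim conjE)
  let ?J = "gen (insert x J)"
  have J': "idl ?J" using idl_sub[OF J] x by (intro gen_idl) auto
  have JJ: "J \<subseteq> ?J" "x \<in> ?J" using gen_superset[of "insert x J"] by auto
  fix w assume wR: "range w \<subseteq> R" and "\<forall>T\<subseteq>{..<n}. Suc (card T) = Suc i \<longrightarrow> kosz p n w T \<in> ?J"
  then have "\<exists>r\<in>R. kosz p n w T - r * x \<in> J" if "T \<subseteq> {..<n}" "card T = i" for T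
    using that gen_insert_idl_iff[OF J x(1)] by auto
  then obtain \<eta>0 where \<eta>0: "\<And>T. T \<subseteq> {..<n} \<Longrightarrow> card T = i \<Longrightarrow> \<eta>0 T \<in> R \<and> kosz p n w T - \<eta>0 T * x \<in> J" by metis
  define \<eta> where "\<eta> T = (if T \<subseteq> {..<n} \<and> card T = i then \<eta>0 T else 0)" for T
  have \<eta>R: "range \<eta> \<subseteq> R" using \<eta>0 by (auto simp: \<eta>_def)
  have \<eta>: "kosz p n w T - x * \<eta> T \<in> J" if "T \<subseteq> {..<n}" "card T = i" for T
    using \<eta>0[OF that] that by (simp add: \<eta>_def mult.commute)
  have "kosz p n \<eta> T \<in> J" if T: "T \<subseteq> {..<n}" "Suc (card T) = i" for T
  proof -
    have fT: "finite T" using T finite_subset by blast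
    have "kosz p n (\<lambda>U. kosz p n w U - x * \<eta> U) T \<in> J"
      using T fT by (intro kosz_mem[OF J p] \<eta>) auto
    then have "- (x * kosz p n \<eta> T) \<in> J" unfolding kosz_diff kosz_smult kosz_kosz[OF T(1)] by simp
    then have "x * kosz p n \<eta> T \<in> J" using idl_uminus[OF J] by fastforce
    moreover have "kosz p n \<eta> T \<in> R" by (rule kosz_closed[OF p \<eta>R])
    ultimately show ?thesis using x(2) by simp
  qed
  then obtain \<xi> where \<xi>: "range \<xi> \<subseteq> R" "\<And>T. T \<subseteq> {..<n} \<Longrightarrow> card T = i \<Longrightarrow> \<eta> T - kosz p n \<xi> T \<in> J"
    using kexactD[OF ex(1) \<eta>R] by metis
  define w' where "w' T = w T - x * \<xi> T" for T
  have w'R: "range w' \<subseteq> R" using wR \<xi>(1) x(1) by (auto simp: w'_def image_subset_iff)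
  have "kosz p n w' T \<in> J" if T: "T \<subseteq> {..<n}" "Suc (card T) = Suc i" for T
  proof -
    have ct: "card T = i" using T by simp
    have "(kosz p n w T - x * \<eta> T) + x * (\<eta> T - kosz p n \<xi> T) \<in> J"
      by (intro idl_add[OF J \<eta>[OF T(1) ct]] idl_mult[OF J x(1) \<xi>(2)[OF T(1) ct]])
    then show ?thesis unfolding w'_def kosz_diff kosz_smult by (simp add: algebra_simps)
  qed
  then obtain \<zeta> where \<zeta>: "range \<zeta> \<subseteq> R" "\<And>T. T \<subseteq> {..<n} \<Longrightarrow> card T = Suc i \<Longrightarrow> w' T - kosz p n \<zeta> T \<in> J"
    using kexactD[OF ex(2) w'R] by metis
  have "w T - kosz p n \<zeta> T \<in> ?J" if T: "T \<subseteq> {..<n}" "card T = Suc i" for T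
  proof -
    have "(w' T - kosz p n \<zeta> T) + \<xi> T * x \<in> ?J"
      using \<zeta>(2)[OF T] JJ \<xi>(1) by (intro idl_add[OF J'] idl_mult[OF J' _ JJ(2)]) auto
    then show ?thesis by (simp add: w'_def algebra_simps)
  qed
  then show "\<exists>\<xi>. range \<xi> \<subseteq> R \<and> (\<forall>T\<subseteq>{..<n}. card T = Suc i \<longrightarrow> w T - kosz p n \<xi> T \<in> ?J)"
    using \<zeta> by blast
qed

lemma kexact_regs:
  assumes p: "\<And>k. k < n \<Longrightarrow> p k \<in> R"
  shows "idl J \<Longrightarrow> regs J xs \<Longrightarrow> (\<And>i. i > j \<Longrightarrow> kexact p J n i) \<Longrightarrow> i > j + length xs \<Longrightarrow>
    kexact p (gen (J \<union> set xs)) n i"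
proof (induction xs arbitrary: J j)
  case Nil
  then show ?case by (simp add: gen_of_idl)
next
  case (Cons x xs)
  let ?J = "gen (insert x J)"
  have x: "x \<in> R" "\<And>y. y \<in> R \<Longrightarrow> x * y \<in> J \<Longrightarrow> y \<in> J" and xs: "regs ?J xs" using Cons.prems by auto
  have i: "idl ?J" using Cons.prems x idl_sub[of J] by (intro gen_idl) auto
  have "kexact p ?J n i" if i: "i > Suc j" for i
  proof -
    obtain i' where i': "i = Suc i'" "i' > j" using i by (cases i) auto
    show ?thesis unfolding i'(1)
      by (rule kexact_quotient[OF Cons.prems(1) p x Cons.prems(3)[OF i'(2)] Cons.prems(3)]) (use i' in auto)
  qed
  then have "kexact p (gen (?J \<union> set xs)) n i" using Cons.prems(4) by (intro Cons.IH[OF i xs]) auto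
  then show ?case using gen_Un_insert[of J x "set xs"] idl_sub[OF Cons.prems(1)] x regs_sub[OF xs] by simp
qed

text \<open>A chain of top degree has a single coordinate and there is nothing above it, so
  exactness there means that only 0 in \<open>R/J\<close> is killed by all
  \<open>p k\<close>.\<close>

lemma kexact_top:
  assumes "idl J" "kexact p J n n" "\<And>k. k < n \<Longrightarrow> p k \<in> R" "a \<in> R" "\<And>k. k < n \<Longrightarrow> p k * a \<in> J"
  shows "a \<in> J"
proof -
  define w where "w T = (if T = {..<n} then a else 0)" for T :: "nat set"
  have wR: "range w \<subseteq> R" using assms by (auto simp: w_def)
  have "kosz p n w T \<in> J" for T
    unfolding kosz_def
  proof (rule idl_sum[OF assms(1)])
    fix k assume k: "k \<in> {..<n} - T"
    have "p k * w (insert k T) \<in> J" using assms k idl_zero[OF assms(1)] by (auto simp: w_def)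
    then show "ksign k T * p k * w (insert k T) \<in> J"
      using idl_mult[OF assms(1) ksign_closed] by (simp add: mult.assoc)
  qed
  then obtain \<xi> where "\<And>T. T \<subseteq> {..<n} \<Longrightarrow> card T = n \<Longrightarrow> w T - kosz p n \<xi> T \<in> J"
    using kexactD[OF assms(2) wR] by metis
  from this[of "{..<n}"] show ?thesis by (simp add: w_def kosz_def)
qed

text \<open>Depth sensitivity. Dividing by \<open>fs\<close> moves the range of vanishing Koszul
  homology up by \<open>length fs\<close>, which leaves the top degree inside the range as long as
  \<open>fs\<close> is shorter than \<open>ps\<close>. If \<open>N\<close> consisted of zero
  divisors modulo \<open>fs\<close>, a single element outside the ideal would be killed by all of
  \<open>ps\<close>, against exactness at the top.\<close>

theorem regs_extend:
  assumes noeth "idl N" "regs {0} ps" "set ps \<subseteq> N"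
  shows "regs {0} fs \<Longrightarrow> set fs \<subseteq> N \<Longrightarrow> length fs + d = length ps \<Longrightarrow>
    \<exists>gs. set gs \<subseteq> N \<and> length gs = d \<and> regs (gen (set fs)) gs"
proof (induction d arbitrary: fs)
  case 0
  then show ?case by (intro exI[of _ "[]"]) auto
next
  case (Suc d)
  let ?n = "length ps"
  let ?p = "\<lambda>k. ps ! k"
  have g0: "gen ({0} \<union> X) = gen X" if "X \<subseteq> R" for X
    using gen_least[OF gen_idl[OF that], of "{0} \<union> X"] gen_mono[of X "{0} \<union> X"] gen_superset[of X] gen_0[of X] by auto
  have NR: "N \<subseteq> R" using assms idl_sub by auto
  have fR: "set fs \<subseteq> R" using Suc.prems NR by auto
  let ?J = "gen (set fs)"
  have J: "idl ?J" by (rule gen_idl[OF fR])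
  have pR: "?p k \<in> R" if "k < ?n" for k using assms that NR nth_mem by blast
  have "map ?p [0..<?n] = ps" by (rule map_nth)
  then have "kexact ?p {0} ?n i" if "i > 0" for i
    using koszul_exact[OF idl_zero_set, of ?p ?n i] assms(3) that by simp
  then have "kexact ?p (gen ({0} \<union> set fs)) ?n ?n"
    using Suc.prems by (intro kexact_regs[OF pR idl_zero_set, where j = 0]) auto
  then have ex: "kexact ?p ?J ?n ?n" using g0[OF fR] by simp
  have "\<exists>x\<in>N. \<forall>y\<in>R. x * y \<in> ?J \<longrightarrow> y \<in> ?J"
  proof (rule ccontr)
    assume "\<not> ?thesis"
    then have "\<exists>y\<in>R. y \<notin> ?J \<and> x * y \<in> ?J" if "x \<in> N" for x using that by auto
    then obtain r where r: "r \<in> R" "r \<notin> ?J" "\<forall>x\<in>N. x * r \<in> ?J"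
      using zero_divisors_common[OF assms(1) J assms(2)] by auto
    have "?p k * r \<in> ?J" if "k < ?n" for k using r(3) assms(4) that nth_mem by blast
    then have "r \<in> ?J" by (intro kexact_top[OF J ex pR r(1)])
    then show False using r by simp
  qed
  then obtain x where x: "x \<in> N" "\<And>y. y \<in> R \<Longrightarrow> x * y \<in> ?J \<Longrightarrow> y \<in> ?J" by auto
  have xR: "x \<in> R" using x NR by auto
  have "regs {0} (fs @ [x])"
    using regs_append[OF idl_zero_set fR, of "[x]"] g0[OF fR] Suc.prems x xR by auto
  from Suc.IH[OF this] obtain gs where gs: "set gs \<subseteq> N" "length gs = d" "regs (gen (set (fs @ [x]))) gs"
    using x Suc.prems by auto
  have "gen (insert x ?J) = gen (set (fs @ [x]))"
    using gen_gen_un[OF fR, of "{x}"] xR by simp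
  then have "regs ?J (x # gs)" using gs x xR by simp
  then show ?case using gs x by (intro exI[of _ "x # gs"]) auto
qed

end

section \<open>Adjoining one element\<close>

context subring_set begin

text \<open>Polynomials over the subring \<open>R\<close> are polynomials over the ambient type with
  coefficients in \<open>R\<close>. For an ideal \<open>J\<close> the definition gives its extension
  to the polynomial ring.\<close>

definition cpoly :: "'a set \<Rightarrow> 'a poly set" where
  "cpoly J = {q. \<forall>i. coeff q i \<in> J}"

lemma cpoly_diff: "idl J \<Longrightarrow> p \<in> cpoly J \<Longrightarrow> q \<in> cpoly J \<Longrightarrow> p - q \<in> cpoly J"
  by (auto simp: cpoly_def idl_diff)

lemma cpoly_add: "idl J \<Longrightarrow> p \<in> cpoly J \<Longrightarrow> q \<in> cpoly J \<Longrightarrow> p + q \<in> cpoly J"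
  by (auto simp: cpoly_def idl_add)

lemma cpoly_mult: "idl J \<Longrightarrow> p \<in> cpoly R \<Longrightarrow> q \<in> cpoly J \<Longrightarrow> p * q \<in> cpoly J"
  by (auto simp: cpoly_def coeff_mult intro!: idl_sum idl_mult)

lemma cpoly_smult: "idl J \<Longrightarrow> c \<in> R \<Longrightarrow> q \<in> cpoly J \<Longrightarrow> smult c q \<in> cpoly J"
  by (auto simp: cpoly_def intro!: idl_mult)

lemma cpoly_monom: "idl J \<Longrightarrow> c \<in> J \<Longrightarrow> monom c n \<in> cpoly J"
  by (auto simp: cpoly_def idl_zero)

lemma cpoly_zero: "idl J \<Longrightarrow> 0 \<in> cpoly J"
  by (auto simp: cpoly_def idl_zero)

lemma cpoly_sub: "idl J \<Longrightarrow> cpoly J \<subseteq> cpoly R"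
  using idl_sub by (auto simp: cpoly_def)

lemma cpoly_carrier:
  "p \<in> cpoly R \<Longrightarrow> q \<in> cpoly R \<Longrightarrow> p - q \<in> cpoly R"
  "p \<in> cpoly R \<Longrightarrow> q \<in> cpoly R \<Longrightarrow> p + q \<in> cpoly R"
  "p \<in> cpoly R \<Longrightarrow> q \<in> cpoly R \<Longrightarrow> p * q \<in> cpoly R"
  "c \<in> R \<Longrightarrow> q \<in> cpoly R \<Longrightarrow> smult c q \<in> cpoly R"
  "c \<in> R \<Longrightarrow> monom c n \<in> cpoly R" "c \<in> R \<Longrightarrow> [:c:] \<in> cpoly R" "1 \<in> cpoly R" "0 \<in> cpoly R"
  using cpoly_diff[OF idl_carrier] cpoly_add[OF idl_carrier] cpoly_mult[OF idl_carrier]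
    cpoly_smult[OF idl_carrier] cpoly_monom[OF idl_carrier, of c] cpoly_zero[OF idl_carrier]
    cpoly_monom[OF idl_carrier, of c 0] cpoly_monom[OF idl_carrier, of 1 0]
  by (auto simp: monom_0 one_pCons)

text \<open>Multiplicativity of leading coefficients over the domain \<open>R/q\<close>:
  \<open>i\<close> and \<open>j\<close> are the degrees modulo \<open>q\<close>, and in the
  convolution every other summand has a factor in \<open>q\<close>.\<close>

lemma top_coeff_mult:
  assumes q: "prime_idl q" and uv: "u \<in> cpoly R" "v \<in> cpoly R"
    and i: "coeff u i \<notin> q" "\<And>k. k > i \<Longrightarrow> coeff u k \<in> q"
    and j: "coeff v j \<notin> q" "\<And>k. k > j \<Longrightarrow> coeff v k \<in> q"
  shows "coeff (u * v) (i + j) \<notin> q"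
proof -
  have id: "idl q" using q prime_idl_idl by simp
  have "coeff (u * v) (i + j) = (\<Sum>k\<le>i + j. coeff u k * coeff v (i + j - k))" by (simp add: coeff_mult)
  also have "\<dots> = coeff u i * coeff v (i + j - i) + (\<Sum>k\<in>{..i + j} - {i}. coeff u k * coeff v (i + j - k))"
    by (rule sum.remove) auto
  finally have eq: "coeff (u * v) (i + j) = coeff u i * coeff v j + (\<Sum>k\<in>{..i + j} - {i}. coeff u k * coeff v (i + j - k))"
    by simp
  have "(\<Sum>k\<in>{..i + j} - {i}. coeff u k * coeff v (i + j - k)) \<in> q"
  proof (rule idl_sum[OF id])
    fix k assume k: "k \<in> {..i + j} - {i}"
    have R: "coeff u k \<in> R" "coeff v (i + j - k) \<in> R" using uv by (auto simp: cpoly_def)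
    show "coeff u k * coeff v (i + j - k) \<in> q"
    proof (cases "k > i")
      case True
      then show ?thesis using i R by (intro idl_mult2[OF id]) auto
    next
      case False
      then have "i + j - k > j" using k by auto
      then show ?thesis using j R by (intro idl_mult[OF id]) auto
    qed
  qed
  moreover have "coeff u i * coeff v j \<notin> q"
    using prime_idl_mult[OF q, of "coeff u i" "coeff v j"] i j uv by (auto simp: cpoly_def)
  ultimately show ?thesis unfolding eq
    using idl_diff[OF id, of "coeff u i * coeff v j + (\<Sum>k\<in>{..i + j} - {i}. coeff u k * coeff v (i + j - k))"] by fastforce
qed

lemma top_coeff_exists:
  assumes "idl q" "u \<notin> cpoly q"
  shows "\<exists>i. coeff u i \<notin> q \<and> (\<forall>k>i. coeff u k \<in> q)"
proof -
  let ?S = "{i. coeff u i \<notin> q}"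
  have "?S \<subseteq> {..degree u}" using idl_zero[OF assms(1)] coeff_eq_0[of u]
    by (metis (mono_tags, lifting) atMost_iff linorder_not_less mem_Collect_eq subsetI)
  then have f: "finite ?S" using finite_subset by blast
  moreover have ne: "?S \<noteq> {}" using assms by (auto simp: cpoly_def)
  ultimately have "Max ?S \<in> ?S" by (rule Max_in)
  then show ?thesis using Max_ge[OF f] by (intro exI[of _ "Max ?S"]) fastforce
qed

text \<open>The leading coefficient need not be invertible, so each step multiplies the dividend by
  it once more. The bound for the degree of the quotient is recorded because
  \<open>jacobson_adjoin\<close> compares quotients with a minimal polynomial.\<close>

lemma pseudo_division:
  assumes f: "f \<in> cpoly R" "degree f > 0" and a: "a = lead_coeff f"
  shows "h \<in> cpoly R \<Longrightarrow> \<exists>k w r. w \<in> cpoly R \<and> r \<in> cpoly R \<and> smult (a ^ k) h = w * f + r \<and>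
    degree r < degree f \<and> (w = 0 \<or> degree w \<le> degree h - degree f)"
proof (induction "degree h" arbitrary: h rule: less_induct)
  case less
  show ?case
  proof (cases "degree h < degree f")
    case True
    then show ?thesis using less.prems
      by (intro exI[of _ 0] exI[of _ 0] exI[of _ h]) (auto simp: cpoly_carrier)
  next
    case False
    have aR: "a \<in> R" using f a by (auto simp: cpoly_def)
    define m where "m = monom (lead_coeff h) (degree h - degree f)"
    have mR: "m \<in> cpoly R" unfolding m_def using less.prems by (intro cpoly_carrier) (auto simp: cpoly_def)
    define h' where "h' = smult a h - m * f"
    have h'R: "h' \<in> cpoly R" unfolding h'_def using less.prems f aR mR by (intro cpoly_carrier) auto
    have deg: "degree h' < degree h"
    proof -
      have "degree h' \<le> degree h" unfolding h'_def
        using False degree_mult_le[of m f] degree_monom_le[of "lead_coeff h" "degree h - degree f"]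
          degree_smult_le[of a h]
        by (intro degree_diff_le) (auto simp: m_def)
      moreover have "coeff h' (degree h) = 0"
      proof -
        have "coeff (m * f) (degree h) = lead_coeff h * lead_coeff f"
          using False unfolding m_def by (simp add: coeff_monom_mult)
        then show ?thesis by (simp add: h'_def a mult.commute)
      qed
      moreover have "degree h > 0" using False f by auto
      ultimately show ?thesis
        by (metis leading_coeff_0_iff degree_0 le_neq_implies_less)
    qed
    from less.hyps[OF deg h'R] obtain k w r where *: "w \<in> cpoly R" "r \<in> cpoly R"
      "smult (a ^ k) h' = w * f + r" "degree r < degree f" "w = 0 \<or> degree w \<le> degree h' - degree f" by auto
    show ?thesis
    proof (intro exI conjI)
      show "smult (a ^ k) m + w \<in> cpoly R" using * mR aR by (intro cpoly_carrier) auto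
      show "smult (a ^ Suc k) h = (smult (a ^ k) m + w) * f + r"
        using *(3) unfolding h'_def by (simp add: smult_diff_right algebra_simps)
      have "degree (smult (a ^ k) m) \<le> degree h - degree f"
        using degree_smult_le[of "a ^ k" m] degree_monom_le[of "lead_coeff h" "degree h - degree f"]
        unfolding m_def by linarith
      moreover have "degree w \<le> degree h - degree f" using *(5) deg by auto
      ultimately show "smult (a ^ k) m + w = 0 \<or> degree (smult (a ^ k) m + w) \<le> degree h - degree f"
        by (auto intro: degree_add_le)
    qed (use * in auto)
  qed
qed

text \<open>Elementwise form of the statement that each prime ideal is an intersection of maximal
  ideals.\<close>

definition jacobson :: bool where
  "jacobson \<longleftrightarrow> (\<forall>q c. prime_idl q \<and> c \<in> R \<and> c \<notin> q \<longrightarrow> (\<exists>m. max_idl m \<and> q \<subseteq> m \<and> c \<notin> m))"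

end

text \<open>Elements of the enlarged ring are values at \<open>t\<close> of polynomials over
  \<open>A\<close>, in general in several ways. Arguments by degree are therefore carried out for
  polynomials and then evaluated at \<open>t\<close>.\<close>

locale subring_adjoin = A: subring_set A for A :: "'a::comm_ring_1 set" + fixes t :: 'a
begin

definition B :: "'a set" where "B = (\<lambda>q. poly q t) ` A.cpoly A"

lemma B_I: "q \<in> A.cpoly A \<Longrightarrow> poly q t \<in> B"
  by (auto simp: B_def)

lemma A_sub_B: "a \<in> A \<Longrightarrow> a \<in> B"
  using B_I[of "[:a:]"] A.cpoly_carrier by auto

sublocale B: subring_set B
proof
  show "1 \<in> B" using B_I[of 1] A.cpoly_carrier by auto
  show "a - b \<in> B" "a * b \<in> B" if ab: "a \<in> B" "b \<in> B" for a b
  proof -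
    obtain p q where "a = poly p t" "b = poly q t" "p \<in> A.cpoly A" "q \<in> A.cpoly A"
      using ab unfolding B_def by auto
    then show "a - b \<in> B" "a * b \<in> B"
      using B_I[of "p - q"] B_I[of "p * q"] A.cpoly_carrier by auto
  qed
qed

lemma t_in_B: "t \<in> B"
  using B_I[of "monom 1 1"] A.cpoly_carrier by (auto simp: poly_monom)

lemma poly_idl: "B.idl J \<Longrightarrow> (\<And>i. coeff q i \<in> J) \<Longrightarrow> poly q t \<in> J"
  unfolding poly_altdef using t_in_B by (intro B.idl_sum B.idl_mult2) auto

text \<open>Hilbert's argument by leading coefficients, applied to polynomials that represent
  elements of \<open>J\<close>: each \<open>g k\<close> has least degree among those whose value is
  not yet generated. Finitely many leading coefficients generate all of them, so some
  \<open>g m\<close> can be lowered in degree by earlier ones, against its minimality.\<close>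

theorem hilbert_basis: assumes A.noeth shows B.noeth
  unfolding B.noeth_def
proof (intro allI impI, rule ccontr)
  fix J assume J: "B.idl J" and nfg: "\<not> (\<exists>X. finite X \<and> X \<subseteq> B \<and> J = B.gen X)"
  define ok where "ok S q \<longleftrightarrow> q \<in> A.cpoly A \<and> poly q t \<in> J \<and> poly q t \<notin> B.gen S" for S q
  have "\<exists>q. ok S q \<and> (\<forall>q'. ok S q' \<longrightarrow> degree q \<le> degree q')" if S: "finite S" "S \<subseteq> J" for S
  proof -
    have "B.gen S \<subseteq> J" by (rule B.gen_least[OF J S(2)])
    moreover have "S \<subseteq> B" using S J B.idl_sub by auto
    moreover from this have "J \<noteq> B.gen S" using nfg S by auto
    ultimately obtain y where "y \<in> J" "y \<notin> B.gen S" by auto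
    moreover from this have "y \<in> B" using J B.idl_mem by auto
    ultimately obtain q where "ok S q" by (auto simp: ok_def B_def)
    then show ?thesis using ex_has_least_nat[of "ok S" q degree] by auto
  qed
  then obtain h where h: "\<And>S. finite S \<Longrightarrow> S \<subseteq> J \<Longrightarrow> ok S (h S) \<and> (\<forall>q'. ok S q' \<longrightarrow> degree (h S) \<le> degree q')" by metis
  define F where "F = rec_nat {} (\<lambda>_ S. insert (poly (h S) t) S)"
  have F0: "F 0 = {}" and FS: "F (Suc k) = insert (poly (h (F k)) t) (F k)" for k by (simp_all add: F_def)
  define g where "g k = h (F k)" for k
  have Fok: "finite (F k) \<and> F k \<subseteq> J" for k
    by (induction k) (use F0 FS h in \<open>auto simp: ok_def\<close>)
  have gok: "ok (F k) (g k)" "ok (F k) q' \<Longrightarrow> degree (g k) \<le> degree q'" for k q'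
    using h[of "F k"] Fok[of k] by (auto simp: g_def)
  have Fmono: "F k \<subseteq> F l" if "k \<le> l" for k l
    using that by (induction rule: dec_induct) (auto simp: FS)
  have degmono: "degree (g k) \<le> degree (g l)" if "k \<le> l" for k l
  proof -
    have "ok (F k) (g l)" using gok(1)[of l] B.gen_mono[OF Fmono[OF that]] by (auto simp: ok_def)
    then show ?thesis by (rule gok(2))
  qed
  have gF: "poly (g i) t \<in> F m" if "i < m" for i m
    using Fmono[of "Suc i" m] FS[of i] that by (auto simp: g_def)
  define a where "a k = lead_coeff (g k)" for k
  have gR: "g k \<in> A.cpoly A" for k using gok(1)[of k] by (auto simp: ok_def)
  have aA: "range a \<subseteq> A" using gR by (auto simp: a_def A.cpoly_def)
  obtain Y where Y: "Y \<subseteq> range a" "finite Y" "A.gen (range a) = A.gen Y"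
    using A.noeth_gen_finite[OF assms aA] by auto
  obtain I where I: "finite I" "Y = a ` I" using finite_subset_image[OF Y(2,1)] by auto
  obtain m where m: "I \<subseteq> {..<m}" using finite_nat_iff_bounded I by auto
  have "a m \<in> A.gen Y" using Y(3) A.gen_inc[of "a m" "range a"] by auto
  then have am: "a m \<in> A.gen (a ` {..<m})" using A.gen_mono[of Y "a ` {..<m}"] I m by auto
  let ?d = "degree (g m)"
  have FB: "B.idl (B.gen (F m))" using Fok[of m] B.idl_sub[OF J] by (intro B.gen_idl) auto
  have "\<exists>q\<in>A.cpoly A. poly q t \<in> B.gen (F m) \<and> degree q \<le> ?d \<and> coeff q ?d = c"
    if "c \<in> A.gen (a ` {..<m})" for c
    using that
  proof induction
    case gen_0
    then show ?case using A.cpoly_carrier B.idl_zero[OF FB] by (intro bexI[of _ 0]) auto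
  next
    case (gen_step r x c)
    then obtain q i where q: "q \<in> A.cpoly A" "poly q t \<in> B.gen (F m)" "degree q \<le> ?d" "coeff q ?d = c"
      and i: "x = a i" "i < m" by auto
    let ?u = "smult r (monom 1 (?d - degree (g i)) * g i)"
    have dd: "degree (g i) \<le> ?d" using degmono[of i m] i by auto
    have "monom 1 (?d - degree (g i)) * g i \<in> A.cpoly A" by (intro A.cpoly_carrier(3,5) gR A.one_closed)
    then have "?u \<in> A.cpoly A" by (rule A.cpoly_carrier(4)[OF gen_step(1)])
    moreover have "poly ?u t \<in> B.gen (F m)"
    proof -
      have "r * t ^ (?d - degree (g i)) \<in> B" using gen_step A_sub_B t_in_B by auto
      then have "(r * t ^ (?d - degree (g i))) * poly (g i) t \<in> B.gen (F m)"
        using gF[OF i(2)] by (intro B.idl_mult[OF FB] B.gen_inc)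
      then show ?thesis by (simp add: poly_monom mult.assoc)
    qed
    moreover have "degree ?u \<le> ?d"
      using degree_smult_le[of r "monom 1 (?d - degree (g i)) * g i"]
        degree_mult_le[of "monom 1 (?d - degree (g i))" "g i"] degree_monom_le[of "1::'a" "?d - degree (g i)"] dd
      by linarith
    moreover have "coeff ?u ?d = r * x"
    proof -
      have "coeff (monom 1 (?d - degree (g i)) * g i) ?d = 1 * coeff (g i) (degree (g i))"
        using dd by (subst coeff_monom_mult) simp
      then show ?thesis by (simp add: i a_def)
    qed
    ultimately show ?case using q
      by (intro bexI[of _ "?u + q"]) (auto intro: B.idl_add[OF FB] degree_add_le A.cpoly_carrier)
  qed
  from this[OF am] obtain q where q: "q \<in> A.cpoly A" "poly q t \<in> B.gen (F m)" "degree q \<le> ?d" "coeff q ?d = a m" by auto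
  let ?e = "g m - q"
  have "poly ?e t \<notin> B.gen (F m)"
  proof
    assume "poly ?e t \<in> B.gen (F m)"
    then have "poly ?e t + poly q t \<in> B.gen (F m)" using q by (intro B.idl_add[OF FB])
    then show False using gok(1)[of m] by (simp add: ok_def)
  qed
  moreover have "poly q t \<in> J" using q(2) B.gen_least[OF J] Fok[of m] by auto
  ultimately have "ok (F m) ?e" using gok(1)[of m] q A.cpoly_carrier B.idl_diff[OF J] by (auto simp: ok_def)
  then have "?d \<le> degree ?e" by (rule gok(2))
  moreover have "degree ?e \<le> ?d" using q by (intro degree_diff_le) auto
  ultimately have "degree ?e = ?d" by simp
  moreover have "coeff ?e ?d = 0" using q by (simp add: a_def)
  ultimately have "?e = 0" by (metis leading_coeff_0_iff)
  then show False using \<open>poly ?e t \<notin> B.gen (F m)\<close> B.idl_zero[OF FB] by simp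
qed

lemma contraction_prime: assumes "B.prime_idl P" shows "A.prime_idl (P \<inter> A)"
proof -
  have P: "B.idl P" "1 \<notin> P" using assms by (auto simp: B.prime_idl_def)
  have "A.idl (P \<inter> A)"
    by (rule A.idlI) (use P B.idl_zero B.idl_add B.idl_mult A_sub_B in auto)
  then show ?thesis unfolding A.prime_idl_def
    using P B.prime_idl_mult[OF assms] A_sub_B by auto
qed

text \<open>Modulo \<open>P\<close> the extension of \<open>m\<close> is represented by polynomials
  with coefficients in \<open>m\<close>; in this form, statements about ideals of \<open>B\<close>
  become statements about coefficients.\<close>

lemma gen_Un_contraction:
  assumes "B.idl P" "A.idl m" "y \<in> B.gen (P \<union> m)"
  shows "\<exists>\<mu>\<in>A.cpoly m. y - poly \<mu> t \<in> P"
  using assms(3)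
proof induction
  case gen_0
  then show ?case using A.cpoly_zero[OF assms(2)] B.idl_zero[OF assms(1)] by (intro bexI[of _ 0]) auto
next
  case (gen_step r x g)
  then obtain \<mu> where \<mu>: "\<mu> \<in> A.cpoly m" "g - poly \<mu> t \<in> P" by auto
  show ?case
  proof (cases "x \<in> P")
    case True
    have "r * x + (g - poly \<mu> t) \<in> P" by (intro B.idl_add[OF assms(1)] B.idl_mult[OF assms(1)] gen_step True \<mu>)
    then show ?thesis using \<mu> by (intro bexI[of _ \<mu>]) (auto simp: algebra_simps)
  next
    case False
    then have x: "x \<in> m" using gen_step by auto
    obtain q where q: "r = poly q t" "q \<in> A.cpoly A" using gen_step by (auto simp: B_def)
    have "[:x:] \<in> A.cpoly m" using A.cpoly_monom[OF assms(2) x, of 0] by (simp add: monom_0)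
    then have "q * [:x:] + \<mu> \<in> A.cpoly m" using q \<mu> by (intro A.cpoly_add A.cpoly_mult assms(2))
    then show ?thesis using q \<mu> by (intro bexI[of _ "q * [:x:] + \<mu>"]) (auto simp: algebra_simps)
  qed
qed

text \<open>If \<open>P\<close> is not extended from \<open>A\<close>, a polynomial of least degree witnessing this behaves like a
  minimal polynomial of \<open>t\<close> modulo \<open>P\<close>.\<close>

definition min_poly_mod :: "'a set \<Rightarrow> 'a poly \<Rightarrow> bool" where
  "min_poly_mod P f \<longleftrightarrow> f \<in> A.cpoly A \<and> poly f t \<in> P \<and> lead_coeff f \<notin> P \<and> degree f > 0 \<and>
     (\<forall>g\<in>A.cpoly A. poly g t \<in> P \<and> degree g < degree f \<longrightarrow> g \<in> A.cpoly (P \<inter> A))"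

lemma min_poly_mod_exists:
  assumes "B.prime_idl P" "f0 \<in> A.cpoly A" "poly f0 t \<in> P" "f0 \<notin> A.cpoly (P \<inter> A)"
  shows "\<exists>f. min_poly_mod P f"
proof -
  let ?ok = "\<lambda>f. f \<in> A.cpoly A \<and> poly f t \<in> P \<and> f \<notin> A.cpoly (P \<inter> A)"
  obtain f where f: "?ok f" and mn: "\<And>g. ?ok g \<Longrightarrow> degree f \<le> degree g"
    using ex_has_least_nat[of ?ok f0 degree] assms by auto
  have P: "B.idl P" using assms B.prime_idl_idl by auto
  have pA: "A.idl (P \<inter> A)" using contraction_prime[OF assms(1)] A.prime_idl_idl by auto
  have lA: "lead_coeff f \<in> A" using f by (auto simp: A.cpoly_def)
  \<comment> \<open>Otherwise the leading term could be removed, and the rest would be a witness of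
    smaller degree.\<close>
  have lc: "lead_coeff f \<notin> P"
  proof
    assume l: "lead_coeff f \<in> P"
    let ?m = "monom (lead_coeff f) (degree f)"
    have m: "?m \<in> A.cpoly (P \<inter> A)" using l lA by (intro A.cpoly_monom[OF pA]) auto
    then have mA: "?m \<in> A.cpoly A" using A.cpoly_sub[OF pA] by auto
    have "poly ?m t \<in> P" using m by (intro poly_idl[OF P]) (auto simp: A.cpoly_def)
    then have "?ok (f - ?m)"
      using f mA A.cpoly_carrier(1)[of f ?m] B.idl_diff[OF P] A.cpoly_add[OF pA _ m, of "f - ?m"] by auto
    then have "degree f \<le> degree (f - ?m)" by (rule mn)
    moreover have "degree (f - ?m) \<le> degree f" using degree_monom_le[of "lead_coeff f"] by (intro degree_diff_le) auto
    ultimately have "degree (f - ?m) = degree f" by auto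
    moreover have "coeff (f - ?m) (degree f) = 0" by simp
    ultimately have "f - ?m = 0" by (metis leading_coeff_0_iff)
    then have "f = ?m" by (metis eq_iff_diff_eq_0)
    then show False using f m by metis
  qed
  have "degree f > 0"
  proof (rule ccontr)
    assume "\<not> ?thesis"
    then obtain c where "f = [:c:]" by (metis degree_eq_zeroE gr0I)
    then have "poly f t = lead_coeff f" by simp
    then show False using f lc by simp
  qed
  moreover have "g \<in> A.cpoly (P \<inter> A)" if "g \<in> A.cpoly A" "poly g t \<in> P" "degree g < degree f" for g
    using mn[of g] that by auto
  ultimately show ?thesis unfolding min_poly_mod_def using f lc by (intro exI[of _ f]) auto
qed

text \<open>Suppose 1 is congruent to \<open>poly \<mu> t\<close> modulo \<open>P\<close> with
  \<open>\<mu>\<close> over \<open>m\<close>, and divide \<open>1 - \<mu>\<close> by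
  \<open>f\<close>. By minimality the remainder has coefficients in \<open>P \<inter> A\<close>,
  hence in \<open>m\<close>. So modulo \<open>m\<close> a nonzero constant is a multiple of
  \<open>f\<close>, which is impossible because \<open>f\<close> keeps its positive degree
  there.\<close>

lemma lying_over:
  assumes P: "B.prime_idl P" and f: "min_poly_mod P f" and m: "A.prime_idl m" "P \<inter> A \<subseteq> m" "lead_coeff f \<notin> m"
  shows "1 \<notin> B.gen (P \<union> m)"
proof
  assume "1 \<in> B.gen (P \<union> m)"
  then obtain \<mu> where \<mu>: "\<mu> \<in> A.cpoly m" "1 - poly \<mu> t \<in> P"
    using gen_Un_contraction B.prime_idl_idl[OF P] A.prime_idl_idl[OF m(1)] by blast
  have mid: "A.idl m" using m A.prime_idl_idl by auto
  have Pid: "B.idl P" using P B.prime_idl_idl by auto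
  have fA: "f \<in> A.cpoly A" "degree f > 0" "poly f t \<in> P" using f by (auto simp: min_poly_mod_def)
  let ?a = "lead_coeff f"
  have aA: "?a \<in> A" using fA by (auto simp: A.cpoly_def)
  have h: "1 - \<mu> \<in> A.cpoly A" using \<mu> A.cpoly_sub[OF mid] by (intro A.cpoly_carrier) auto
  obtain k w r where *: "w \<in> A.cpoly A" "r \<in> A.cpoly A" "smult (?a ^ k) (1 - \<mu>) = w * f + r" "degree r < degree f"
    using A.pseudo_division[OF fA(1,2) refl h] by blast
  have "r = smult (?a ^ k) (1 - \<mu>) - w * f" using *(3) by simp
  then have "poly r t = ?a ^ k * (1 - poly \<mu> t) - poly w t * poly f t" by simp
  also have "\<dots> \<in> P"
    using A_sub_B[OF aA]
    by (intro B.idl_diff[OF Pid B.idl_mult[OF Pid _ \<mu>(2)] B.idl_mult[OF Pid B_I[OF *(1)] fA(3)]]) auto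
  finally have "r \<in> A.cpoly (P \<inter> A)" using f * by (auto simp: min_poly_mod_def)
  then have r: "r \<in> A.cpoly m" using m by (auto simp: A.cpoly_def)
  have am: "?a ^ k \<notin> m" using A.prime_idl_power[OF m(1) aA] m by auto
  have eq: "w * f = smult (?a ^ k) 1 - (smult (?a ^ k) \<mu> + r)" using *(3) by (simp add: smult_diff_right algebra_simps)
  have e: "smult (?a ^ k) \<mu> + r \<in> A.cpoly m" using r \<mu> aA by (intro A.cpoly_add A.cpoly_smult mid) auto
  have wm: "w \<notin> A.cpoly m"
  proof
    assume "w \<in> A.cpoly m"
    then have "f * w \<in> A.cpoly m" using fA by (intro A.cpoly_mult[OF mid])
    then have "smult (?a ^ k) 1 \<in> A.cpoly m" using A.cpoly_add[OF mid _ e, of "w * f"] eq by (simp add: mult.commute)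
    then have "coeff (smult (?a ^ k) 1) 0 \<in> m" unfolding A.cpoly_def by blast
    then show False using am by simp
  qed
  obtain i where i: "coeff w i \<notin> m" "\<forall>k>i. coeff w k \<in> m" using A.top_coeff_exists[OF mid wm] by auto
  have "coeff (w * f) (i + degree f) \<notin> m"
    by (rule A.top_coeff_mult[OF m(1) *(1) fA(1)]) (use i m A.idl_zero[OF mid] in \<open>auto simp: coeff_eq_0\<close>)
  moreover have "coeff (w * f) (i + degree f) = - coeff (smult (?a ^ k) \<mu> + r) (i + degree f)"
    unfolding eq using fA by (simp add: coeff_eq_0)
  moreover have "- coeff (smult (?a ^ k) \<mu> + r) (i + degree f) \<in> m"
    using e by (intro A.idl_uminus[OF mid]) (auto simp: A.cpoly_def)
  ultimately show False by simp
qed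

text \<open>First, \<open>t\<close> is algebraic modulo \<open>P\<close>: otherwise an inverse of
  \<open>t\<close> modulo \<open>P\<close> would give a polynomial with coefficients in
  \<open>P\<close> and constant term 1. By the Jacobson property a maximal \<open>m\<close> above
  the contraction avoids the leading coefficient of a minimal polynomial; its extension together
  with \<open>P\<close> is proper, so \<open>m\<close> lies in \<open>P\<close>.\<close>

lemma max_idl_contraction:
  assumes "A.jacobson" "B.max_idl P"
  shows "A.max_idl (P \<inter> A)"
proof -
  have P: "B.prime_idl P" by (rule B.max_idl_prime[OF assms(2)])
  have Pid: "B.idl P" using P B.prime_idl_idl by auto
  have p: "A.prime_idl (P \<inter> A)" by (rule contraction_prime[OF P])
  have "\<exists>f0\<in>A.cpoly A. poly f0 t \<in> P \<and> f0 \<notin> A.cpoly (P \<inter> A)"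
  proof (rule ccontr)
    assume "\<not> ?thesis"
    then have all: "f0 \<in> A.cpoly (P \<inter> A)" if "f0 \<in> A.cpoly A" "poly f0 t \<in> P" for f0 using that by auto
    have tP: "t \<notin> P"
    proof
      assume "t \<in> P"
      then have "monom 1 1 \<in> A.cpoly (P \<inter> A)" using A.cpoly_carrier by (intro all) (auto simp: poly_monom)
      then have "coeff (monom 1 1) 1 \<in> P" unfolding A.cpoly_def by blast
      then show False using B.prime_idl_one[OF P] by simp
    qed
    have "B.idl (B.gen (insert t P))" using B.idl_sub[OF Pid] t_in_B by (intro B.gen_idl) auto
    moreover have "P \<subseteq> B.gen (insert t P)" "t \<in> B.gen (insert t P)" using B.gen_superset[of "insert t P"] by auto
    ultimately have "1 \<in> B.gen (insert t P)" using assms(2) tP unfolding B.max_idl_def by metis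
    then obtain b where "b \<in> B" "1 - b * t \<in> P" using B.gen_insert_idl_iff[OF Pid t_in_B] by auto
    then obtain \<beta> where \<beta>: "\<beta> \<in> A.cpoly A" "1 - poly \<beta> t * t \<in> P" by (auto simp: B_def)
    have "1 - \<beta> * monom 1 1 \<in> A.cpoly (P \<inter> A)"
      using \<beta> A.cpoly_carrier by (intro all) (auto simp: poly_monom)
    then have "coeff (1 - \<beta> * monom 1 1) 0 \<in> P" unfolding A.cpoly_def by blast
    then show False using B.prime_idl_one[OF P] by (simp add: mult.commute[of \<beta>] coeff_monom_mult)
  qed
  then obtain f where f: "min_poly_mod P f" using min_poly_mod_exists[OF P] by auto
  have "lead_coeff f \<in> A" "lead_coeff f \<notin> P" using f by (auto simp: min_poly_mod_def A.cpoly_def)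
  then obtain m where m: "A.max_idl m" "P \<inter> A \<subseteq> m" "lead_coeff f \<notin> m"
    using assms(1) p unfolding A.jacobson_def by blast
  have "1 \<notin> B.gen (P \<union> m)" by (rule lying_over[OF P f A.max_idl_prime[OF m(1)] m(2,3)])
  moreover have "m \<subseteq> A" using m A.max_idl_def A.idl_sub by auto
  moreover have "B.idl (B.gen (P \<union> m))" using B.idl_sub[OF Pid] A_sub_B \<open>m \<subseteq> A\<close> by (intro B.gen_idl) auto
  ultimately have "B.gen (P \<union> m) = P" using assms(2) B.gen_superset[of "P \<union> m"] unfolding B.max_idl_def by blast
  then have "m \<subseteq> P \<inter> A" using B.gen_superset[of "P \<union> m"] \<open>m \<subseteq> A\<close> by auto
  then have "P \<inter> A = m" using m by auto
  then show ?thesis using m by simp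
qed

text \<open>If \<open>t\<close> is transcendental modulo \<open>P\<close>, a maximal ideal
  containing \<open>P\<close> and \<open>1 + t * c\<close> avoids \<open>c\<close>. If not, some
  \<open>b\<close> in \<open>A\<close> outside \<open>P\<close> is a multiple of \<open>c\<close>
  modulo \<open>P\<close>, and it suffices to lie over a maximal ideal of \<open>A\<close> that
  avoids \<open>b\<close> and the leading coefficient of a minimal polynomial.\<close>

lemma jacobson_adjoin:
  assumes "A.jacobson" "B.noeth"
  shows "B.jacobson"
  unfolding B.jacobson_def
proof (intro allI impI, elim conjE)
  fix P c assume P: "B.prime_idl P" and c: "c \<in> B" "c \<notin> P"
  have Pid: "B.idl P" using P B.prime_idl_idl by auto
  have p: "A.prime_idl (P \<inter> A)" by (rule contraction_prime[OF P])
  then have pid: "A.idl (P \<inter> A)" using A.prime_idl_idl by auto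
  obtain \<gamma> where \<gamma>: "\<gamma> \<in> A.cpoly A" "c = poly \<gamma> t" using c by (auto simp: B_def)
  show "\<exists>m. B.max_idl m \<and> P \<subseteq> m \<and> c \<notin> m"
  proof (cases "\<exists>f0\<in>A.cpoly A. poly f0 t \<in> P \<and> f0 \<notin> A.cpoly (P \<inter> A)")
    case False
    then have all: "f0 \<in> A.cpoly (P \<inter> A)" if "f0 \<in> A.cpoly A" "poly f0 t \<in> P" for f0 using that by auto
    define g where "g = 1 + monom 1 1 * \<gamma>"
    have mA: "monom 1 1 * \<gamma> \<in> A.cpoly A" by (intro A.cpoly_carrier(3,5) \<gamma> A.one_closed)
    have gA: "g \<in> A.cpoly A" unfolding g_def by (rule A.cpoly_carrier(2)[OF A.cpoly_carrier(7) mA])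
    have gt: "poly g t = 1 + t * c" by (simp add: g_def \<gamma> poly_monom)
    have "1 \<notin> B.gen (insert (poly g t) P)"
    proof
      assume "1 \<in> B.gen (insert (poly g t) P)"
      then obtain b where "b \<in> B" "1 - b * poly g t \<in> P" using B.gen_insert_idl_iff[OF Pid B_I[OF gA]] by auto
      then obtain \<beta> where \<beta>: "\<beta> \<in> A.cpoly A" "1 - poly \<beta> t * poly g t \<in> P" by (auto simp: B_def)
      have e: "1 - \<beta> * g \<in> A.cpoly (P \<inter> A)"
        using \<beta> gA A.cpoly_carrier by (intro all) auto
      have "\<gamma> \<notin> A.cpoly (P \<inter> A)" using c poly_idl[OF Pid, of \<gamma>] \<gamma> by (auto simp: A.cpoly_def)
      then obtain i where i: "coeff \<gamma> i \<notin> P \<inter> A" "\<forall>k>i. coeff \<gamma> k \<in> P \<inter> A" using A.top_coeff_exists[OF pid] by auto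
      have gc: "coeff g (Suc k) = coeff \<gamma> k" for k
        by (simp add: g_def coeff_monom_mult one_pCons)
      have gi: "coeff g (Suc i) \<notin> P \<inter> A" using i gc by metis
      have gk: "coeff g k \<in> P \<inter> A" if "k > Suc i" for k
        using that i gc[of "k - 1"] by auto
      have "\<beta> \<notin> A.cpoly (P \<inter> A)"
      proof
        assume "\<beta> \<in> A.cpoly (P \<inter> A)"
        then have "g * \<beta> \<in> A.cpoly (P \<inter> A)" using gA by (intro A.cpoly_mult[OF pid])
        then have "(1 - \<beta> * g) + g * \<beta> \<in> A.cpoly (P \<inter> A)" by (rule A.cpoly_add[OF pid e])
        then have "1 \<in> A.cpoly (P \<inter> A)" by (simp add: mult.commute)
        then have "coeff 1 0 \<in> P" unfolding A.cpoly_def by blast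
        then show False using B.prime_idl_one[OF P] by simp
      qed
      then obtain j where j: "coeff \<beta> j \<notin> P \<inter> A" "\<forall>k>j. coeff \<beta> k \<in> P \<inter> A" using A.top_coeff_exists[OF pid] by auto
      \<comment> \<open>The top coefficient sits in the positive degree \<open>j + Suc i\<close>, to
        which the polynomial 1 contributes nothing.\<close>
      have "coeff (\<beta> * g) (j + Suc i) \<notin> P \<inter> A"
        by (rule A.top_coeff_mult[OF p \<beta>(1) gA]) (use j gi gk in auto)
      moreover have "coeff (1 - \<beta> * g) (j + Suc i) \<in> P \<inter> A" using e unfolding A.cpoly_def by blast
      then have "- coeff (1 - \<beta> * g) (j + Suc i) \<in> P \<inter> A" by (rule A.idl_uminus[OF pid])
      moreover have "- coeff (1 - \<beta> * g) (j + Suc i) = coeff (\<beta> * g) (j + Suc i)" by (simp add: one_pCons)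
      ultimately show False by simp
    qed
    moreover have "B.idl (B.gen (insert (poly g t) P))" using B.idl_sub[OF Pid] B_I[OF gA] by (intro B.gen_idl) auto
    ultimately obtain M where M: "B.max_idl M" "B.gen (insert (poly g t) P) \<subseteq> M"
      using B.noeth_max_idl[OF assms(2)] by metis
    have Mid: "B.idl M" "1 \<notin> M" using M by (auto simp: B.max_idl_def)
    have PM: "P \<subseteq> M" "poly g t \<in> M" using M(2) B.gen_superset[of "insert (poly g t) P"] by auto
    have "c \<notin> M"
    proof
      assume "c \<in> M"
      then have "poly g t - t * c \<in> M" using PM t_in_B by (intro B.idl_diff[OF Mid(1)] B.idl_mult[OF Mid(1)])
      then show False using gt Mid by simp
    qed
    then show ?thesis using M PM by auto
  next
    case True
    then obtain f where f: "min_poly_mod P f" using min_poly_mod_exists[OF P] by auto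
    let ?a = "lead_coeff f"
    have fA: "f \<in> A.cpoly A" "degree f > 0" "poly f t \<in> P" and fa: "?a \<in> A" "?a \<notin> P"
      using f by (auto simp: min_poly_mod_def A.cpoly_def)
    have fmin: "g \<in> A.cpoly (P \<inter> A)" if "g \<in> A.cpoly A" "poly g t \<in> P" "degree g < degree f" for g
      using f that by (auto simp: min_poly_mod_def)
    let ?G = "B.gen (insert c P)"
    have Gid: "B.idl ?G" using B.idl_sub[OF Pid] c by (intro B.gen_idl) auto
    have PG: "P \<subseteq> ?G" "c \<in> ?G" using B.gen_superset[of "insert c P"] by auto
    let ?ok = "\<lambda>h. h \<in> A.cpoly A \<and> poly h t \<in> ?G \<and> poly h t \<notin> P"
    have "?ok \<gamma>" using \<gamma> c PG by auto
    then obtain h where h: "?ok h" and hmin: "\<And>h'. ?ok h' \<Longrightarrow> degree h \<le> degree h'"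
      using ex_has_least_nat[of ?ok \<gamma> degree] by auto
    \<comment> \<open>The polynomial \<open>h\<close> has least degree among those with value in
      \<open>?G\<close> but not in \<open>P\<close>. If it were not constant, dividing
      \<open>f\<close> by \<open>h\<close> would give a remainder with value in \<open>P\<close>,
      hence also a quotient with value in \<open>P\<close>. Both have smaller degree than
      \<open>f\<close> and thus coefficients in \<open>P\<close>, so the product of
      \<open>lead_coeff f\<close> with a power of \<open>lead_coeff h\<close> would lie in
      \<open>P\<close>.\<close>
    have "\<exists>b\<in>A. b \<notin> P \<and> b \<in> ?G"
    proof (cases "degree h = 0")
      case True
      then obtain b where "h = [:b:]" by (metis degree_eq_zeroE)
      then show ?thesis using h by (intro bexI[of _ b]) (auto simp: A.cpoly_def dest: spec[of _ 0])
    next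
      case False
      let ?l = "lead_coeff h"
      have lA: "?l \<in> A" using h by (auto simp: A.cpoly_def)
      have lP: "?l \<notin> P"
      proof
        assume l: "?l \<in> P"
        let ?m = "monom ?l (degree h)"
        have m: "?m \<in> A.cpoly (P \<inter> A)" using l lA by (intro A.cpoly_monom[OF pid]) auto
        then have mA: "?m \<in> A.cpoly A" using A.cpoly_sub[OF pid] by auto
        have mP: "poly ?m t \<in> P" using m by (intro poly_idl[OF Pid]) (auto simp: A.cpoly_def)
        have "?ok (h - ?m)"
          using h mA A.cpoly_carrier(1)[of h ?m] B.idl_diff[OF Gid, of "poly h t" "poly ?m t"] PG mP
            B.idl_add[OF Pid _ mP, of "poly h t - poly ?m t"] by auto
        then have "degree h \<le> degree (h - ?m)" by (rule hmin)
        moreover have "degree (h - ?m) \<le> degree h" using degree_monom_le[of ?l] by (intro degree_diff_le) auto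
        ultimately have "degree (h - ?m) = degree h" by auto
        moreover have "coeff (h - ?m) (degree h) = 0" by simp
        ultimately have "h - ?m = 0" by (metis leading_coeff_0_iff)
        then have "h = ?m" by (metis eq_iff_diff_eq_0)
        then show False using h mP by metis
      qed
      have hdeg: "degree h < degree f"
      proof -
        obtain k w r where *: "w \<in> A.cpoly A" "r \<in> A.cpoly A" "smult (?a ^ k) h = w * f + r" "degree r < degree f"
          using A.pseudo_division[OF fA(1,2) refl] h by blast
        have "r = smult (?a ^ k) h - w * f" using *(3) by simp
        then have rt: "poly r t = ?a ^ k * poly h t - poly w t * poly f t" by simp
        have wf: "poly w t * poly f t \<in> P" using B_I[OF *(1)] fA by (intro B.idl_mult[OF Pid])
        have "poly h t \<in> ?G" "poly w t * poly f t \<in> ?G" using h wf PG by auto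
        then have "poly r t \<in> ?G" unfolding rt
          using A_sub_B[OF fa(1)] by (intro B.idl_diff[OF Gid B.idl_mult[OF Gid]]) auto
        moreover have "poly r t \<notin> P"
        proof
          assume "poly r t \<in> P"
          then have "?a ^ k * poly h t \<in> P" using B.idl_add[OF Pid _ wf, of "poly r t"] rt by simp
          moreover have "?a ^ k \<notin> P" using B.prime_idl_power[OF P A_sub_B[OF fa(1)]] fa by auto
          ultimately show False using B.prime_idl_mult[OF P, of "?a ^ k" "poly h t"] A_sub_B[OF fa(1)] h B_I by auto
        qed
        ultimately have "degree h \<le> degree r" using * by (intro hmin) auto
        then show ?thesis using * by auto
      qed
      have hA: "h \<in> A.cpoly A" "degree h > 0" using h False by auto
      obtain k w r where *: "w \<in> A.cpoly A" "r \<in> A.cpoly A" "smult (?l ^ k) f = w * h + r" "degree r < degree h"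
          "w = 0 \<or> degree w \<le> degree f - degree h"
        using A.pseudo_division[OF hA refl fA(1)] by blast
      have "r = smult (?l ^ k) f - w * h" using *(3) by simp
      then have rt: "poly r t = ?l ^ k * poly f t - poly w t * poly h t" by simp
      have lf: "?l ^ k * poly f t \<in> P" using A_sub_B[OF lA] by (intro B.idl_mult[OF Pid _ fA(3)]) auto
      have "poly h t \<in> ?G" "?l ^ k * poly f t \<in> ?G" using h lf PG by auto
      then have "poly r t \<in> ?G" unfolding rt
        using B_I[OF *(1)] by (intro B.idl_diff[OF Gid _ B.idl_mult[OF Gid]]) auto
      then have rP: "poly r t \<in> P" using hmin[of r] * by force
      then have rp: "r \<in> A.cpoly (P \<inter> A)" using * hdeg by (intro fmin) auto
      have "poly w t * poly h t \<in> P" using B.idl_diff[OF Pid lf rP] rt by simp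
      then have wP: "poly w t \<in> P" using B.prime_idl_mult[OF P B_I[OF *(1)] B_I[OF hA(1)]] h by auto
      have "degree w < degree f" using * hA fA by auto
      then have "w \<in> A.cpoly (P \<inter> A)" using * wP by (intro fmin)
      then have "h * w \<in> A.cpoly (P \<inter> A)" using hA by (intro A.cpoly_mult[OF pid])
      then have "smult (?l ^ k) f \<in> A.cpoly (P \<inter> A)" using A.cpoly_add[OF pid _ rp] *(3) by (simp add: mult.commute)
      then have "coeff (smult (?l ^ k) f) (degree f) \<in> P \<inter> A" unfolding A.cpoly_def by blast
      then have "?l ^ k * ?a \<in> P \<inter> A" by simp
      then have "?l ^ k \<in> P \<inter> A \<or> ?a \<in> P \<inter> A" using lA fa by (intro A.prime_idl_mult[OF p]) auto
      then have "?l \<in> P" using A.prime_idl_power[OF p lA] fa by auto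
      then show ?thesis using lP by simp
    qed
    then obtain b where b: "b \<in> A" "b \<notin> P" "b \<in> ?G" by auto
    have "?a * b \<notin> P \<inter> A" using A.prime_idl_mult[OF p, of ?a b] b fa by auto
    then obtain m where m: "A.max_idl m" "P \<inter> A \<subseteq> m" "?a * b \<notin> m"
      using assms(1) p b fa unfolding A.jacobson_def by (metis A.mult_closed)
    have mid: "A.idl m" "1 \<notin> m" using m by (auto simp: A.max_idl_def)
    have am: "?a \<notin> m" "b \<notin> m" using m(3) A.idl_mult[OF mid(1) fa(1)] A.idl_mult2[OF mid(1) b(1)] by auto
    have "1 \<notin> B.gen (P \<union> m)" by (rule lying_over[OF P f A.max_idl_prime[OF m(1)] m(2) am(1)])
    moreover have mA: "m \<subseteq> A" using A.idl_sub[OF mid(1)] .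
    moreover have "B.idl (B.gen (P \<union> m))" using B.idl_sub[OF Pid] A_sub_B \<open>m \<subseteq> A\<close> by (intro B.gen_idl) auto
    ultimately obtain M where M: "B.max_idl M" "B.gen (P \<union> m) \<subseteq> M"
      using B.noeth_max_idl[OF assms(2)] by metis
    have Mid: "B.idl M" "1 \<notin> M" using M by (auto simp: B.max_idl_def)
    have PM: "P \<subseteq> M" "m \<subseteq> M" using M(2) B.gen_superset[of "P \<union> m"] by auto
    have "c \<notin> M"
    proof
      assume "c \<in> M"
      then have "?G \<subseteq> M" using PM by (intro B.gen_least[OF Mid(1)]) auto
      then have bM: "b \<in> M" using b by auto
      have "A.idl (A.gen (insert b m))" using mA b by (intro A.gen_idl) auto
      moreover have "m \<subseteq> A.gen (insert b m)" "b \<in> A.gen (insert b m)" using A.gen_superset[of "insert b m"] by auto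
      ultimately have "1 \<in> A.gen (insert b m)" using m(1) am unfolding A.max_idl_def by metis
      then obtain r where r: "r \<in> A" "1 - r * b \<in> m" using A.gen_insert_idl_iff[OF mid(1) b(1)] by auto
      then have "(1 - r * b) + r * b \<in> M" using PM bM A_sub_B by (intro B.idl_add[OF Mid(1)] B.idl_mult[OF Mid(1)]) auto
      then show False using Mid by simp
    qed
    then show ?thesis using M PM by auto
  qed
qed

end

section \<open>Polynomial rings\<close>

abbreviation "lookup \<equiv> Poly_Mapping.lookup"
abbreviation "keys \<equiv> Poly_Mapping.keys"
abbreviation "single \<equiv> Poly_Mapping.single"

definition polys :: "'v set \<Rightarrow> ('v, 'k::field) mpoly set" where
  "polys V = {p. \<forall>m\<in>keys p. keys m \<subseteq> V}"

definition Const :: "'k::field \<Rightarrow> ('v, 'k) mpoly" where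
  "Const c = single 0 c"

lemma Const_simps [simp]:
  "Const 0 = 0" "Const 1 = 1" "Const (a + b) = Const a + Const b" "Const (a - b) = Const a - Const b"
  "Const (a * b) = Const a * Const b" "Const (- a) = - Const a"
  by (simp_all add: Const_def single_add single_diff mult_single single_uminus)

lemma lookup_Const_mult: "lookup (Const c * p) m = c * lookup p m"
  unfolding Const_def mult_map_scale_conv_mult[symmetric] by transfer (auto simp: when_def)

lemma Const_mult_single: "Const c * single m d = single m (c * d)"
  by (simp add: Const_def mult_single)

lemma keys_Const_mult: "keys (Const c * p) \<subseteq> keys p"
  by (auto simp: in_keys_iff lookup_Const_mult)

lemma Const_eq_0_iff [simp]: "Const c = 0 \<longleftrightarrow> c = 0"
  by (metis Const_simps(1) Const_def lookup_single_eq lookup_zero)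

lemma keys_plus_nat: "keys (m + m' :: 'v \<Rightarrow>\<^sub>0 nat) = keys m \<union> keys m'"
  by (auto simp: in_keys_iff lookup_add)

lemma mpoly_sum_singles: "p = (\<Sum>m\<in>keys p. single m (lookup p m))"
proof (rule poly_mapping_eqI)
  fix k
  have "lookup (\<Sum>m\<in>keys p. single m (lookup p m)) k = (\<Sum>m\<in>keys p. if m = k then lookup p m else 0)"
    by (simp add: lookup_sum lookup_single when_def)
  also have "\<dots> = lookup p k" by (simp add: sum.delta in_keys_iff)
  finally show "lookup p k = lookup (\<Sum>m\<in>keys p. single m (lookup p m)) k" by simp
qed

lemma subring_polys: "subring_set (polys V)"
proof
  show "(1 :: ('a, 'b) mpoly) \<in> polys V" by (simp add: polys_def)
  fix a b :: "('a, 'b) mpoly"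
  assume ab: "a \<in> polys V" "b \<in> polys V"
  have "keys (a - b) \<subseteq> keys a \<union> keys b" by (auto simp: in_keys_iff lookup_minus)
  then show "a - b \<in> polys V" using ab by (auto simp: polys_def)
  show "a * b \<in> polys V" unfolding polys_def
  proof (intro CollectI ballI)
    fix m assume "m \<in> keys (a * b)"
    then obtain x y where "m = x + y" "x \<in> keys a" "y \<in> keys b" using keys_mult[of a b] by auto
    then show "keys m \<subseteq> V" using ab by (auto simp: polys_def keys_plus_nat)
  qed
qed

interpretation polys: subring_set "polys V" for V :: "'v set" by (rule subring_polys)

lemma polys_mono: "V \<subseteq> W \<Longrightarrow> polys V \<subseteq> polys W"
  by (auto simp: polys_def)

lemma Const_polys [simp, intro]: "Const c \<in> polys V"
  by (auto simp: polys_def Const_def)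

lemma Var_polys [simp]: "(Var v :: ('v, 'k::field) mpoly) \<in> polys V \<longleftrightarrow> v \<in> V"
  by (auto simp: polys_def Var_def)

lemma single_polys': "keys m \<subseteq> V \<Longrightarrow> single m c \<in> polys V"
  by (cases "c = 0") (auto simp: polys_def)

lemma Var_power: "Var v ^ n = single (single v n) 1"
  by (induction n) (auto simp: Var_def mult_single single_add[symmetric])

lemma single_split:
  "single m c = single (m - single v (lookup m v)) c * Var v ^ lookup m v"
proof -
  have "m - single v (lookup m v) + single v (lookup m v) = m"
    by (rule poly_mapping_eqI) (auto simp: lookup_add lookup_minus lookup_single when_def)
  then show ?thesis by (simp add: Var_power mult_single)
qed

interpretation polys_adj: subring_adjoin "polys V" "Var v" for V :: "'v set" and v :: 'v
  by unfold_locales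

text \<open>Identifies the abstract extension by \<open>Var v\<close> with the polynomial ring in
  one more variable, so that the variables can be treated one at a time.\<close>

lemma polys_insert: "polys_adj.B V v = (polys (insert v V) :: ('v, 'k::field) mpoly set)"
proof
  show "polys_adj.B V v \<subseteq> (polys (insert v V) :: ('v, 'k) mpoly set)"
  proof
    fix p :: "('v, 'k) mpoly"
    assume "p \<in> polys_adj.B V v"
    then obtain q where q: "p = poly q (Var v)" "q \<in> polys.cpoly (polys V)" by (auto simp: polys_adj.B_def)
    have "coeff q i \<in> polys (insert v V)" for i
      using q polys_mono[of V "insert v V"] by (auto simp: polys.cpoly_def)
    then show "p \<in> polys (insert v V)" unfolding q(1) poly_altdef by auto
  qed
  show "polys (insert v V) \<subseteq> (polys_adj.B V v :: ('v, 'k) mpoly set)"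
  proof
    fix p :: "('v, 'k) mpoly"
    assume p: "p \<in> polys (insert v V)"
    have "single m (lookup p m) \<in> polys_adj.B V v" if "m \<in> keys p" for m
    proof -
      have "keys m \<subseteq> insert v V" using p that by (auto simp: polys_def)
      have "keys (m - single v (lookup m v)) \<subseteq> V"
      proof
        fix x assume "x \<in> keys (m - single v (lookup m v))"
        then have "x \<noteq> v" "x \<in> keys m"
          by (auto simp: in_keys_iff lookup_minus lookup_single when_def split: if_splits)
        then show "x \<in> V" using \<open>keys m \<subseteq> insert v V\<close> by auto
      qed
      then have "single (m - single v (lookup m v)) (lookup p m) \<in> polys V" by (rule single_polys')
      then show ?thesis
        by (subst single_split[of m _ v])
          (intro polys_adj.B.mult_closed polys_adj.B.power_closed polys_adj.t_in_B polys_adj.A_sub_B)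
    qed
    then show "p \<in> polys_adj.B V v" by (subst mpoly_sum_singles) (rule polys_adj.B.sum_closed)
  qed
qed

lemma polys_empty: "polys {} = range Const"
proof -
  have "p \<in> range Const" if "p \<in> polys {}" for p :: "('v, 'k::field) mpoly"
  proof -
    have "keys p \<subseteq> {0}" using that by (auto simp: polys_def)
    then have "p = Const (lookup p 0)"
      by (intro poly_mapping_eqI) (auto simp: Const_def lookup_single when_def in_keys_iff)
    then show ?thesis by blast
  qed
  then show ?thesis by auto
qed

section \<open>Noetherian and Jacobson property, elimination of variables\<close>

lemma polys_empty_idl:
  assumes "polys.idl {} (J :: ('v, 'k::field) mpoly set)" "J \<noteq> {0}"
  shows "1 \<in> J"
proof -
  obtain x where x: "x \<in> J" "x \<noteq> 0" using assms polys.idl_zero by blast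
  then obtain c where c: "x = Const c" using polys.idl_mem[OF assms(1)] polys_empty by blast
  then have "Const (inverse c) * x \<in> J" using x by (intro polys.idl_mult[OF assms(1)]) auto
  moreover have "Const (inverse c) * x = 1" using x c by (metis Const_eq_0_iff Const_simps(2,5) left_inverse)
  ultimately show ?thesis by simp
qed

abbreviation "Noeth \<equiv> subring_set.noeth"
abbreviation "Jacobson \<equiv> subring_set.jacobson"

theorem noeth_jacobson_polys:
  assumes "finite V"
  shows "Noeth (polys V :: ('v, 'k::field) mpoly set) \<and> Jacobson (polys V :: ('v, 'k) mpoly set)"
  using assms
proof (induction V rule: finite_induct)
  case empty
  show ?case
  proof
    show "Noeth (polys {} :: ('v, 'k) mpoly set)"
      unfolding polys.noeth_def
    proof (intro allI impI)
      fix J :: "('v, 'k) mpoly set" assume J: "polys.idl {} J"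
      show "\<exists>X. finite X \<and> X \<subseteq> polys {} \<and> J = polys.gen {} X"
      proof (cases "J = {0}")
        case True
        then have "J = polys.gen {} {}" using polys.gen_least[OF J, of "{}"] polys.gen_0[where X = "{}"] by auto
        then show ?thesis by blast
      next
        case False
        then have J1: "1 \<in> J" by (rule polys_empty_idl[OF J])
        then have "J = polys {}" by (rule polys.idl_eq_carrier[OF J])
        moreover have "polys.gen {} {1 :: ('v, 'k) mpoly} = polys {}"
          by (intro polys.idl_eq_carrier polys.gen_idl) (auto intro: polys.gen_inc)
        ultimately show ?thesis by (intro exI[of _ "{1}"]) auto
      qed
    qed
    show "Jacobson (polys {} :: ('v, 'k) mpoly set)"
      unfolding polys.jacobson_def
    proof (intro allI impI, elim conjE)
      fix q :: "('v, 'k) mpoly set" and c assume q: "polys.prime_idl {} q" "c \<notin> q" "c \<in> polys {}"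
      have "q = {0}" using polys_empty_idl[of q] q polys.prime_idl_idl polys.prime_idl_one by blast
      moreover have "polys.max_idl {} {0 :: ('v, 'k) mpoly}"
        unfolding polys.max_idl_def using polys_empty_idl polys.idl_zero_set by auto
      ultimately show "\<exists>m. polys.max_idl {} m \<and> q \<subseteq> m \<and> c \<notin> m" using q by blast
    qed
  qed
next
  case (insert v V)
  have "Noeth (polys_adj.B V v :: ('v, 'k) mpoly set)"
    by (rule polys_adj.hilbert_basis) (use insert in auto)
  moreover from this have "Jacobson (polys_adj.B V v :: ('v, 'k) mpoly set)"
    by (intro polys_adj.jacobson_adjoin) (use insert in auto)
  ultimately show ?case by (simp add: polys_insert)
qed

lemmas noeth_polys = conjunct1[OF noeth_jacobson_polys]
lemmas jacobson_polys = conjunct2[OF noeth_jacobson_polys]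

text \<open>The Nullstellensatz in a form valid over every field: a maximal ideal need not come from
  a point with coordinates in the field, but eliminating variables keeps it maximal.\<close>

lemma max_idl_contract_polys:
  assumes "finite U" "finite V" "polys.max_idl (U \<union> V) (P :: ('v, 'k::field) mpoly set)"
  shows "polys.max_idl V (P \<inter> polys V)"
  using assms(1,3)
proof (induction U arbitrary: P rule: finite_induct)
  case empty
  then have "polys.idl V P" by (simp add: polys.max_idl_def)
  then have "P \<subseteq> polys V" by (rule polys.idl_sub)
  then show ?case using empty by (simp add: inf.absorb1)
next
  case (insert v U)
  have e: "polys_adj.B (U \<union> V) v = (polys (insert v U \<union> V) :: ('v, 'k) mpoly set)"
    using polys_insert[of "U \<union> V" v] by simp
  have "polys.max_idl (U \<union> V) (P \<inter> polys (U \<union> V))"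
  proof (rule polys_adj.max_idl_contraction[of "U \<union> V" v P])
    show "Jacobson (polys (U \<union> V) :: ('v, 'k) mpoly set)" using insert assms by (intro jacobson_polys) auto
    show "subring_set.max_idl (polys_adj.B (U \<union> V) v) P" unfolding e using insert by simp
  qed
  then have "polys.max_idl V (P \<inter> polys (U \<union> V) \<inter> polys V)" by (rule insert.IH)
  moreover have "P \<inter> polys (U \<union> V) \<inter> polys V = P \<inter> polys V" using polys_mono[of V "U \<union> V"] by auto
  ultimately show ?case by simp
qed

lemma lookup_mult_Var_power:
  assumes "p \<in> polys U" "v \<notin> U" "keys m \<subseteq> U"
  shows "lookup (p * Var v ^ j) (m + single v i) = (if i = j then lookup p m else 0)"
proof -
  have sh: "single m' c * Var v ^ j = single (m' + single v j) c" for m' and c :: 'b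
    by (simp add: Var_power mult_single)
  have "p * Var v ^ j = (\<Sum>m'\<in>keys p. single (m' + single v j) (lookup p m'))"
    by (subst mpoly_sum_singles) (simp add: sum_distrib_right sh)
  then have "lookup (p * Var v ^ j) (m + single v i)
      = (\<Sum>m'\<in>keys p. if m' + single v j = m + single v i then lookup p m' else 0)"
    by (simp add: lookup_sum lookup_single when_def)
  also have "\<dots> = (\<Sum>m'\<in>keys p. if m' = m then (if i = j then lookup p m' else 0) else 0)"
  proof (rule sum.cong)
    fix m' assume "m' \<in> keys p"
    then have "v \<notin> keys m'" "v \<notin> keys m" using assms by (auto simp: polys_def)
    then have "lookup m' v = 0" "lookup m v = 0" by (simp_all add: in_keys_iff)
    then have "m' + single v j = m + single v i \<longleftrightarrow> m' = m \<and> i = j"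
      by (metis add_left_cancel add.commute add_right_cancel lookup_add lookup_single_eq add_0)
    then show "(if m' + single v j = m + single v i then lookup p m' else 0) =
        (if m' = m then (if i = j then lookup p m' else 0) else 0)" by auto
  qed auto
  also have "\<dots> = (if i = j then lookup p m else 0)"
    by (auto simp: sum.delta in_keys_iff)
  finally show ?thesis .
qed

lemma poly_Var_eq_0:
  assumes "q \<in> polys.cpoly (polys U)" "v \<notin> U" "poly q (Var v) = (0 :: ('v, 'k::field) mpoly)"
  shows "q = 0"
proof (rule poly_eqI)
  fix i
  have qU: "coeff q j \<in> polys U" for j using assms by (auto simp: polys.cpoly_def)
  show "coeff q i = coeff 0 i"
  proof (rule poly_mapping_eqI)
    fix m
    show "lookup (coeff q i) m = lookup (coeff 0 i) m"
    proof (cases "keys m \<subseteq> U")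
      case True
      have "0 = lookup (poly q (Var v)) (m + single v i)" using assms by simp
      also have "\<dots> = (\<Sum>j\<le>degree q. if i = j then lookup (coeff q j) m else 0)"
        unfolding poly_altdef lookup_sum using lookup_mult_Var_power[OF qU assms(2) True] by simp
      also have "\<dots> = lookup (coeff q i) m" by (auto simp: sum.delta' coeff_eq_0)
      finally show ?thesis by simp
    next
      case False
      then have "m \<notin> keys (coeff q i)" using qU[of i] by (auto simp: polys_def)
      then show ?thesis by (simp add: in_keys_iff)
    qed
  qed
qed

lemma poly_Var_inj:
  assumes "q \<in> polys.cpoly (polys U)" "r \<in> polys.cpoly (polys U)" "v \<notin> U"
    "poly q (Var v) = (poly r (Var v) :: ('v, 'k::field) mpoly)"
  shows "q = r"
  using poly_Var_eq_0[of "q - r" U v] polys.cpoly_carrier(1)[OF assms(1,2)] assms(3,4) by simp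

text \<open>Elimination of all variables but \<open>v\<close> leaves a maximal ideal of a polynomial
  ring in one variable. It is not 0, since \<open>Var v\<close> generates a larger proper
  ideal.\<close>

lemma max_idl_univariate:
  assumes "finite V" "v \<in> V" "polys.max_idl V (P :: ('v, 'k::field) mpoly set)"
  shows "\<exists>q :: 'k poly. lead_coeff q = 1 \<and> poly (map_poly Const q) (Var v) \<in> P"
proof -
  have P1: "polys.max_idl {v} (P \<inter> polys {v})"
    using max_idl_contract_polys[of "V - {v}" "{v}" P] assms by (simp add: insert_absorb)
  then have Q: "polys.idl {v} (P \<inter> polys {v})" "1 \<notin> P \<inter> polys {v}"
    and mx: "\<And>J. polys.idl {v} J \<Longrightarrow> 1 \<notin> J \<Longrightarrow> P \<inter> polys {v} \<subseteq> J \<Longrightarrow> J = P \<inter> polys {v}"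
    by (auto simp: polys.max_idl_def)
  have "P \<inter> polys {v} \<noteq> {0}"
  proof
    assume z: "P \<inter> polys {v} = {0}"
    let ?J = "polys.gen {v} (insert (Var v) {0 :: ('v, 'k) mpoly})"
    have J: "polys.idl {v} ?J" by (rule polys.gen_idl) auto
    have VJ: "Var v \<in> ?J" by (rule polys.gen_inc) simp
    have "1 \<notin> ?J"
    proof
      assume "1 \<in> ?J"
      then obtain r :: "('v, 'k) mpoly" where "1 - r * Var v \<in> {0}"
        using polys.gen_insert_idl_iff[OF polys.idl_zero_set, of "Var v" "{v}" 1] by auto
      then have "1 = r * Var v" by simp
      then have "0 \<in> keys (r * Var v)" by simp
      then obtain a where "0 = a + single v (1::nat)" using keys_mult[of r "Var v"] by (auto simp: Var_def)
      then have "lookup (0 :: 'v \<Rightarrow>\<^sub>0 nat) v = lookup a v + 1" by (metis lookup_add lookup_single_eq)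
      then show False by simp
    qed
    then have "?J = P \<inter> polys {v}" using z polys.idl_zero[OF J] by (intro mx[OF J]) auto
    then have "Var v = (0 :: ('v, 'k) mpoly)" using VJ z by simp
    then have "lookup (Var v :: ('v, 'k) mpoly) (single v 1) = 0" by simp
    then show False by (simp add: Var_def)
  qed
  then obtain h where h: "h \<in> P" "h \<in> polys {v}" "h \<noteq> 0" using polys.idl_zero[OF Q(1)] by auto
  then have "h \<in> polys_adj.B {} v" by (simp add: polys_insert)
  then obtain q where q: "h = poly q (Var v)" "q \<in> polys.cpoly (polys {})" by (auto simp: polys_adj.B_def)
  have "\<exists>c. coeff q i = Const c" for i
    using q polys_empty by (auto simp: polys.cpoly_def)
  then obtain c where c: "\<And>i. coeff q i = Const (c i)" by metis
  have "q \<noteq> 0" using q h by auto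
  then have l: "c (degree q) \<noteq> 0" using c[of "degree q"] by auto
  \<comment> \<open>The coefficients of \<open>q\<close> lie in \<open>polys {}\<close>, so they are
    constants; division by the leading one gives a monic polynomial over the field itself.\<close>
  define q' where "q' = Poly (map (\<lambda>i. inverse (c (degree q)) * c i) [0..<Suc (degree q)])"
  have cq': "coeff q' i = inverse (c (degree q)) * c i" for i
  proof (cases "i \<le> degree q")
    case False
    then have "c i = 0" using c[of i] coeff_eq_0[of q i] by simp
    then show ?thesis using False by (simp add: q'_def nth_default_def)
  qed (simp add: q'_def nth_default_def del: upt_Suc)
  have "degree q' = degree q"
  proof (rule antisym)
    show "degree q' \<le> degree q"
    proof (rule degree_le, intro allI impI)
      fix i assume "degree q < i"
      then have "c i = 0" using c[of i] coeff_eq_0[of q i] by simp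
      then show "coeff q' i = 0" by (simp add: cq')
    qed
    show "degree q \<le> degree q'" using cq'[of "degree q"] l by (intro le_degree) simp
  qed
  then have lc: "lead_coeff q' = 1" using l by (simp add: cq')
  have "map_poly Const q' = smult (Const (inverse (c (degree q)))) q"
    by (rule poly_eqI) (simp add: coeff_map_poly cq' c)
  then have "poly (map_poly Const q') (Var v) = Const (inverse (c (degree q))) * h" using q by simp
  moreover have "Const (inverse (c (degree q))) * h \<in> P"
    using polys.idl_mult[of V P] assms(3) h by (auto simp: polys.max_idl_def)
  ultimately show ?thesis using lc by (intro exI[of _ q']) simp
qed

section \<open>Regular sequences of full length in maximal ideals\<close>

context subring_set begin

lemma cpoly_cancel_monic:
  assumes "idl J" "q \<in> cpoly R" "lead_coeff q = 1" "h \<in> cpoly R" "q * h \<in> cpoly J"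
  shows "h \<in> cpoly J"
proof (rule ccontr)
  assume "h \<notin> cpoly J"
  then obtain i where i: "coeff h i \<notin> J" "\<And>k. k > i \<Longrightarrow> coeff h k \<in> J" using top_coeff_exists[OF assms(1)] by blast
  let ?d = "degree q"
  have "coeff (q * h) (?d + i) = (\<Sum>k\<le>?d + i. coeff q k * coeff h (?d + i - k))" by (simp add: coeff_mult)
  also have "\<dots> = coeff q ?d * coeff h (?d + i - ?d) + (\<Sum>k\<in>{..?d + i} - {?d}. coeff q k * coeff h (?d + i - k))"
    by (rule sum.remove) auto
  finally have eq: "coeff (q * h) (?d + i) = coeff h i + (\<Sum>k\<in>{..?d + i} - {?d}. coeff q k * coeff h (?d + i - k))"
    using assms(3) by simp
  have "(\<Sum>k\<in>{..?d + i} - {?d}. coeff q k * coeff h (?d + i - k)) \<in> J"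
  proof (rule idl_sum[OF assms(1)])
    fix k assume k: "k \<in> {..?d + i} - {?d}"
    show "coeff q k * coeff h (?d + i - k) \<in> J"
    proof (cases "k > ?d")
      case True
      then show ?thesis using idl_zero[OF assms(1)] by (simp add: coeff_eq_0)
    next
      case False
      then have "?d + i - k > i" using k by auto
      then show ?thesis using i(2) assms(2) by (intro idl_mult[OF assms(1)]) (auto simp: cpoly_def)
    qed
  qed
  moreover have "coeff (q * h) (?d + i) \<in> J" using assms(5) unfolding cpoly_def by blast
  ultimately show False using i(1) eq idl_diff[OF assms(1), of "coeff (q * h) (?d + i)"] by fastforce
qed

end

text \<open>Each polynomial is monic in its own variable over the ring in the other variables, which
  contains the earlier members. By \<open>key\<close>, the ideal of the earlier members consists of
  the polynomials in that variable with coefficients in their ideal over the smaller ring, and there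
  a monic factor can be cancelled.\<close>

lemma regs_univariate:
  fixes q :: "'v \<Rightarrow> 'k::field poly"
  assumes "distinct vs" "\<And>v. v \<in> set vs \<Longrightarrow> lead_coeff (q v) = 1"
  shows "polys.regs (set vs) {0} (map (\<lambda>v. poly (map_poly Const (q v)) (Var v)) vs)"
proof -
  let ?V = "set vs"
  let ?f = "\<lambda>v. poly (map_poly Const (q v)) (Var v) :: ('v, 'k) mpoly"
  have mc: "map_poly Const (q v) \<in> polys.cpoly (polys U)" for v and U :: "'v set"
    by (auto simp: polys.cpoly_def coeff_map_poly)
  have fU: "?f v \<in> polys U" if "v \<in> U" for v U
    unfolding poly_altdef using that by (intro polys.sum_closed polys.mult_closed polys.power_closed) (auto simp: coeff_map_poly)
  have id0: "polys.idl ?V {0 :: ('v, 'k) mpoly}" by (rule polys.idl_zero_set)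
  have sub: "set (map ?f vs) \<subseteq> polys ?V" using fU by auto
  show ?thesis unfolding polys.regs_iff_nth[OF id0 sub]
  proof (intro allI impI ballI)
    fix i y assume i: "i < length (map ?f vs)" and y: "y \<in> polys ?V"
      and yy: "map ?f vs ! i * y \<in> polys.gen ?V ({0} \<union> set (take i (map ?f vs)))"
    let ?v = "vs ! i"
    let ?U = "?V - {?v}"
    let ?X = "{0} \<union> set (take i (map ?f vs))"
    have vV: "?v \<in> ?V" using i by simp
    have iV: "insert ?v ?U = ?V" using vV by auto
    have BV: "polys_adj.B ?U ?v = (polys ?V :: ('v, 'k) mpoly set)" using polys_insert[of ?U ?v] iV by simp
    have XU: "?X \<subseteq> polys ?U"
    proof -
      have "u \<in> ?U" if u: "u \<in> set (take i vs)" for u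
      proof -
        obtain j where "j < i" "j < length vs" "u = vs ! j" using u by (auto simp: in_set_conv_nth)
        then show ?thesis using assms(1) i by (auto simp: nth_eq_iff_index_eq)
      qed
      then show ?thesis using fU by (auto simp: take_map)
    qed
    let ?J = "polys.gen ?U ?X"
    have Jid: "polys.idl ?U ?J" by (rule polys.gen_idl[OF XU])
    have XV: "?X \<subseteq> polys ?V" using XU polys_mono[of ?U ?V] by auto
    have key: "z \<in> polys.gen ?V ?X \<longleftrightarrow> (\<exists>h\<in>polys.cpoly ?J. z = poly h (Var ?v))" for z
    proof
      assume "z \<in> polys.gen ?V ?X"
      then have "z \<in> subring_set.gen (polys_adj.B ?U ?v) ({0} \<union> ?J)"
        unfolding BV using polys.gen_mono[of ?X "{0} \<union> ?J" ?V] polys.gen_superset[of ?X ?U] by auto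
      then show "\<exists>h\<in>polys.cpoly ?J. z = poly h (Var ?v)"
        using polys_adj.gen_Un_contraction[OF polys_adj.B.idl_zero_set Jid, of z ?v] by auto
    next
      assume "\<exists>h\<in>polys.cpoly ?J. z = poly h (Var ?v)"
      then obtain h where h: "h \<in> polys.cpoly ?J" "z = poly h (Var ?v)" by auto
      have gi: "polys.idl ?V (polys.gen ?V ?X)" by (rule polys.gen_idl[OF XV])
      have "?J \<subseteq> polys.gen ?V ?X \<inter> polys ?U"
      proof (rule polys.gen_least)
        show "polys.idl ?U (polys.gen ?V ?X \<inter> polys ?U)"
        proof (rule polys.idlI)
          show "r * a \<in> polys.gen ?V ?X \<inter> polys ?U" if "r \<in> polys ?U" "a \<in> polys.gen ?V ?X \<inter> polys ?U" for r a
            using polys.idl_mult[OF gi, of r a] that polys_mono[of ?U ?V] by auto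
        qed (use polys.idl_zero[OF gi] polys.idl_add[OF gi] in auto)
        show "?X \<subseteq> polys.gen ?V ?X \<inter> polys ?U" using XU polys.gen_superset[of ?X ?V] by auto
      qed
      then have "coeff h j \<in> polys.gen ?V ?X" for j using h by (auto simp: polys.cpoly_def)
      then show "z \<in> polys.gen ?V ?X"
        unfolding h(2) using polys_adj.poly_idl[of ?U ?v "polys.gen ?V ?X" h] gi BV by simp
    qed
    obtain h where h: "y = poly h (Var ?v)" "h \<in> polys.cpoly (polys ?U)"
      using y unfolding BV[symmetric] polys_adj.B_def by auto
    obtain h' where h': "h' \<in> polys.cpoly ?J" "?f ?v * y = poly h' (Var ?v)"
      using yy i key by auto
    let ?q = "map_poly Const (q ?v) :: ('v, 'k) mpoly poly"
    have eq: "?q * h = h'"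
    proof (rule poly_Var_inj)
      show "?q * h \<in> polys.cpoly (polys ?U)" by (rule polys.cpoly_carrier(3)[OF mc h(2)])
      show "h' \<in> polys.cpoly (polys ?U)" using h' polys.cpoly_sub[OF Jid] by auto
      show "poly (?q * h) (Var ?v) = poly h' (Var ?v)" using h h' by simp
    qed simp
    have lc: "lead_coeff ?q = 1"
      using assms(2)[OF vV] by (simp add: coeff_map_poly degree_map_poly)
    have "?q * h \<in> polys.cpoly ?J" using h'(1) eq by simp
    then have "h \<in> polys.cpoly ?J" by (rule polys.cpoly_cancel_monic[OF Jid mc lc h(2)])
    then show "y \<in> polys.gen ?V ?X" unfolding key h(1) by (rule bexI[rotated]) simp
  qed
qed

theorem max_idl_regs:
  assumes "finite V" "polys.max_idl V (P :: ('v, 'k::field) mpoly set)"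
  shows "\<exists>ps. length ps = card V \<and> set ps \<subseteq> P \<and> polys.regs V {0} ps"
proof -
  have "\<exists>q :: 'k poly. lead_coeff q = 1 \<and> poly (map_poly Const q) (Var v) \<in> P" if "v \<in> V" for v
    by (rule max_idl_univariate[OF assms(1) that assms(2)])
  then obtain q :: "'v \<Rightarrow> 'k poly" where q: "\<And>v. v \<in> V \<Longrightarrow> lead_coeff (q v) = 1 \<and> poly (map_poly Const (q v)) (Var v) \<in> P"
    by metis
  obtain vs where vs: "set vs = V" "distinct vs" using finite_distinct_list[OF assms(1)] by auto
  show ?thesis
    using regs_univariate[OF vs(2), of q] q vs distinct_card[OF vs(2)]
    by (intro exI[of _ "map (\<lambda>v. poly (map_poly Const (q v)) (Var v)) vs"]) auto
qed

section \<open>The length of chains of primes\<close>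

lemma monom_deg_superset:
  "finite A \<Longrightarrow> keys m \<subseteq> A \<Longrightarrow> monom_deg m = (\<Sum>v\<in>A. lookup m v)"
  unfolding monom_deg_def by (rule sum.mono_neutral_left) (auto simp: in_keys_iff)

lemma monom_deg_plus: "monom_deg (m + m') = monom_deg m + monom_deg m'"
proof -
  have "monom_deg x = (\<Sum>v\<in>keys m \<union> keys m'. lookup x v)" if "x \<in> {m, m', m + m'}" for x
    using that by (intro monom_deg_superset) (auto simp: keys_plus_nat)
  then show ?thesis by (simp add: lookup_add sum.distrib)
qed

lemma monom_deg_simps [simp]: "monom_deg 0 = 0" "monom_deg (single v n) = n"
  by (simp_all add: monom_deg_def)

lemma lookup_le_monom_deg: "lookup m v \<le> monom_deg m"
  using monom_deg_superset[of "insert v (keys m)" m, OF _ subset_insertI] member_le_sum[of v "insert v (keys m)" "lookup m"] by auto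

definition deg_le :: "nat \<Rightarrow> ('v, 'k::field) mpoly \<Rightarrow> bool" where
  "deg_le d p \<longleftrightarrow> (\<forall>m\<in>keys p. monom_deg m \<le> d)"

lemma deg_le_exists: "\<exists>d. deg_le d p"
  using Max_ge[of "monom_deg ` keys p"] by (intro exI[of _ "Max (monom_deg ` keys p)"]) (auto simp: deg_le_def)

lemma deg_le_mono: "deg_le d p \<Longrightarrow> d \<le> e \<Longrightarrow> deg_le e p"
  by (auto simp: deg_le_def intro: order_trans)

lemma deg_le_mult: "deg_le d p \<Longrightarrow> deg_le e q \<Longrightarrow> deg_le (d + e) (p * q)"
  using keys_mult[of p q] by (fastforce simp: deg_le_def monom_deg_plus intro: add_mono)

lemma deg_le_one: "deg_le 0 1"
  by (simp add: deg_le_def)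

lemma deg_le_power: "deg_le d p \<Longrightarrow> deg_le (n * d) (p ^ n)"
  by (induction n) (auto simp: deg_le_one intro: deg_le_mult)

text \<open>Linear independence over the field modulo an ideal \<open>Q\<close>; the indexed form
  also excludes repetitions in the family.\<close>

definition indep :: "('v, 'k::field) mpoly set \<Rightarrow> nat \<Rightarrow> (nat \<Rightarrow> ('v, 'k) mpoly) \<Rightarrow> bool" where
  "indep Q h b \<longleftrightarrow> (\<forall>c. (\<Sum>i<h. Const (c i) * b i) \<in> Q \<longrightarrow> (\<forall>i<h. c i = 0))"

lemma indepD: "indep Q h b \<Longrightarrow> (\<Sum>i<h. Const (c i) * b i) \<in> Q \<Longrightarrow> i < h \<Longrightarrow> c i = 0"
  unfolding indep_def by blast

lemma vector_space_mpoly: "vector_space (\<lambda>c (p :: ('v, 'k::field) mpoly). Const c * p)"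
  by unfold_locales (simp_all add: algebra_simps)

lemma indep_span_bound:
  fixes b :: "nat \<Rightarrow> ('v, 'k::field) mpoly"
  assumes "indep {0} h b" "finite T"
    and "\<And>i. i < h \<Longrightarrow> \<exists>c. b i = (\<Sum>t\<in>T. Const (c t) * t)"
  shows "h \<le> card T"
proof -
  interpret vs: vector_space "\<lambda>c (p :: ('v, 'k) mpoly). Const c * p" by (rule vector_space_mpoly)
  have inj: "inj_on b {..<h}"
  proof (rule inj_onI, rule ccontr)
    fix i j assume ij: "i \<in> {..<h}" "j \<in> {..<h}" "b i = b j" "i \<noteq> j"
    let ?c = "\<lambda>k. if k = i then 1 else if k = j then - 1 else 0 :: 'k"
    have "(\<Sum>k<h. Const (?c k) * b k) = (\<Sum>k\<in>{i, j}. Const (?c k) * b k)"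
      using ij by (intro sum.mono_neutral_right) auto
    also have "\<dots> = 0" using ij by simp
    finally have "?c i = 0" using ij by (intro indepD[OF assms(1), of ?c i]) auto
    then show False by auto
  qed
  have "vs.independent (b ` {..<h})"
    unfolding vs.dependent_explicit
  proof (rule notI, elim exE conjE bexE)
    fix t u v assume t: "finite t" "t \<subseteq> b ` {..<h}" "(\<Sum>v\<in>t. Const (u v) * v) = 0" and v: "v \<in> t" "u v \<noteq> 0"
    let ?c = "\<lambda>i. if b i \<in> t then u (b i) else 0"
    have "(\<Sum>i<h. Const (?c i) * b i) = (\<Sum>v\<in>b ` {..<h}. Const (if v \<in> t then u v else 0) * v)"
      using inj by (simp add: sum.reindex)
    also have "\<dots> = (\<Sum>v\<in>t. Const (u v) * v)"
      using t by (intro sum.mono_neutral_cong_right) auto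
    finally have "(\<Sum>i<h. Const (?c i) * b i) \<in> {0}" using t by simp
    note z = indepD[OF assms(1), of ?c, OF this]
    obtain i where "i < h" "v = b i" using t v by auto
    then show False using v z[of i] by auto
  qed
  moreover have "b ` {..<h} \<subseteq> vs.span T"
  proof
    fix x assume "x \<in> b ` {..<h}"
    then obtain c where "x = (\<Sum>t\<in>T. Const (c t) * t)" using assms(3) by auto
    then show "x \<in> vs.span T" by (simp only:) (rule vs.span_sum, rule vs.span_scale, rule vs.span_base)
  qed
  ultimately have "card (b ` {..<h}) \<le> card T" using vs.independent_span_bound[OF assms(2)] by auto
  then show ?thesis using inj by (simp add: card_image)
qed

text \<open>The crude count of monomials with all exponents at most \<open>d\<close> suffices, since
  only the order of growth in \<open>d\<close> is used.\<close>

lemma indep_deg_bound: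
  fixes b :: "nat \<Rightarrow> ('v, 'k::field) mpoly"
  assumes "finite V" "indep {0} h b" "\<And>i. i < h \<Longrightarrow> b i \<in> polys V \<and> deg_le d (b i)"
  shows "h \<le> Suc d ^ card V"
proof -
  define M where "M = {m :: 'v \<Rightarrow>\<^sub>0 nat. keys m \<subseteq> V \<and> (\<forall>v. lookup m v \<le> d)}"
  let ?r = "\<lambda>m :: 'v \<Rightarrow>\<^sub>0 nat. restrict (lookup m) V"
  have inj: "inj_on ?r M"
  proof (rule inj_onI, rule poly_mapping_eqI)
    fix m m' v assume *: "m \<in> M" "m' \<in> M" "?r m = ?r m'"
    show "lookup m v = lookup m' v"
    proof (cases "v \<in> V")
      case True
      then show ?thesis using fun_cong[OF *(3), of v] by simp
    next
      case False
      then have "v \<notin> keys m" "v \<notin> keys m'" using * by (auto simp: M_def)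
      then show ?thesis by (simp add: in_keys_iff)
    qed
  qed
  have im: "?r ` M \<subseteq> PiE V (\<lambda>_. {..d})" by (auto simp: M_def)
  have finP: "finite (PiE V (\<lambda>_. {..d}))" using assms by (intro finite_PiE) auto
  have finM: "finite M" using finite_imageD[OF finite_subset[OF im finP] inj] .
  have "card M = card (?r ` M)" using inj by (simp add: card_image)
  also have "\<dots> \<le> card (PiE V (\<lambda>_. {..d}))" by (rule card_mono[OF finP im])
  also have "\<dots> = Suc d ^ card V" using assms by (simp add: card_PiE)
  finally have cM: "card M \<le> Suc d ^ card V" .
  let ?T = "(\<lambda>m. single m (1::'k)) ` M"
  have injT: "inj_on (\<lambda>m. single m (1::'k)) M"
    by (rule inj_onI) (metis keys_single one_neq_zero singleton_inject)
  have "h \<le> card ?T"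
  proof (rule indep_span_bound[OF assms(2)])
    show "finite ?T" using finM by simp
    fix i assume i: "i < h"
    have sub: "keys (b i) \<subseteq> M"
    proof
      fix m assume m: "m \<in> keys (b i)"
      then have "keys m \<subseteq> V" "monom_deg m \<le> d" using assms(3)[OF i] by (auto simp: polys_def deg_le_def)
      moreover have "lookup m v \<le> d" for v using lookup_le_monom_deg[of m v] calculation by simp
      ultimately show "m \<in> M" by (auto simp: M_def)
    qed
    have "b i = (\<Sum>m\<in>keys (b i). Const (lookup (b i) m) * single m 1)"
      by (subst mpoly_sum_singles) (simp add: Const_mult_single)
    also have "\<dots> = (\<Sum>m\<in>M. Const (lookup (b i) m) * single m 1)"
      using sub finM by (intro sum.mono_neutral_left) (auto simp: in_keys_iff)
    also have "\<dots> = (\<Sum>t\<in>?T. Const (lookup (b i) (inv_into M (\<lambda>m. single m (1::'k)) t)) * t)"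
      by (subst sum.reindex[OF injT]) (auto simp: inv_into_f_f[OF injT] intro!: sum.cong)
    finally show "\<exists>c. b i = (\<Sum>t\<in>?T. Const (c t) * t)"
      by (intro exI[of _ "\<lambda>t. lookup (b i) (inv_into M (\<lambda>m. single m (1::'k)) t)"])
  qed
  also have "card ?T \<le> card M" by (rule card_image_le[OF finM])
  finally show ?thesis using cM by simp
qed

text \<open>Along a strict inclusion of primes the growth of the number of independent elements of bounded
  degree drops by a factor of the degree, since powers of an element of the difference multiply an
  independent family.\<close>

lemma indep_powers:
  fixes g :: "('v, 'k::field) mpoly"
  assumes Q: "polys.prime_idl V Q" and Q': "polys.idl V Q'" and QQ: "Q \<subseteq> Q'"
    and g: "g \<in> Q'" "g \<notin> Q" and bV: "\<And>i. i < h \<Longrightarrow> b i \<in> polys V" and ind: "indep Q' h b"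
  shows "indep Q (t * h) (\<lambda>j. g ^ (j div h) * b (j mod h))"
proof (induction t)
  case 0
  then show ?case by (simp add: indep_def)
next
  case (Suc t)
  show ?case unfolding indep_def
  proof (intro allI impI)
    fix c i
    assume s: "(\<Sum>j<Suc t * h. Const (c j) * (g ^ (j div h) * b (j mod h))) \<in> Q" and i: "i < Suc t * h"
    have Qid: "polys.idl V Q" using Q polys.prime_idl_idl by auto
    have gV: "g \<in> polys V" using polys.idl_mem[OF Q' g(1)] .
    have h0: "h > 0" using i by (cases h) auto
    let ?A = "\<Sum>j<h. Const (c j) * b j"
    let ?B = "\<Sum>j<t * h. Const (c (h + j)) * (g ^ (j div h) * b (j mod h))"
    have BV: "?B \<in> polys V"
      using bV gV h0 by (intro polys.sum_closed polys.mult_closed polys.power_closed) auto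
    have "(\<Sum>j<Suc t * h. Const (c j) * (g ^ (j div h) * b (j mod h))) =
        (\<Sum>j<h. Const (c j) * (g ^ (j div h) * b (j mod h))) +
        (\<Sum>j<t * h. Const (c (h + j)) * (g ^ ((h + j) div h) * b ((h + j) mod h)))"
      using sum.nested_swap sum.atLeastLessThan_concat[of 0 h "h + t * h" "\<lambda>j. Const (c j) * (g ^ (j div h) * b (j mod h))"]
        sum.shift_bounds_nat_ivl[of "\<lambda>j. Const (c j) * (g ^ (j div h) * b (j mod h))" 0 h "t * h"]
      by (simp add: atLeast0LessThan add.commute)
    also have "(\<Sum>j<h. Const (c j) * (g ^ (j div h) * b (j mod h))) = ?A" by (intro sum.cong) auto
    also have "(\<Sum>j<t * h. Const (c (h + j)) * (g ^ ((h + j) div h) * b ((h + j) mod h))) = g * ?B"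
      using h0 by (simp add: sum_distrib_left div_add_self1 algebra_simps)
    finally have s': "?A + g * ?B \<in> Q" using s by simp
    have "g * ?B \<in> Q'" using BV by (rule polys.idl_mult2[OF Q' _ g(1)])
    then have "?A \<in> Q'" using polys.idl_diff[OF Q', of "?A + g * ?B" "g * ?B"] s' QQ by auto
    then have c0: "\<forall>j<h. c j = 0" using indepD[OF ind] by blast
    then have "?A = 0" by simp
    then have "g * ?B \<in> Q" using s' by simp
    then have "?B \<in> Q" using polys.prime_idl_mult[OF Q gV BV] g by auto
    then have "\<forall>j<t * h. c (h + j) = 0" using Suc.IH unfolding indep_def by (elim allE[of _ "\<lambda>j. c (h + j)"]) simp
    then have "c (h + (i - h)) = 0" if "i \<ge> h" using i that by (elim allE[of _ "i - h"]) auto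
    then show "c i = 0" using c0 i by (cases "i < h") auto
  qed
qed

lemma chain_growth:
  assumes "finite V" "polys.chain V k Q0 (Q :: ('v, 'k::field) mpoly set)"
  shows "\<exists>C. \<forall>d h b. indep Q h b \<and> (\<forall>i<h. b i \<in> polys V \<and> deg_le d (b i)) \<longrightarrow>
    h * Suc d ^ k \<le> C * Suc d ^ card V"
  using assms(2)
proof (induction rule: polys.chain.induct)
  case (chain_0 P)
  have P0: "0 \<in> P" using chain_0 polys.prime_idl_idl polys.idl_zero by blast
  have "h \<le> Suc d ^ card V" if "indep P h b" "\<forall>i<h. b i \<in> polys V \<and> deg_le d (b i)" for d h b
  proof (rule indep_deg_bound[OF assms(1)])
    show "indep {0} h b" using that P0 by (auto simp: indep_def)
  qed (use that in auto)
  then show ?case by (intro exI[of _ 1]) auto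
next
  case (chain_Suc k P Q Q')
  then obtain C where C: "\<And>d h b. indep Q h b \<Longrightarrow> (\<And>i. i < h \<Longrightarrow> b i \<in> polys V \<and> deg_le d (b i)) \<Longrightarrow>
    h * Suc d ^ k \<le> C * Suc d ^ card V" by blast
  have Q: "polys.prime_idl V Q" using chain_Suc polys.chain_primes by blast
  have Q': "polys.idl V Q'" using chain_Suc polys.prime_idl_idl by blast
  obtain g where g: "g \<in> Q'" "g \<notin> Q" using chain_Suc by auto
  have gV: "g \<in> polys V" using polys.idl_mem[OF Q' g(1)] .
  obtain \<delta> where \<delta>: "deg_le \<delta> g" using deg_le_exists by auto
  show ?case
  proof (intro exI allI impI, elim conjE)
    fix d h b
    assume ind: "indep Q' h b" and b: "\<forall>i<h. b i \<in> polys V \<and> deg_le d (b i)"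
    \<comment> \<open>Degree bound for products of a member of \<open>b\<close> with a power of
      \<open>g\<close> of exponent at most \<open>d\<close>. Passing from \<open>Suc d\<close> to
      \<open>Suc ?D\<close> costs at most the factor \<open>Suc \<delta> ^ card V\<close>, which is
      absorbed into the constant.\<close>
    let ?D = "d + d * \<delta>"
    have "Suc d * h * Suc ?D ^ k \<le> C * Suc ?D ^ card V"
    proof (rule C)
      show "indep Q (Suc d * h) (\<lambda>j. g ^ (j div h) * b (j mod h))"
        using chain_Suc b by (intro indep_powers[OF Q Q' _ g _ ind]) auto
      fix j assume j: "j < Suc d * h"
      then have h0: "h > 0" by (cases h) auto
      have "j div h \<le> d" using j by (metis less_mult_imp_div_less less_Suc_eq_le)
      then have "j div h * \<delta> + d \<le> ?D" by simp
      then show "g ^ (j div h) * b (j mod h) \<in> polys V \<and> deg_le ?D (g ^ (j div h) * b (j mod h))"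
        using b h0 gV deg_le_mult[OF deg_le_power[OF \<delta>, of "j div h"], of d "b (j mod h)"]
        by (auto intro: deg_le_mono)
    qed
    moreover have "Suc d ^ k \<le> Suc ?D ^ k" by (intro power_mono) auto
    then have "h * Suc d ^ Suc k \<le> Suc d * h * Suc ?D ^ k"
      by (metis mult.commute mult.left_commute mult_le_mono2 power_Suc)
    moreover have "Suc ?D \<le> Suc \<delta> * Suc d" by simp
    then have "Suc ?D ^ card V \<le> Suc \<delta> ^ card V * Suc d ^ card V"
      by (metis power_mono power_mult_distrib zero_le)
    then have "C * Suc ?D ^ card V \<le> C * Suc \<delta> ^ card V * Suc d ^ card V"
      by (metis mult.assoc mult_le_mono2)
    ultimately show "h * Suc d ^ Suc k \<le> C * Suc \<delta> ^ card V * Suc d ^ card V" by linarith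
  qed
qed

theorem chain_length_le:
  assumes "finite V" "polys.chain V k Q0 (Q :: ('v, 'k::field) mpoly set)"
  shows "k \<le> card V"
proof (rule ccontr)
  assume "\<not> ?thesis"
  then have k: "k = Suc (k - 1)" "k - 1 \<ge> card V" by auto
  obtain C where C: "\<And>d h b. indep Q h b \<Longrightarrow> (\<forall>i<h. b i \<in> polys V \<and> deg_le d (b i)) \<Longrightarrow>
    h * Suc d ^ k \<le> C * Suc d ^ card V" using chain_growth[OF assms] by blast
  have Q: "polys.prime_idl V Q" using assms polys.chain_primes by blast
  have Qid: "polys.idl V Q" using Q polys.prime_idl_idl by auto
  have ind: "indep Q 1 (\<lambda>_. 1)"
    unfolding indep_def
  proof (intro allI impI)
    fix c :: "nat \<Rightarrow> 'k" and i :: nat assume *: "(\<Sum>i<1. Const (c i) * 1) \<in> Q" "i < 1"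
    show "c i = 0"
    proof (rule ccontr)
      assume "c i \<noteq> 0"
      have "Const (inverse (c 0)) * Const (c 0) \<in> Q" using * by (intro polys.idl_mult[OF Qid]) auto
      then have "1 \<in> Q" using * \<open>c i \<noteq> 0\<close> by (simp flip: Const_simps(5))
      then show False using polys.prime_idl_one[OF Q] by simp
    qed
  qed
  \<comment> \<open>The polynomial 1 alone is independent modulo \<open>Q\<close>. The degree bound
    is taken to be \<open>C\<close>, so that one extra factor \<open>Suc C\<close> exceeds the
    constant.\<close>
  have "1 * Suc C ^ k \<le> C * Suc C ^ card V"
    using deg_le_mono[OF deg_le_one, of C] by (intro C[OF ind]) auto
  moreover have "Suc C ^ k \<ge> Suc C * Suc C ^ card V"
  proof -
    have "Suc C ^ card V \<le> Suc C ^ (k - 1)" using k(2) by (intro power_increasing) auto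
    then have "Suc C * Suc C ^ card V \<le> Suc C * Suc C ^ (k - 1)" by (rule mult_le_mono2)
    also have "\<dots> = Suc C ^ k" using k(1) by (metis power_Suc)
    finally show ?thesis .
  qed
  ultimately have "Suc C * Suc C ^ card V \<le> C * Suc C ^ card V" by (simp only: mult_1_left)
  then show False by simp
qed

section \<open>Toric primes of collections of cells\<close>

lemma polys_induct [consumes 1, case_names Const Var add mult]:
  assumes "h \<in> polys V" "\<And>c. P (Const c)" "\<And>v. v \<in> V \<Longrightarrow> P (Var v)"
    and "\<And>p q. p \<in> polys V \<Longrightarrow> q \<in> polys V \<Longrightarrow> P p \<Longrightarrow> P q \<Longrightarrow> P (p + q)"
    and "\<And>p q. p \<in> polys V \<Longrightarrow> q \<in> polys V \<Longrightarrow> P p \<Longrightarrow> P q \<Longrightarrow> P (p * q)"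
  shows "P (h :: ('v, 'k::field) mpoly)"
proof -
  have P1: "P 1" using assms(2)[of 1] by simp
  have P0: "P 0" using assms(2)[of 0] by simp
  have pw: "P (Var v ^ n)" if "v \<in> V" for v n
    by (induction n) (use P1 that assms(3,5) in auto)
  have sg: "keys m \<subseteq> V \<Longrightarrow> P (single m c)" if "finite U" "keys m = U" for U m c
    using that
  proof (induction U arbitrary: m rule: finite_induct)
    case empty
    then have "m = 0" by (metis keys_eq_empty)
    then show ?case using assms(2)[of c] by (simp add: Const_def)
  next
    case (insert v U)
    let ?m = "m - single v (lookup m v)"
    have k: "keys ?m = U"
    proof -
      have "keys ?m = keys m - {v}"
        by (auto simp: in_keys_iff lookup_minus lookup_single when_def split: if_splits)
      then show ?thesis using insert by simp
    qed
    have "P (single ?m c * Var v ^ lookup m v)"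
      using insert k pw[of v "lookup m v"] by (intro assms(5) insert.IH[OF _ k] single_polys' polys.power_closed) auto
    then show ?case using single_split[of m c v] by simp
  qed
  have "P (\<Sum>m\<in>A. single m (lookup h m))" if "finite A" "A \<subseteq> keys h" for A
    using that
  proof (induction A rule: finite_induct)
    case (insert m A)
    have "keys m \<subseteq> V" using insert assms(1) by (auto simp: polys_def)
    then have s1: "single m (lookup h m) \<in> polys V" "P (single m (lookup h m))"
      using sg[of "keys m" m] by (auto intro: single_polys')
    have "single x (lookup h x) \<in> polys V" if "x \<in> A" for x
    proof -
      have "x \<in> keys h" using insert that by auto
      then have "keys x \<subseteq> V" using assms(1) by (simp add: polys_def)
      then show ?thesis by (rule single_polys')
    qed
    then have "(\<Sum>m\<in>A. single m (lookup h m)) \<in> polys V" by (rule polys.sum_closed)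
    then show ?case using insert assms(4)[OF s1(1) _ s1(2)] by simp
  qed (use P0 in auto)
  from this[of "keys h"] show ?thesis using mpoly_sum_singles[of h] by simp
qed

section \<open>Evaluation homomorphisms\<close>

definition mon :: "('v \<Rightarrow> 'b::comm_ring_1) \<Rightarrow> ('v \<Rightarrow>\<^sub>0 nat) \<Rightarrow> 'b" where
  "mon g m = (\<Prod>v\<in>keys m. g v ^ lookup m v)"

text \<open>The coefficient map is a parameter because values are taken in the field, in polynomials
  and in fractions of polynomials.\<close>

definition ev :: "('k::field \<Rightarrow> 'b::comm_ring_1) \<Rightarrow> ('v \<Rightarrow> 'b) \<Rightarrow> ('v, 'k) mpoly \<Rightarrow> 'b" where
  "ev \<kappa> g p = (\<Sum>m\<in>keys p. \<kappa> (lookup p m) * mon g m)"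

lemma mon_superset: "finite A \<Longrightarrow> keys m \<subseteq> A \<Longrightarrow> mon g m = (\<Prod>v\<in>A. g v ^ lookup m v)"
  unfolding mon_def by (rule prod.mono_neutral_left) (auto simp: in_keys_iff)

lemma mon_plus: "mon g (m + m') = mon g m * mon g m'"
proof -
  have "mon g x = (\<Prod>v\<in>keys m \<union> keys m'. g v ^ lookup x v)" if "x \<in> {m, m', m + m'}" for x
    using that by (intro mon_superset) (auto simp: keys_plus_nat)
  then show ?thesis by (simp add: lookup_add power_add prod.distrib)
qed

lemma mon_simps [simp]: "mon g 0 = 1" "mon g (single v n) = g v ^ n"
  by (simp_all add: mon_def)

lemma mon_nonzero: "(\<And>v. v \<in> keys m \<Longrightarrow> g v \<noteq> 0) \<Longrightarrow> mon g m \<noteq> (0 :: 'b::idom)"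
  by (simp add: mon_def)

locale coeff_hom =
  fixes \<kappa> :: "'k::field \<Rightarrow> 'b::comm_ring_1"
  assumes hom_one [simp]: "\<kappa> 1 = 1" and hom_add: "\<kappa> (a + b) = \<kappa> a + \<kappa> b" and hom_mult: "\<kappa> (a * b) = \<kappa> a * \<kappa> b"
begin

lemma hom_zero [simp]: "\<kappa> 0 = 0"
  using hom_add[of 0 0] by simp

lemma ev_superset: "finite A \<Longrightarrow> keys p \<subseteq> A \<Longrightarrow> ev \<kappa> g p = (\<Sum>m\<in>A. \<kappa> (lookup p m) * mon g m)"
  unfolding ev_def by (rule sum.mono_neutral_left) (auto simp: in_keys_iff)

lemma ev_add [simp]: "ev \<kappa> g (p + q) = ev \<kappa> g p + ev \<kappa> g q"
proof -
  have "ev \<kappa> g x = (\<Sum>m\<in>keys p \<union> keys q. \<kappa> (lookup x m) * mon g m)" if "x \<in> {p, q, p + q}" for x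
    using that keys_add[of p q] by (intro ev_superset) auto
  then show ?thesis by (simp add: lookup_add hom_add distrib_right sum.distrib)
qed

lemma ev_single [simp]: "ev \<kappa> g (single m c) = \<kappa> c * mon g m"
  by (cases "c = 0") (simp_all add: ev_def)

lemma ev_zero [simp]: "ev \<kappa> g 0 = 0"
  by (simp add: ev_def)

lemma ev_sum: "ev \<kappa> g (sum f A) = (\<Sum>i\<in>A. ev \<kappa> g (f i))"
  by (induction A rule: infinite_finite_induct) simp_all

lemma ev_mult [simp]: "ev \<kappa> g (p * q) = ev \<kappa> g p * ev \<kappa> g q"
proof -
  have "p * q = (\<Sum>m\<in>keys p. \<Sum>n\<in>keys q. single (m + n) (lookup p m * lookup q n))"
    by (subst mpoly_sum_singles[of p], subst mpoly_sum_singles[of q]) (simp add: sum_product mult_single)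
  then have "ev \<kappa> g (p * q) = (\<Sum>m\<in>keys p. \<Sum>n\<in>keys q. (\<kappa> (lookup p m) * mon g m) * (\<kappa> (lookup q n) * mon g n))"
    by (simp add: ev_sum hom_mult mon_plus mult_ac)
  then show ?thesis by (simp add: ev_def sum_product)
qed

lemma ev_one [simp]: "ev \<kappa> g 1 = 1"
  using ev_single[of g 0 1] by simp

lemma ev_Const [simp]: "ev \<kappa> g (Const c) = \<kappa> c"
  by (simp add: Const_def)

lemma ev_Var [simp]: "ev \<kappa> g (Var v) = g v"
  by (simp add: Var_def)

lemma ev_diff [simp]: "ev \<kappa> g (p - q) = ev \<kappa> g p - ev \<kappa> g q"
  using ev_add[of g "p - q" q] by (simp add: algebra_simps)

lemma ev_adj_minor: "ev \<kappa> g (adj_minor (i, j)) = g (i, j) * g (i + 1, j + 1) - g (i, j + 1) * g (i + 1, j)"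
  by (simp add: adj_minor_def)

lemma ev_kernel_idl: "polys.idl V {h \<in> polys V. ev \<kappa> g h = 0}"
  by (rule polys.idlI) auto

lemma ev_gen:
  assumes "X \<subseteq> polys V" "\<And>x. x \<in> X \<Longrightarrow> ev \<kappa> g x = 0" "h \<in> polys.gen V X"
  shows "ev \<kappa> g h = 0"
  using polys.gen_least[OF ev_kernel_idl[of V g], of X] assms by auto

end

lemma ev_kernel_prime:
  fixes \<kappa> :: "'k::field \<Rightarrow> 'b::idom"
  assumes "coeff_hom \<kappa>"
  shows "polys.prime_idl V {h \<in> polys V. ev \<kappa> g h = 0}"
proof -
  interpret coeff_hom \<kappa> by (rule assms)
  show ?thesis unfolding polys.prime_idl_def using ev_kernel_idl[of V g] by auto
qed

lemma coeff_hom_Const: "coeff_hom Const"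
  by unfold_locales auto

text \<open>Fractions require an integral domain; for polynomials this rests on a linear order of
  the variables, here the lexicographic order of points.\<close>

definition to_fr :: "'a::idom \<Rightarrow> 'a fract" where
  "to_fr x = Fraction_Field.Fract x 1"

lemma to_fr_simps [simp]:
  "to_fr (a + b) = to_fr a + to_fr b" "to_fr (a - b) = to_fr a - to_fr b" "to_fr (a * b) = to_fr a * to_fr b" "to_fr 1 = 1" "to_fr a = 0 \<longleftrightarrow> a = 0"
  by (simp_all add: to_fr_def One_fract_def Zero_fract_def eq_fract)

lemma coeff_hom_fr: "coeff_hom (\<lambda>c. to_fr (Const c :: ('v::linorder, 'k::field) mpoly))"
  by unfold_locales auto

lemma ev_compose:
  assumes "coeff_hom \<kappa>" "h \<in> polys V" "\<And>v. v \<in> V \<Longrightarrow> ev \<kappa> g (g' v) = g'' v"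
  shows "ev \<kappa> g (ev Const g' h) = ev \<kappa> g'' h"
proof -
  interpret coeff_hom \<kappa> by (rule assms)
  interpret C: coeff_hom Const by (rule coeff_hom_Const)
  show ?thesis using assms(2) by (induction rule: polys_induct) (auto simp: assms(3))
qed

lemma ev_Const_Var: assumes "h \<in> polys V" "\<And>v. v \<in> V \<Longrightarrow> g v = Var v" shows "ev Const g h = h"
proof -
  interpret C: coeff_hom Const by (rule coeff_hom_Const)
  show ?thesis using assms(1) by (induction rule: polys_induct) (auto simp: assms(2))
qed

text \<open>Within a cell the top corner has the strictly largest value, so the minors can be solved
  for their top corners in this order.\<close>

definition vrank :: "point \<Rightarrow> int" where "vrank p = fst p + snd p"

definition top_corner :: "point \<Rightarrow> point" where "top_corner p = (fst p + 1, snd p + 1)"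

definition minor_eq :: "(point \<Rightarrow> 'b::comm_ring_1) \<Rightarrow> point \<Rightarrow> bool" where
  "minor_eq g p \<longleftrightarrow> g p * g (fst p + 1, snd p + 1) = g (fst p, snd p + 1) * g (fst p + 1, snd p)"

lemma (in coeff_hom) ev_adj_minor_eq_0: "ev \<kappa> g (adj_minor p) = 0 \<longleftrightarrow> minor_eq g p"
  by (cases p) (simp add: ev_adj_minor minor_eq_def)

lemma cell_alt: "cell p = {p, (fst p, snd p + 1), (fst p + 1, snd p), top_corner p}"
  by (cases p) (auto simp: cell_def top_corner_def)

lemma adj_minor_polys: "cell p \<subseteq> V \<Longrightarrow> adj_minor p \<in> polys V"
  by (cases p) (auto simp: adj_minor_def cell_def)

definition pgens :: "point set \<Rightarrow> point set \<Rightarrow> point set \<Rightarrow> (point, 'k::field) mpoly set" where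
  "pgens W D F = Var ` W \<union> adj_minor ` D \<union> (\<lambda>p. Var p - 1) ` F"

text \<open>For admissible data this is the prime of the generic point at which the variables in \<open>W\<close> vanish,
  those in \<open>F\<close> equal \<open>1\<close> and the minors of \<open>D\<close> are solved for their top corners.\<close>

definition psat :: "point set \<Rightarrow> point set \<Rightarrow> point set \<Rightarrow> point set \<Rightarrow> (point, 'k::field) mpoly set" where
  "psat V W D F = {h \<in> polys V. \<exists>m. keys m \<subseteq> V - W \<and> single m 1 * h \<in> polys.gen V (pgens W D F)}"

text \<open>\<open>F\<close> avoids the top corners because these coordinates are determined by the
  minors. What is left outside \<open>W\<close>, \<open>F\<close> and the top corners are the free
  coordinates.\<close>

definition admissible :: "point set \<Rightarrow> point set \<Rightarrow> point set \<Rightarrow> point set \<Rightarrow> bool" where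
  "admissible V W D F \<longleftrightarrow> finite V \<and> finite D \<and> W \<subseteq> V \<and> (\<forall>p\<in>D. cell p \<subseteq> V - W) \<and> F \<subseteq> V - W - top_corner ` D"

lemma pgens_polys: "admissible V W D F \<Longrightarrow> pgens W D F \<subseteq> polys V"
  unfolding pgens_def admissible_def
  by (auto intro!: adj_minor_polys polys.diff_closed)

lemma pgens_mono: "W \<subseteq> W' \<Longrightarrow> D \<subseteq> D' \<Longrightarrow> F \<subseteq> F' \<Longrightarrow> pgens W D F \<subseteq> pgens W' D' F'"
  by (auto simp: pgens_def)

lemma psat_inc: "admissible V W D F \<Longrightarrow> polys.gen V (pgens W D F) \<subseteq> psat V W D F"
  unfolding psat_def using polys.gen_sub[OF pgens_polys[of V W D F]]
  by (auto intro!: exI[of _ 0])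

text \<open>The saturating monomials do not vanish at \<open>g\<close>, so a multiple in the
  generated ideal is enough.\<close>

lemma psat_kill:
  fixes \<kappa> :: "'k::field \<Rightarrow> 'b::idom"
  assumes "coeff_hom \<kappa>" "admissible V W D F" "\<And>v. v \<in> W \<Longrightarrow> g v = 0" "\<And>v. v \<in> V - W \<Longrightarrow> g v \<noteq> 0"
    "\<And>p. p \<in> D \<Longrightarrow> minor_eq g p" "\<And>v. v \<in> F \<Longrightarrow> g v = 1" "h \<in> psat V W D F"
  shows "ev \<kappa> g h = 0"
proof -
  interpret coeff_hom \<kappa> by (rule assms)
  obtain m where m: "keys m \<subseteq> V - W" "single m 1 * h \<in> polys.gen V (pgens W D F)"
    using assms(7) by (auto simp: psat_def)
  have "ev \<kappa> g (single m 1 * h) = 0"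
    by (rule ev_gen[OF pgens_polys[OF assms(2)] _ m(2)])
      (auto simp: pgens_def assms(3,6) ev_adj_minor_eq_0 assms(5))
  moreover have "mon g m \<noteq> 0" using m assms(4) by (intro mon_nonzero) auto
  ultimately show ?thesis by simp
qed

text \<open>The saturating monomials stay outside \<open>Q\<close>. This makes \<open>psat\<close>
  the least prime that contains the generators and no variable outside \<open>W\<close>.\<close>

lemma psat_below_prime:
  assumes "polys.prime_idl V Q" "pgens W D F \<subseteq> Q" "\<And>v. v \<in> V - W \<Longrightarrow> Var v \<notin> Q"
  shows "psat V W D F \<subseteq> (Q :: (point, 'k::field) mpoly set)"
proof
  fix h :: "(point, 'k) mpoly" assume "h \<in> psat V W D F"
  then obtain m where h: "h \<in> polys V" and m: "keys m \<subseteq> V - W" "single m 1 * h \<in> polys.gen V (pgens W D F)"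
    by (auto simp: psat_def)
  have Qid: "polys.idl V Q" using assms(1) polys.prime_idl_idl by auto
  have "single m 1 * h \<in> Q" using m(2) polys.gen_least[OF Qid assms(2)] by auto
  moreover have "single m 1 \<notin> Q"
  proof -
    interpret C: coeff_hom Const by (rule coeff_hom_Const)
    have "single m 1 = (\<Prod>v\<in>keys m. Var v ^ lookup m v :: (point, 'k) mpoly)"
      using ev_Const_Var[of "single m (1 :: 'k)" UNIV Var] C.ev_single[of Var m 1] by (simp add: polys_def mon_def)
    moreover have "(\<Prod>v\<in>keys m. Var v ^ lookup m v) \<notin> Q"
    proof
      assume *: "(\<Prod>v\<in>keys m. Var v ^ lookup m v) \<in> Q"
      have "\<exists>v\<in>keys m. Var v ^ lookup m v \<in> Q"
        by (rule polys.prime_idl_prod[OF assms(1) _ _ *]) (use m in \<open>auto intro: polys.power_closed\<close>)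
      then show False using polys.prime_idl_power[OF assms(1)] m assms(3) by (metis Diff_iff Var_polys subset_iff)
    qed
    ultimately show ?thesis by simp
  qed
  moreover have "single m 1 \<in> polys V" using m by (intro single_polys') auto
  ultimately show "h \<in> Q" using polys.prime_idl_mult[OF assms(1) _ h] by blast
qed

text \<open>At the generic point each coordinate outside \<open>W\<close> is a quotient of two
  monomials in the free coordinates. The induction follows \<open>vrank\<close> and solves the minor
  whose top corner is \<open>v\<close>.\<close>

lemma psat_reduce_Var:
  assumes adm: "admissible V W D F" and v: "v \<in> V - W"
  shows "\<exists>m1 m2. keys m1 \<subseteq> V - W - top_corner ` D - F \<and> keys m2 \<subseteq> V - W - top_corner ` D - F \<and>
    single m1 1 * Var v - single m2 1 \<in> polys.gen V (pgens W D F :: (point, 'k::field) mpoly set)"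
  using v
proof (induction "card {u\<in>V. vrank u < vrank v}" arbitrary: v rule: less_induct)
  case less
  let ?I = "polys.gen V (pgens W D F) :: (point, 'k) mpoly set"
  let ?U = "V - W - top_corner ` D - F"
  have I: "polys.idl V ?I" by (rule polys.gen_idl[OF pgens_polys[OF adm]])
  consider "v \<in> ?U" | "v \<in> F" | "v \<in> top_corner ` D" using less.prems by auto
  then show ?case
  proof cases
    case 1
    then show ?thesis using polys.idl_zero[OF I]
      by (intro exI[of _ 0] exI[of _ "single v 1"]) (auto simp: Var_def)
  next
    case 2
    then have "Var v - 1 \<in> ?I" by (intro polys.gen_inc) (auto simp: pgens_def)
    then show ?thesis by (intro exI[of _ 0]) auto
  next
    case 3
    then obtain p where p: "p \<in> D" "v = top_corner p" by auto
    let ?c = "(fst p, snd p + 1)" and ?d = "(fst p + 1, snd p)"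
    have cV: "cell p \<subseteq> V - W" using adm p by (auto simp: admissible_def)
    then have V3: "p \<in> V - W" "?c \<in> V - W" "?d \<in> V - W" "v \<in> V - W" unfolding cell_alt p(2) by auto
    have fin: "finite V" using adm by (simp add: admissible_def)
    have IH: "\<exists>m1 m2. keys m1 \<subseteq> ?U \<and> keys m2 \<subseteq> ?U \<and> single m1 1 * Var u - single m2 1 \<in> ?I"
      if "u \<in> V - W" "vrank u < vrank v" for u
    proof (rule less.hyps[OF _ that(1)])
      show "card {x \<in> V. vrank x < vrank u} < card {x \<in> V. vrank x < vrank v}"
        using that fin by (intro psubset_card_mono) auto
    qed
    have rk: "vrank p < vrank v" "vrank ?c < vrank v" "vrank ?d < vrank v" by (simp_all add: vrank_def p top_corner_def)
    obtain a1 a2 where a: "keys a1 \<subseteq> ?U" "keys a2 \<subseteq> ?U" "single a1 1 * Var p - single a2 1 \<in> ?I" using IH[OF V3(1) rk(1)] by auto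
    obtain c1 c2 where c: "keys c1 \<subseteq> ?U" "keys c2 \<subseteq> ?U" "single c1 1 * Var ?c - single c2 1 \<in> ?I" using IH[OF V3(2) rk(2)] by auto
    obtain d1 d2 where d: "keys d1 \<subseteq> ?U" "keys d2 \<subseteq> ?U" "single d1 1 * Var ?d - single d2 1 \<in> ?I" using IH[OF V3(3) rk(3)] by auto
    have "adj_minor p \<in> ?I" using p by (intro polys.gen_inc) (auto simp: pgens_def)
    then have f: "Var p * Var v - Var ?c * Var ?d \<in> ?I" by (cases p) (simp add: adj_minor_def p(2) top_corner_def)
    define A1 A2 C1 C2 D1 D2 :: "(point, 'k) mpoly" where AA: "A1 = single a1 1" "A2 = single a2 1" "C1 = single c1 1" "C2 = single c2 1" "D1 = single d1 1" "D2 = single d2 1"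
    have mem: "A1 \<in> polys V" "A2 \<in> polys V" "C1 \<in> polys V" "C2 \<in> polys V" "D1 \<in> polys V" "D2 \<in> polys V"
      unfolding AA using a c d by (auto intro!: single_polys')
    have vm: "Var v \<in> polys V" "Var ?d \<in> polys V" using V3 by auto
    \<comment> \<open>Substitution of the reductions of the three lower corners into the minor,
      after multiplication by \<open>A1 * C1 * D1\<close>.\<close>
    have "(A1 * C1 * D1) * (Var p * Var v - Var ?c * Var ?d) - (C1 * D1 * Var v) * (A1 * Var p - A2)
        + (A1 * D1 * Var ?d) * (C1 * Var ?c - C2) + (A1 * C2) * (D1 * Var ?d - D2) \<in> ?I"
      by (intro polys.idl_add[OF I polys.idl_add[OF I polys.idl_diff[OF I polys.idl_mult[OF I _ f]
            polys.idl_mult[OF I _ a(3)[folded AA]]] polys.idl_mult[OF I _ c(3)[folded AA]]]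
            polys.idl_mult[OF I _ d(3)[folded AA]]] polys.mult_closed mem vm)
    then have "(A2 * C1 * D1) * Var v - A1 * C2 * D2 \<in> ?I" by (simp add: algebra_simps)
    then have "single (a2 + c1 + d1) 1 * Var v - single (a1 + c2 + d2) 1 \<in> ?I" by (simp add: AA mult_single)
    moreover have "keys (a2 + c1 + d1) \<subseteq> ?U" "keys (a1 + c2 + d2) \<subseteq> ?U" using a c d by (auto simp: keys_plus_nat)
    ultimately show ?thesis by blast
  qed
qed

lemma psat_reduce:
  assumes adm: "admissible V W D F" and h: "h \<in> polys V"
  shows "\<exists>m h'. keys m \<subseteq> V - W - top_corner ` D - F \<and> h' \<in> polys (V - W - top_corner ` D - F) \<and>
    single m 1 * h - h' \<in> polys.gen V (pgens W D F :: (point, 'k::field) mpoly set)"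
  using h
proof (induction rule: polys_induct)
  let ?I = "polys.gen V (pgens W D F) :: (point, 'k) mpoly set"
  let ?U = "V - W - top_corner ` D - F"
  have I: "polys.idl V ?I" by (rule polys.gen_idl[OF pgens_polys[OF adm]])
  have UV: "polys ?U \<subseteq> polys V" by (rule polys_mono) auto
  case (Const c)
  show ?case using polys.idl_zero[OF I] by (intro exI[of _ 0] exI[of _ "Const c"]) auto
next
  let ?I = "polys.gen V (pgens W D F) :: (point, 'k) mpoly set"
  let ?U = "V - W - top_corner ` D - F"
  case (Var v)
  show ?case
  proof (cases "v \<in> W")
    case True
    then have "Var v \<in> ?I" by (intro polys.gen_inc) (auto simp: pgens_def)
    then show ?thesis by (intro exI[of _ 0] exI[of _ 0]) auto
  next
    case False
    then obtain m1 m2 where "keys m1 \<subseteq> ?U" "keys m2 \<subseteq> ?U" "single m1 1 * Var v - single m2 1 \<in> ?I"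
      using psat_reduce_Var[OF adm, of v] Var by blast
    then show ?thesis by (intro exI[of _ m1] exI[of _ "single m2 1"]) (auto intro: single_polys')
  qed
next
  let ?I = "polys.gen V (pgens W D F) :: (point, 'k) mpoly set"
  let ?U = "V - W - top_corner ` D - F"
  have I: "polys.idl V ?I" by (rule polys.gen_idl[OF pgens_polys[OF adm]])
  have UV: "polys ?U \<subseteq> polys V" by (rule polys_mono) auto
  {
    case (add p q)
    then obtain m p' n q' where *: "keys m \<subseteq> ?U" "p' \<in> polys ?U" "single m 1 * p - p' \<in> ?I"
      "keys n \<subseteq> ?U" "q' \<in> polys ?U" "single n 1 * q - q' \<in> ?I" by blast
    have mn: "single m 1 \<in> polys ?U" "single n 1 \<in> polys ?U" using * by (auto intro: single_polys')
    have smn: "single (m + n) (1 :: 'k) = single m 1 * single n 1" by (simp add: mult_single)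
    have "single n 1 * (single m 1 * p - p') + single m 1 * (single n 1 * q - q') \<in> ?I"
      using * mn UV by (intro polys.idl_add[OF I] polys.idl_mult[OF I]) auto
    then have "single (m + n) 1 * (p + q) - (single n 1 * p' + single m 1 * q') \<in> ?I"
      unfolding smn by (simp add: algebra_simps)
    moreover have "single n 1 * p' + single m 1 * q' \<in> polys ?U"
      by (intro polys.add_closed polys.mult_closed mn *)
    ultimately show ?case using * by (intro exI[of _ "m + n"]) (auto simp: keys_plus_nat)
  next
    case (mult p q)
    then obtain m p' n q' where *: "keys m \<subseteq> ?U" "p' \<in> polys ?U" "single m 1 * p - p' \<in> ?I"
      "keys n \<subseteq> ?U" "q' \<in> polys ?U" "single n 1 * q - q' \<in> ?I" by blast
    have mn: "single m 1 \<in> polys ?U" "single n 1 \<in> polys ?U" using * by (auto intro: single_polys')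
    have smn: "single (m + n) (1 :: 'k) = single m 1 * single n 1" by (simp add: mult_single)
    have "(single n 1 * q) * (single m 1 * p - p') + p' * (single n 1 * q - q') \<in> ?I"
      using * mn UV mult by (intro polys.idl_add[OF I] polys.idl_mult[OF I] polys.mult_closed) auto
    then have "single (m + n) 1 * (p * q) - p' * q' \<in> ?I"
      unfolding smn by (simp add: algebra_simps)
    moreover have "p' * q' \<in> polys ?U" by (intro polys.mult_closed *)
    ultimately show ?case using * by (intro exI[of _ "m + n"] exI[of _ "p' * q'"]) (auto simp: keys_plus_nat)
  }
qed

text \<open>A polynomial vanishing at \<open>g\<close> becomes, after multiplication by a monomial,
  congruent to one in the free coordinates. That one also vanishes at \<open>g\<close> and is 0 by
  \<open>inj\<close>, so membership is decided at a single sufficiently general point.\<close>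

lemma psat_eq_kernel:
  fixes \<kappa> :: "'k::field \<Rightarrow> 'b::idom"
  assumes "coeff_hom \<kappa>" "admissible V W D F" "\<And>v. v \<in> W \<Longrightarrow> g v = 0" "\<And>v. v \<in> V - W \<Longrightarrow> g v \<noteq> 0"
    "\<And>p. p \<in> D \<Longrightarrow> minor_eq g p" "\<And>v. v \<in> F \<Longrightarrow> g v = 1"
    and inj: "\<And>h. h \<in> polys (V - W - top_corner ` D - F) \<Longrightarrow> ev \<kappa> g h = 0 \<Longrightarrow> h = 0"
  shows "psat V W D F = {h \<in> polys V. ev \<kappa> g h = 0}"
proof
  have kill: "ev \<kappa> g h = 0" if "h \<in> psat V W D F" for h
    by (rule psat_kill[OF assms(1,2)]) (use assms that in auto)
  then show "psat V W D F \<subseteq> {h \<in> polys V. ev \<kappa> g h = 0}" by (auto simp: psat_def)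
  interpret coeff_hom \<kappa> by (rule assms)
  show "{h \<in> polys V. ev \<kappa> g h = 0} \<subseteq> psat V W D F"
  proof clarify
    fix h :: "(point, 'k) mpoly" assume h: "h \<in> polys V" "ev \<kappa> g h = 0"
    from psat_reduce[OF assms(2) h(1)] obtain m h' where m: "keys m \<subseteq> V - W - top_corner ` D - F"
      and h': "h' \<in> polys (V - W - top_corner ` D - F)" and I: "single m 1 * h - h' \<in> polys.gen V (pgens W D F)" by blast
    have "single m 1 * h - h' \<in> psat V W D F" using psat_inc[OF assms(2)] I by auto
    then have "ev \<kappa> g (single m 1 * h - h') = 0" by (rule kill)
    then have "h' = 0" using inj[OF h'] h by simp
    then show "h \<in> psat V W D F" using h m I by (auto simp: psat_def)
  qed
qed

lemma solve_minor_eqs: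
  fixes \<iota> :: "point \<Rightarrow> 'b::field"
  assumes "finite D" "\<And>v. \<iota> v \<noteq> 0"
  shows "\<exists>\<tau>. (\<forall>v. v \<notin> top_corner ` D \<longrightarrow> \<tau> v = \<iota> v) \<and> (\<forall>v. \<tau> v \<noteq> 0) \<and> (\<forall>p\<in>D. minor_eq \<tau> p)"
  using assms(1)
proof (induction rule: finite_ranking_induct[where f = vrank])
  case empty
  then show ?case using assms(2) by (intro exI[of _ \<iota>]) auto
next
  case (insert x S)
  then obtain \<tau> where \<tau>: "\<And>v. v \<notin> top_corner ` S \<Longrightarrow> \<tau> v = \<iota> v" "\<And>v. \<tau> v \<noteq> 0" "\<And>p. p \<in> S \<Longrightarrow> minor_eq \<tau> p" by blast
  show ?case
  proof (cases "x \<in> S")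
    case True
    then show ?thesis using \<tau> by (intro exI[of _ \<tau>]) (auto simp: insert_absorb)
  next
    case False
    let ?b = "top_corner x"
    define \<tau>' where "\<tau>' = \<tau>(?b := \<tau> (fst x, snd x + 1) * \<tau> (fst x + 1, snd x) / \<tau> x)"
    have "minor_eq \<tau>' p" if p: "p \<in> S" for p
    proof -
      \<comment> \<open>Cells are added in the order of \<open>vrank\<close>, so the coordinate
        changed last belongs to no earlier cell.\<close>
      have "vrank p \<le> vrank x" "p \<noteq> x" using insert p False by auto
      then have "?b \<notin> cell p" by (auto simp: cell_alt top_corner_def vrank_def prod_eq_iff)
      then have "\<tau>' u = \<tau> u" if "u \<in> cell p" for u using that by (auto simp: \<tau>'_def)
      then show ?thesis using \<tau>(3)[OF p] by (simp add: minor_eq_def cell_alt top_corner_def)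
    qed
    moreover have "minor_eq \<tau>' x"
    proof -
      have "x \<noteq> ?b" "(fst x, snd x + 1) \<noteq> ?b" "(fst x + 1, snd x) \<noteq> ?b" by (auto simp: top_corner_def prod_eq_iff)
      then show ?thesis using \<tau>(2)[of x] by (simp add: minor_eq_def \<tau>'_def flip: top_corner_def)
    qed
    moreover have "\<tau>' v \<noteq> 0" for v using \<tau>(2) by (simp add: \<tau>'_def)
    moreover have "\<tau>' v = \<iota> v" if "v \<notin> top_corner ` insert x S" for v
      using that \<tau>(1)[of v] by (auto simp: \<tau>'_def)
    ultimately show ?thesis by (intro exI[of _ \<tau>']) auto
  qed
qed

lemma psat_generic_point:
  assumes adm: "admissible V W D F"
  shows "\<exists>g :: point \<Rightarrow> (point, 'k::field) mpoly fract.
    psat V W D F = {h \<in> polys V. ev (\<lambda>c. to_fr (Const c)) g h = 0} \<and> (\<forall>v\<in>V - W - top_corner ` D - F. g v = to_fr (Var v))"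
proof -
  define \<iota> where "\<iota> v = (if v \<in> F then 1 else to_fr (Var v :: (point, 'k) mpoly))" for v
  have "Var v \<noteq> (0 :: (point, 'k) mpoly)" for v
    by (metis Var_def lookup_single_eq lookup_zero zero_neq_one)
  then have "\<iota> v \<noteq> 0" for v by (simp add: \<iota>_def)
  moreover have "finite D" using adm by (simp add: admissible_def)
  ultimately obtain \<tau> where \<tau>: "\<And>v. v \<notin> top_corner ` D \<Longrightarrow> \<tau> v = \<iota> v" "\<And>v. \<tau> v \<noteq> 0" "\<And>p. p \<in> D \<Longrightarrow> minor_eq \<tau> p"
    using solve_minor_eqs[of D \<iota>] by blast
  define g where "g v = (if v \<in> W then 0 else \<tau> v)" for v
  interpret H: coeff_hom "\<lambda>c. to_fr (Const c :: (point, 'k) mpoly)" by (rule coeff_hom_fr)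
  have gU: "g v = to_fr (Var v)" if "v \<in> V - W - top_corner ` D - F" for v
    using that \<tau>(1)[of v] by (auto simp: g_def \<iota>_def)
  have "psat V W D F = {h \<in> polys V. ev (\<lambda>c. to_fr (Const c)) g h = 0}"
  proof (rule psat_eq_kernel[OF coeff_hom_fr adm])
    show "minor_eq g p" if "p \<in> D" for p
    proof -
      have "cell p \<inter> W = {}" using adm that by (auto simp: admissible_def)
      then have "g u = \<tau> u" if "u \<in> cell p" for u using that by (auto simp: g_def)
      then show ?thesis using \<tau>(3)[OF that] by (simp add: minor_eq_def cell_alt top_corner_def)
    qed
    show "g v = 1" if "v \<in> F" for v using that adm \<tau>(1)[of v] by (auto simp: g_def \<iota>_def admissible_def)
    fix h :: "(point, 'k) mpoly" assume h: "h \<in> polys (V - W - top_corner ` D - F)" "ev (\<lambda>c. to_fr (Const c)) g h = 0"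
    have "ev (\<lambda>c. to_fr (Const c)) g h = to_fr h" using h(1)
      by (induction rule: polys_induct) (simp_all add: gU)
    then show "h = 0" using h by simp
  qed (use \<tau> in \<open>auto simp: g_def\<close>)
  then show ?thesis using gU by blast
qed

lemma psat_prime:
  assumes "admissible V W D F"
  shows "polys.prime_idl V (psat V W D F :: (point, 'k::field) mpoly set)"
proof -
  obtain g :: "point \<Rightarrow> (point, 'k) mpoly fract" where
    g: "psat V W D F = {h \<in> polys V. ev (\<lambda>c. to_fr (Const c)) g h = 0}"
    using psat_generic_point[OF assms] by blast
  show ?thesis unfolding g by (rule ev_kernel_prime[OF coeff_hom_fr])
qed

section \<open>Chains of primes between the toric primes\<close>

lemma chain_W:
  assumes "finite V" "W \<subseteq> V"
  shows "polys.chain V (card W) (psat V {} {} {}) (psat V W {} {} :: (point, 'k::field) mpoly set)"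
proof -
  have "finite W" using assms finite_subset by auto
  then show ?thesis using assms(2)
  proof (induction W rule: finite_induct)
    case empty
    then show ?case using assms by (auto intro!: polys.chain_0 psat_prime simp: admissible_def)
  next
    case (insert w W)
    interpret C: coeff_hom Const by (rule coeff_hom_Const)
    have adm: "admissible V W {} {}" "admissible V (insert w W) {} {}" using insert assms by (auto simp: admissible_def)
    let ?g = "\<lambda>W v. if v \<in> W then 0 else Var v :: (point, 'k) mpoly"
    have nz: "Var v \<noteq> (0 :: (point, 'k) mpoly)" for v
      by (metis Var_def lookup_single_eq lookup_zero zero_neq_one)
    have ker: "psat V W' {} {} = {h \<in> polys V. ev Const (?g W') h = 0}" if "admissible V W' {} {}" for W'
    proof -
      have inj: "h = 0" if "h \<in> polys (V - W')" "ev Const (?g W') h = 0" for h :: "(point, 'k) mpoly"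
        using ev_Const_Var[of h "V - W'" "?g W'"] that by auto
      show ?thesis by (rule psat_eq_kernel[OF coeff_hom_Const that]) (use nz inj in auto)
    qed
    have "psat V W {} {} \<subseteq> (psat V (insert w W) {} {} :: (point, 'k) mpoly set)"
      unfolding ker[OF adm(1)] ker[OF adm(2)]
    proof
      fix h :: "(point, 'k) mpoly" assume "h \<in> {h \<in> polys V. ev Const (?g W) h = 0}"
      then have h: "h \<in> polys V" "ev Const (?g W) h = 0" by blast+
      \<comment> \<open>Setting one more variable to 0 factors through setting those of
        \<open>W\<close> to 0, so the kernels increase.\<close>
      have "ev Const (?g (insert w W)) (ev Const (?g W) h) = ev Const (?g (insert w W)) h"
        by (rule ev_compose[OF coeff_hom_Const h(1)]) auto
      then have "ev Const (?g (insert w W)) h = 0" unfolding h(2) by simp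
      then show "h \<in> {h \<in> polys V. ev Const (?g (insert w W)) h = 0}" using h by blast
    qed
    moreover have "Var w \<in> (psat V (insert w W) {} {} :: (point, 'k) mpoly set)" "Var w \<notin> (psat V W {} {} :: (point, 'k) mpoly set)"
      unfolding ker[OF adm(1)] ker[OF adm(2)] using insert nz by auto
    ultimately have "psat V W {} {} \<subset> (psat V (insert w W) {} {} :: (point, 'k) mpoly set)" by blast
    then have "polys.chain V (Suc (card W)) (psat V {} {} {}) (psat V (insert w W) {} {} :: (point, 'k) mpoly set)"
      using insert psat_prime[OF adm(2)] by (intro polys.chain_Suc) auto
    then show ?case using insert by simp
  qed
qed

lemma chain_D:
  assumes "admissible V W D {}"
  shows "polys.chain V (card D) (psat V W {} {}) (psat V W D {} :: (point, 'k::field) mpoly set)"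
proof -
  have "finite D" using assms by (simp add: admissible_def)
  then show ?thesis using assms
  proof (induction rule: finite_ranking_induct[where f = vrank])
    case empty
    then show ?case by (auto intro!: polys.chain_0 psat_prime)
  next
    case (insert x S)
    interpret C: coeff_hom Const by (rule coeff_hom_Const)
    have adm: "admissible V W S {}" using insert by (auto simp: admissible_def)
    show ?case
    proof (cases "x \<in> S")
      case True
      then show ?thesis using insert adm by (simp add: insert_absorb)
    next
      case False
      let ?b = "top_corner x"
      \<comment> \<open>A point that separates the two primes: the newest top corner keeps its
        variable, and every other coordinate outside \<open>W\<close> is 1. No cell of
        \<open>S\<close> contains that corner, while the minor of \<open>x\<close> becomes
        \<open>Var ?b - 1\<close>.\<close>
      define g where "g v = (if v \<in> W then 0 else if v = ?b then Var ?b else 1 :: (point, 'k) mpoly)" for v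
      have nz: "Var v \<noteq> (0 :: (point, 'k) mpoly)" for v
        by (metis Var_def lookup_single_eq lookup_zero zero_neq_one)
      have cx: "cell x \<subseteq> V - W" using insert by (auto simp: admissible_def)
      have "psat V W S {} \<subseteq> (psat V W (insert x S) {} :: (point, 'k) mpoly set)"
        unfolding psat_def using polys.gen_mono[OF pgens_mono[of W W S "insert x S" "{}" "{}"], of V] by blast
      moreover have "adj_minor x \<in> (psat V W (insert x S) {} :: (point, 'k) mpoly set)"
        by (intro subsetD[OF psat_inc[OF insert.prems]] polys.gen_inc) (auto simp: pgens_def)
      moreover have "adj_minor x \<notin> (psat V W S {} :: (point, 'k) mpoly set)"
      proof
        assume "adj_minor x \<in> (psat V W S {} :: (point, 'k) mpoly set)"
        then have "ev Const g (adj_minor x) = 0"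
        proof (rule psat_kill[OF coeff_hom_Const adm, rotated -1])
          fix p assume p: "p \<in> S"
          then have "cell p \<inter> W = {}" using adm by (auto simp: admissible_def)
          moreover have "vrank p \<le> vrank x" "p \<noteq> x" using insert p False by auto
          then have "?b \<notin> cell p" by (auto simp: cell_alt top_corner_def vrank_def prod_eq_iff)
          ultimately have "g u = 1" if "u \<in> cell p" for u using that by (auto simp: g_def)
          then show "minor_eq g p" by (simp add: minor_eq_def cell_alt top_corner_def)
        qed (use nz in \<open>auto simp: g_def\<close>)
        then have "minor_eq g x" by (simp add: C.ev_adj_minor_eq_0)
        moreover have "g x = 1" "g (fst x, snd x + 1) = 1" "g (fst x + 1, snd x) = 1" "g ?b = Var ?b"
          using cx by (auto simp: g_def cell_alt top_corner_def prod_eq_iff)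
        ultimately have "Var ?b = (1 :: (point, 'k) mpoly)" by (simp add: minor_eq_def flip: top_corner_def)
        then have "keys (Var ?b :: (point, 'k) mpoly) = keys (1 :: (point, 'k) mpoly)" by simp
        then have "single ?b (1::nat) = 0" by (simp add: Var_def)
        then show False by (metis lookup_single_eq lookup_zero zero_neq_one)
      qed
      ultimately have "psat V W S {} \<subset> (psat V W (insert x S) {} :: (point, 'k) mpoly set)" by blast
      then have "polys.chain V (Suc (card S)) (psat V W {} {}) (psat V W (insert x S) {} :: (point, 'k) mpoly set)"
        using insert adm psat_prime[OF insert.prems] by (intro polys.chain_Suc) auto
      then show ?thesis using False insert by simp
    qed
  qed
qed

lemma chain_F:
  assumes "admissible V W D F"
  shows "polys.chain V (card F) (psat V W D {}) (psat V W D F :: (point, 'k::field) mpoly set)"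
proof -
  have "finite F" using assms finite_subset[of F V] by (auto simp: admissible_def)
  then show ?thesis using assms
  proof (induction F rule: finite_induct)
    case empty
    then show ?case by (auto intro!: polys.chain_0 psat_prime)
  next
    case (insert v F)
    have adm: "admissible V W D F" using insert by (auto simp: admissible_def)
    interpret H: coeff_hom "\<lambda>c. to_fr (Const c :: (point, 'k) mpoly)" by (rule coeff_hom_fr)
    have "psat V W D F \<subseteq> (psat V W D (insert v F) :: (point, 'k) mpoly set)"
      unfolding psat_def using polys.gen_mono[OF pgens_mono[of W W D D F "insert v F"], of V] by blast
    moreover have "Var v - 1 \<in> (psat V W D (insert v F) :: (point, 'k) mpoly set)"
      by (intro subsetD[OF psat_inc[OF insert.prems]] polys.gen_inc) (auto simp: pgens_def)
    moreover have "Var v - 1 \<notin> (psat V W D F :: (point, 'k) mpoly set)"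
    proof
      assume *: "Var v - 1 \<in> (psat V W D F :: (point, 'k) mpoly set)"
      obtain g :: "point \<Rightarrow> (point, 'k) mpoly fract" where
        g: "psat V W D F = {h \<in> polys V. ev (\<lambda>c. to_fr (Const c)) g h = 0}" "\<forall>v\<in>V - W - top_corner ` D - F. g v = to_fr (Var v)"
        using psat_generic_point[OF adm] by blast
      have "v \<in> V - W - top_corner ` D - F" using insert by (auto simp: admissible_def)
      then have "to_fr (Var v - 1 :: (point, 'k) mpoly) = 0" using * g by simp
      then have "Var v = (1 :: (point, 'k) mpoly)" by (simp del: to_fr_simps(1-4))
      then have "keys (Var v :: (point, 'k) mpoly) = keys (1 :: (point, 'k) mpoly)" by simp
      then have "single v (1::nat) = 0" by (simp add: Var_def)
      then show False by (metis lookup_single_eq lookup_zero zero_neq_one)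
    qed
    ultimately have "psat V W D F \<subset> (psat V W D (insert v F) :: (point, 'k) mpoly set)" by blast
    then have "polys.chain V (Suc (card F)) (psat V W D {}) (psat V W D (insert v F) :: (point, 'k) mpoly set)"
      using insert adm psat_prime[OF insert.prems] by (intro polys.chain_Suc) auto
    then show ?case using insert by simp
  qed
qed

section \<open>Convex collections without squares and crosses\<close>

text \<open>Cells are represented by their lower left corners. Weak connectedness appears in cut
  form: some king's move leaves every nonempty proper part. Applied to half-planes and quadrants,
  this replaces the handling of paths.\<close>

locale hv_convex =
  fixes G :: "point set"
  assumes row: "(i, j) \<in> G \<Longrightarrow> (l, j) \<in> G \<Longrightarrow> i \<le> k \<Longrightarrow> k \<le> l \<Longrightarrow> (k, j) \<in> G"
    and col: "(i, j) \<in> G \<Longrightarrow> (i, l) \<in> G \<Longrightarrow> j \<le> k \<Longrightarrow> k \<le> l \<Longrightarrow> (i, k) \<in> G"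
    and cut: "T \<subseteq> G \<Longrightarrow> p \<in> T \<Longrightarrow> q \<in> G \<Longrightarrow> q \<notin> T \<Longrightarrow>
      \<exists>x y x' y'. (x, y) \<in> T \<and> (x', y') \<in> G \<and> (x', y') \<notin> T \<and> \<bar>x - x'\<bar> \<le> 1 \<and> \<bar>y - y'\<bar> \<le> 1"

text \<open>The reflections act on cells. When the cell at \<open>(x, y)\<close> goes to
  \<open>(- x, y)\<close>, the vertex \<open>(x, y)\<close> goes to \<open>(1 - x, y)\<close>; this
  is the origin of the shifts by one below.\<close>

definition flipx :: "point set \<Rightarrow> point set" where "flipx G = {(x, y). (- x, y) \<in> G}"
definition flipy :: "point set \<Rightarrow> point set" where "flipy G = {(x, y). (x, - y) \<in> G}"
definition swapxy :: "point set \<Rightarrow> point set" where "swapxy G = {(x, y). (y, x) \<in> G}"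

lemma mem_flips [simp]:
  "(x, y) \<in> flipx G \<longleftrightarrow> (- x, y) \<in> G" "(x, y) \<in> flipy G \<longleftrightarrow> (x, - y) \<in> G" "(x, y) \<in> swapxy G \<longleftrightarrow> (y, x) \<in> G"
  by (auto simp: flipx_def flipy_def swapxy_def)

lemma hv_flipx: assumes "hv_convex G" shows "hv_convex (flipx G)"
proof -
  interpret hv_convex G by (rule assms)
  show ?thesis
  proof
    fix T p q assume *: "T \<subseteq> flipx G" "p \<in> T" "q \<in> flipx G" "q \<notin> T"
    obtain px py qx qy where pq: "p = (px, py)" "q = (qx, qy)" by (cases p, cases q) auto
    have "flipx T \<subseteq> G" using *(1) by auto
    then obtain x y x' y' where "(x, y) \<in> flipx T" "(x', y') \<in> G" "(x', y') \<notin> flipx T" "\<bar>x - x'\<bar> \<le> 1" "\<bar>y - y'\<bar> \<le> 1"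
      using cut[of "flipx T" "(- px, py)" "(- qx, qy)"] * pq by auto
    then show "\<exists>x y x' y'. (x, y) \<in> T \<and> (x', y') \<in> flipx G \<and> (x', y') \<notin> T \<and> \<bar>x - x'\<bar> \<le> 1 \<and> \<bar>y - y'\<bar> \<le> 1"
      by (intro exI[of _ "- x"] exI[of _ y] exI[of _ "- x'"] exI[of _ y']) auto
  next
    show "(k, j) \<in> flipx G" if "(i, j) \<in> flipx G" "(l, j) \<in> flipx G" "i \<le> k" "k \<le> l" for i j k l
      using row[of "- l" j "- i" "- k"] that by simp
    show "(i, k) \<in> flipx G" if "(i, j) \<in> flipx G" "(i, l) \<in> flipx G" "j \<le> k" "k \<le> l" for i j k l
      using col[of "- i" j l k] that by simp
  qed
qed

lemma hv_swapxy: assumes "hv_convex G" shows "hv_convex (swapxy G)"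
proof -
  interpret hv_convex G by (rule assms)
  show ?thesis
  proof
    fix T p q assume *: "T \<subseteq> swapxy G" "p \<in> T" "q \<in> swapxy G" "q \<notin> T"
    obtain px py qx qy where pq: "p = (px, py)" "q = (qx, qy)" by (cases p, cases q) auto
    have "swapxy T \<subseteq> G" using *(1) by auto
    then obtain x y x' y' where "(x, y) \<in> swapxy T" "(x', y') \<in> G" "(x', y') \<notin> swapxy T" "\<bar>x - x'\<bar> \<le> 1" "\<bar>y - y'\<bar> \<le> 1"
      using cut[of "swapxy T" "(py, px)" "(qy, qx)"] * pq by auto
    then show "\<exists>x y x' y'. (x, y) \<in> T \<and> (x', y') \<in> swapxy G \<and> (x', y') \<notin> T \<and> \<bar>x - x'\<bar> \<le> 1 \<and> \<bar>y - y'\<bar> \<le> 1"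
      by (intro exI[of _ y] exI[of _ x] exI[of _ y'] exI[of _ x']) auto
  next
    show "(k, j) \<in> swapxy G" if "(i, j) \<in> swapxy G" "(l, j) \<in> swapxy G" "i \<le> k" "k \<le> l" for i j k l
      using col[of j i l k] that by simp
    show "(i, k) \<in> swapxy G" if "(i, j) \<in> swapxy G" "(i, l) \<in> swapxy G" "j \<le> k" "k \<le> l" for i j k l
      using row[of j i l k] that by simp
  qed
qed

lemma flipy_alt: "flipy G = swapxy (flipx (swapxy G))"
  by auto

lemma hv_flipy: "hv_convex G \<Longrightarrow> hv_convex (flipy G)"
  unfolding flipy_alt by (intro hv_swapxy hv_flipx)

section \<open>Crossing a column\<close>

context hv_convex begin

lemma column_nonempty:
  assumes "(x1, y1) \<in> G" "(x2, y2) \<in> G" "x1 \<le> x" "x \<le> x2"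
  shows "\<exists>y. (x, y) \<in> G"
proof (cases "x1 = x")
  case False
  show ?thesis
  proof (cases "x2 = x")
    case False
    obtain u v u' v' where "(u, v) \<in> {c\<in>G. fst c < x}" "(u', v') \<in> G" "(u', v') \<notin> {c\<in>G. fst c < x}" "\<bar>u - u'\<bar> \<le> 1"
      using cut[of "{c\<in>G. fst c < x}" "(x1, y1)" "(x2, y2)"] assms \<open>x1 \<noteq> x\<close> by auto
    then have "u' = x" by auto
    then show ?thesis using \<open>(u', v') \<in> G\<close> by auto
  qed (use assms in auto)
qed (use assms in auto)

text \<open>Let \<open>k\<close> be the height just below the lowest cell of column
  \<open>x\<close>. A king's move out of the part left of the column and below height
  \<open>k\<close> must end at height \<open>k\<close> on the same side, because the column has no
  cells up to there; likewise on the right. Row convexity then produces the forbidden cell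
  \<open>(x, k)\<close>.\<close>

lemma column_crossing_below:
  assumes p: "(x1, y1) \<in> G" "y1 \<le> h" and q: "(x2, y2) \<in> G" "y2 \<le> h" and x: "x1 \<le> x" "x \<le> x2"
    and low: "\<And>y. (x, y) \<in> G \<Longrightarrow> y > h"
  shows False
proof -
  obtain y0 where "(x, y0) \<in> G" using column_nonempty[OF p(1) q(1) x] by auto
  then have "\<exists>n :: nat. (x, h + 1 + int n) \<in> G"
    using low[of y0] by (intro exI[of _ "nat (y0 - h - 1)"]) auto
  then have ex: "\<exists>n. (x, h + 1 + int n) \<in> G \<and> (\<forall>m<n. (x, h + 1 + int m) \<notin> G)"
    using exists_least_iff[of "\<lambda>n. (x, h + 1 + int n) \<in> G"] by auto
  then obtain n where n: "(x, h + 1 + int n) \<in> G" "\<And>m. m < n \<Longrightarrow> (x, h + 1 + int m) \<notin> G" by auto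
  define k where "k = h + int n"
  have nk: "(x, y) \<notin> G" if "y \<le> k" for y
  proof
    assume "(x, y) \<in> G"
    then have "y > h" by (rule low)
    then have "nat (y - h - 1) < n" using that by (simp add: k_def nat_less_iff)
    then show False using n(2)[of "nat (y - h - 1)"] \<open>(x, y) \<in> G\<close> \<open>y > h\<close> by simp
  qed
  have hk: "h \<le> k" by (simp add: k_def)
  have "(x, y1) \<notin> G" "(x, y2) \<notin> G" using nk[of y1] nk[of y2] p q hk by auto
  then have "x1 \<noteq> x" "x2 \<noteq> x" using p q by auto
  then have x12: "x1 < x" "x < x2" using x by auto
  have "\<exists>u<x. (u, k) \<in> G"
  proof (cases "y1 = k")
    case False
    let ?T = "{c\<in>G. fst c < x \<and> snd c < k}"
    obtain u v u' v' where "(u, v) \<in> ?T" "(u', v') \<in> G" "(u', v') \<notin> ?T" "\<bar>u - u'\<bar> \<le> 1" "\<bar>v - v'\<bar> \<le> 1"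
      using cut[of ?T "(x1, y1)" "(x2, y2)"] p q x12 False hk by auto
    then have "u < x" "v < k" "v' \<le> k" by auto
    then have "u' \<noteq> x" using nk[of v'] \<open>(u', v') \<in> G\<close> by auto
    then have "u' < x" using \<open>u < x\<close> \<open>\<bar>u - u'\<bar> \<le> 1\<close> by auto
    moreover from this have "v' = k" using \<open>(u', v') \<notin> ?T\<close> \<open>(u', v') \<in> G\<close> \<open>v' \<le> k\<close> by auto
    ultimately show ?thesis using \<open>(u', v') \<in> G\<close> by auto
  qed (use p x12 in auto)
  then obtain u where u: "u < x" "(u, k) \<in> G" by auto
  have "\<exists>u>x. (u, k) \<in> G"
  proof (cases "y2 = k")
    case False
    let ?T = "{c\<in>G. fst c > x \<and> snd c < k}"
    obtain u v u' v' where "(u, v) \<in> ?T" "(u', v') \<in> G" "(u', v') \<notin> ?T" "\<bar>u - u'\<bar> \<le> 1" "\<bar>v - v'\<bar> \<le> 1"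
      using cut[of ?T "(x2, y2)" "(x1, y1)"] p q x12 False hk by auto
    then have "u > x" "v < k" "v' \<le> k" by auto
    then have "u' \<noteq> x" using nk[of v'] \<open>(u', v') \<in> G\<close> by auto
    then have "u' > x" using \<open>u > x\<close> \<open>\<bar>u - u'\<bar> \<le> 1\<close> by auto
    moreover from this have "v' = k" using \<open>(u', v') \<notin> ?T\<close> \<open>(u', v') \<in> G\<close> \<open>v' \<le> k\<close> by auto
    ultimately show ?thesis using \<open>(u', v') \<in> G\<close> by auto
  qed (use q x12 in auto)
  then obtain u' where "x < u'" "(u', k) \<in> G" by auto
  then have "(x, k) \<in> G" using row[of u k u' x] u by auto
  then show False using nk[of k] by simp
qed

end

text \<open>Cells of column \<open>x\<close> both above and below the interval of heights would fill
  it by column convexity, so all of them lie on one side, which \<open>column_crossing_below\<close>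
  and its reflection exclude. Connectedness enters the analysis of forks only through this discrete
  intermediate value property.\<close>

lemma column_crossing:
  assumes "hv_convex G" "(x1, y1) \<in> G" "(x2, y2) \<in> G" "x1 \<le> x" "x \<le> x2"
  shows "\<exists>y. (x, y) \<in> G \<and> min y1 y2 \<le> y \<and> y \<le> max y1 y2"
proof (rule ccontr)
  assume n: "\<not> ?thesis"
  interpret hv_convex G by (rule assms)
  interpret F: hv_convex "flipy G" by (rule hv_flipy[OF assms(1)])
  have "(\<forall>y. (x, y) \<in> G \<longrightarrow> y > max y1 y2) \<or> (\<forall>y. (x, y) \<in> G \<longrightarrow> y < min y1 y2)"
  proof (rule ccontr)
    assume "\<not> ?thesis"
    then obtain y y' where yy: "(x, y) \<in> G" "(x, y') \<in> G" "\<not> y > max y1 y2" "\<not> y' < min y1 y2" by auto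
    then have "\<not> (min y1 y2 \<le> y \<and> y \<le> max y1 y2)" "\<not> (min y1 y2 \<le> y' \<and> y' \<le> max y1 y2)" using n by blast+
    then have *: "(x, y) \<in> G" "(x, y') \<in> G" "y < min y1 y2" "y' > max y1 y2" using yy by linarith+
    then have "(x, y1) \<in> G" using col[of x y y' y1] by auto
    then show False using n by (meson max.cobounded1 min.cobounded1)
  qed
  then show False
  proof
    assume "\<forall>y. (x, y) \<in> G \<longrightarrow> y > max y1 y2"
    then show False using column_crossing_below[of x1 y1 "max y1 y2" x2 y2 x] assms by auto
  next
    assume "\<forall>y. (x, y) \<in> G \<longrightarrow> y < min y1 y2"
    then show False using F.column_crossing_below[of x1 "- y1" "- min y1 y2" x2 "- y2" x] assms by fastforce
  qed
qed

section \<open>Forks and collisions of antidiagonals\<close>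

definition no_square :: "point set \<Rightarrow> bool" where
  "no_square G \<longleftrightarrow> (\<forall>i j. \<not> ((i, j) \<in> G \<and> (i + 1, j) \<in> G \<and> (i, j + 1) \<in> G \<and> (i + 1, j + 1) \<in> G))"

definition no_cross :: "point set \<Rightarrow> bool" where
  "no_cross G \<longleftrightarrow> (\<forall>i j. \<not> ((i, j) \<in> G \<and> (i + 1, j) \<in> G \<and> (i - 1, j) \<in> G \<and> (i, j + 1) \<in> G \<and> (i, j - 1) \<in> G))"

lemma no_squareD: "no_square G \<Longrightarrow> (i, j) \<in> G \<Longrightarrow> (i + 1, j) \<in> G \<Longrightarrow> (i, j + 1) \<in> G \<Longrightarrow> (i + 1, j + 1) \<in> G \<Longrightarrow> False"
  unfolding no_square_def by blast

lemma no_square_flipx: "no_square G \<Longrightarrow> no_square (flipx G)"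
  unfolding no_square_def
proof (intro allI notI)
  fix i j assume n: "\<forall>i j. \<not> ((i, j) \<in> G \<and> (i + 1, j) \<in> G \<and> (i, j + 1) \<in> G \<and> (i + 1, j + 1) \<in> G)"
    and *: "(i, j) \<in> flipx G \<and> (i + 1, j) \<in> flipx G \<and> (i, j + 1) \<in> flipx G \<and> (i + 1, j + 1) \<in> flipx G"
  show False using n[rule_format, of "- i - 1" j] * by simp
qed

lemma no_square_swapxy: "no_square G \<Longrightarrow> no_square (swapxy G)"
  unfolding no_square_def by simp

lemma no_square_flipy: "no_square G \<Longrightarrow> no_square (flipy G)"
  unfolding flipy_alt by (intro no_square_swapxy no_square_flipx)

text \<open>A fork at the lower left end of a staircase running to the upper right: the cell \<open>(i, j)\<close>
  carries a straight horizontal tail on its left and a straight vertical tail below.\<close>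

definition forkSW :: "point set \<Rightarrow> int \<Rightarrow> int \<Rightarrow> bool" where
  "forkSW G i j \<longleftrightarrow> (i, j) \<in> G \<and> (i - 1, j) \<in> G \<and> (i, j - 1) \<in> G \<and>
     (\<forall>x y. (x, y) \<in> G \<and> x < i \<longrightarrow> y = j) \<and> (\<forall>x y. (x, y) \<in> G \<and> y < j \<longrightarrow> x = i)"

abbreviation "rot G \<equiv> flipx (flipy G)"

definition forkNE :: "point set \<Rightarrow> int \<Rightarrow> int \<Rightarrow> bool" where
  "forkNE G i j \<longleftrightarrow> forkSW (rot G) (1 - i) (1 - j)"

text \<open>As a vertex, \<open>(i, j)\<close> is the lower right corner of the first cell and the
  upper left corner of the second. These are exactly the vertices that are antidiagonal corners of
  two cells, hence the possible collisions when each cell picks an antidiagonal corner.\<close>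

definition anti :: "point set \<Rightarrow> int \<Rightarrow> int \<Rightarrow> bool" where
  "anti G i j \<longleftrightarrow> (i - 1, j) \<in> G \<and> (i, j - 1) \<in> G"

text \<open>Every collision sits at an end of the staircase, where it can be resolved on one
  tail.\<close>

definition forks :: "point set \<Rightarrow> bool" where
  "forks G \<longleftrightarrow> (\<forall>i j. anti G i j \<longrightarrow> forkSW G i j \<or> forkNE G i j)"

lemma anti_rot: "anti (rot G) (1 - i) (1 - j) \<longleftrightarrow> anti G i j"
  by (auto simp: anti_def)

lemma anti_swapxy: "anti (swapxy G) j i \<longleftrightarrow> anti G i j"
  by (auto simp: anti_def)

lemma forkSW_swapxy: "forkSW (swapxy G) j i \<longleftrightarrow> forkSW G i j"
  by (auto simp: forkSW_def)

lemma corner_mem: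
  assumes "hv_convex G" "anti G i j" "(x, y) \<in> G" "x \<ge> i" "y \<ge> j"
  shows "(i, j) \<in> G"
proof -
  interpret hv_convex G by (rule assms)
  obtain h where "(i, h) \<in> G" "h \<ge> j"
    using column_crossing[OF assms(1), of "i - 1" j x y i] assms by (auto simp: anti_def)
  then show ?thesis using col[of i "j - 1" h j] assms by (auto simp: anti_def)
qed

text \<open>Crossing column \<open>i - 1\<close> on the way to such a cell would fill
  \<open>(i - 1, j - 1)\<close> and complete a square around the vertex
  \<open>(i, j)\<close>.\<close>

lemma no_cell_SW:
  assumes G: "hv_convex G" "no_square G" and v: "anti G i j" "(i, j) \<in> G" and r: "(x, y) \<in> G" "x < i" "y < j"
  shows False
proof -
  interpret hv_convex G by (rule G)
  obtain h where "(i - 1, h) \<in> G" "h \<le> j - 1"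
    using column_crossing[OF G(1), of x y i "j - 1" "i - 1"] v r by (auto simp: anti_def)
  then have "(i - 1, j - 1) \<in> G" using col[of "i - 1" h j "j - 1"] v by (auto simp: anti_def)
  then show False using no_squareD[OF G(2), of "i - 1" "j - 1"] v by (auto simp: anti_def)
qed

text \<open>A cell on the left outside row \<open>j\<close> must be above that row. Crossings of the
  columns \<open>i - 1\<close> and \<open>i\<close> between it and \<open>(x', y')\<close> then fill
  the square whose lower left cell is \<open>(i - 1, j)\<close>.\<close>

lemma left_tail:
  assumes G: "hv_convex G" "no_square G" and v: "anti G i j" "(i, j) \<in> G"
    and q: "(x', y') \<in> G" "x' \<ge> i" "y' > j" and r: "(x, y) \<in> G" "x < i"
  shows "y = j"
proof (rule ccontr)
  assume "y \<noteq> j"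
  interpret hv_convex G by (rule G)
  have "y > j" using no_cell_SW[OF G v r] \<open>y \<noteq> j\<close> by force
  obtain h where "(i - 1, h) \<in> G" "h \<ge> j + 1"
    using column_crossing[OF G(1), of x y x' y' "i - 1"] q r \<open>y > j\<close> by auto
  then have 1: "(i - 1, j + 1) \<in> G" using col[of "i - 1" j h "j + 1"] v by (auto simp: anti_def)
  obtain h where "(i, h) \<in> G" "h \<ge> j + 1"
    using column_crossing[OF G(1), of x y x' y' i] q r \<open>y > j\<close> by auto
  then have 2: "(i, j + 1) \<in> G" using col[of i j h "j + 1"] v by (auto simp: anti_def)
  show False using no_squareD[OF G(2), of "i - 1" j] v 1 2 by (auto simp: anti_def)
qed

lemma bottom_tail:
  assumes G: "hv_convex G" "no_square G" and v: "anti G i j" "(i, j) \<in> G"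
    and q: "(x', y') \<in> G" "x' > i" "y' \<ge> j" and r: "(x, y) \<in> G" "y < j"
  shows "x = i"
  using left_tail[OF hv_swapxy[OF G(1)] no_square_swapxy[OF G(2)], of j i y' x' y x] v q r
  by (simp add: anti_swapxy)

lemma forkSW_I:
  assumes G: "hv_convex G" "no_square G" and v: "anti G i j"
    and q: "(x', y') \<in> G" "x' > i" "y' > j"
  shows "forkSW G i j"
proof -
  have m: "(i, j) \<in> G" using corner_mem[OF G(1) v q(1)] q by auto
  have "y = j" if "(x, y) \<in> G" "x < i" for x y
    using left_tail[OF G v m q(1) _ q(3) that] q(2) by linarith
  moreover have "x = i" if "(x, y) \<in> G" "y < j" for x y
    using bottom_tail[OF G v m q(1) q(2) _ that] q(3) by linarith
  ultimately show ?thesis unfolding forkSW_def using m v unfolding anti_def by blast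
qed

text \<open>The diagonal pairs of \<open>G\<close> are the antidiagonal pairs of its mirror image.\<close>

lemma forks_flipx_case:
  assumes G: "hv_convex G" "no_square G" and v: "anti G i j"
    and reg: "\<And>x y. (x, y) \<in> G \<Longrightarrow> x < i \<Longrightarrow> y \<ge> j" "\<And>x y. (x, y) \<in> G \<Longrightarrow> x \<ge> i \<Longrightarrow> y \<ge> j \<Longrightarrow> (i, j) \<in> G \<and> y = j"
  shows "forks (flipx G)"
  unfolding forks_def
proof (intro allI impI)
  fix s0 t assume "anti (flipx G) s0 t"
  define s where "s = 1 - s0"
  have u: "(s, t) \<in> G" "(s - 1, t - 1) \<in> G" using \<open>anti (flipx G) s0 t\<close> by (auto simp: anti_def s_def)
  have s0: "s0 = 1 - s" by (simp add: s_def)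
  \<comment> \<open>A cell far out on the opposite side makes the diagonal pair a fork of the mirror
    image. The names \<open>SE\<close> and \<open>NW\<close> tell where the tails of this fork lie
    in \<open>G\<close>.\<close>
  have SE: "forkSW (flipx G) s0 t" if q: "(x, y) \<in> G" "x \<le> s - 2" "y \<ge> t + 1" for x y
    using forkSW_I[OF hv_flipx[OF G(1)] no_square_flipx[OF G(2)], of s0 t "- x" y] \<open>anti (flipx G) s0 t\<close> q
    by (auto simp: s0)
  have NW: "forkNE (flipx G) s0 t" if q: "(x, y) \<in> G" "x \<ge> s + 1" "y \<le> t - 2" for x y
  proof -
    have e: "rot (flipx G) = flipy G" by auto
    have "anti (flipy G) (1 - s0) (1 - t)" using \<open>anti (flipx G) s0 t\<close> by (auto simp: anti_def)
    then show ?thesis unfolding forkNE_def e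
      using forkSW_I[OF hv_flipy[OF G(1)] no_square_flipy[OF G(2)], of "1 - s0" "1 - t" x "- y"] q
      by (auto simp: s0)
  qed
  \<comment> \<open>Cases by the position of the lower cell of the diagonal pair. One of the two
    cells at the vertex \<open>(i, j)\<close> serves as the far cell, except when the pair consists
    of \<open>(i + 1, j)\<close> and \<open>(i, j - 1)\<close>; there the fork is verified directly.
    The last case is contradictory.\<close>
  consider "s - 1 < i" | "s - 1 \<ge> i" "t - 1 < j" | "s - 1 \<ge> i" "t - 1 \<ge> j" by linarith
  then show "forkSW (flipx G) s0 t \<or> forkNE (flipx G) s0 t"
  proof cases
    case 1
    then have t: "t - 1 \<ge> j" using reg(1)[OF u(2)] by auto
    then have "s < i" using reg(2)[OF u(1)] by force
    then show ?thesis using NW[of i "j - 1"] v t by (auto simp: anti_def)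
  next
    case 2
    show ?thesis
    proof (cases "t < j")
      case True
      then show ?thesis using SE[of "i - 1" j] v 2 by (auto simp: anti_def)
    next
      case False
      then have tj: "t = j" and E: "(i, j) \<in> G" using reg(2)[OF u(1)] 2 by auto
      interpret hv_convex G by (rule G)
      have si: "s = i + 1"
      proof (rule ccontr)
        assume "s \<noteq> i + 1"
        then have "s > i + 1" using 2 by auto
        then have "(i + 1, j) \<in> G" "(i + 1, j - 1) \<in> G"
          using row[of i j s "i + 1"] row[of i "j - 1" "s - 1" "i + 1"] u v E tj by (auto simp: anti_def)
        then show False using no_squareD[OF G(2), of i "j - 1"] v E by (auto simp: anti_def)
      qed
      have right: "y = j" if r: "(x, y) \<in> G" "x \<ge> i + 1" for x y
      proof (rule ccontr)
        assume "y \<noteq> j"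
        then have "y < j" using reg(2)[of x y] r by force
        then obtain h where "(i + 1, h) \<in> G" "h \<le> j - 1"
          using column_crossing[OF G(1), of i "j - 1" x y "i + 1"] r v by (auto simp: anti_def)
        then have "(i + 1, j - 1) \<in> G" using col[of "i + 1" h j "j - 1"] u si tj by auto
        then show False using no_squareD[OF G(2), of i "j - 1"] v E u si tj by (auto simp: anti_def)
      qed
      have down: "x = i" if r: "(x, y) \<in> G" "y < j" for x y
        using reg(1)[OF r(1)] right[OF r(1)] r by force
      have s0i: "s0 = - i" using s0 si by simp
      have "(i + 1, j) \<in> G" "(i, j - 1) \<in> G" using u si tj by auto
      then have "(- i, j) \<in> flipx G" "(- i - 1, j) \<in> flipx G" "(- i, j - 1) \<in> flipx G"
        using E by (simp_all add: add.commute)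
      moreover have "y = j" if "(x, y) \<in> flipx G" "x < - i" for x y using right[of "- x" y] that by simp
      moreover have "x = - i" if "(x, y) \<in> flipx G" "y < j" for x y using down[of "- x" y] that by simp
      ultimately have "forkSW (flipx G) s0 t"
        unfolding forkSW_def s0i tj by blast
      then show ?thesis by simp
    qed
  next
    case 3
    then have "t - 1 = j" "t = j" using reg(2)[OF u(2)] reg(2)[OF u(1)] by auto
    then show ?thesis by simp
  qed
qed

lemma forks_swapxy: assumes "forks (swapxy G)" shows "forks G"
  unfolding forks_def
proof (intro allI impI)
  fix i j assume "anti G i j"
  then have "forkSW (swapxy G) j i \<or> forkNE (swapxy G) j i" using assms by (auto simp: forks_def anti_swapxy)
  moreover have "rot (swapxy G) = swapxy (rot G)" by auto
  ultimately show "forkSW G i j \<or> forkNE G i j" by (auto simp: forkNE_def forkSW_swapxy)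
qed

lemma forks_rot: assumes "forks (rot G)" shows "forks G"
  unfolding forks_def
proof (intro allI impI)
  fix i j assume "anti G i j"
  then have "forkSW (rot G) (1 - i) (1 - j) \<or> forkNE (rot G) (1 - i) (1 - j)"
    using assms anti_rot[of G i j] by (auto simp: forks_def)
  moreover have "rot (rot G) = G" by auto
  ultimately show "forkSW G i j \<or> forkNE G i j" by (auto simp: forkNE_def)
qed

text \<open>A cell strictly above row \<open>j\<close> and not left of column \<open>i\<close>,
  together with a cell strictly right of column \<open>i\<close> and not below row \<open>j\<close>,
  would straighten both tails and give a fork. So one of these regions is empty, and this is the
  situation of \<open>forks_flipx_case\<close>, directly or with the coordinates exchanged.\<close>

lemma not_forkSW_case:
  assumes G: "hv_convex G" "no_square G" and v: "anti G i j" and n: "\<not> forkSW G i j" and E: "(i, j) \<in> G"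
  shows "forks (flipx G)"
proof -
  have "(\<forall>x y. (x, y) \<in> G \<and> x \<ge> i \<longrightarrow> y \<le> j) \<or> (\<forall>x y. (x, y) \<in> G \<and> y \<ge> j \<longrightarrow> x \<le> i)"
  proof (rule ccontr)
    assume "\<not> ?thesis"
    then obtain x y x' y' where q: "(x, y) \<in> G" "x \<ge> i" "y > j" "(x', y') \<in> G" "y' \<ge> j" "x' > i" by force
    have "forkSW G i j" unfolding forkSW_def
      using E v left_tail[OF G v E q(1-3)] bottom_tail[OF G v E q(4) q(6) q(5)] unfolding anti_def by blast
    then show False using n by simp
  qed
  then show ?thesis
  proof
    assume "\<forall>x y. (x, y) \<in> G \<and> x \<ge> i \<longrightarrow> y \<le> j"
    then show ?thesis using no_cell_SW[OF G v E] E by (intro forks_flipx_case[OF G v]) force+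
  next
    assume *: "\<forall>x y. (x, y) \<in> G \<and> y \<ge> j \<longrightarrow> x \<le> i"
    have "forks (flipx (swapxy G))"
    proof (rule forks_flipx_case[OF hv_swapxy[OF G(1)] no_square_swapxy[OF G(2)], of j i])
      show "anti (swapxy G) j i" using v by (simp add: anti_swapxy)
      show "y \<ge> i" if "(x, y) \<in> swapxy G" "x < j" for x y
        using no_cell_SW[OF G v E, of y x] that by force
      show "(j, i) \<in> swapxy G \<and> y = i" if "(x, y) \<in> swapxy G" "x \<ge> j" "y \<ge> i" for x y
        using * that E by force
    qed
    then have "forks (flipy G)" by (intro forks_swapxy[of "flipy G"]) (simp add: flipy_alt[symmetric] flipy_def flipx_def swapxy_def)
    moreover have "flipy G = rot (flipx G)" by auto
    ultimately show ?thesis by (metis forks_rot)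
  qed
qed

text \<open>One antidiagonal collision that is not a fork fixes the orientation of the whole
  collection: it confines the cells so much that every diagonal collision is a fork. The argument
  distinguishes whether the cells \<open>(i, j)\<close> and \<open>(i - 1, j - 1)\<close> at the
  vertex are present.\<close>

theorem forks_or_flipx:
  assumes G: "hv_convex G" "no_square G"
  shows "forks G \<or> forks (flipx G)"
proof (rule ccontr)
  assume n: "\<not> ?thesis"
  then obtain i j where v: "anti G i j" "\<not> forkSW G i j" "\<not> forkNE G i j" by (auto simp: forks_def)
  have E: "(i, j) \<notin> G" using not_forkSW_case[OF G v(1,2)] n by auto
  have E2: "(i - 1, j - 1) \<notin> G"
  proof
    assume "(i - 1, j - 1) \<in> G"
    then have "forks (flipx (rot G))"
      using not_forkSW_case[OF hv_flipx[OF hv_flipy[OF G(1)]] no_square_flipx[OF no_square_flipy[OF G(2)]], of "1 - i" "1 - j"] v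
      by (simp add: anti_rot forkNE_def)
    moreover have "flipx (rot G) = rot (flipx G)" by auto
    ultimately have "forks (flipx G)" by (metis forks_rot)
    then show False using n by simp
  qed
  have "forks (flipx G)"
  proof (rule forks_flipx_case[OF G v(1)])
    show "y \<ge> j" if "(x, y) \<in> G" "x < i" for x y
    proof (rule ccontr)
      assume "\<not> y \<ge> j"
      then have "(1 - i, 1 - j) \<in> rot G"
        using corner_mem[OF hv_flipx[OF hv_flipy[OF G(1)]], of "1 - i" "1 - j" "- x" "- y"] v that by (simp add: anti_rot)
      then show False using E2 by simp
    qed
    show "(i, j) \<in> G \<and> y = j" if "(x, y) \<in> G" "x \<ge> i" "y \<ge> j" for x y
      using corner_mem[OF G(1) v(1) that] E by simp
  qed
  then show False using n by simp
qed

section \<open>Cells with an edge in a given set of vertices\<close>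

text \<open>\<open>W\<close> contains both ends of an edge, because each edge joins a diagonal corner with an antidiagonal
  corner.\<close>

definition edge_in :: "point set \<Rightarrow> point \<Rightarrow> bool" where
  "edge_in W p \<longleftrightarrow> (p \<in> W \<or> top_corner p \<in> W) \<and> ((fst p, snd p + 1) \<in> W \<or> (fst p + 1, snd p) \<in> W)"

text \<open>Every counted cell receives a vertex in \<open>W\<close> from its antidiagonal, except on one tail of each
  fork, where the diagonal is used; the two parameters \<open>c\<close>, \<open>d\<close> are the antidiagonal corners of the
  two branching cells on the tails that decide which tail is switched.\<close>

lemma hall_two_forks:
  fixes G W :: "point set"
  assumes fin: "finite W"
    and SW: "\<And>x y. (x, y) \<in> G \<Longrightarrow> x < i \<Longrightarrow> y = j" "\<And>x y. (x, y) \<in> G \<Longrightarrow> y < j \<Longrightarrow> x = i"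
    and NE: "\<And>x y. (x, y) \<in> G \<Longrightarrow> x \<ge> k \<Longrightarrow> y = l - 1" "\<And>x y. (x, y) \<in> G \<Longrightarrow> y \<ge> l \<Longrightarrow> x = k - 1"
    and anti: "\<And>x y. (x - 1, y) \<in> G \<Longrightarrow> (x, y - 1) \<in> G \<Longrightarrow> (x, y) = (i, j) \<or> (x, y) = (k, l)"
    and sep: "i < k" "j < l" "(i, j) \<noteq> (k - 1, l - 1)"
  shows "finite {p\<in>G. edge_in W p} \<and> card {p\<in>G. edge_in W p} \<le> card W"
proof -
  \<comment> \<open>\<open>c\<close> is an antidiagonal corner of the lower branching cell and also
    a diagonal corner of the adjacent cell of the left tail. If \<open>c\<close> is not in
    \<open>W\<close>, the left tail can use diagonals without conflict. If it is, the branching cell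
    takes \<open>c\<close>, and its other antidiagonal corner becomes free for the diagonals of the
    bottom tail. At the other end \<open>d\<close> decides in the same way between the right and the
    top tail.\<close>
  define c where "c = (i, j + 1)"
  define d where "d = (k, l - 1)"
  define tail where "tail p \<longleftrightarrow> (if c \<in> W then snd p < j else fst p < i) \<or> (if d \<in> W then snd p \<ge> l else fst p \<ge> k)" for p :: point
  define pr where "pr p = (if tail p then {p, top_corner p}
     else if p = (i, j) \<and> c \<in> W then {c} else if p = (k - 1, l - 1) \<and> d \<in> W then {d}
     else {(fst p, snd p + 1), (fst p + 1, snd p)})" for p :: point
  let ?X = "{p\<in>G. edge_in W p}"
  have "\<exists>v. v \<in> W \<and> v \<in> pr p" if "p \<in> ?X" for p
  proof (cases "tail p")
    case True
    have "\<exists>v. v \<in> W \<and> v \<in> {p, top_corner p}" using that unfolding edge_in_def by blast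
    then show ?thesis unfolding pr_def using True by (simp only: if_True)
  next
    case False
    have ac: "\<exists>v. v \<in> W \<and> v \<in> {(fst p, snd p + 1), (fst p + 1, snd p)}" using that unfolding edge_in_def by blast
    show ?thesis
    proof (cases "p = (i, j) \<and> c \<in> W")
      case True
      then show ?thesis unfolding pr_def using False by (intro exI[of _ c]) (simp only: if_False if_True simp_thms, simp)
    next
      case n1: False
      show ?thesis
      proof (cases "p = (k - 1, l - 1) \<and> d \<in> W")
        case True
        then show ?thesis unfolding pr_def using False n1 by (intro exI[of _ d]) (simp only: if_False if_True simp_thms, simp)
      next
        case n2: False
        show ?thesis unfolding pr_def if_not_P[OF False] if_not_P[OF n1] if_not_P[OF n2] by (rule ac)
      qed
    qed
  qed
  then obtain f where f: "\<And>p. p \<in> ?X \<Longrightarrow> f p \<in> W \<and> f p \<in> pr p" by metis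
  \<comment> \<open>Different cells have no allowed vertex of \<open>W\<close> in common, so every
    choice of allowed vertices is injective. After unfolding this is linear arithmetic in the
    coordinates.\<close>
  have disj: "p = q" if pq: "p \<in> G" "q \<in> G" and z: "z \<in> W" "z \<in> pr p" "z \<in> pr q" for p q z
  proof -
    obtain px py qx qy zx zy where e: "p = (px, py)" "q = (qx, qy)" "z = (zx, zy)" by (cases p, cases q, cases z) auto
    have cz: "(zx, zy) = (i, j + 1) \<Longrightarrow> c \<in> W" and dz: "(zx, zy) = (k, l - 1) \<Longrightarrow> d \<in> W" using z e by (auto simp: c_def d_def)
    have p: "px < i \<Longrightarrow> py = j" "py < j \<Longrightarrow> px = i" "px \<ge> k \<Longrightarrow> py = l - 1" "py \<ge> l \<Longrightarrow> px = k - 1"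
      using SW[of px py] NE[of px py] pq e by auto
    have q: "qx < i \<Longrightarrow> qy = j" "qy < j \<Longrightarrow> qx = i" "qx \<ge> k \<Longrightarrow> qy = l - 1" "qy \<ge> l \<Longrightarrow> qx = k - 1"
      using SW[of qx qy] NE[of qx qy] pq e by auto
    have a1: "(zx, zy) = (i, j) \<or> (zx, zy) = (k, l)" if "px = zx - 1" "py = zy" "qx = zx" "qy = zy - 1"
      using anti[of zx zy] pq e that by auto
    have a2: "(zx, zy) = (i, j) \<or> (zx, zy) = (k, l)" if "qx = zx - 1" "qy = zy" "px = zx" "py = zy - 1"
      using anti[of zx zy] pq e that by auto
    have tp: "tail p \<longleftrightarrow> (if c \<in> W then py < j else px < i) \<or> (if d \<in> W then py \<ge> l else px \<ge> k)"
     and tq: "tail q \<longleftrightarrow> (if c \<in> W then qy < j else qx < i) \<or> (if d \<in> W then qy \<ge> l else qx \<ge> k)"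
      by (simp_all add: tail_def e)
    have zp: "tail p \<and> (zx = px \<and> zy = py \<or> zx = px + 1 \<and> zy = py + 1) \<or>
       \<not> tail p \<and> (zx = px \<and> zy = py + 1 \<or> zx = px + 1 \<and> zy = py) \<and>
       (px = i \<and> py = j \<and> c \<in> W \<longrightarrow> zx = i) \<and> (px = k - 1 \<and> py = l - 1 \<and> d \<in> W \<longrightarrow> zx = k)"
      using z(2) sep unfolding e pr_def by (auto simp: top_corner_def c_def d_def split: if_splits)
    have zq: "tail q \<and> (zx = qx \<and> zy = qy \<or> zx = qx + 1 \<and> zy = qy + 1) \<or>
       \<not> tail q \<and> (zx = qx \<and> zy = qy + 1 \<or> zx = qx + 1 \<and> zy = qy) \<and>
       (qx = i \<and> qy = j \<and> c \<in> W \<longrightarrow> zx = i) \<and> (qx = k - 1 \<and> qy = l - 1 \<and> d \<in> W \<longrightarrow> zx = k)"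
      using z(3) sep unfolding e pr_def by (auto simp: top_corner_def c_def d_def split: if_splits)
    have "px = qx \<and> py = qy"
    proof (rule ccontr)
      assume ne: "\<not> ?thesis"
      show False
      proof (cases "tail p")
        case tpT: True
        show False
        proof (cases "tail q")
          case True
          show False using True tpT ne zp zq p q sep unfolding tp tq prod.inject by (smt (z3))
        next
          case False
          show False using False tpT ne zp zq p q sep cz dz unfolding tp tq prod.inject by (smt (z3))
        qed
      next
        case tpF: False
        show False
        proof (cases "tail q")
          case True
          show False using True tpF ne zp zq p q sep cz dz unfolding tp tq prod.inject by (smt (z3))
        next
          case False
          show False using False tpF ne zp zq a1 a2 sep unfolding tp tq prod.inject by (smt (z3))
        qed
      qed
    qed
    then show ?thesis using e by simp
  qed
  have inj: "inj_on f ?X"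
    using disj f by (intro inj_onI) (metis (no_types, lifting) mem_Collect_eq)
  have sub: "f ` ?X \<subseteq> W" using f by auto
  show ?thesis using inj sub fin card_inj_on_le[OF inj sub fin] finite_imageD[OF finite_subset[OF sub fin] inj] by auto
qed

lemma forkNE_iff:
  "forkNE G k l \<longleftrightarrow> (k - 1, l - 1) \<in> G \<and> (k, l - 1) \<in> G \<and> (k - 1, l) \<in> G \<and>
     (\<forall>x y. (x, y) \<in> G \<and> x \<ge> k \<longrightarrow> y = l - 1) \<and> (\<forall>x y. (x, y) \<in> G \<and> y \<ge> l \<longrightarrow> x = k - 1)"
proof -
  have 1: "(\<forall>x y. (- x, - y) \<in> G \<and> x < 1 - k \<longrightarrow> y = 1 - l) \<longleftrightarrow> (\<forall>x y. (x, y) \<in> G \<and> x \<ge> k \<longrightarrow> y = l - 1)"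
    (is "?l \<longleftrightarrow> ?r")
  proof
    assume l: ?l
    show ?r
    proof (intro allI impI)
      fix x y assume "(x, y) \<in> G \<and> x \<ge> k"
      then show "y = l - 1" using l[rule_format, of "- x" "- y"] by simp
    qed
  next
    assume r: ?r
    show ?l
    proof (intro allI impI)
      fix x y assume "(- x, - y) \<in> G \<and> x < 1 - k"
      then show "y = 1 - l" using r[rule_format, of "- x" "- y"] by simp
    qed
  qed
  have 2: "(\<forall>x y. (- x, - y) \<in> G \<and> y < 1 - l \<longrightarrow> x = 1 - k) \<longleftrightarrow> (\<forall>x y. (x, y) \<in> G \<and> y \<ge> l \<longrightarrow> x = k - 1)"
    (is "?l \<longleftrightarrow> ?r")
  proof
    assume l: ?l
    show ?r
    proof (intro allI impI)
      fix x y assume "(x, y) \<in> G \<and> y \<ge> l"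
      then show "x = k - 1" using l[rule_format, of "- x" "- y"] by simp
    qed
  next
    assume r: ?r
    show ?l
    proof (intro allI impI)
      fix x y assume "(- x, - y) \<in> G \<and> y < 1 - l"
      then show "x = 1 - k" using r[rule_format, of "- x" "- y"] by simp
    qed
  qed
  show ?thesis unfolding forkNE_def forkSW_def mem_flips 1 2 by simp
qed

lemma bounded_cells:
  assumes "finite (G :: point set)"
  shows "\<exists>B>0. \<forall>x y. (x, y) \<in> G \<longrightarrow> \<bar>x\<bar> < B \<and> \<bar>y\<bar> < B"
  using assms
proof (induction G rule: finite_induct)
  case empty
  then show ?case by (intro exI[of _ 1]) auto
next
  case (insert p G)
  then obtain B where B: "B > 0" "\<And>x y. (x, y) \<in> G \<Longrightarrow> \<bar>x\<bar> < B \<and> \<bar>y\<bar> < B" by blast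
  obtain u v where p: "p = (u, v)" by (cases p)
  have "\<bar>x\<bar> < B + \<bar>u\<bar> + \<bar>v\<bar> \<and> \<bar>y\<bar> < B + \<bar>u\<bar> + \<bar>v\<bar>" if "(x, y) \<in> insert p G" for x y
    using that B(1) B(2)[of x y] p by auto
  then show ?case using B(1) by (intro exI[of _ "B + \<bar>u\<bar> + \<bar>v\<bar>"]) auto
qed

lemma hall_forks:
  assumes "finite G" "finite W" "forks G" "no_cross G"
  shows "card {p\<in>G. edge_in W p} \<le> card W"
proof -
  obtain B where B: "B > 0" "\<And>x y. (x, y) \<in> G \<Longrightarrow> \<bar>x\<bar> < B \<and> \<bar>y\<bar> < B" using bounded_cells[OF assms(1)] by blast
  \<comment> \<open>A missing fork is replaced by a fictitious one outside a bounding box of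
    \<open>G\<close>, where the conditions on the tails hold vacuously.\<close>
  have "\<exists>i j. (forkSW G i j \<or> (\<forall>i j. \<not> forkSW G i j) \<and> i = - B - 2 \<and> j = - B - 2)" by blast
  then obtain i j where ij: "forkSW G i j \<or> (\<forall>i j. \<not> forkSW G i j) \<and> i = - B - 2 \<and> j = - B - 2" by blast
  have "\<exists>k l. (forkNE G k l \<or> (\<forall>k l. \<not> forkNE G k l) \<and> k = B + 2 \<and> l = B + 2)" by blast
  then obtain k l where kl: "forkNE G k l \<or> (\<forall>k l. \<not> forkNE G k l) \<and> k = B + 2 \<and> l = B + 2" by blast
  have SW: "x < i \<Longrightarrow> y = j" "y < j \<Longrightarrow> x = i" if "(x, y) \<in> G" for x y
    using ij B(2)[OF that] that unfolding forkSW_def by auto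
  have NE: "x \<ge> k \<Longrightarrow> y = l - 1" "y \<ge> l \<Longrightarrow> x = k - 1" if "(x, y) \<in> G" for x y
    using kl B(2)[OF that] that unfolding forkNE_iff by auto
  have uSW: "i' = i \<and> j' = j" if f: "forkSW G i' j'" for i' j'
  proof -
    have "forkSW G i j" using ij f by blast
    then have m: "(i, j) \<in> G" "(i - 1, j) \<in> G" "(i, j - 1) \<in> G" by (auto simp: forkSW_def)
    have m': "(i', j') \<in> G" "(i' - 1, j') \<in> G" "(i', j' - 1) \<in> G" using f by (auto simp: forkSW_def)
    have f1: "x < i' \<Longrightarrow> y = j'" and f2: "y < j' \<Longrightarrow> x = i'" if "(x, y) \<in> G" for x y using f that by (auto simp: forkSW_def)
    show ?thesis
    proof (cases "i' \<le> i")
      case True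
      then have "j' = j" using SW(1)[OF m'(2)] by simp
      then show ?thesis using SW(2)[OF m'(3)] by simp
    next
      case False
      then have "j = j'" using f1[OF m(2)] by simp
      then show ?thesis using f2[OF m(3)] by simp
    qed
  qed
  have uNE: "k' = k \<and> l' = l" if f: "forkNE G k' l'" for k' l'
  proof -
    have "forkNE G k l" using kl f by blast
    then have m: "(k - 1, l - 1) \<in> G" "(k, l - 1) \<in> G" "(k - 1, l) \<in> G" by (auto simp: forkNE_iff)
    have m': "(k' - 1, l' - 1) \<in> G" "(k', l' - 1) \<in> G" "(k' - 1, l') \<in> G" using f by (auto simp: forkNE_iff)
    have f1: "x \<ge> k' \<Longrightarrow> y = l' - 1" and f2: "y \<ge> l' \<Longrightarrow> x = k' - 1" if "(x, y) \<in> G" for x y using f that by (auto simp: forkNE_iff)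
    show ?thesis
    proof (cases "k' \<ge> k")
      case True
      then have "l' = l" using NE(1)[OF m'(2)] by simp
      then show ?thesis using NE(2)[OF m'(3)] by simp
    next
      case False
      then have "l = l'" using f1[OF m(2)] by simp
      then show ?thesis using f2[OF m(3)] by simp
    qed
  qed
  have anti: "(x, y) = (i, j) \<or> (x, y) = (k, l)" if "(x - 1, y) \<in> G" "(x, y - 1) \<in> G" for x y
    using assms(3) that uSW[of x y] uNE[of x y] unfolding forks_def anti_def by blast
  \<comment> \<open>The two branching cells are different because a common one would be the centre
    of a cross; this is where \<open>no_cross\<close> enters.\<close>
  have sep: "i < k \<and> j < l \<and> (i, j) \<noteq> (k - 1, l - 1)"
  proof (cases "forkSW G i j \<and> forkNE G k l")
    case True
    then have m: "(k - 1, l - 1) \<in> G" "(k, l - 1) \<in> G" "(k - 1, l) \<in> G" "(i, j) \<in> G" "(i - 1, j) \<in> G" "(i, j - 1) \<in> G"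
      by (auto simp: forkNE_iff forkSW_def)
    have "i < k" using SW(1)[OF m(2)] SW(2)[OF m(2)] SW(1)[OF m(1)] SW(2)[OF m(1)] SW(1)[OF m(3)] by linarith
    moreover have "j < l" using SW(1)[OF m(3)] SW(2)[OF m(3)] SW(1)[OF m(1)] SW(2)[OF m(1)] SW(1)[OF m(2)] SW(2)[OF m(2)] by linarith
    moreover have "(i, j) \<noteq> (k - 1, l - 1)"
    proof
      assume "(i, j) = (k - 1, l - 1)"
      then have "k = i + 1" "l = j + 1" by auto
      then show False using assms(4) m unfolding no_cross_def by auto
    qed
    ultimately show ?thesis by simp
  next
    case False
    show ?thesis
    proof (cases "forkSW G i j")
      case True
      then have "(i, j) \<in> G" by (simp add: forkSW_def)
      then show ?thesis using B(2)[of i j] kl False True by auto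
    next
      case F1: False
      then have i: "i = - B - 2" "j = - B - 2" using ij by auto
      show ?thesis
      proof (cases "forkNE G k l")
        case True
        then have "(k - 1, l - 1) \<in> G" by (simp add: forkNE_iff)
        then show ?thesis using B(2)[of "k - 1" "l - 1"] i by auto
      next
        case False
        then show ?thesis using kl i B(1) by auto
      qed
    qed
  qed
  have "finite {p\<in>G. edge_in W p} \<and> card {p\<in>G. edge_in W p} \<le> card W"
  proof (rule hall_two_forks[where i = i and j = j and k = k and l = l])
    show "i < k" "j < l" "(i, j) \<noteq> (k - 1, l - 1)" using sep by blast+
  qed (fact assms(2) SW NE anti)+
  then show ?thesis by blast
qed

theorem hall_cells:
  assumes G: "hv_convex G" "no_square G" "no_cross G" and fin: "finite G" "finite W"
  shows "card {p\<in>G. edge_in W p} \<le> card W"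
proof (cases "forks G")
  case True
  then show ?thesis using hall_forks[OF fin True G(3)] by simp
next
  case False
  then have f: "forks (flipx G)" using forks_or_flipx[OF G(1,2)] by auto
  \<comment> \<open>Vertices and cells are reflected by different maps, since the lower right corner
    of a cell becomes the lower left corner of its mirror image.\<close>
  define \<phi> where "\<phi> = (\<lambda>(x, y). (1 - x, y) :: point)"
  define \<psi> where "\<psi> = (\<lambda>(x, y). (- x, y) :: point)"
  have inj: "inj \<phi>" "inj \<psi>" by (auto simp: inj_def \<phi>_def \<psi>_def)
  have flip: "flipx G = \<psi> ` G" by (force simp: \<psi>_def image_iff)
  have mem: "(1 - x, y) \<in> \<phi> ` W \<longleftrightarrow> (x, y) \<in> W" for x y
    using inj_image_mem_iff[OF inj(1), of "(x, y)" W] by (simp add: \<phi>_def)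
  have e: "edge_in (\<phi> ` W) (\<psi> p) \<longleftrightarrow> edge_in W p" for p
  proof -
    obtain x y where p: "p = (x, y)" by (cases p)
    show ?thesis
      using mem[of x y] mem[of "x + 1" y] mem[of x "y + 1"] mem[of "x + 1" "y + 1"]
      by (auto simp: edge_in_def p \<psi>_def top_corner_def)
  qed
  have "{p\<in>flipx G. edge_in (\<phi> ` W) p} = \<psi> ` {p\<in>G. edge_in W p}" unfolding flip using e by auto
  then have "card {p\<in>flipx G. edge_in (\<phi> ` W) p} = card {p\<in>G. edge_in W p}"
    using inj(2) by (simp add: card_image inj_on_subset[OF inj(2)])
  moreover have "no_cross (flipx G)" unfolding no_cross_def
  proof (intro allI notI)
    fix i j assume "(i, j) \<in> flipx G \<and> (i + 1, j) \<in> flipx G \<and> (i - 1, j) \<in> flipx G \<and> (i, j + 1) \<in> flipx G \<and> (i, j - 1) \<in> flipx G"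
    moreover have "- (i + 1) = - i - 1" "- (i - 1) = - i + 1" by simp_all
    ultimately have "(- i, j) \<in> G" "(- i - 1, j) \<in> G" "(- i + 1, j) \<in> G" "(- i, j + 1) \<in> G" "(- i, j - 1) \<in> G"
      unfolding mem_flips by metis+
    then show False using G(3) unfolding no_cross_def by blast
  qed
  moreover have "finite (flipx G)" "finite (\<phi> ` W)" using fin flip by auto
  moreover have "card (\<phi> ` W) = card W" using inj(1) by (simp add: card_image inj_on_subset[OF inj(1)])
  ultimately show ?thesis using hall_forks[of "flipx G" "\<phi> ` W"] f by simp
qed

section \<open>Sets of vertices that violate the Hall bound\<close>

text \<open>The weight that is \<open>1\<close> on \<open>W\<close> and \<open>0\<close> elsewhere makes all adjacent minors homogeneous.\<close>

definition balanced :: "point set \<Rightarrow> point \<Rightarrow> bool" where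
  "balanced W p \<longleftrightarrow> (of_bool (p \<in> W) + of_bool (top_corner p \<in> W) :: nat) =
     of_bool ((fst p, snd p + 1) \<in> W) + of_bool ((fst p + 1, snd p) \<in> W)"

text \<open>The strict inequality violates the Hall bound. The edge condition puts all minors into
  the prime of \<open>W\<close>, and balance puts the point that vanishes exactly on
  \<open>W\<close> on the toric variety of all cells.\<close>

definition heavy :: "point set \<Rightarrow> point set \<Rightarrow> bool" where
  "heavy G W \<longleftrightarrow> W \<subseteq> \<Union> (cell ` G) \<and> (\<forall>p\<in>G. balanced W p) \<and> (\<forall>p\<in>G. cell p \<inter> W \<noteq> {} \<longrightarrow> edge_in W p) \<and>
     card W < card {p\<in>G. cell p \<inter> W \<noteq> {}}"

text \<open>Without squares, only the centre and its four edge neighbours meet the central cell: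
  five cells against four vertices.\<close>

lemma heavy_cross:
  assumes G: "finite G" "no_square G" and X: "(i, j) \<in> G" "(i + 1, j) \<in> G" "(i - 1, j) \<in> G" "(i, j + 1) \<in> G" "(i, j - 1) \<in> G"
  shows "heavy G (cell (i, j))"
proof -
  let ?W = "cell (i, j)"
  let ?X = "{(i, j), (i + 1, j), (i - 1, j), (i, j + 1), (i, j - 1)}"
  have near: "p \<in> ?X" if p: "p \<in> G" "cell p \<inter> ?W \<noteq> {}" for p
  proof -
    obtain x y where xy: "p = (x, y)" by (cases p)
    have "\<bar>x - i\<bar> \<le> 1" "\<bar>y - j\<bar> \<le> 1" using p(2) by (auto simp: xy cell_def)
    moreover have "(i + 1, j + 1) \<notin> G" using no_squareD[OF G(2), of i j] X by auto
    moreover have "(i + 1, j - 1) \<notin> G" using no_squareD[OF G(2), of i "j - 1"] X by auto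
    moreover have "(i - 1, j + 1) \<notin> G" using no_squareD[OF G(2), of "i - 1" j] X by auto
    moreover have "(i - 1, j - 1) \<notin> G" using no_squareD[OF G(2), of "i - 1" "j - 1"] X by auto
    moreover have "x = i - 1 \<or> x = i \<or> x = i + 1" "y = j - 1 \<or> y = j \<or> y = j + 1" using calculation(1,2) by linarith+
    ultimately show ?thesis using p(1) unfolding xy by auto
  qed
  have far: "cell p \<inter> ?W \<noteq> {}" if pX: "p \<in> ?X" for p
  proof -
    consider "p = (i, j)" | "p = (i + 1, j)" | "p = (i - 1, j)" | "p = (i, j + 1)" | "p = (i, j - 1)" using pX by blast
    then show ?thesis by cases (simp_all add: cell_def)
  qed
  have eq: "{p\<in>G. cell p \<inter> ?W \<noteq> {}} = ?X" using near far X by blast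
  have "card ?X = 5" by simp
  moreover have "card ?W \<le> 4" unfolding cell_def by (simp add: card_insert_if)
  ultimately have "card ?W < card {p\<in>G. cell p \<inter> ?W \<noteq> {}}" unfolding eq by simp
  moreover have "balanced ?W p" if "p \<in> G" for p
  proof (cases "p \<in> ?X")
    case True
    then consider "p = (i, j)" | "p = (i + 1, j)" | "p = (i - 1, j)" | "p = (i, j + 1)" | "p = (i, j - 1)" by blast
    then show ?thesis by cases (simp_all add: balanced_def cell_def top_corner_def)
  next
    case False
    then have "cell p \<inter> ?W = {}" using near[of p] that by blast
    then have "p \<notin> ?W" "top_corner p \<notin> ?W" "(fst p, snd p + 1) \<notin> ?W" "(fst p + 1, snd p) \<notin> ?W"
      unfolding cell_alt[of p] by blast+
    then show ?thesis by (simp add: balanced_def)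
  qed
  moreover have "edge_in ?W p" if pG: "p \<in> G" "cell p \<inter> ?W \<noteq> {}" for p
  proof -
    consider "p = (i, j)" | "p = (i + 1, j)" | "p = (i - 1, j)" | "p = (i, j + 1)" | "p = (i, j - 1)" using near[OF pG] by blast
    then show ?thesis by cases (simp_all add: edge_in_def cell_def top_corner_def)
  qed
  ultimately show ?thesis using X unfolding heavy_def by auto
qed

text \<open>\<open>W\<close> consists of the vertices of the adjacent cells on the horizontal line
  through the centre of the square. The columns occupied next to this line form an interval
  \<open>Y\<close>, so \<open>W\<close> has \<open>card Y + 1\<close> elements, whereas at least
  \<open>card Y + 2\<close> cells touch the line because both columns of the square count
  twice.\<close>

lemma heavy_line:
  assumes G: "finite G" "\<And>x y z j. (x, j) \<in> G \<Longrightarrow> (z, j) \<in> G \<Longrightarrow> x \<le> y \<Longrightarrow> y \<le> z \<Longrightarrow> (y, j) \<in> G"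
    and Q: "(i, j) \<in> G" "(i - 1, j) \<in> G" "(i, j - 1) \<in> G" "(i - 1, j - 1) \<in> G"
  shows "\<exists>W. heavy G W"
proof -
  define U where "U = {x. (x, j) \<in> G}"
  define D where "D = {x. (x, j - 1) \<in> G}"
  define Y where "Y = U \<union> D"
  have fUD: "finite U" "finite D"
    unfolding U_def D_def by (rule finite_subset[OF _ finite_imageI[OF G(1), of fst]], auto intro: rev_image_eqI)+
  have Yconv: "y \<in> Y" if "x \<in> Y" "z \<in> Y" "x \<le> y" "y \<le> z" for x y z
  proof (cases "y \<le> i")
    case True
    then show ?thesis using that(1) G(2)[OF _ Q(1) that(3)] G(2)[OF _ Q(3) that(3)] by (auto simp: Y_def U_def D_def)
  next
    case False
    then show ?thesis using that(2) G(2)[OF Q(1) _ _ that(4)] G(2)[OF Q(3) _ _ that(4)] by (auto simp: Y_def U_def D_def)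
  qed
  have fY: "finite Y" "Y \<noteq> {}" using fUD Q by (auto simp: Y_def U_def)
  have Yint: "Y = {Min Y..Max Y}"
  proof (intro equalityI subsetI)
    fix y assume "y \<in> {Min Y..Max Y}"
    then show "y \<in> Y" using Yconv[OF Min_in[OF fY] Max_in[OF fY], of y] by simp
  qed (simp add: fY)
  have mm: "Min Y \<le> Max Y" using Min_le[OF fY(1) Max_in[OF fY]] .
  obtain lo hi where Yeq: "Y = {lo..hi}" and mm: "lo \<le> hi" using Yint mm by blast
  define W where "W = (\<lambda>x. (x, j)) ` {lo..hi + 1}"
  have mW: "(x, y) \<in> W \<longleftrightarrow> y = j \<and> (x \<in> Y \<or> x - 1 \<in> Y)" for x y
    using mm unfolding Yeq W_def by auto
  have meet: "cell p \<inter> W \<noteq> {} \<longleftrightarrow> snd p = j \<or> snd p = j - 1" if "p \<in> G" for p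
  proof -
    obtain x y where p: "p = (x, y)" by (cases p)
    have "x \<in> Y" if "y = j \<or> y = j - 1" using that \<open>p \<in> G\<close> p by (auto simp: Y_def U_def D_def)
    then show ?thesis unfolding p cell_def by (auto simp: mW)
  qed
  have eqX: "{p\<in>G. cell p \<inter> W \<noteq> {}} = (\<lambda>x. (x, j)) ` U \<union> (\<lambda>x. (x, j - 1)) ` D"
    using meet by (force simp: U_def D_def image_iff)
  have "card ((\<lambda>x. (x, j)) ` U \<union> (\<lambda>x. (x, j - 1)) ` D) = card U + card D"
    using fUD by (subst card_Un_disjoint) (auto simp: card_image inj_on_def)
  also have "\<dots> = card Y + card (U \<inter> D)" unfolding Y_def by (rule card_Un_Int[OF fUD])
  also have "\<dots> \<ge> card Y + 2"
  proof -
    have "{i - 1, i} \<subseteq> U \<inter> D" using Q by (auto simp: U_def D_def)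
    then have "card {i - 1, i} \<le> card (U \<inter> D)" using fUD by (intro card_mono) auto
    then show ?thesis by simp
  qed
  finally have cX: "card {p\<in>G. cell p \<inter> W \<noteq> {}} \<ge> card Y + 2" unfolding eqX .
  have "card W = card {lo..hi + 1}" unfolding W_def by (intro card_image) (auto simp: inj_on_def)
  also have "\<dots> = card Y + 1" using mm unfolding Yeq by simp
  finally have "card W < card {p\<in>G. cell p \<inter> W \<noteq> {}}" using cX by simp
  moreover have "balanced W p" "cell p \<inter> W \<noteq> {} \<longrightarrow> edge_in W p" if "p \<in> G" for p
  proof -
    obtain x y where p: "p = (x, y)" by (cases p)
    have "x \<in> Y" if "y = j \<or> y = j - 1" using that \<open>p \<in> G\<close> p by (auto simp: Y_def U_def D_def)
    then show "balanced W p" "cell p \<inter> W \<noteq> {} \<longrightarrow> edge_in W p"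
      using meet[OF \<open>p \<in> G\<close>] unfolding p balanced_def edge_in_def top_corner_def by (auto simp: mW)
  qed
  moreover have "W \<subseteq> \<Union> (cell ` G)"
  proof
    fix v assume "v \<in> W"
    then obtain x where v: "v = (x, j)" "x \<in> Y \<or> x - 1 \<in> Y" using mW by (cases v) auto
    then consider "(x, j) \<in> G" | "(x, j - 1) \<in> G" | "(x - 1, j) \<in> G" | "(x - 1, j - 1) \<in> G" by (auto simp: Y_def U_def D_def)
    then show "v \<in> \<Union> (cell ` G)" unfolding v(1) by cases (rule UN_I, assumption, simp add: cell_def)+
  qed
  ultimately show ?thesis unfolding heavy_def by (intro exI[of _ W]) blast
qed

theorem heavy_exists:
  assumes "finite G" "hv_convex G" "\<not> no_square G \<or> \<not> no_cross G"
  shows "\<exists>W. heavy G W"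
proof (cases "no_square G")
  case True
  then obtain i j where "(i, j) \<in> G" "(i + 1, j) \<in> G" "(i - 1, j) \<in> G" "(i, j + 1) \<in> G" "(i, j - 1) \<in> G"
    using assms by (auto simp: no_cross_def)
  then show ?thesis using heavy_cross[OF assms(1) True] by blast
next
  case False
  then obtain i j where "(i, j) \<in> G" "(i + 1, j) \<in> G" "(i, j + 1) \<in> G" "(i + 1, j + 1) \<in> G" by (auto simp: no_square_def)
  then show ?thesis using heavy_line[OF assms(1) hv_convex.row[OF assms(2)], where i = "i + 1" and j = "j + 1"] by simp
qed

section \<open>Regular sequences of adjacent minors\<close>

context subring_set begin

lemma idl_mult_either: "idl J \<Longrightarrow> a \<in> R \<Longrightarrow> b \<in> R \<Longrightarrow> a \<in> J \<or> b \<in> J \<Longrightarrow> a * b \<in> J"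
  using idl_mult[of J a b] idl_mult2[of J b a] by argo

lemma prime_idl_mult_iff: "prime_idl P \<Longrightarrow> a \<in> R \<Longrightarrow> b \<in> R \<Longrightarrow> a * b \<in> P \<longleftrightarrow> a \<in> P \<or> b \<in> P"
  using prime_idl_mult[of P a b] idl_mult_either[OF prime_idl_idl, of P a b] by argo

lemma gen_insert_zero: "X \<subseteq> R \<Longrightarrow> gen (insert 0 X) = gen X"
  using gen_least[OF gen_idl, of X "insert 0 X"] gen_superset[of X] idl_zero[OF gen_idl, of X] gen_mono[of X "insert 0 X"]
  by blast

lemma colon_idl: "idl J \<Longrightarrow> y \<in> R \<Longrightarrow> idl {s\<in>R. s * y \<in> J}"
  by (rule idlI) (auto simp: distrib_right mult.assoc idl_zero intro: idl_add[of J] idl_mult[of J])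

lemma regs_snoc:
  assumes "set xs \<subseteq> R"
  shows "regs {0} (xs @ [x]) \<longleftrightarrow>
    regs {0} xs \<and> x \<in> R \<and> (\<forall>y\<in>R. x * y \<in> gen (set xs) \<longrightarrow> y \<in> gen (set xs))"
proof (cases "x \<in> R")
  case True
  then show ?thesis using regs_append[OF idl_zero_set assms, of "[x]"] gen_insert_zero[OF assms] by simp
next
  case False
  then show ?thesis using regs_sub[of "{0}" "xs @ [x]"] by auto
qed

end

lemma adj_minor_alt:
  "adj_minor p = Var p * Var (top_corner p) - Var (fst p, snd p + 1) * Var (fst p + 1, snd p)"
  by (cases p) (simp add: adj_minor_def top_corner_def)

text \<open>The two monomials of the minor are congruent modulo \<open>Q\<close>. Once one corner
  variable lies in \<open>Q\<close>, so do both products, and by primality each of them contributes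
  a corner.\<close>

lemma prime_edge_in:
  assumes Q: "polys.prime_idl V (Q :: (point, 'k::field) mpoly set)" and "adj_minor p \<in> Q" "cell p \<subseteq> V"
    and "cell p \<inter> {v\<in>V. Var v \<in> Q} \<noteq> {}"
  shows "edge_in {v\<in>V. Var v \<in> Q} p"
proof -
  define a b c d where "a = (Var p :: (point, 'k) mpoly)" and "b = (Var (top_corner p) :: (point, 'k) mpoly)"
    and "c = (Var (fst p, snd p + 1) :: (point, 'k) mpoly)" and "d = (Var (fst p + 1, snd p) :: (point, 'k) mpoly)"
  have V: "p \<in> V" "top_corner p \<in> V" "(fst p, snd p + 1) \<in> V" "(fst p + 1, snd p) \<in> V"
    using assms(3) by (auto simp: cell_alt)
  then have R: "a \<in> polys V" "b \<in> polys V" "c \<in> polys V" "d \<in> polys V" by (auto simp: a_def b_def c_def d_def)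
  have I: "polys.idl V Q" using Q by (rule polys.prime_idl_idl)
  have f: "a * b - c * d \<in> Q" using assms(2) by (simp add: adj_minor_alt a_def b_def c_def d_def)
  then have iff: "a * b \<in> Q \<longleftrightarrow> c * d \<in> Q" by (rule polys.idl_cong_mem[OF I])
  have ab: "a * b \<in> Q \<longleftrightarrow> a \<in> Q \<or> b \<in> Q" and cd: "c * d \<in> Q \<longleftrightarrow> c \<in> Q \<or> d \<in> Q"
    by (intro polys.prime_idl_mult_iff[OF Q] R)+
  have "a \<in> Q \<or> b \<in> Q \<or> c \<in> Q \<or> d \<in> Q"
    using assms(4) by (auto simp: cell_alt a_def b_def c_def d_def)
  then show ?thesis using iff ab cd V unfolding edge_in_def by (auto simp: a_def b_def c_def d_def)
qed

text \<open>Cells outside \<open>D\<close> meet \<open>W\<close> and hence have an edge in it, so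
  the Hall bound gives \<open>card G \<le> card W + card D\<close>. The right side is the length of
  the chain that adjoins first the variables of \<open>W\<close> and then the minors of
  \<open>D\<close>.\<close>

lemma lower_chain:
  fixes Q :: "(point, 'k::field) mpoly set"
  assumes "finite V" "finite G" "\<And>p. p \<in> G \<Longrightarrow> cell p \<subseteq> V" and Q: "polys.prime_idl V Q" "adj_minor ` G \<subseteq> Q"
    and hall: "\<And>W. W \<subseteq> V \<Longrightarrow> card {p\<in>G. edge_in W p} \<le> card W"
  shows "\<exists>l\<ge>card G. polys.chain V l (psat V {} {} {}) Q"
proof -
  define W where "W = {v\<in>V. Var v \<in> Q}"
  define D where "D = {p\<in>G. cell p \<inter> W = {}}"
  have adm: "admissible V W D {}" using assms(1-3) by (auto simp: admissible_def W_def D_def)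
  have fW: "finite W" using assms(1) by (simp add: W_def)
  have pg: "pgens W D {} \<subseteq> Q" using Q(2) by (auto simp: pgens_def W_def D_def)
  have sub: "psat V W D {} \<subseteq> Q"
    by (rule psat_below_prime[OF Q(1) pg]) (auto simp: W_def)
  have c: "polys.chain V (card W + card D) (psat V {} {} {}) (psat V W D {} :: (point, 'k) mpoly set)"
    by (rule polys.chain_append[OF chain_D[OF adm] chain_W[OF assms(1)]]) (auto simp: W_def)
  have "G - D \<subseteq> {p\<in>G. edge_in W p}"
    unfolding D_def W_def using prime_edge_in[OF Q(1)] Q(2) assms(3) by blast
  then have "card (G - D) \<le> card {p\<in>G. edge_in W p}" using assms(2) by (intro card_mono) auto
  then have "card (G - D) \<le> card W" using hall[of W] by (auto simp: W_def)
  moreover have "card (G - D) = card G - card D" using assms(2) by (intro card_Diff_subset) (auto simp: D_def)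
  ultimately have "card G \<le> card W + card D" by linarith
  then show ?thesis using polys.chain_end_mono[OF c Q(1) sub] by (meson le_trans)
qed

theorem good_regs:
  assumes V: "finite V" "\<And>p. p \<in> G \<Longrightarrow> cell p \<subseteq> V"
    and hall: "\<And>W. W \<subseteq> V \<Longrightarrow> card {p\<in>G. edge_in W p} \<le> card W" and fG: "finite G"
  shows "distinct ps \<Longrightarrow> set ps \<subseteq> G \<Longrightarrow> polys.regs V {0} (map adj_minor ps :: (point, 'k::field) mpoly list)"
proof (induction ps rule: rev_induct)
  case (snoc p ps)
  let ?f = "adj_minor p :: (point, 'k) mpoly"
  let ?fs = "map adj_minor ps :: (point, 'k) mpoly list"
  define J where "J = polys.gen V (set ?fs)"
  have N: "Noeth (polys V :: (point, 'k) mpoly set)" using noeth_polys[OF V(1)] .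
  have IH: "polys.regs V {0} ?fs" using snoc by auto
  have "adj_minor ` G \<subseteq> (polys V :: (point, 'k) mpoly set)" using adj_minor_polys[OF V(2)] by blast
  then have R: "?f \<in> polys V" "set ?fs \<subseteq> polys V" using snoc.prems(2) by auto
  have Jid: "polys.idl V J" unfolding J_def by (rule polys.gen_idl[OF R(2)])
  have "y \<in> J" if y: "y \<in> polys V" "?f * y \<in> J" for y
  proof (rule ccontr)
    assume nJ: "y \<notin> J"
    let ?C = "{s \<in> polys V. s * y \<in> J}"
    have "1 \<notin> ?C" using nJ by simp
    then obtain M where M: "polys.max_idl V M" "?C \<subseteq> M"
      using polys.noeth_max_idl[OF N polys.colon_idl[OF Jid y(1)]] by auto
    have Mp: "polys.prime_idl V M" using M(1) by (rule polys.max_idl_prime)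
    then have Mi: "polys.idl V M" by (rule polys.prime_idl_idl)
    have "\<exists>q c. polys.prime_idl V q \<and> q \<subseteq> M \<and> c \<in> polys V \<and> (\<forall>a\<in>polys V. a * (c * y) \<in> J \<longleftrightarrow> a \<in> q)"
      by (rule polys.assoc_prime_exists[OF N Jid Mp y(1)]) (use M(2) in auto)
    then obtain q c where q: "polys.prime_idl V q" "q \<subseteq> M" "c \<in> polys V"
      and qc: "\<And>a. a \<in> polys V \<Longrightarrow> a * (c * y) \<in> J \<longleftrightarrow> a \<in> q" by blast
    have qi: "polys.idl V q" using q(1) by (rule polys.prime_idl_idl)
    have cy: "c * y \<in> polys V" using q(3) y(1) by (rule polys.mult_closed)
    have "?f * (c * y) = c * (?f * y)" by (simp add: mult_ac)
    then have "?f * (c * y) \<in> J" using polys.idl_mult[OF Jid q(3) y(2)] by metis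
    then have fq: "?f \<in> q" using qc[OF R(1)] by blast
    have Jq: "J \<subseteq> q" using qc polys.idl_mult2[OF Jid cy] polys.idl_mem[OF Jid] by blast
    have fsJ: "set ?fs \<subseteq> J" unfolding J_def by (rule polys.gen_superset)
    have fsM: "set ?fs \<subseteq> M" using fsJ Jq q(2) by blast
    \<comment> \<open>The overlong chain is assembled from here: \<open>?fs\<close> extends inside
      \<open>M\<close> to a regular sequence of length \<open>card V\<close>, which yields
      \<open>card V - length ps\<close> steps above \<open>q\<close>, while the minors in
      \<open>q\<close>, now including \<open>?f\<close>, yield at least
      \<open>Suc (length ps)\<close> steps below it.\<close>
    obtain hs where hs: "length hs = card V" "set hs \<subseteq> M" "polys.regs V {0} hs"
      using max_idl_regs[OF V(1) M(1)] by blast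
    have z: "{0} \<subseteq> M" using polys.idl_zero[OF Mi] by simp
    obtain Q where "polys.chain V (length ?fs) Q M"
      using polys.regs_chain_below[OF N polys.idl_zero_set IH Mp z fsM] by blast
    then have "length ?fs \<le> card V" by (rule chain_length_le[OF V(1)])
    then obtain d where d: "length ?fs + d = card V" using le_Suc_ex by metis
    obtain gs where gs: "set gs \<subseteq> M" "length gs = d" "polys.regs V J gs"
      using polys.regs_extend[OF N Mi hs(3,2) IH fsM] d hs(1) unfolding J_def by metis
    have "\<exists>P'. polys.chain V (length gs) q P' \<and> P' \<subseteq> M"
      by (rule polys.ischebeck[OF N Mp Jid gs(3,1) q(1,2) cy])
        (use qc q(2) polys.idl_mem[OF qi] in blast)+
    then obtain P' where P': "polys.chain V d q P'" using gs(2) by blast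
    have G': "finite (set (ps @ [p]))" "\<And>p'. p' \<in> set (ps @ [p]) \<Longrightarrow> cell p' \<subseteq> V"
      using snoc.prems V(2) by auto
    have sub: "adj_minor ` set (ps @ [p]) \<subseteq> q" using fq fsJ Jq by auto
    have "\<exists>l\<ge>card (set (ps @ [p])). polys.chain V l (psat V {} {} {}) q"
    proof (rule lower_chain[OF V(1) G' q(1) sub])
      fix W assume W: "W \<subseteq> V"
      have "card {p' \<in> set (ps @ [p]). edge_in W p'} \<le> card {p' \<in> G. edge_in W p'}"
        using snoc.prems fG by (intro card_mono) auto
      then show "card {p' \<in> set (ps @ [p]). edge_in W p'} \<le> card W" using hall[OF W] by linarith
    qed
    then obtain l where l: "l \<ge> card (set (ps @ [p]))" "polys.chain V l (psat V {} {} {}) q" by blast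
    have "card (set (ps @ [p])) = Suc (length ps)" using distinct_card[OF snoc.prems(1)] by simp
    moreover have "l + d \<le> card V" using chain_length_le[OF V(1) polys.chain_append[OF P' l(2)]] .
    ultimately show False using l(1) d by simp
  qed
  then have "polys.regs V {0} (?fs @ [?f])"
    unfolding polys.regs_snoc[OF R(2)] J_def[symmetric] using IH R(1) by blast
  then show ?case by simp
qed simp

text \<open>The consequences of regularity are separated from the combinatorics: \<open>J\<close>
  below is the ideal of any regular sequence \<open>fs\<close>.\<close>

locale regular_ideal =
  fixes V :: "'v set" and fs :: "('v, 'k::field) mpoly list"
  assumes finV: "finite V" and regs: "polys.regs V {0} fs"
begin

definition J where "J = polys.gen V (set fs)"

lemma noeth: "Noeth (polys V :: ('v, 'k) mpoly set)"
  using noeth_polys[OF finV] .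

lemma fs_sub: "set fs \<subseteq> polys V"
  using regs by (rule polys.regs_sub)

lemma fs_J: "set fs \<subseteq> J"
  unfolding J_def by (rule polys.gen_superset)

lemma J_idl: "polys.idl V J"
  unfolding J_def by (rule polys.gen_idl[OF fs_sub])

text \<open>The regular sequence supplies \<open>length fs\<close> further steps below the start of
  the chain.\<close>

lemma chain_over_J:
  assumes "polys.chain V k Q P" "J \<subseteq> Q"
  shows "length fs + k \<le> card V"
proof -
  have Q: "polys.prime_idl V Q" using polys.chain_primes[OF assms(1)] by blast
  have "{0} \<subseteq> Q" using polys.idl_zero[OF polys.prime_idl_idl[OF Q]] by simp
  then obtain Q0 where "polys.chain V (length fs) Q0 Q"
    using polys.regs_chain_below[OF noeth polys.idl_zero_set regs Q] fs_J assms(2) by blast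
  then show ?thesis using chain_length_le[OF finV polys.chain_append[OF assms(1)]] by blast
qed

lemma regs_over_J:
  assumes "polys.regs V J hs" "set hs \<subseteq> M" "polys.prime_idl V M" "J \<subseteq> M"
  shows "length fs + length hs \<le> card V"
  using polys.regs_chain_below[OF noeth J_idl assms(1,3,4,2)] chain_over_J by blast

lemma max_regs:
  assumes M: "polys.max_idl V M" "J \<subseteq> M"
  shows "\<exists>gs. set gs \<subseteq> M \<and> length fs + length gs = card V \<and> polys.regs V J gs"
proof -
  have Mp: "polys.prime_idl V M" using M(1) by (rule polys.max_idl_prime)
  have Mi: "polys.idl V M" using Mp by (rule polys.prime_idl_idl)
  obtain hs where hs: "length hs = card V" "set hs \<subseteq> M" "polys.regs V {0} hs"
    using max_idl_regs[OF finV M(1)] by blast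
  have "length fs \<le> card V" using chain_over_J[OF polys.chain_0[OF Mp] M(2)] by simp
  then obtain d where d: "length fs + d = card V" using le_Suc_ex by metis
  then show ?thesis
    using polys.regs_extend[OF noeth Mi hs(3,2) regs] fs_J M(2) hs(1) unfolding J_def by (metis subset_trans)
qed

lemma max_chain:
  assumes M: "polys.max_idl V M" "J \<subseteq> M"
  shows "\<exists>Q. J \<subseteq> Q \<and> polys.chain V (card V - length fs) Q M"
proof -
  have Mp: "polys.prime_idl V M" using M(1) by (rule polys.max_idl_prime)
  obtain gs where "set gs \<subseteq> M" "length fs + length gs = card V" "polys.regs V J gs" using max_regs[OF M] by blast
  moreover from this have "card V - length fs = length gs" by linarith
  ultimately show ?thesis using polys.regs_chain_below[OF noeth J_idl _ Mp M(2), of gs] by simp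
qed

text \<open>The upper bound replaces Krull's height theorem. A minimal prime \<open>P\<close> is
  associated to \<open>J\<close>, so Ischebeck's inequality in a maximal ideal above
  \<open>P\<close> gives \<open>card V - length fs\<close> steps starting at \<open>P\<close>, and
  only \<open>length fs\<close> steps remain below.\<close>

lemma minimal_prime_chains:
  assumes P: "polys.prime_idl V P" "J \<subseteq> P" and min: "\<And>Q. polys.prime_idl V Q \<Longrightarrow> J \<subseteq> Q \<Longrightarrow> Q \<subseteq> P \<Longrightarrow> Q = P"
  shows "\<exists>Q. polys.chain V (length fs) Q P" "polys.chain V k Q P \<Longrightarrow> k \<le> length fs"
proof -
  have Pi: "polys.idl V P" using P(1) by (rule polys.prime_idl_idl)
  have z: "{0} \<subseteq> P" using polys.idl_zero[OF Pi] by simp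
  show "\<exists>Q. polys.chain V (length fs) Q P"
    using polys.regs_chain_below[OF noeth polys.idl_zero_set regs P(1) z] fs_J P(2) by blast
  assume k: "polys.chain V k Q P"
  have "1 \<notin> P" using P(1) by (rule polys.prime_idl_one)
  then obtain M where M: "polys.max_idl V M" "P \<subseteq> M" using polys.noeth_max_idl[OF noeth Pi] by blast
  have Mp: "polys.prime_idl V M" using M(1) by (rule polys.max_idl_prime)
  have "\<exists>q c. polys.prime_idl V q \<and> q \<subseteq> P \<and> c \<in> polys V \<and> (\<forall>a\<in>polys V. a * (c * 1) \<in> J \<longleftrightarrow> a \<in> q)"
    by (rule polys.assoc_prime_exists[OF noeth J_idl P(1)]) (use P(2) in auto)
  then obtain q c where q: "polys.prime_idl V q" "q \<subseteq> P" "c \<in> polys V"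
    and qc: "\<And>a. a \<in> polys V \<Longrightarrow> a * c \<in> J \<longleftrightarrow> a \<in> q" by auto
  have "J \<subseteq> q" using qc polys.idl_mult2[OF J_idl q(3)] polys.idl_mem[OF J_idl] by blast
  then have qP: "q = P" using min q by blast
  have JM: "J \<subseteq> M" using P(2) M(2) by blast
  obtain gs where gs: "set gs \<subseteq> M" "length fs + length gs = card V" "polys.regs V J gs"
    using max_regs[OF M(1) JM] by blast
  have "\<exists>P'. polys.chain V (length gs) P P' \<and> P' \<subseteq> M"
    by (rule polys.ischebeck[OF noeth Mp J_idl gs(3,1) P(1) M(2) q(3)])
      (use qc qP M(2) polys.idl_mem[OF Pi] in blast)+
  then obtain P' where "polys.chain V (length gs) P P'" by blast
  then have "k + length gs \<le> card V" using chain_length_le[OF finV polys.chain_append[OF _ k]] by blast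
  then show "k \<le> length fs" using gs(2) by linarith
qed

end

section \<open>Ideals of collections with a heavy set of vertices\<close>

text \<open>Among chains of primes above \<open>I\<close> that end in \<open>Q\<close> there is a
  longest one, since lengths are bounded by \<open>card V\<close>; its first member is
  minimal.\<close>

lemma minimal_prime_below:
  fixes Q :: "('v, 'k::field) mpoly set"
  assumes "finite V" "polys.prime_idl V Q" "I \<subseteq> Q"
  shows "\<exists>P. polys.prime_idl V P \<and> I \<subseteq> P \<and> P \<subseteq> Q \<and>
    (\<forall>P'. polys.prime_idl V P' \<and> I \<subseteq> P' \<and> P' \<subseteq> P \<longrightarrow> P' = P)"
proof -
  let ?A = "\<lambda>k. \<exists>P. polys.chain V k P Q \<and> I \<subseteq> P"
  have "?A 0" using polys.chain_0[OF assms(2)] assms(3) by blast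
  moreover have "\<forall>k. ?A k \<longrightarrow> k \<le> card V" using chain_length_le[OF assms(1)] by blast
  ultimately obtain k where k: "?A k" "\<And>l. ?A l \<Longrightarrow> l \<le> k"
    using Nat.ex_has_greatest_nat[of ?A 0 "card V"] by blast
  from k(1) obtain P where P: "polys.chain V k P Q" "I \<subseteq> P" by blast
  have "P' = P" if P': "polys.prime_idl V P'" "I \<subseteq> P'" "P' \<subseteq> P" for P'
  proof (rule ccontr)
    assume "P' \<noteq> P"
    then have "polys.chain V (Suc k) P' Q" using polys.chain_Cons[OF P'(1) _ P(1)] P'(3) by blast
    then show False using k(2)[of "Suc k"] P'(2) by auto
  qed
  then show ?thesis using P polys.chain_primes[OF P(1)] by blast
qed

text \<open>Independent quadrics need as many generators as there are quadrics, because only the constant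
  coefficients of the multipliers contribute to the quadratic part.\<close>

definition low2 :: "('v, 'k::field) mpoly \<Rightarrow> bool" where
  "low2 p \<longleftrightarrow> (\<forall>m\<in>keys p. 2 \<le> monom_deg m)"

definition quad :: "('v, 'k::field) mpoly \<Rightarrow> ('v, 'k) mpoly" where
  "quad p = (\<Sum>m\<in>{m\<in>keys p. monom_deg m = 2}. single m (lookup p m))"

lemma lookup_quad: "lookup (quad p) m = (if monom_deg m = 2 then lookup p m else 0)"
proof -
  have "lookup (quad p) m = (\<Sum>m'\<in>{m\<in>keys p. monom_deg m = 2}. lookup (single m' (lookup p m')) m)"
    by (simp add: quad_def lookup_sum)
  also have "\<dots> = (\<Sum>m'\<in>{m\<in>keys p. monom_deg m = 2}. if m' = m then lookup p m else 0)"
    by (rule sum.cong) (auto simp: lookup_single when_def)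
  also have "\<dots> = (if m \<in> {m\<in>keys p. monom_deg m = 2} then lookup p m else 0)"
    by (rule sum.delta) simp
  finally show ?thesis by (auto simp: in_keys_iff)
qed

lemma quad_simps [simp]: "quad 0 = 0" "quad (p + q) = quad p + quad q" "quad (Const c * p) = Const c * quad p"
  by (rule poly_mapping_eqI; simp add: lookup_quad lookup_add lookup_Const_mult)+

lemma quad_eq: "(\<And>m. m \<in> keys p \<Longrightarrow> monom_deg m = 2) \<Longrightarrow> quad p = p"
  by (rule poly_mapping_eqI) (auto simp: lookup_quad in_keys_iff)

lemma quad_eq_0: "(\<And>m. m \<in> keys p \<Longrightarrow> monom_deg m \<noteq> 2) \<Longrightarrow> quad p = 0"
  by (rule poly_mapping_eqI) (auto simp: lookup_quad in_keys_iff)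

lemma keys_Var_mult: "m \<in> keys (Var v * p) \<Longrightarrow> \<exists>m'\<in>keys p. m = single v 1 + m'"
  using keys_mult[of "Var v" p] by (auto simp: Var_def)

lemma low2_simps: "low2 0" "low2 p \<Longrightarrow> low2 q \<Longrightarrow> low2 (p + q)" "low2 p \<Longrightarrow> low2 (Const c * p)"
  using keys_add[of p q] keys_Const_mult[of c p] by (auto simp: low2_def)

text \<open>The scalar is the constant term of \<open>r\<close>. Its independence of
  \<open>y\<close> is what lets the statement pass through products.\<close>

lemma quad_mult:
  assumes "r \<in> polys V"
  shows "\<exists>c. \<forall>y. low2 y \<longrightarrow> low2 (r * y) \<and> quad (r * y) = Const c * quad (y :: ('v, 'k::field) mpoly)"
  using assms
proof (induction rule: polys_induct)
  case (Const c)
  show ?case by (intro exI[of _ c]) (simp add: low2_simps)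
next
  case (Var v)
  have "3 \<le> monom_deg m" if "low2 y" "m \<in> keys (Var v * y)" for y m
    using keys_Var_mult[OF that(2)] that(1) by (auto simp: low2_def monom_deg_plus)
  then have "low2 (Var v * y) \<and> quad (Var v * y) = Const 0 * quad y" if "low2 y" for y
    using that by (force simp: low2_def intro!: quad_eq_0)
  then show ?case by blast
next
  case (add p q)
  then obtain c d where "\<forall>y. low2 y \<longrightarrow> low2 (p * y) \<and> quad (p * y) = Const c * quad y"
    "\<forall>y. low2 y \<longrightarrow> low2 (q * y) \<and> quad (q * y) = Const d * quad y" by blast
  then show ?case by (intro exI[of _ "c + d"]) (simp add: distrib_right low2_simps)
next
  case (mult p q)
  then obtain c d where "\<forall>y. low2 y \<longrightarrow> low2 (p * y) \<and> quad (p * y) = Const c * quad y"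
    "\<forall>y. low2 y \<longrightarrow> low2 (q * y) \<and> quad (q * y) = Const d * quad y" by blast
  then show ?case by (intro exI[of _ "c * d"]) (simp add: mult.assoc)
qed

theorem quadric_generators_bound:
  fixes b :: "nat \<Rightarrow> ('v, 'k::field) mpoly"
  assumes X: "finite X" "X \<subseteq> polys V" "\<And>x. x \<in> X \<Longrightarrow> low2 x"
    and b: "indep {0} h b" "\<And>i. i < h \<Longrightarrow> b i \<in> polys.gen V X" "\<And>i. i < h \<Longrightarrow> quad (b i) = b i"
  shows "h \<le> card X"
proof -
  define T where "T = quad ` X"
  define Sp where "Sp = {y. \<exists>c. y = (\<Sum>t\<in>T. Const (c t) * t)}"
  have T: "finite T" "card T \<le> card X" using X(1) by (auto simp: T_def card_image_le)
  have S0: "0 \<in> Sp" unfolding Sp_def by (auto intro!: exI[of _ "\<lambda>_. 0"])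
  have Sadd: "y + z \<in> Sp" if yz: "y \<in> Sp" "z \<in> Sp" for y z
  proof -
    obtain c d where "y = (\<Sum>t\<in>T. Const (c t) * t)" "z = (\<Sum>t\<in>T. Const (d t) * t)" using yz by (auto simp: Sp_def)
    then have "y + z = (\<Sum>t\<in>T. Const (c t + d t) * t)" by (simp add: distrib_right sum.distrib)
    then show ?thesis unfolding Sp_def by (intro CollectI exI[of _ "\<lambda>t. c t + d t"])
  qed
  have Smult: "Const a * y \<in> Sp" if y: "y \<in> Sp" for a y
  proof -
    obtain c where "y = (\<Sum>t\<in>T. Const (c t) * t)" using y by (auto simp: Sp_def)
    then have "Const a * y = (\<Sum>t\<in>T. Const (a * c t) * t)" by (simp add: sum_distrib_left mult.assoc)
    then show ?thesis unfolding Sp_def by (intro CollectI exI[of _ "\<lambda>t. a * c t"])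
  qed
  have ST: "t \<in> Sp" if t: "t \<in> T" for t
  proof -
    have "(\<Sum>t'\<in>T. Const (if t' = t then 1 else 0) * t') = (\<Sum>t'\<in>T. if t' = t then t else 0)"
      by (rule sum.cong) auto
    then have "t = (\<Sum>t'\<in>T. Const (if t' = t then 1 else 0) * t')" using t T(1) by simp
    then show ?thesis unfolding Sp_def by (intro CollectI exI[of _ "\<lambda>t'. if t' = t then 1 else 0"])
  qed
  let ?J = "{y \<in> polys V. low2 y \<and> quad y \<in> Sp}"
  have "polys.idl V ?J"
  proof (rule polys.idlI)
    fix r a :: "('v, 'k) mpoly" assume r: "r \<in> polys V" and a: "a \<in> ?J"
    obtain c where "\<forall>y. low2 y \<longrightarrow> low2 (r * y) \<and> quad (r * y) = Const c * quad y" using quad_mult[OF r] by blast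
    then show "r * a \<in> ?J" using r a Smult by auto
  qed (auto simp: low2_simps S0 Sadd)
  then have "polys.gen V X \<subseteq> ?J" by (rule polys.gen_least) (use X ST T_def in auto)
  then have "b i \<in> Sp" if "i < h" for i using b(2,3)[OF that] by auto
  then have "\<exists>c. b i = (\<Sum>t\<in>T. Const (c t) * t)" if "i < h" for i using that unfolding Sp_def by blast
  then have "h \<le> card T" by (rule indep_span_bound[OF b(1) T(1)])
  then show ?thesis using T(2) by linarith
qed

lemma Var_mult_Var: "Var u * Var v = single (single u 1 + single v 1) 1"
  by (simp add: Var_def mult_single)

lemma adj_minor_single:
  "adj_minor p = single (single p 1 + single (top_corner p) 1) 1 -
     single (single (fst p, snd p + 1) 1 + single (fst p + 1, snd p) 1) 1"
  by (simp add: adj_minor_alt Var_mult_Var)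

lemma keys_adj_minor:
  assumes "m \<in> keys (adj_minor p :: (point, 'k::field) mpoly)"
  shows "monom_deg m = 2"
proof -
  let ?a = "single p 1 + single (top_corner p) (1::nat)"
  let ?b = "single (fst p, snd p + 1) 1 + single (fst p + 1, snd p) (1::nat)"
  have "m \<in> keys (single ?a (1::'k)) \<union> keys (single ?b (1::'k))"
    using assms keys_diff[of "single ?a (1::'k)" "single ?b 1"] unfolding adj_minor_single by blast
  then show ?thesis by (auto simp: monom_deg_plus)
qed

text \<open>The diagonal monomial determines its cell and is never the antidiagonal monomial of a
  cell. So each minor has a monomial occurring in no other, whence the independence of the
  minors.\<close>

lemma lookup_adj_minor:
  "lookup (adj_minor q :: (point, 'k::field) mpoly) (single p 1 + single (top_corner p) 1) = (if q = p then 1 else 0)"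
proof -
  have eq: "{u, v} = {u', v'}" if "single u (1::nat) + single v 1 = single u' 1 + single v' 1" for u v u' v' :: point
    using arg_cong[OF that, of keys] by (simp add: keys_plus_nat insert_commute)
  have 1: "single (fst q, snd q + 1) (1::nat) + single (fst q + 1, snd q) 1 \<noteq> single p 1 + single (top_corner p) 1"
  proof
    assume "single (fst q, snd q + 1) (1::nat) + single (fst q + 1, snd q) 1 = single p 1 + single (top_corner p) 1"
    from eq[OF this] show False by (cases p, cases q) (auto simp: top_corner_def doubleton_eq_iff)
  qed
  have 2: "q = p" if "single q (1::nat) + single (top_corner q) 1 = single p 1 + single (top_corner p) 1"
    using eq[OF that] by (cases p, cases q) (auto simp: top_corner_def doubleton_eq_iff)
  show ?thesis using 1 2 by (auto simp: adj_minor_single lookup_minus lookup_single when_def)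
qed

lemma indep_adj_minors:
  assumes "inj_on e {..<h}"
  shows "indep {0} h (\<lambda>i. adj_minor (e i) :: (point, 'k::field) mpoly)"
  unfolding indep_def
proof (intro allI impI)
  fix c and i assume z: "(\<Sum>i<h. Const (c i) * adj_minor (e i)) \<in> {0 :: (point, 'k) mpoly}" and i: "i < h"
  let ?m = "single (e i) 1 + single (top_corner (e i)) (1::nat)"
  have "(\<Sum>j<h. lookup (Const (c j) * adj_minor (e j)) ?m) = lookup (0 :: (point, 'k) mpoly) ?m"
    using z by (simp flip: lookup_sum)
  also have "(\<Sum>j<h. lookup (Const (c j) * adj_minor (e j)) ?m) = (\<Sum>j<h. if j = i then c i else 0)"
    using assms i by (intro sum.cong) (auto simp: lookup_Const_mult lookup_adj_minor[unfolded One_nat_def] inj_on_def)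
  finally show "c i = 0" using i by simp
qed

lemma coeff_hom_id: "coeff_hom id"
  by unfold_locales auto

section \<open>The primes \<open>Q\<close> and \<open>L\<close> and their common maximal ideal
  \<open>M\<close>\<close>

locale heavy_cells =
  fixes G W V and I :: "(point, 'k::field) mpoly set"
  assumes finG: "finite G" and heavy: "heavy G W"
  defines "V \<equiv> \<Union> (cell ` G)" and "I \<equiv> polys.gen V (adj_minor ` G)"
begin

definition D where "D = {p\<in>G. cell p \<inter> W = {}}"
text \<open>Setting all free coordinates to 1 cuts the variety of \<open>Q\<close> down to one
  point, so \<open>card F\<close> is the length of a chain from \<open>Q\<close> to the maximal
  ideal \<open>M\<close>.\<close>

definition F where "F = V - W - top_corner ` D"
definition Q :: "(point, 'k) mpoly set" where "Q = psat V W D {}"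
definition M :: "(point, 'k) mpoly set" where "M = psat V W D F"
definition L :: "(point, 'k) mpoly set" where "L = psat V {} G {}"

lemma finV: "finite V" unfolding V_def using finG by (auto simp: cell_alt)

lemma cell_V: "p \<in> G \<Longrightarrow> cell p \<subseteq> V" by (auto simp: V_def)

lemma noethV: "Noeth (polys V :: (point, 'k) mpoly set)"
  using noeth_polys[OF finV] .

lemma WV: "W \<subseteq> V" and bal: "p \<in> G \<Longrightarrow> balanced W p" and edge: "p \<in> G \<Longrightarrow> p \<notin> D \<Longrightarrow> edge_in W p"
  and cW: "card W < card {p\<in>G. cell p \<inter> W \<noteq> {}}"
  using heavy by (auto simp: heavy_def V_def D_def)

lemma adm: "admissible V W D F" "admissible V W D {}" "admissible V {} G {}"
  using finV finG WV cell_V by (auto simp: admissible_def D_def F_def)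

lemma primes: "polys.prime_idl V Q" "polys.prime_idl V M" "polys.prime_idl V L"
  unfolding Q_def M_def L_def by (rule psat_prime adm)+

lemma minors_polys: "adj_minor ` G \<subseteq> (polys V :: (point, 'k) mpoly set)"
  using adj_minor_polys[OF cell_V] by blast

lemma I_idl: "polys.idl V I" unfolding I_def by (rule polys.gen_idl[OF minors_polys])

lemma minors_I: "adj_minor ` G \<subseteq> I" unfolding I_def by (rule polys.gen_superset)

lemma I_Q: "I \<subseteq> Q"
proof -
  have Qi: "polys.idl V Q" using primes(1) by (rule polys.prime_idl_idl)
  have pg: "pgens W D {} \<subseteq> Q" unfolding Q_def using psat_inc[OF adm(2)] polys.gen_superset by blast
  have "adj_minor p \<in> Q" if p: "p \<in> G" for p
  proof (cases "p \<in> D")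
    case True
    then show ?thesis using pg by (auto simp: pgens_def)
  next
    case False
    have R: "Var p \<in> polys V" "Var (top_corner p) \<in> polys V" "Var (fst p, snd p + 1) \<in> polys V" "Var (fst p + 1, snd p) \<in> polys V"
      using cell_V[OF p] by (auto simp: cell_alt)
    have w: "Var ` W \<subseteq> Q" using pg by (auto simp: pgens_def)
    have "Var p \<in> Q \<or> Var (top_corner p) \<in> Q" "Var (fst p, snd p + 1) \<in> Q \<or> Var (fst p + 1, snd p) \<in> Q"
      using edge[OF p False] w unfolding edge_in_def by blast+
    then have "Var p * Var (top_corner p) \<in> Q" "Var (fst p, snd p + 1) * Var (fst p + 1, snd p) \<in> Q"
      using polys.idl_mult_either[OF Qi R(1,2)] polys.idl_mult_either[OF Qi R(3,4)] by blast+
    then show ?thesis unfolding adj_minor_alt by (rule polys.idl_diff[OF Qi])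
  qed
  then have "adj_minor ` G \<subseteq> Q" by blast
  then show ?thesis unfolding I_def by (rule polys.gen_least[OF Qi])
qed

lemma I_L: "I \<subseteq> L"
  unfolding I_def L_def using psat_inc[OF adm(3)] by (simp add: pgens_def)

text \<open>The failure of the Hall bound enters here: there are
  \<open>card V - card W - card D\<close> free coordinates, and
  \<open>card W < card (G - D)\<close>.\<close>

lemma card_F: "card V < card G + card F"
proof -
  have top: "top_corner ` D \<subseteq> V - W" using adm(2) by (auto simp: admissible_def cell_alt)
  have "inj_on top_corner D" by (auto simp: inj_on_def top_corner_def prod_eq_iff)
  then have cD: "card (top_corner ` D) = card D" by (rule card_image)
  have fin: "finite W" "finite D" using WV finV finite_subset finG by (auto simp: D_def)
  have "card F = card (V - W) - card (top_corner ` D)"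
    unfolding F_def using fin top by (intro card_Diff_subset) auto
  moreover have "card (V - W) = card V - card W" using fin WV by (intro card_Diff_subset)
  moreover have "G - D = {p\<in>G. cell p \<inter> W \<noteq> {}}" by (auto simp: D_def)
  then have "card W < card (G - D)" using cW by simp
  moreover have "card (G - D) = card G - card D" using fin by (intro card_Diff_subset) (auto simp: D_def)
  ultimately show ?thesis using cD by linarith
qed

lemma chain_QM: "polys.chain V (card F) Q M"
  unfolding Q_def M_def by (rule chain_F[OF adm(1)])

lemma chain_L: "polys.chain V (card G) (psat V {} {} {}) L"
  unfolding L_def by (rule chain_D[OF adm(3)])

text \<open>A chain ending below \<open>Q\<close> can be continued by \<open>card F\<close> steps to
  \<open>M\<close>, within the total length \<open>card V\<close>.\<close>

lemma below_Q:
  assumes "polys.chain V k P0 P" "P \<subseteq> Q"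
  shows "k < card G"
proof -
  obtain l where "l \<ge> k" "polys.chain V l P0 Q" using polys.chain_end_mono[OF assms(1) primes(1) assms(2)] by blast
  then show ?thesis using chain_length_le[OF finV polys.chain_append[OF chain_QM]] card_F by fastforce
qed

definition pt :: "point \<Rightarrow> 'k" where "pt v = (if v \<in> W then 0 else 1)"

lemma M_kernel: "M = {h \<in> polys V. ev id pt h = 0}"
  unfolding M_def
proof (rule psat_eq_kernel[OF coeff_hom_id adm(1)])
  interpret coeff_hom "id :: 'k \<Rightarrow> 'k" by (rule coeff_hom_id)
  have e: "V - W - top_corner ` D - F = {}" by (auto simp: F_def)
  show "h = 0" if h: "h \<in> polys (V - W - top_corner ` D - F)" "ev id pt h = 0" for h
  proof -
    obtain c where c: "h = Const c" using h(1) unfolding e polys_empty by blast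
    have c0: "c = 0" using h(2) unfolding c ev_Const id_apply .
    show ?thesis unfolding c c0 by (rule Const_simps(1))
  qed
  show "minor_eq pt p" if "p \<in> D" for p
  proof -
    have "cell p \<inter> W = {}" using that by (simp add: D_def)
    then have "pt u = 1" if "u \<in> cell p" for u using that by (auto simp: pt_def)
    then show ?thesis by (simp add: minor_eq_def cell_alt top_corner_def)
  qed
qed (auto simp: pt_def F_def)

lemma M_max: "polys.max_idl V M"
  unfolding polys.max_idl_def
proof (intro conjI allI impI)
  interpret coeff_hom "id :: 'k \<Rightarrow> 'k" by (rule coeff_hom_id)
  show Mi: "polys.idl V M" using primes(2) by (rule polys.prime_idl_idl)
  show "1 \<notin> M" using primes(2) by (rule polys.prime_idl_one)
  fix J assume J: "polys.idl V J \<and> 1 \<notin> J \<and> M \<subseteq> J"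
  then have Ji: "polys.idl V J" by blast
  have "h \<in> M" if h: "h \<in> J" for h
  proof -
    let ?c = "ev id pt h"
    have hV: "h \<in> polys V" using polys.idl_mem[OF Ji h] .
    then have "h - Const ?c \<in> M" unfolding M_kernel by auto
    then have "h - Const ?c \<in> J" using J by blast
    from polys.idl_diff[OF Ji h this] have c: "Const ?c \<in> J" by simp
    have "?c = 0"
    proof (rule ccontr)
      assume "?c \<noteq> 0"
      then have "Const (inverse ?c) * Const ?c = (1 :: (point, 'k) mpoly)" by (metis Const_simps(2,5) left_inverse)
      then show False using polys.idl_mult[OF Ji Const_polys c, of "inverse ?c"] J by simp
    qed
    then show ?thesis using hV unfolding M_kernel by blast
  qed
  then show "J = M" using J by blast
qed

lemma L_M: "L \<subseteq> M"
proof
  fix h assume h: "h \<in> L"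
  then have hV: "h \<in> polys V" unfolding L_def psat_def by blast
  interpret C: coeff_hom "Const :: 'k \<Rightarrow> (point, 'k) mpoly" by (rule coeff_hom_Const)
  interpret coeff_hom "id :: 'k \<Rightarrow> 'k" by (rule coeff_hom_id)
  \<comment> \<open>A curve on the toric variety: \<open>Var undefined\<close> merely serves as a
    parameter, placed on the coordinates in \<open>W\<close>, and balance makes all minors vanish
    along it. Its coordinates are nonzero, so \<open>L\<close> vanishes on it, and hence also at
    \<open>pt\<close>, which is reached at parameter value 0.\<close>
  define g where "g v = (if v \<in> W then Var undefined else 1 :: (point, 'k) mpoly)" for v
  have nz: "Var v \<noteq> (0 :: (point, 'k) mpoly)" for v :: point
    by (metis Var_def lookup_single_eq lookup_zero zero_neq_one)
  have "ev Const g h = 0"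
  proof (rule psat_kill[OF coeff_hom_Const adm(3)])
    show "h \<in> psat V {} G {}" using h by (simp add: L_def)
    show "minor_eq g p" if "p \<in> G" for p
      using bal[OF that] unfolding minor_eq_def balanced_def g_def top_corner_def by (auto split: if_splits)
  qed (use nz in \<open>auto simp: g_def\<close>)
  moreover have "ev id (\<lambda>_. 0) (ev Const g h) = ev id pt h"
    by (rule ev_compose[OF coeff_hom_id hV]) (simp add: g_def pt_def)
  ultimately show "h \<in> M" using hV by (simp add: M_kernel)
qed

lemma mono_L: "single m 1 \<notin> L"
proof
  interpret coeff_hom "id :: 'k \<Rightarrow> 'k" by (rule coeff_hom_id)
  assume m: "single m 1 \<in> L"
  have "ev id (\<lambda>_. 1 :: 'k) (single m 1) = 0"
    by (rule psat_kill[OF coeff_hom_id adm(3) _ _ _ _ m[unfolded L_def]]) (auto simp: minor_eq_def)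
  then show False by (simp add: mon_def)
qed

lemma L_minimal:
  assumes "polys.prime_idl V P" "I \<subseteq> P" "P \<subseteq> L"
  shows "P = L"
proof -
  have "pgens {} G {} \<subseteq> P" using minors_I assms(2) by (auto simp: pgens_def)
  moreover have "Var v \<notin> P" for v using mono_L[of "single v 1"] assms(3) by (auto simp: Var_def)
  ultimately have "L \<subseteq> P" unfolding L_def by (intro psat_below_prime[OF assms(1)])
  then show ?thesis using assms(3) by blast
qed

text \<open>A monomial multiplies each of the finitely many generators of \<open>L\<close> into
  \<open>I\<close>, and the product of these monomials does so for all of them. It is not in
  \<open>L\<close>, so \<open>L\<close> is an associated prime of \<open>I\<close>, as Ischebeck's
  inequality requires.\<close>

lemma L_kill: "\<exists>r\<in>polys V. r \<notin> L \<and> (\<forall>a\<in>L. a * r \<in> I)"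
proof -
  have Li: "polys.idl V L" using primes(3) by (rule polys.prime_idl_idl)
  obtain X where X: "finite X" "X \<subseteq> polys V" "L = polys.gen V X" using polys.noethE[OF noethV Li] by blast
  have "\<exists>m. keys m \<subseteq> V \<and> (\<forall>x\<in>Y. single m 1 * x \<in> I)" if "finite Y" "Y \<subseteq> L" for Y
    using that
  proof (induction Y rule: finite_induct)
    case empty
    show ?case by (intro exI[of _ 0]) auto
  next
    case (insert x Y)
    then obtain m where m: "keys m \<subseteq> V" "\<forall>x\<in>Y. single m 1 * x \<in> I" by auto
    have "x \<in> L" using insert by auto
    then obtain m' where m': "keys m' \<subseteq> V" "single m' 1 * x \<in> I"
      unfolding L_def psat_def I_def pgens_def by auto
    have mm: "single (m + m') (1::'k) = single m 1 * single m' 1" "single (m + m') (1::'k) = single m' 1 * single m 1"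
      by (simp_all add: mult_single add.commute)
    have "single (m + m') 1 * y \<in> I" if "y \<in> insert x Y" for y
    proof (cases "y = x")
      case True
      then show ?thesis unfolding mm(1) mult.assoc using polys.idl_mult[OF I_idl single_polys'[OF m(1)] m'(2)] by simp
    next
      case False
      then have "single m 1 * y \<in> I" using that m(2) by blast
      then show ?thesis unfolding mm(2) mult.assoc by (rule polys.idl_mult[OF I_idl single_polys'[OF m'(1)]])
    qed
    then show ?case using m(1) m'(1) by (intro exI[of _ "m + m'"]) (auto simp: keys_plus_nat)
  qed
  from this[OF X(1)] obtain m where m: "keys m \<subseteq> V" "\<forall>x\<in>X. single m 1 * x \<in> I"
    using X(3) polys.gen_superset[of X V] by auto
  let ?r = "single m (1::'k)"
  have r: "?r \<in> polys V" using m(1) by (rule single_polys')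
  have "X \<subseteq> {s \<in> polys V. s * ?r \<in> I}" using X(2) m(2) by (auto simp: mult.commute)
  then have "L \<subseteq> {s \<in> polys V. s * ?r \<in> I}" unfolding X(3) by (rule polys.gen_least[OF polys.colon_idl[OF I_idl r]])
  then show ?thesis using r mono_L[of m] by blast
qed

lemma depth_M:
  assumes "polys.regs V I xs" "set xs \<subseteq> M"
  shows "length xs < card F"
proof -
  obtain r where r: "r \<in> polys V" "r \<notin> L" "\<And>a. a \<in> L \<Longrightarrow> a * r \<in> I" using L_kill by blast
  have "\<exists>P'. polys.chain V (length xs) L P' \<and> P' \<subseteq> M"
  proof (rule polys.ischebeck[OF noethV primes(2) I_idl assms primes(3) L_M r(1) r(3)])
    fix s assume s: "s \<in> polys V" "s * r \<in> I"
    then show "s \<in> M" using polys.prime_idl_mult[OF primes(3) s(1) r(1)] r(2) I_L L_M by blast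
  qed
  then obtain P' where "polys.chain V (length xs) L P'" by blast
  from chain_length_le[OF finV polys.chain_append[OF this chain_L]] show ?thesis using card_F by linarith
qed

lemma not_regular_gens:
  assumes "polys.regs V {0} xs"
  shows "I \<noteq> polys.gen V (set xs)"
proof
  assume eq: "I = polys.gen V (set xs)"
  have xsI: "set xs \<subseteq> I" unfolding eq by (rule polys.gen_superset)
  have z: "{0} \<subseteq> Q" using polys.idl_zero[OF polys.prime_idl_idl[OF primes(1)]] by simp
  obtain P where "polys.chain V (length xs) P Q"
    using polys.regs_chain_below[OF noethV polys.idl_zero_set assms primes(1) z] xsI I_Q by blast
  then have small: "length xs < card G" using below_Q by blast
  obtain e where e: "bij_betw e {..<card G} G" using ex_bij_betw_nat_finite[OF finG] by (auto simp: atLeast0LessThan)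
  have low: "low2 x" if "x \<in> I" for x
  proof -
    have "polys.idl V ({y \<in> polys V. low2 y} :: (point, 'k) mpoly set)"
    proof (rule polys.idlI)
      fix r a :: "(point, 'k) mpoly" assume r: "r \<in> polys V" and a: "a \<in> {y \<in> polys V. low2 y}"
      then show "r * a \<in> {y \<in> polys V. low2 y}" using quad_mult[OF r] by auto
    qed (auto simp: low2_simps)
    moreover have "adj_minor ` G \<subseteq> ({y \<in> polys V. low2 y} :: (point, 'k) mpoly set)"
    proof -
      have "low2 (adj_minor p :: (point, 'k) mpoly)" for p
        unfolding low2_def using keys_adj_minor[where p = p and 'k = 'k] by simp
      then show ?thesis using minors_polys by (simp add: image_subset_iff)
    qed
    ultimately have "I \<subseteq> {y \<in> polys V. low2 y}" unfolding I_def by (rule polys.gen_least)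
    then show ?thesis using that by blast
  qed
  have "card G \<le> card (set xs)"
  proof (rule quadric_generators_bound)
    show "indep {0} (card G) (\<lambda>i. adj_minor (e i) :: (point, 'k) mpoly)"
      using e by (intro indep_adj_minors) (auto simp: bij_betw_def)
    show "adj_minor (e i) \<in> polys.gen V (set xs)" if "i < card G" for i
    proof -
      have "e i \<in> G" using that e by (auto simp: bij_betw_def)
      then show ?thesis using minors_I unfolding eq[symmetric] by blast
    qed
    show "quad (adj_minor (e i)) = (adj_minor (e i) :: (point, 'k) mpoly)" for i
      by (rule quad_eq) (rule keys_adj_minor)
    show "set xs \<subseteq> polys V" using assms by (rule polys.regs_sub)
  qed (use xsI low in auto)
  then show False using small card_length[of xs] by linarith
qed

end

section \<open>The Koszul resolution\<close>

text \<open>The matrices of the Koszul complex, with respect to an arbitrary enumeration of the subsets of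
  each cardinality.\<close>

definition subs :: "nat \<Rightarrow> nat \<Rightarrow> nat set list" where
  "subs N i = (SOME xs. distinct xs \<and> set xs = {T. T \<subseteq> {..<N} \<and> card T = i})"

lemma subs: "distinct (subs N i)" "set (subs N i) = {T. T \<subseteq> {..<N} \<and> card T = i}"
proof -
  have "finite {T. T \<subseteq> {..<N} \<and> card T = i}" by simp
  then have "\<exists>xs. distinct xs \<and> set xs = {T. T \<subseteq> {..<N} \<and> card T = i}" using finite_distinct_list by metis
  then have "distinct (subs N i) \<and> set (subs N i) = {T. T \<subseteq> {..<N} \<and> card T = i}"
    unfolding subs_def by (rule someI_ex)
  then show "distinct (subs N i)" "set (subs N i) = {T. T \<subseteq> {..<N} \<and> card T = i}" by auto
qed

lemma length_subs: "length (subs N i) = N choose i"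
  using distinct_card[OF subs(1), of N i] n_subsets[of "{..<N}" i] by (simp add: subs(2))

lemma subs_nth: "s < N choose i \<Longrightarrow> subs N i ! s \<subseteq> {..<N} \<and> card (subs N i ! s) = i"
  using nth_mem[of s "subs N i"] by (simp add: subs(2) length_subs)

lemma subs_index:
  assumes "T \<subseteq> {..<N}" "card T = i"
  obtains s where "s < N choose i" "subs N i ! s = T"
proof -
  have "T \<in> set (subs N i)" using assms by (simp add: subs(2))
  then show ?thesis using that by (auto simp: in_set_conv_nth length_subs)
qed

lemma sum_subs: "(\<Sum>s<N choose i. f (subs N i ! s)) = (\<Sum>T | T \<subseteq> {..<N} \<and> card T = i. f T)"
  using sum.reindex_bij_betw[OF bij_betw_nth[OF subs(1) refl subs(2)[symmetric]], of f N i] by (simp add: length_subs)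

text \<open>At most one summand is nonzero; the sum form avoids selecting the element by which
  \<open>U\<close> exceeds \<open>T\<close>.\<close>

definition kcoef :: "(nat \<Rightarrow> 'a::comm_ring_1) \<Rightarrow> nat \<Rightarrow> nat set \<Rightarrow> nat set \<Rightarrow> 'a" where
  "kcoef p N T U = (\<Sum>k\<in>{..<N} - T. if U = insert k T then ksign k T * p k else 0)"

definition kmat :: "(nat \<Rightarrow> 'a::comm_ring_1) \<Rightarrow> nat \<Rightarrow> nat \<Rightarrow> 'a mat" where
  "kmat p N i = mat (N choose i) (N choose Suc i) (\<lambda>(r, s). kcoef p N (subs N i ! r) (subs N (Suc i) ! s))"

text \<open>A coordinate vector extended by 0 to a function on all index sets, so that the results
  about \<open>kosz\<close> apply to it.\<close>

definition subfn :: "nat \<Rightarrow> nat \<Rightarrow> 'a::comm_ring_1 vec \<Rightarrow> nat set \<Rightarrow> 'a" where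
  "subfn N i w U = (\<Sum>s<N choose i. if U = subs N i ! s then w $ s else 0)"

definition subvec :: "nat \<Rightarrow> nat \<Rightarrow> (nat set \<Rightarrow> 'a) \<Rightarrow> 'a vec" where
  "subvec N i \<omega> = vec (N choose i) (\<lambda>s. \<omega> (subs N i ! s))"

lemma subfn_nth:
  assumes "s < N choose i"
  shows "subfn N i w (subs N i ! s) = w $ s"
proof -
  have "(subs N i ! s = subs N i ! s') = (s' = s)" if "s' < N choose i" for s'
    using nth_eq_iff_index_eq[OF subs(1)[of N i], of s s'] assms that by (auto simp: length_subs)
  then have "subfn N i w (subs N i ! s) = (\<Sum>s'<N choose i. if s' = s then w $ s' else 0)"
    unfolding subfn_def by (intro sum.cong) auto
  then show ?thesis using assms by simp
qed

lemma subfn_subvec: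
  assumes "T \<subseteq> {..<N}" "card T = i"
  shows "subfn N i (subvec N i \<omega>) T = \<omega> T"
proof -
  obtain s where "s < N choose i" "subs N i ! s = T" using subs_index[OF assms] by blast
  then show ?thesis using subfn_nth[of s N i "subvec N i \<omega>"] by (auto simp: subvec_def)
qed

lemma kmat_mult:
  assumes "dim_vec w = N choose Suc i" "r < N choose i"
  shows "row (kmat p N i) r \<bullet> w = kosz p N (subfn N (Suc i) w) (subs N i ! r)"
proof -
  let ?T = "subs N i ! r"
  have "row (kmat p N i) r \<bullet> w = (\<Sum>s<N choose Suc i. kcoef p N ?T (subs N (Suc i) ! s) * w $ s)"
    using assms by (simp add: kmat_def scalar_prod_def lessThan_atLeast0)
  also have "\<dots> = (\<Sum>s<N choose Suc i. \<Sum>k\<in>{..<N} - ?T. ksign k ?T * p k * (if insert k ?T = subs N (Suc i) ! s then w $ s else 0))"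
    unfolding kcoef_def sum_distrib_right by (intro sum.cong) auto
  also have "\<dots> = (\<Sum>k\<in>{..<N} - ?T. ksign k ?T * p k * subfn N (Suc i) w (insert k ?T))"
    unfolding subfn_def sum_distrib_left by (rule sum.swap)
  finally show ?thesis by (simp add: kosz_def)
qed

lemma kmat_dim [simp]: "dim_row (kmat p N i) = N choose i" "dim_col (kmat p N i) = N choose Suc i"
  by (simp_all add: kmat_def)

lemma homogeneous_add: "homogeneous t p \<Longrightarrow> homogeneous t q \<Longrightarrow> homogeneous t (p + q)"
  using keys_add[of p q] by (auto simp: homogeneous_def)

lemma homogeneous_uminus: "homogeneous t (- p) \<longleftrightarrow> homogeneous t p"
  by (simp add: homogeneous_def)

lemma homogeneous_sum: "(\<And>i. i \<in> A \<Longrightarrow> homogeneous t (f i)) \<Longrightarrow> homogeneous t (sum f A)"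
  by (induction A rule: infinite_finite_induct) (simp_all add: homogeneous_add homogeneous_def[of _ 0])

lemma homogeneous_ksign: "homogeneous t p \<Longrightarrow> homogeneous t (ksign k T * p)"
  unfolding ksign_def by (cases "even (card {l \<in> T. l < k})") (simp_all add: homogeneous_uminus)

lemma homogeneous_kcoef: "(\<And>k. k < N \<Longrightarrow> homogeneous t (p k)) \<Longrightarrow> homogeneous t (kcoef p N T U)"
  unfolding kcoef_def by (intro homogeneous_sum) (auto intro: homogeneous_ksign simp: homogeneous_def[of _ 0])

lemma (in subring_set) kcoef_mem: "idl J \<Longrightarrow> (\<And>k. k < N \<Longrightarrow> p k \<in> J) \<Longrightarrow> kcoef p N T U \<in> J"
  unfolding kcoef_def by (rule idl_sum) (auto simp: idl_zero intro: idl_mult ksign_closed)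

lemma carrier_poly_ring: "carrier (poly_ring V) = polys V"
  by (simp add: poly_ring_def polys_def)

lemma free_module_carrier:
  "w \<in> carrier (free_module V n) \<longleftrightarrow> dim_vec w = n \<and> (\<forall>i<n. w $ i \<in> polys V)"
proof -
  have "carrier (free_module V n) = {w \<in> carrier_vec n. set\<^sub>v w \<subseteq> polys V}"
    by (simp add: free_module_def carrier_poly_ring)
  then show ?thesis by (auto simp only: mem_Collect_eq vec_set_def carrier_vec_def image_subset_iff lessThan_iff atLeast0LessThan)
qed

lemma free_module_ops:
  "zero (free_module V n) = 0\<^sub>v n" "add (free_module V n) = (+)" "module.smult (free_module V n) = (\<cdot>\<^sub>v)"
  by (simp_all add: free_module_def module_vec_def)

lemmas free_module_simps = free_module_carrier free_module_ops

context regular_ideal begin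

abbreviation "N \<equiv> length fs"
abbreviation "p k \<equiv> fs ! k"

lemma p_polys: "k < N \<Longrightarrow> p k \<in> polys V" and p_J: "k < N \<Longrightarrow> p k \<in> J"
  using fs_sub fs_J nth_mem by blast+

lemma J_iff: "y \<in> J \<longleftrightarrow> (\<exists>c. range c \<subseteq> polys V \<and> y = (\<Sum>k<N. p k * c k))"
proof -
  have "(!) fs ` {..<N} = set fs" using nth_image[of N fs] by (simp add: lessThan_atLeast0)
  then have "J = polys.gen V ({0} \<union> (!) fs ` {..<N})" unfolding J_def using polys.gen_insert_zero[OF fs_sub] by simp
  moreover have "y \<in> polys.gen V ({0} \<union> (!) fs ` {..<N}) \<longleftrightarrow> (\<exists>c. range c \<subseteq> polys V \<and> y - (\<Sum>k<N. p k * c k) \<in> {0})"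
    by (rule polys.gen_Un_image_iff[OF polys.idl_zero_set]) (rule p_polys)
  ultimately show ?thesis by simp
qed

lemma subfn_polys:
  assumes "w \<in> carrier (free_module V (N choose i))"
  shows "range (subfn N i w) \<subseteq> polys V"
proof -
  have "subfn N i w U \<in> polys V" for U
    unfolding subfn_def using assms by (intro polys.sum_closed) (auto simp: free_module_simps)
  then show ?thesis by auto
qed

lemma kmat_free:
  assumes "w \<in> carrier (free_module V (N choose Suc i))"
  shows "kmat p N i *\<^sub>v w \<in> carrier (free_module V (N choose i))"
proof -
  have "kosz p N (subfn N (Suc i) w) T \<in> polys V" for T
    by (rule polys.kosz_closed[OF _ subfn_polys[OF assms]]) (rule p_polys)
  then have "(kmat p N i *\<^sub>v w) $ r \<in> polys V" if "r < N choose i" for r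
    using assms that by (simp add: kmat_mult free_module_simps)
  then show ?thesis by (simp add: free_module_simps)
qed

lemma subvec_free: "range \<omega> \<subseteq> polys V \<Longrightarrow> subvec N i \<omega> \<in> carrier (free_module V (N choose i))"
  by (auto simp: free_module_simps subvec_def)

lemma subs_0: "subs N 0 ! 0 = {}"
  using subs_nth[of 0 N 0] by (auto dest: finite_subset)

lemma kmat_image_0:
  "(\<lambda>w. kmat p N 0 *\<^sub>v w) ` carrier (free_module V (N choose Suc 0)) = {w \<in> carrier (free_module V (N choose 0)). w $ 0 \<in> J}"
  (is "?l = ?r")
proof
  show "?l \<subseteq> ?r"
  proof
    fix v assume "v \<in> ?l"
    then obtain w where w: "w \<in> carrier (free_module V (N choose Suc 0))" "v = kmat p N 0 *\<^sub>v w" by blast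
    have "v $ 0 = kosz p N (subfn N (Suc 0) w) {}" using w by (simp add: kmat_mult free_module_simps subs_0)
    also have "\<dots> = (\<Sum>k<N. p k * subfn N (Suc 0) w {k})" by (simp add: kosz_def ksign_def)
    also have "\<dots> \<in> J" using p_J subfn_polys[OF w(1)] by (intro polys.idl_sum[OF J_idl] polys.idl_mult2[OF J_idl]) auto
    finally show "v \<in> ?r" using kmat_free[OF w(1)] w(2) by simp
  qed
  show "?r \<subseteq> ?l"
  proof
    fix v assume v: "v \<in> ?r"
    then obtain c where c: "range c \<subseteq> polys V" "v $ 0 = (\<Sum>k<N. p k * c k)" using J_iff by blast
    let ?\<omega> = "\<lambda>U. c (the_elem U)"
    let ?w = "subvec N (Suc 0) ?\<omega>"
    have w: "?w \<in> carrier (free_module V (N choose Suc 0))" using c(1) by (intro subvec_free) auto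
    have "(kmat p N 0 *\<^sub>v ?w) $ 0 = kosz p N (subfn N (Suc 0) ?w) {}"
      using w by (simp add: kmat_mult free_module_simps subs_0)
    also have "\<dots> = kosz p N ?\<omega> {}" by (rule kosz_cong) (simp add: subfn_subvec)
    also have "\<dots> = v $ 0" by (simp add: kosz_def ksign_def c(2))
    finally have "kmat p N 0 *\<^sub>v ?w = v" using v w by (intro eq_vecI) (auto simp: free_module_simps)
    then show "v \<in> ?l" using w by blast
  qed
qed

lemma kmat_image_Suc:
  "(\<lambda>w. kmat p N (Suc i) *\<^sub>v w) ` carrier (free_module V (N choose Suc (Suc i)))
     = {w \<in> carrier (free_module V (N choose Suc i)). kmat p N i *\<^sub>v w = 0\<^sub>v (N choose i)}"
  (is "?l = ?r")
proof
  have sf: "subfn N (Suc i) (kmat p N (Suc i) *\<^sub>v w) U = kosz p N (subfn N (Suc (Suc i)) w) U"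
    if w: "w \<in> carrier (free_module V (N choose Suc (Suc i)))" and U: "U \<subseteq> {..<N}" "card U = Suc i" for w U
  proof -
    obtain s where "s < N choose Suc i" "subs N (Suc i) ! s = U" using subs_index[OF U] by blast
    then show ?thesis using subfn_nth[of s N "Suc i" "kmat p N (Suc i) *\<^sub>v w"] w
      by (auto simp: kmat_mult free_module_simps)
  qed
  show "?l \<subseteq> ?r"
  proof
    fix v assume "v \<in> ?l"
    then obtain w where w: "w \<in> carrier (free_module V (N choose Suc (Suc i)))" "v = kmat p N (Suc i) *\<^sub>v w" by blast
    have vf: "v \<in> carrier (free_module V (N choose Suc i))" using kmat_free[OF w(1)] w(2) by simp
    have "(kmat p N i *\<^sub>v v) $ r = 0" if r: "r < N choose i" for r
    proof -
      have T: "subs N i ! r \<subseteq> {..<N}" "card (subs N i ! r) = i" using subs_nth[OF r] by auto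
      have "(kmat p N i *\<^sub>v v) $ r = kosz p N (subfn N (Suc i) v) (subs N i ! r)"
        using vf r by (simp add: kmat_mult free_module_simps)
      also have "\<dots> = kosz p N (kosz p N (subfn N (Suc (Suc i)) w)) (subs N i ! r)"
        unfolding w(2) using T by (intro kosz_cong sf[OF w(1)]) (auto simp: finite_subset)
      finally show ?thesis using kosz_kosz[OF T(1)] by simp
    qed
    then show "v \<in> ?r" using vf by (auto intro!: eq_vecI)
  qed
  show "?r \<subseteq> ?l"
  proof
    fix v assume "v \<in> ?r"
    then have v: "v \<in> carrier (free_module V (N choose Suc i))" "kmat p N i *\<^sub>v v = 0\<^sub>v (N choose i)" by auto
    have ex: "polys.kexact V p {0} N (Suc i)"
      by (rule polys.koszul_exact[OF polys.idl_zero_set]) (simp_all add: map_nth regs)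
    have z: "kosz p N (subfn N (Suc i) v) T \<in> {0}" if T: "T \<subseteq> {..<N}" "Suc (card T) = Suc i" for T
    proof -
      obtain r where r: "r < N choose i" "subs N i ! r = T" using subs_index[OF T(1), of i] T(2) by auto
      have "kosz p N (subfn N (Suc i) v) T = (kmat p N i *\<^sub>v v) $ r" using v(1) r by (simp add: kmat_mult free_module_simps)
      then show ?thesis using v(2) r(1) by simp
    qed
    obtain \<xi> where \<xi>: "range \<xi> \<subseteq> polys V" "\<And>T. T \<subseteq> {..<N} \<Longrightarrow> card T = Suc i \<Longrightarrow> subfn N (Suc i) v T - kosz p N \<xi> T \<in> {0}"
      using polys.kexactD[OF ex subfn_polys[OF v(1)] z] by blast
    let ?w = "subvec N (Suc (Suc i)) \<xi>"
    have w: "?w \<in> carrier (free_module V (N choose Suc (Suc i)))" using \<xi>(1) by (rule subvec_free)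
    have "(kmat p N (Suc i) *\<^sub>v ?w) $ r = v $ r" if r: "r < N choose Suc i" for r
    proof -
      have T: "subs N (Suc i) ! r \<subseteq> {..<N}" "card (subs N (Suc i) ! r) = Suc i" using subs_nth[OF r] by auto
      have "(kmat p N (Suc i) *\<^sub>v ?w) $ r = kosz p N (subfn N (Suc (Suc i)) ?w) (subs N (Suc i) ! r)"
        using w r by (simp add: kmat_mult free_module_simps)
      also have "\<dots> = kosz p N \<xi> (subs N (Suc i) ! r)"
        using T by (intro kosz_cong subfn_subvec) (auto simp: finite_subset)
      also have "\<dots> = v $ r" using \<xi>(2)[OF T] subfn_nth[OF r, of v] by simp
      finally show ?thesis .
    qed
    then have "kmat p N (Suc i) *\<^sub>v ?w = v" using v(1) by (intro eq_vecI) (auto simp: free_module_simps)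
    then show "v \<in> ?l" using w by blast
  qed
qed

theorem koszul_resolution:
  assumes "\<And>k. k < N \<Longrightarrow> homogeneous 2 (p k)"
  shows "graded_free_resolution V J (\<lambda>i. N choose i) (\<lambda>i _. 2 * int i) (kmat p N)"
  unfolding graded_free_resolution_def
proof (intro conjI allI impI)
  fix i r s assume rs: "r < N choose i" "s < N choose Suc i"
  have e: "kmat p N i $$ (r, s) = kcoef p N (subs N i ! r) (subs N (Suc i) ! s)" using rs by (simp add: kmat_def)
  show "kmat p N i $$ (r, s) \<in> carrier (poly_ring V)"
    unfolding e carrier_poly_ring by (rule polys.kcoef_mem[OF polys.idl_carrier p_polys])
  have "2 * int (Suc i) - 2 * int i = 2" by simp
  then show "homogeneous (2 * int (Suc i) - 2 * int i) (kmat p N i $$ (r, s))"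
    unfolding e using homogeneous_kcoef[of N 2 p] assms by metis
next
  show "(*\<^sub>v) (kmat p N 0) ` carrier (free_module V (N choose 1)) = {w \<in> carrier (free_module V (N choose 0)). w $ 0 \<in> J}"
    using kmat_image_0 by simp
next
  fix i show "kmat p N i \<in> carrier_mat (N choose i) (N choose Suc i)" by (rule carrier_matI) (rule kmat_dim)+
next
  fix i show "(*\<^sub>v) (kmat p N (Suc i)) ` carrier (free_module V (N choose Suc (Suc i)))
     = {w \<in> carrier (free_module V (N choose Suc i)). kmat p N i *\<^sub>v w = 0\<^sub>v (N choose i)}"
    by (rule kmat_image_Suc)
next
  show "N choose 0 = 1" by (rule binomial_n_0)
next
  show "2 * int 0 = 0" by simp
qed

text \<open>Self-duality at the end of the Koszul complex: the last dual differential has the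
  elements \<open>p k\<close>, up to sign, as its matrix entries, so its image in the free module of
  rank one is the ideal they generate.\<close>

lemma coboundaries:
  assumes "N > 0"
  shows "ext_coboundaries V (\<lambda>i. N choose i) (kmat p N) N = {v \<in> carrier (free_module V 1). v $ 0 \<in> J}"
    (is "?l = ?r")
proof -
  obtain c where c: "N = Suc c" using assms gr0_implies_Suc by blast
  define At where "At w = transpose_mat (kmat p N c) *\<^sub>v w" for w
  have l: "?l = At ` carrier (free_module V (N choose c))"
    unfolding At_def using c by (simp add: ext_coboundaries_def split: nat.split)
  have top: "subs N N ! 0 = {..<N}"
    using subs_nth[of 0 N N] card_subset_eq[of "{..<N}" "subs N N ! 0"] by simp
  have mult: "dim_vec (At w) = 1 \<and> At w $ 0 = (\<Sum>r<N choose c. kcoef p N (subs N c ! r) {..<N} * w $ r)"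
    if "dim_vec w = N choose c" for w
  proof -
    have d: "N choose Suc c = 1" using c by simp
    have "(transpose_mat (kmat p N c) *\<^sub>v w) $ 0 = (\<Sum>r<N choose c. kmat p N c $$ (r, 0) * w $ r)"
      using that d by (simp add: scalar_prod_def lessThan_atLeast0)
    also have "\<dots> = (\<Sum>r<N choose c. kcoef p N (subs N c ! r) (subs N (Suc c) ! 0) * w $ r)"
      using d by (intro sum.cong) (auto simp: kmat_def)
    also have "subs N (Suc c) ! 0 = {..<N}" using top unfolding c[symmetric] .
    finally have "(transpose_mat (kmat p N c) *\<^sub>v w) $ 0 = (\<Sum>r<N choose c. kcoef p N (subs N c ! r) {..<N} * w $ r)" .
    moreover have "dim_vec (transpose_mat (kmat p N c) *\<^sub>v w) = 1"
      by (simp only: dim_mult_mat_vec index_transpose_mat kmat_dim d)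
    ultimately show ?thesis unfolding At_def by blast
  qed
  show ?thesis
  proof
    show "?l \<subseteq> ?r"
    proof
      fix v assume "v \<in> ?l"
      then obtain w where w: "w \<in> carrier (free_module V (N choose c))" "v = At w" unfolding l by blast
      have "v $ 0 = (\<Sum>r<N choose c. kcoef p N (subs N c ! r) {..<N} * w $ r)" "dim_vec v = 1"
        using mult[of w] w by (auto simp: free_module_simps)
      moreover have "(\<Sum>r<N choose c. kcoef p N (subs N c ! r) {..<N} * w $ r) \<in> J"
        using w(1) polys.kcoef_mem[OF J_idl p_J]
        by (intro polys.idl_sum[OF J_idl] polys.idl_mult2[OF J_idl]) (auto simp: free_module_simps)
      ultimately show "v \<in> ?r" using polys.idl_mem[OF J_idl] by (auto simp: free_module_simps)
    qed
    show "?r \<subseteq> ?l"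
    proof
      fix v assume v: "v \<in> ?r"
      then obtain a where a: "range a \<subseteq> polys V" "v $ 0 = (\<Sum>k<N. p k * a k)" using J_iff by blast
      \<comment> \<open>On the complement of \<open>{k}\<close> the value is \<open>a k\<close> with
        the same sign as the matrix entry, so the signs cancel as squares. The sum there has a
        single term; it avoids selecting \<open>k\<close> from \<open>T\<close>.\<close>
      let ?\<omega> = "\<lambda>T. \<Sum>k\<in>{..<N} - T. ksign k T * a k"
      let ?w = "subvec N c ?\<omega>"
      have w: "?w \<in> carrier (free_module V (N choose c))"
        using a(1) polys.ksign_closed by (intro subvec_free) (auto intro!: polys.sum_closed polys.mult_closed)
      have "(\<Sum>r<N choose c. kcoef p N (subs N c ! r) {..<N} * ?w $ r) =
          (\<Sum>r<N choose c. (\<lambda>T. kcoef p N T {..<N} * ?\<omega> T) (subs N c ! r))"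
        by (rule sum.cong) (auto simp: subvec_def)
      also have "\<dots> = (\<Sum>T | T \<subseteq> {..<N} \<and> card T = c. kcoef p N T {..<N} * ?\<omega> T)" by (rule sum_subs)
      also have "\<dots> = (\<Sum>k<N. kcoef p N ({..<N} - {k}) {..<N} * ?\<omega> ({..<N} - {k}))"
      proof (rule sum.reindex_bij_betw[symmetric], rule bij_betwI')
        show "({..<N} - {x} = {..<N} - {y}) = (x = y)" if "x \<in> {..<N}" "y \<in> {..<N}" for x y using that by blast
        show "{..<N} - {x} \<in> {T. T \<subseteq> {..<N} \<and> card T = c}" if "x \<in> {..<N}" for x using that c by simp
        show "\<exists>x\<in>{..<N}. T = {..<N} - {x}" if "T \<in> {T. T \<subseteq> {..<N} \<and> card T = c}" for T
        proof -
          have T: "T \<subseteq> {..<N}" "card T = c" using that by auto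
          have "card ({..<N} - T) = 1" using T c by (simp add: card_Diff_subset finite_subset)
          then obtain x where "{..<N} - T = {x}" by (auto simp: card_1_singleton_iff)
          then show ?thesis using T(1) by (intro bexI[of _ x]) auto
        qed
      qed
      also have "\<dots> = (\<Sum>k<N. p k * a k)"
      proof (rule sum.cong)
        fix k assume "k \<in> {..<N}"
        then have e: "{..<N} - ({..<N} - {k}) = {k}" "insert k ({..<N} - {k}) = {..<N}" by auto
        have s: "ksign k T * ksign k T = (1 :: ('v, 'k) mpoly)" for T by (simp add: ksign_def flip: power_add)
        have "ksign k T * x * (ksign k T * y) = x * y" for T and x y :: "('v, 'k) mpoly"
        proof -
          have "ksign k T * x * (ksign k T * y) = (ksign k T * ksign k T) * (x * y)" by (simp add: mult_ac)
          then show ?thesis by (simp add: s)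
        qed
        then show "kcoef p N ({..<N} - {k}) {..<N} * ?\<omega> ({..<N} - {k}) = p k * a k"
          unfolding kcoef_def e(1) using e(2) by simp
      qed simp
      finally have "At ?w $ 0 = v $ 0"
        using mult[of ?w] a(2) by (simp add: subvec_def)
      then have "At ?w = v"
        using mult[of ?w] v by (intro eq_vecI) (auto simp: free_module_simps subvec_def)
      then show "v \<in> ?l" using w unfolding l by blast
    qed
  qed
qed

lemma cocycles: "ext_cocycles V (\<lambda>i. N choose i) (kmat p N) N = carrier (free_module V 1)"
proof -
  have z: "N choose Suc N = 0" by (simp add: binomial_eq_0)
  have "transpose_mat (kmat p N N) *\<^sub>v w = 0\<^sub>v (N choose Suc N)" for w
    by (rule eq_vecI) (simp_all add: z)
  then show ?thesis by (simp add: ext_cocycles_def)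
qed

end

section \<open>The canonical module\<close>

lemma quot_module_simps:
  "carrier (M QuotM N) = (\<lambda>v. N +>\<^bsub>M\<^esub> v) ` carrier M" "add (M QuotM N) = set_add M"
  "a \<odot>\<^bsub>M QuotM N\<^esub> X = (\<Union>x\<in>X. N +>\<^bsub>M\<^esub> (a \<odot>\<^bsub>M\<^esub> x))"
  by (auto simp: quot_module_def A_RCOSETS_def')

lemma module_isomorphic_QuotM:
  assumes bij: "bij_betw \<phi> (carrier M) (carrier M')"
    and cl: "\<And>x y. x \<in> carrier M \<Longrightarrow> y \<in> carrier M \<Longrightarrow> x \<oplus>\<^bsub>M\<^esub> y \<in> carrier M"
      "\<And>a x. a \<in> carrier R \<Longrightarrow> x \<in> carrier M \<Longrightarrow> a \<odot>\<^bsub>M\<^esub> x \<in> carrier M"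
    and hom: "\<And>x y. x \<in> carrier M \<Longrightarrow> y \<in> carrier M \<Longrightarrow> \<phi> (x \<oplus>\<^bsub>M\<^esub> y) = \<phi> x \<oplus>\<^bsub>M'\<^esub> \<phi> y"
      "\<And>a x. a \<in> carrier R \<Longrightarrow> x \<in> carrier M \<Longrightarrow> \<phi> (a \<odot>\<^bsub>M\<^esub> x) = a \<odot>\<^bsub>M'\<^esub> \<phi> x"
    and N: "N \<subseteq> carrier M" "N' = \<phi> ` N"
  shows "module_isomorphic R (M QuotM N) (M' QuotM N')"
proof -
  have co: "\<phi> ` (N +>\<^bsub>M\<^esub> v) = N' +>\<^bsub>M'\<^esub> \<phi> v" if "v \<in> carrier M" for v
  proof -
    have "\<phi> ` (N +>\<^bsub>M\<^esub> v) = (\<Union>h\<in>N. {\<phi> (h \<oplus>\<^bsub>M\<^esub> v)})" by (auto simp: a_r_coset_def')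
    also have "\<dots> = (\<Union>h\<in>N. {\<phi> h \<oplus>\<^bsub>M'\<^esub> \<phi> v})" using hom(1) that N(1) by (intro SUP_cong) auto
    finally show ?thesis by (simp add: a_r_coset_def' N(2))
  qed
  have sub: "X \<subseteq> carrier M" if "X \<in> carrier (M QuotM N)" for X
    using that cl(1) N(1) by (auto simp: quot_module_simps a_r_coset_def')
  show ?thesis unfolding module_isomorphic_def
  proof (intro exI[of _ "image \<phi>"] conjI ballI)
    have "inj_on (image \<phi>) (carrier (M QuotM N))"
      using bij sub by (intro inj_on_subset[OF inj_on_image_Pow]) (auto simp: bij_betw_def)
    moreover have "image \<phi> ` carrier (M QuotM N) = (\<lambda>v. N' +>\<^bsub>M'\<^esub> v) ` (\<phi> ` carrier M)"
      unfolding quot_module_simps image_image using co by (intro image_cong) auto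
    ultimately show "bij_betw (image \<phi>) (carrier (M QuotM N)) (carrier (M' QuotM N'))"
      using bij by (simp add: bij_betw_def quot_module_simps)
  next
    fix X Y assume "X \<in> carrier (M QuotM N)" "Y \<in> carrier (M QuotM N)"
    then have s: "X \<subseteq> carrier M" "Y \<subseteq> carrier M" using sub by auto
    have "\<phi> ` (X <+>\<^bsub>M\<^esub> Y) = (\<Union>x\<in>X. \<Union>y\<in>Y. {\<phi> (x \<oplus>\<^bsub>M\<^esub> y)})" by (auto simp: set_add_def')
    also have "\<dots> = (\<Union>x\<in>X. \<Union>y\<in>Y. {\<phi> x \<oplus>\<^bsub>M'\<^esub> \<phi> y})" using hom(1) s by (intro SUP_cong) auto
    finally show "\<phi> ` (X \<oplus>\<^bsub>M QuotM N\<^esub> Y) = \<phi> ` X \<oplus>\<^bsub>M' QuotM N'\<^esub> \<phi> ` Y"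
      by (simp add: quot_module_simps set_add_def')
  next
    fix a X assume a: "a \<in> carrier R" and "X \<in> carrier (M QuotM N)"
    then have s: "X \<subseteq> carrier M" using sub by auto
    have "\<phi> ` (a \<odot>\<^bsub>M QuotM N\<^esub> X) = (\<Union>x\<in>X. \<phi> ` (N +>\<^bsub>M\<^esub> (a \<odot>\<^bsub>M\<^esub> x)))"
      by (simp add: quot_module_simps image_UN)
    also have "\<dots> = (\<Union>x\<in>X. N' +>\<^bsub>M'\<^esub> (a \<odot>\<^bsub>M'\<^esub> \<phi> x))"
      using s a by (intro SUP_cong) (auto simp: co cl(2) hom(2) subset_iff)
    finally show "\<phi> ` (a \<odot>\<^bsub>M QuotM N\<^esub> X) = a \<odot>\<^bsub>M' QuotM N'\<^esub> \<phi> ` X"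
      by (simp add: quot_module_simps)
  qed
qed

context regular_ideal begin

text \<open>The copy of \<open>J\<close> in the free module of rank one, whose elements are vectors
  of length 1.\<close>

definition K :: "('v, 'k) mpoly vec set" where "K = {v \<in> carrier (free_module V 1). v $ 0 \<in> J}"

lemma free_1_eqI: "v \<in> carrier (free_module V 1) \<Longrightarrow> w \<in> carrier (free_module V 1) \<Longrightarrow> v $ 0 = w $ 0 \<Longrightarrow> v = w"
  by (intro eq_vecI) (auto simp: free_module_carrier)

lemma ext_module_eq:
  assumes "N > 0"
  shows "ext_module V (\<lambda>i. N choose i) (kmat p N) N = free_module V 1 QuotM K"
  by (simp add: ext_module_def coboundaries[OF assms, unfolded One_nat_def] cocycles K_def)

lemma ext_isomorphic: "module_isomorphic (poly_ring V) (free_module V 1 QuotM K) (self_module (poly_ring V) QuotM J)"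
proof (rule module_isomorphic_QuotM[where \<phi> = "\<lambda>v. v $ 0"])
  have emb: "vec 1 (\<lambda>_. a) \<in> carrier (free_module V 1)" if "a \<in> polys V" for a
    using that by (simp add: free_module_carrier)
  have sc: "carrier (self_module (poly_ring V)) = polys V" by (simp add: self_module_def carrier_poly_ring)
  show "bij_betw (\<lambda>v. v $ 0) (carrier (free_module V 1)) (carrier (self_module (poly_ring V)))"
    unfolding sc
  proof (rule bij_betwI')
    show "\<exists>v\<in>carrier (free_module V 1). a = v $ 0" if "a \<in> polys V" for a
      using emb[OF that] by (intro bexI[of _ "vec 1 (\<lambda>_. a)"]) simp_all
  qed (use free_1_eqI in \<open>auto simp: free_module_carrier\<close>)
  show "J = (\<lambda>v. v $ 0) ` K"
  proof
    show "J \<subseteq> (\<lambda>v. v $ 0) ` K"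
    proof
      fix a assume a: "a \<in> J"
      then have "vec 1 (\<lambda>_. a) \<in> K" using emb polys.idl_mem[OF J_idl a] by (simp add: K_def)
      then show "a \<in> (\<lambda>v. v $ 0) ` K" by (rule rev_image_eqI) simp
    qed
  qed (auto simp: K_def)
qed (auto simp: K_def self_module_def poly_ring_def free_module_simps simp flip: polys_def)

text \<open>The scalar multiple of a coset is defined as a union over its members, so independence
  of the representative has to be shown before it can be computed.\<close>

lemma coset_smult:
  assumes "a \<in> polys V" "e \<in> carrier (free_module V 1)"
  shows "a \<odot>\<^bsub>free_module V 1 QuotM K\<^esub> (K +>\<^bsub>free_module V 1\<^esub> e) = K +>\<^bsub>free_module V 1\<^esub> (a \<cdot>\<^sub>v e)"
proof -
  let ?F = "free_module V 1 :: (('v, 'k) mpoly, ('v, 'k) mpoly vec) module"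
  have mem: "v \<in> K +>\<^bsub>?F\<^esub> w \<longleftrightarrow> v \<in> carrier ?F \<and> v $ 0 - w $ 0 \<in> J" if "w \<in> carrier ?F" for v w
  proof
    assume "v \<in> K +>\<^bsub>?F\<^esub> w"
    then obtain h where "h \<in> K" "v = h + w" by (auto simp: a_r_coset_def' free_module_ops)
    then show "v \<in> carrier ?F \<and> v $ 0 - w $ 0 \<in> J" using that by (auto simp: K_def free_module_carrier)
  next
    assume v: "v \<in> carrier ?F \<and> v $ 0 - w $ 0 \<in> J"
    then have "v - w \<in> K" using that by (auto simp: K_def free_module_carrier)
    moreover have "v = (v - w) + w" using v that by (intro eq_vecI) (auto simp: free_module_carrier)
    ultimately show "v \<in> K +>\<^bsub>?F\<^esub> w" by (auto simp: a_r_coset_def' free_module_ops)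
  qed
  have ae: "a \<cdot>\<^sub>v x \<in> carrier ?F" if "x \<in> carrier ?F" for x using assms(1) that by (auto simp: free_module_carrier)
  have "K +>\<^bsub>?F\<^esub> (a \<cdot>\<^sub>v x) = K +>\<^bsub>?F\<^esub> (a \<cdot>\<^sub>v e)" if "x \<in> K +>\<^bsub>?F\<^esub> e" for x
  proof -
    have x: "x \<in> carrier ?F" "x $ 0 - e $ 0 \<in> J" using that mem[OF assms(2)] by auto
    have d: "a * (x $ 0) - a * (e $ 0) \<in> J" using polys.idl_mult[OF J_idl assms(1) x(2)] by (simp add: right_diff_distrib)
    have iff: "y - a * (x $ 0) \<in> J \<longleftrightarrow> y - a * (e $ 0) \<in> J" for y
      using polys.idl_cong_mem[OF J_idl, of "y - a * (e $ 0)" "y - a * (x $ 0)"] d by (simp add: algebra_simps)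
    have c: "(a \<cdot>\<^sub>v x) $ 0 = a * (x $ 0)" "(a \<cdot>\<^sub>v e) $ 0 = a * (e $ 0)"
      using x(1) assms(2) by (auto simp: free_module_carrier)
    show ?thesis using mem[OF ae[OF x(1)]] mem[OF ae[OF assms(2)]] unfolding c iff by blast
  qed
  moreover have "K +>\<^bsub>?F\<^esub> e \<noteq> {}" using mem[OF assms(2), of e] assms(2) polys.idl_zero[OF J_idl] by auto
  ultimately show ?thesis unfolding quot_module_simps free_module_ops by blast
qed

lemma quot_generated:
  assumes "C \<subseteq> carrier (free_module V 1 QuotM K)" "K +>\<^bsub>free_module V 1\<^esub> vec 1 (\<lambda>_. 1) \<in> C"
  shows "module_generated_by (poly_ring V) (free_module V 1 QuotM K) C"
  unfolding module_generated_by_def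
proof (intro conjI allI impI)
  let ?F = "free_module V 1 :: (('v, 'k) mpoly, ('v, 'k) mpoly vec) module"
  fix N' assume N': "submodule N' (poly_ring V) (?F QuotM K) \<and> C \<subseteq> N'"
  then interpret submodule N' "poly_ring V" "?F QuotM K" by blast
  have "K +>\<^bsub>?F\<^esub> v \<in> N'" if v: "v \<in> carrier ?F" for v
  proof -
    have vp: "v $ 0 \<in> polys V" using v by (simp add: free_module_carrier)
    have e: "vec 1 (\<lambda>_. 1) \<in> carrier ?F" by (simp add: free_module_carrier)
    have "v = v $ 0 \<cdot>\<^sub>v vec 1 (\<lambda>_. 1)" using v by (intro eq_vecI) (auto simp: free_module_carrier)
    then have "K +>\<^bsub>?F\<^esub> v = (v $ 0) \<odot>\<^bsub>?F QuotM K\<^esub> (K +>\<^bsub>?F\<^esub> vec 1 (\<lambda>_. 1))"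
      using coset_smult[OF vp e] by simp
    then show ?thesis using N' assms(2) vp smult_closed by (auto simp: carrier_poly_ring)
  qed
  then have "carrier (?F QuotM K) \<subseteq> N'" by (auto simp: quot_module_simps)
  moreover have "N' \<subseteq> carrier (?F QuotM K)" using subset by simp
  ultimately show "N' = carrier (?F QuotM K)" by blast
qed (use assms in auto)

theorem gorenstein_level:
  assumes "N > 0" "\<And>k. k < N \<Longrightarrow> homogeneous 2 (p k)" "cohen_macaulay (poly_ring V Quot J)"
    and "enat N + krull_dim (poly_ring V Quot J) = enat (card V)"
  shows "gorenstein_algebra V J \<and> level_algebra V J"
proof -
  let ?b = "\<lambda>i. N choose i" and ?d = "\<lambda>i (_ :: nat). 2 * int i"
  have can: "canonical_data V J ?b ?d (kmat p N) N"
    unfolding canonical_data_def using koszul_resolution[OF assms(2)] assms(4) by blast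
  \<comment> \<open>The basis vector in the top degree of the Koszul complex has degree
    \<open>2 * N\<close>, so in degree \<open>card V - 2 * N\<close> the component consists of the
    classes of constants, and the class of 1 generates.\<close>
  let ?C = "canonical_component V ?b ?d (kmat p N) N (int (card V) - 2 * int N)"
  have C: "?C = {K +>\<^bsub>free_module V 1\<^esub> w | w. w \<in> carrier (free_module V 1) \<and> homogeneous 0 (w $ 0)}"
    by (simp add: canonical_component_def coboundaries[OF assms(1), unfolded One_nat_def] cocycles K_def)
  have one: "homogeneous 0 (1 :: ('v, 'k) mpoly)" by (simp add: homogeneous_def)
  have "module_generated_by (poly_ring V) (free_module V 1 QuotM K) ?C"
  proof (rule quot_generated)
    show "?C \<subseteq> carrier (free_module V 1 QuotM K)" unfolding C by (auto simp: quot_module_simps)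
    have "vec 1 (\<lambda>_. 1) \<in> carrier (free_module V 1)" "homogeneous 0 (vec 1 (\<lambda>_. 1 :: ('v, 'k) mpoly) $ 0)"
      using one by (simp_all add: free_module_carrier)
    then show "K +>\<^bsub>free_module V 1\<^esub> vec 1 (\<lambda>_. 1) \<in> ?C" unfolding C by blast
  qed
  then have "module_generated_by (poly_ring V) (ext_module V ?b (kmat p N) N) ?C"
    unfolding ext_module_eq[OF assms(1)] .
  moreover have "module_isomorphic (poly_ring V) (ext_module V ?b (kmat p N) N) (self_module (poly_ring V) QuotM J)"
    unfolding ext_module_eq[OF assms(1)] by (rule ext_isomorphic)
  ultimately show ?thesis unfolding gorenstein_algebra_def level_algebra_def using can assms(3) by blast
qed

end

section \<open>Transfer to rings given as records\<close>

text \<open>Connects the inductive chains with the indexed families in the definition of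
  \<open>prime_height\<close>.\<close>

lemma (in subring_set) chain_iff_fun:
  "chain n P Q \<longleftrightarrow> (\<exists>f. (\<forall>i\<le>n. prime_idl (f i)) \<and> (\<forall>i<n. f i \<subset> f (Suc i)) \<and> f 0 = P \<and> f n = Q)"
proof
  show "chain n P Q \<Longrightarrow> \<exists>f. (\<forall>i\<le>n. prime_idl (f i)) \<and> (\<forall>i<n. f i \<subset> f (Suc i)) \<and> f 0 = P \<and> f n = Q"
  proof (induction rule: chain.induct)
    case (chain_0 P)
    then show ?case by (intro exI[of _ "\<lambda>_. P"]) auto
  next
    case (chain_Suc k P Q Q')
    then obtain f where f: "\<forall>i\<le>k. prime_idl (f i)" "\<forall>i<k. f i \<subset> f (Suc i)" "f 0 = P" "f k = Q" by blast
    define g where "g = f(Suc k := Q')"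
    have g: "g (Suc k) = Q'" "\<And>i. i \<le> k \<Longrightarrow> g i = f i" by (auto simp: g_def)
    have "prime_idl (g i)" if "i \<le> Suc k" for i
      using that f(1) g chain_Suc.hyps(2) by (cases "i = Suc k") auto
    moreover have "g i \<subset> g (Suc i)" if "i < Suc k" for i
      using that f(2,4) g chain_Suc.hyps(3) by (cases "i = k") auto
    ultimately show ?case using f(3) g by (intro exI[of _ g]) auto
  qed
next
  assume "\<exists>f. (\<forall>i\<le>n. prime_idl (f i)) \<and> (\<forall>i<n. f i \<subset> f (Suc i)) \<and> f 0 = P \<and> f n = Q"
  then show "chain n P Q"
  proof (induction n arbitrary: Q)
    case 0
    then show ?case by (auto intro: chain_0)
  next
    case (Suc n)
    then obtain f where f: "\<forall>i\<le>Suc n. prime_idl (f i)" "\<forall>i<Suc n. f i \<subset> f (Suc i)" "f 0 = P" "f (Suc n) = Q" by blast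
    have "chain n P (f n)" using f by (intro Suc.IH exI[of _ f]) auto
    then show ?case using f by (metis chain_Suc le_refl lessI)
  qed
qed

text \<open>Transfers the subset-based theory to a ring \<open>T\<close> given as a record that is isomorphic to \<open>R/J\<close>
  by way of \<open>\<pi>\<close>; this covers both \<open>poly_ring V\<close> and its quotients.\<close>

locale ring_image = subring_set R for R :: "'a::comm_ring_1 set" +
  fixes T :: "('b, 'c) ring_scheme" and \<pi> :: "'a \<Rightarrow> 'b" and J :: "'a set"
  assumes J: "idl J" and T: "cring T" and carr: "carrier T = \<pi> ` R"
    and add: "a \<in> R \<Longrightarrow> b \<in> R \<Longrightarrow> \<pi> (a + b) = \<pi> a \<oplus>\<^bsub>T\<^esub> \<pi> b"
    and mult: "a \<in> R \<Longrightarrow> b \<in> R \<Longrightarrow> \<pi> (a * b) = \<pi> a \<otimes>\<^bsub>T\<^esub> \<pi> b"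
    and one: "\<pi> 1 = \<one>\<^bsub>T\<^esub>"
    and eq: "a \<in> R \<Longrightarrow> b \<in> R \<Longrightarrow> \<pi> a = \<pi> b \<longleftrightarrow> a - b \<in> J"
begin

lemma \<pi>_carrier: "a \<in> R \<Longrightarrow> \<pi> a \<in> carrier T"
  by (simp add: carr)

lemma \<pi>_zero: "\<pi> 0 = \<zero>\<^bsub>T\<^esub>"
proof -
  interpret T: cring T by (rule T)
  show ?thesis using add[of 0 0] T.add.l_cancel_one[of "\<pi> 0" "\<pi> 0"] \<pi>_carrier[of 0] by simp
qed

lemma \<pi>_uminus: "a \<in> R \<Longrightarrow> \<ominus>\<^bsub>T\<^esub> \<pi> a = \<pi> (- a)"
proof -
  interpret T: cring T by (rule T)
  assume a: "a \<in> R"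
  then have "\<pi> (- a) \<oplus>\<^bsub>T\<^esub> \<pi> a = \<zero>\<^bsub>T\<^esub>" using add[of "- a" a] \<pi>_zero by simp
  then show ?thesis using a by (intro T.minus_equality) (auto intro: \<pi>_carrier)
qed

definition pre :: "'b set \<Rightarrow> 'a set" where "pre A = {a \<in> R. \<pi> a \<in> A}"

lemma mem_image: "idl A \<Longrightarrow> J \<subseteq> A \<Longrightarrow> a \<in> R \<Longrightarrow> \<pi> a \<in> \<pi> ` A \<longleftrightarrow> a \<in> A"
proof
  assume A: "idl A" "J \<subseteq> A" "a \<in> R" "\<pi> a \<in> \<pi> ` A"
  then obtain b where b: "b \<in> A" "\<pi> a = \<pi> b" by blast
  then have "a - b \<in> A" using eq[of a b] A idl_mem by blast
  then show "a \<in> A" using idl_cong_mem[OF A(1)] b(1) by blast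
qed auto

lemma pre_image: "idl A \<Longrightarrow> J \<subseteq> A \<Longrightarrow> pre (\<pi> ` A) = A"
  using mem_image idl_sub[of A] by (auto simp: pre_def)

lemma ideal_pre:
  assumes "ideal A T"
  shows "idl (pre A)" "J \<subseteq> pre A" "\<pi> ` pre A = A"
proof -
  interpret T: cring T by (rule T)
  interpret A: ideal A T by (rule assms)
  show "idl (pre A)"
    by (rule idlI) (auto simp: pre_def add mult \<pi>_zero \<pi>_carrier A.I_l_closed)
  show "J \<subseteq> pre A"
  proof
    fix a assume a: "a \<in> J"
    then have "a \<in> R" "\<pi> a = \<pi> 0" using idl_mem[OF J] eq[of a 0] by auto
    then show "a \<in> pre A" by (simp add: pre_def \<pi>_zero)
  qed
  show "\<pi> ` pre A = A" using A.a_subset carr by (auto simp: pre_def)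
qed

lemma ideal_image:
  assumes "idl A"
  shows "ideal (\<pi> ` A) T"
proof (rule idealI)
  interpret T: cring T by (rule T)
  have AR: "a \<in> A \<Longrightarrow> a \<in> R" for a using idl_mem[OF assms] .
  show "ring T" by (rule T.ring_axioms)
  show "subgroup (\<pi> ` A) (add_monoid T)"
  proof (rule subgroup.intro)
    show "\<pi> ` A \<subseteq> carrier (add_monoid T)" using AR by (auto simp: carr)
    show "x \<otimes>\<^bsub>add_monoid T\<^esub> y \<in> \<pi> ` A" if xy: "x \<in> \<pi> ` A" "y \<in> \<pi> ` A" for x y
    proof -
      obtain a b where ab: "a \<in> A" "b \<in> A" "x = \<pi> a" "y = \<pi> b" using xy by blast
      then have "x \<oplus>\<^bsub>T\<^esub> y = \<pi> (a + b)" using AR add by simp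
      then show ?thesis using idl_add[OF assms ab(1,2)] by simp
    qed
    show "\<one>\<^bsub>add_monoid T\<^esub> \<in> \<pi> ` A" using idl_zero[OF assms] \<pi>_zero by (auto intro: rev_image_eqI)
    show "inv\<^bsub>add_monoid T\<^esub> x \<in> \<pi> ` A" if xA: "x \<in> \<pi> ` A" for x
    proof -
      obtain a where a: "a \<in> A" "x = \<pi> a" using xA by blast
      then have "inv\<^bsub>add_monoid T\<^esub> x = \<pi> (- a)" using \<pi>_uminus[OF AR[OF a(1)]] by (simp add: a_inv_def)
      then show ?thesis using idl_uminus[OF assms a(1)] by simp
    qed
  qed
  show l: "x \<otimes>\<^bsub>T\<^esub> a \<in> \<pi> ` A" if ax: "a \<in> \<pi> ` A" "x \<in> carrier T" for a x
  proof -
    obtain b r where b: "b \<in> A" "a = \<pi> b" "r \<in> R" "x = \<pi> r" using ax carr by auto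
    then have "x \<otimes>\<^bsub>T\<^esub> a = \<pi> (r * b)" using AR mult by simp
    then show ?thesis using idl_mult[OF assms b(3,1)] by simp
  qed
  show "a \<otimes>\<^bsub>T\<^esub> x \<in> \<pi> ` A" if a: "a \<in> \<pi> ` A" "x \<in> carrier T" for a x
  proof -
    have "a \<in> carrier T" using a AR by (auto simp: carr)
    then show ?thesis using l[OF a] T.m_comm[of a x] a(2) by simp
  qed
qed

lemma image_mono_iff: "idl A \<Longrightarrow> J \<subseteq> A \<Longrightarrow> idl B \<Longrightarrow> J \<subseteq> B \<Longrightarrow> \<pi> ` A \<subseteq> \<pi> ` B \<longleftrightarrow> A \<subseteq> B"
proof (intro iffI subsetI)
  fix x assume A: "idl A" "idl B" "J \<subseteq> B" "\<pi> ` A \<subseteq> \<pi> ` B" "x \<in> A"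
  then have "\<pi> x \<in> \<pi> ` B" by blast
  then show "x \<in> B" using mem_image[OF A(2,3) idl_mem[OF A(1,5)]] by blast
qed auto

lemma image_eq_iff: "idl A \<Longrightarrow> J \<subseteq> A \<Longrightarrow> idl B \<Longrightarrow> J \<subseteq> B \<Longrightarrow> \<pi> ` A = \<pi> ` B \<longleftrightarrow> A = B"
  using pre_image[of A] pre_image[of B] by metis

lemma image_full_iff: "idl A \<Longrightarrow> J \<subseteq> A \<Longrightarrow> \<pi> ` A = carrier T \<longleftrightarrow> 1 \<in> A"
  using image_eq_iff[OF _ _ idl_carrier, of A] idl_sub[OF J] idl_eq_carrier[of A] by (auto simp: carr)

lemma primeideal_image_iff:
  assumes "idl A" "J \<subseteq> A"
  shows "primeideal (\<pi> ` A) T \<longleftrightarrow> prime_idl A"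
proof
  assume "primeideal (\<pi> ` A) T"
  then interpret P: primeideal "\<pi> ` A" T .
  have "a \<in> A \<or> b \<in> A" if ab: "a \<in> R" "b \<in> R" "a * b \<in> A" for a b
  proof -
    have "\<pi> a \<otimes>\<^bsub>T\<^esub> \<pi> b \<in> \<pi> ` A" using ab mult by (metis imageI)
    then show ?thesis using P.I_prime[of "\<pi> a" "\<pi> b"] ab \<pi>_carrier mem_image[OF assms] by blast
  qed
  then show "prime_idl A" unfolding prime_idl_def using P.I_notcarr image_full_iff[OF assms] assms(1) by blast
next
  assume P: "prime_idl A"
  show "primeideal (\<pi> ` A) T"
  proof (rule primeidealI[OF ideal_image[OF assms(1)] T])
    show "carrier T \<noteq> \<pi> ` A" using image_full_iff[OF assms] prime_idl_one[OF P] by metis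
    fix x y assume xy: "x \<in> carrier T" "y \<in> carrier T" "x \<otimes>\<^bsub>T\<^esub> y \<in> \<pi> ` A"
    then obtain a b where ab: "a \<in> R" "b \<in> R" "x = \<pi> a" "y = \<pi> b" using carr by auto
    then have "\<pi> (a * b) \<in> \<pi> ` A" using xy(3) mult by simp
    then have "a * b \<in> A" using mem_image[OF assms, of "a * b"] ab(1,2) by simp
    then show "x \<in> \<pi> ` A \<or> y \<in> \<pi> ` A" using prime_idl_mult[OF P ab(1,2)] ab by blast
  qed
qed

lemma primeideal_iff: "primeideal P T \<longleftrightarrow> (\<exists>A. prime_idl A \<and> J \<subseteq> A \<and> P = \<pi> ` A)"
  using primeideal_image_iff ideal_pre primeideal.axioms(1) prime_idl_idl by metis

lemma maximalideal_iff: "maximalideal M T \<longleftrightarrow> (\<exists>A. max_idl A \<and> J \<subseteq> A \<and> M = \<pi> ` A)"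
proof
  assume "maximalideal M T"
  then interpret M: maximalideal M T .
  let ?A = "pre M"
  note A = ideal_pre[OF M.ideal_axioms]
  have "1 \<notin> ?A" using image_full_iff[OF A(1,2)] A(3) M.I_notcarr by metis
  moreover have "B = ?A" if B: "idl B" "1 \<notin> B" "?A \<subseteq> B" for B
  proof -
    have JB: "J \<subseteq> B" using A(2) B(3) by blast
    have "M \<subseteq> \<pi> ` B" using A(3) B(3) by blast
    moreover have "\<pi> ` B \<subseteq> carrier T" using idl_sub[OF B(1)] by (auto simp: carr)
    ultimately have "\<pi> ` B = M \<or> \<pi> ` B = carrier T" by (rule M.I_maximal[OF ideal_image[OF B(1)]])
    then show ?thesis using image_full_iff[OF B(1) JB] B(2) pre_image[OF B(1) JB] by metis
  qed
  ultimately have "max_idl ?A" unfolding max_idl_def using A(1) by blast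
  then show "\<exists>A. max_idl A \<and> J \<subseteq> A \<and> M = \<pi> ` A" using A by metis
next
  assume "\<exists>A. max_idl A \<and> J \<subseteq> A \<and> M = \<pi> ` A"
  then obtain A where A: "max_idl A" "J \<subseteq> A" "M = \<pi> ` A" by blast
  have Ai: "idl A" and A1: "1 \<notin> A" using A(1) by (auto simp: max_idl_def)
  show "maximalideal M T" unfolding A(3)
  proof (rule maximalidealI[OF ideal_image[OF Ai]])
    show "carrier T \<noteq> \<pi> ` A" using image_full_iff[OF Ai A(2)] A1 by metis
    fix B assume B: "ideal B T" "\<pi> ` A \<subseteq> B" "B \<subseteq> carrier T"
    note p = ideal_pre[OF B(1)]
    have "A \<subseteq> pre B" using B(2) idl_mem[OF Ai] by (auto simp: pre_def)
    then have "pre B = A \<or> 1 \<in> pre B" using A(1) p(1) unfolding max_idl_def by blast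
    then show "B = \<pi> ` A \<or> B = carrier T" using image_full_iff[OF p(1,2)] p(3) by metis
  qed
qed

lemma Idl_image:
  assumes "X \<subseteq> R"
  shows "Idl\<^bsub>T\<^esub> (\<pi> ` X) = \<pi> ` gen (J \<union> X)"
proof -
  have sub: "J \<union> X \<subseteq> R" using assms idl_sub[OF J] by blast
  show ?thesis
  proof
    show "Idl\<^bsub>T\<^esub> (\<pi> ` X) \<subseteq> \<pi> ` gen (J \<union> X)"
      unfolding genideal_def using ideal_image[OF gen_idl[OF sub]] gen_superset[of "J \<union> X"] by blast
    have "\<pi> ` gen (J \<union> X) \<subseteq> B" if B: "ideal B T" "\<pi> ` X \<subseteq> B" for B
    proof -
      note p = ideal_pre[OF B(1)]
      have "J \<union> X \<subseteq> pre B" using p(2) B(2) assms by (auto simp: pre_def)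
      then have "gen (J \<union> X) \<subseteq> pre B" by (rule gen_least[OF p(1)])
      then show ?thesis by (auto simp: pre_def)
    qed
    then show "\<pi> ` gen (J \<union> X) \<subseteq> Idl\<^bsub>T\<^esub> (\<pi> ` X)" unfolding genideal_def by blast
  qed
qed

section \<open>Height, depth, dimension and minimal primes under the transfer\<close>

lemma prime_height_eq:
  assumes "prime_idl P" "J \<subseteq> P"
  shows "prime_height T (\<pi> ` P) = Sup {enat n | n. \<exists>Q. J \<subseteq> Q \<and> chain n Q P}"
proof -
  have "(\<exists>Q. (\<forall>i\<le>n. primeideal (Q i) T) \<and> (\<forall>i<n. Q i \<subset> Q (Suc i)) \<and> Q n = \<pi> ` P) \<longleftrightarrow> (\<exists>Q. J \<subseteq> Q \<and> chain n Q P)"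
    (is "?l \<longleftrightarrow> ?r") for n
  proof
    assume ?l
    then obtain Q where Q: "\<And>i. i \<le> n \<Longrightarrow> primeideal (Q i) T" "\<And>i. i < n \<Longrightarrow> Q i \<subset> Q (Suc i)" "Q n = \<pi> ` P" by blast
    have id: "ideal (Q i) T" if "i \<le> n" for i using Q(1)[OF that] by (rule primeideal.axioms(1))
    have "prime_idl (pre (Q i))" if i: "i \<le> n" for i
      using primeideal_image_iff[OF ideal_pre(1,2)[OF id[OF i]]] ideal_pre(3)[OF id[OF i]] Q(1)[OF i] by simp
    moreover have "pre (Q i) \<subset> pre (Q (Suc i))" if i: "i < n" for i
    proof -
      have "pre (Q i) \<subseteq> pre (Q (Suc i))" using Q(2)[OF i] by (auto simp: pre_def)
      moreover have "pre (Q i) \<noteq> pre (Q (Suc i))"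
      proof
        assume "pre (Q i) = pre (Q (Suc i))"
        then have "\<pi> ` pre (Q i) = \<pi> ` pre (Q (Suc i))" by (rule arg_cong)
        moreover have "i \<le> n" "Suc i \<le> n" using i by auto
        ultimately have "Q i = Q (Suc i)" by (simp only: ideal_pre(3)[OF id])
        then show False using Q(2)[OF i] by blast
      qed
      ultimately show ?thesis by blast
    qed
    moreover have "pre (Q n) = P" using Q(3) pre_image[OF prime_idl_idl[OF assms(1)] assms(2)] by simp
    ultimately have "chain n (pre (Q 0)) P" unfolding chain_iff_fun by (intro exI[of _ "\<lambda>i. pre (Q i)"]) auto
    then show ?r using ideal_pre(2)[OF id[of 0]] by blast
  next
    assume ?r
    then obtain Q0 f where f: "J \<subseteq> Q0" "\<And>i. i \<le> n \<Longrightarrow> prime_idl (f i)" "\<And>i. i < n \<Longrightarrow> f i \<subset> f (Suc i)" "f 0 = Q0" "f n = P"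
      unfolding chain_iff_fun by metis
    have Jf: "J \<subseteq> f i" if "i \<le> n" for i
      using that
    proof (induction i)
      case (Suc i)
      then have "J \<subseteq> f i" "f i \<subset> f (Suc i)" using f(3)[of i] by auto
      then show ?case by blast
    qed (use f in auto)
    have "primeideal (\<pi> ` f i) T" if "i \<le> n" for i
      using primeideal_image_iff[OF prime_idl_idl Jf] f(2) that by blast
    moreover have "\<pi> ` f i \<subset> \<pi> ` f (Suc i)" if i: "i < n" for i
    proof -
      have p: "idl (f i)" "idl (f (Suc i))" "J \<subseteq> f i" "J \<subseteq> f (Suc i)" using i f(2) Jf prime_idl_idl by auto
      show ?thesis using f(3)[OF i] image_mono_iff[OF p(1,3,2,4)] image_eq_iff[OF p(1,3,2,4)] by blast
    qed
    ultimately show ?l using f(5) by (intro exI[of _ "\<lambda>i. \<pi> ` f i"]) auto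
  qed
  then show ?thesis unfolding prime_height_def by simp
qed

lemma regular_sequence_iff:
  assumes "set ys \<subseteq> R"
  shows "regular_sequence T (map \<pi> ys) \<longleftrightarrow> regs J ys \<and> 1 \<notin> gen (J \<union> set ys)"
proof -
  have sub: "J \<union> set (take i ys) \<subseteq> R" for i using assms idl_sub[OF J] set_take_subset[of i ys] by blast
  have Idl: "Idl\<^bsub>T\<^esub> (set (take i (map \<pi> ys))) = \<pi> ` gen (J \<union> set (take i ys))" for i
    using Idl_image[of "set (take i ys)"] sub[of i] by (simp add: take_map)
  have full: "Idl\<^bsub>T\<^esub> (set (map \<pi> ys)) = \<pi> ` gen (J \<union> set ys)" using Idl_image[OF assms] by simp
  have g: "idl (gen (J \<union> set (take i ys)))" "J \<subseteq> gen (J \<union> set (take i ys))" for i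
    using gen_idl[OF sub] gen_superset[of "J \<union> set (take i ys)"] by auto
  have sub': "J \<union> set ys \<subseteq> R" using assms idl_sub[OF J] by blast
  have g': "idl (gen (J \<union> set ys))" "J \<subseteq> gen (J \<union> set ys)"
    using gen_idl[OF sub'] gen_superset[of "J \<union> set ys"] by auto
  have m: "\<pi> y \<in> \<pi> ` gen (J \<union> set (take i ys)) \<longleftrightarrow> y \<in> gen (J \<union> set (take i ys))" if "y \<in> R" for y i
    by (rule mem_image[OF g that])
  have "(\<forall>y\<in>carrier T. map \<pi> ys ! i \<otimes>\<^bsub>T\<^esub> y \<in> Idl\<^bsub>T\<^esub> (set (take i (map \<pi> ys))) \<longrightarrow> y \<in> Idl\<^bsub>T\<^esub> (set (take i (map \<pi> ys)))) \<longleftrightarrow>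
      (\<forall>y\<in>R. ys ! i * y \<in> gen (J \<union> set (take i ys)) \<longrightarrow> y \<in> gen (J \<union> set (take i ys)))" if i: "i < length ys" for i
  proof -
    have yi: "ys ! i \<in> R" using assms i nth_mem by blast
    have "\<pi> (ys ! i) \<otimes>\<^bsub>T\<^esub> \<pi> y \<in> \<pi> ` gen (J \<union> set (take i ys)) \<longleftrightarrow> ys ! i * y \<in> gen (J \<union> set (take i ys))" if y: "y \<in> R" for y
      using m[of "ys ! i * y" i] mult[OF yi y] yi y by simp
    then show ?thesis unfolding Idl carr using i m by simp
  qed
  moreover have "Idl\<^bsub>T\<^esub> (set (map \<pi> ys)) \<noteq> carrier T \<longleftrightarrow> 1 \<notin> gen (J \<union> set ys)"
    unfolding full using image_full_iff[OF g'] by blast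
  moreover have "set (map \<pi> ys) \<subseteq> carrier T" using assms by (auto simp: carr)
  ultimately show ?thesis unfolding regular_sequence_def regs_iff_nth[OF J assms] by auto
qed

lemma lift_list: "set xs \<subseteq> \<pi> ` A \<Longrightarrow> \<exists>ys. set ys \<subseteq> A \<and> xs = map \<pi> ys"
proof (induction xs)
  case (Cons x xs)
  then obtain ys a where "set ys \<subseteq> A" "xs = map \<pi> ys" "a \<in> A" "x = \<pi> a" by auto
  then show ?case by (intro exI[of _ "a # ys"]) auto
qed simp

lemma ideal_depth_eq:
  assumes P: "prime_idl P" "J \<subseteq> P"
  shows "ideal_depth T (\<pi> ` P) = Sup {enat (length ys) | ys. regs J ys \<and> set ys \<subseteq> P}"
proof -
  have PR: "P \<subseteq> R" using idl_sub[OF prime_idl_idl[OF P(1)]] .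
  have "{enat (length xs) | xs. regular_sequence T xs \<and> set xs \<subseteq> \<pi> ` P} = {enat (length ys) | ys. regs J ys \<and> set ys \<subseteq> P}"
    (is "?l = ?r")
  proof
    show "?l \<subseteq> ?r"
    proof
      fix n assume "n \<in> ?l"
      then obtain xs where xs: "n = enat (length xs)" "regular_sequence T xs" "set xs \<subseteq> \<pi> ` P" by blast
      then obtain ys where ys: "set ys \<subseteq> P" "xs = map \<pi> ys" using lift_list by blast
      have "set ys \<subseteq> R" using ys(1) PR by blast
      then have "regs J ys" using regular_sequence_iff xs(2) ys(2) by blast
      then show "n \<in> ?r" using xs(1) ys by auto
    qed
    show "?r \<subseteq> ?l"
    proof
      fix n assume "n \<in> ?r"
      then obtain ys where ys: "n = enat (length ys)" "regs J ys" "set ys \<subseteq> P" by blast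
      have "gen (J \<union> set ys) \<subseteq> P" using ys(3) P(2) by (intro gen_least prime_idl_idl[OF P(1)]) auto
      then have "1 \<notin> gen (J \<union> set ys)" using prime_idl_one[OF P(1)] by blast
      then have "regular_sequence T (map \<pi> ys)" using regular_sequence_iff ys PR by blast
      moreover have "set (map \<pi> ys) \<subseteq> \<pi> ` P" using ys(3) by auto
      ultimately show "n \<in> ?l" using ys(1) by (auto intro!: exI[of _ "map \<pi> ys"])
    qed
  qed
  then show ?thesis unfolding ideal_depth_def by simp
qed

lemma noetherian_image:
  assumes noeth
  shows "noetherian_ring T"
proof -
  interpret T: cring T by (rule T)
  show ?thesis
  proof (rule T.noetherian_ringI)
    fix A assume A: "ideal A T"
    note p = ideal_pre[OF A]
    obtain X where X: "finite X" "X \<subseteq> R" "pre A = gen X" using noethE[OF assms p(1)] by blast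
    have "gen (J \<union> X) = gen X"
    proof
      show "gen (J \<union> X) \<subseteq> gen X" using p(2) X(3) gen_superset[of X] by (intro gen_least gen_idl X(2)) auto
    qed (rule gen_mono, blast)
    then have "A = Idl\<^bsub>T\<^esub> (\<pi> ` X)" using Idl_image[OF X(2)] X(3) p(3) by simp
    then show "\<exists>X\<subseteq>carrier T. finite X \<and> A = Idl\<^bsub>T\<^esub> X" using X(1,2) carr by (intro exI[of _ "\<pi> ` X"]) auto
  qed
qed

lemma cohen_macaulay_iff:
  assumes noeth
  shows "cohen_macaulay T \<longleftrightarrow> (\<forall>M. max_idl M \<and> J \<subseteq> M \<longrightarrow>
    Sup {enat (length ys) | ys. regs J ys \<and> set ys \<subseteq> M} = Sup {enat n | n. \<exists>Q. J \<subseteq> Q \<and> chain n Q M})"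
proof -
  have "(\<forall>P. maximalideal P T \<longrightarrow> ideal_depth T P = prime_height T P) \<longleftrightarrow>
    (\<forall>M. max_idl M \<and> J \<subseteq> M \<longrightarrow> ideal_depth T (\<pi> ` M) = prime_height T (\<pi> ` M))"
    unfolding maximalideal_iff by blast
  also have "\<dots> \<longleftrightarrow> (\<forall>M. max_idl M \<and> J \<subseteq> M \<longrightarrow>
    Sup {enat (length ys) | ys. regs J ys \<and> set ys \<subseteq> M} = Sup {enat n | n. \<exists>Q. J \<subseteq> Q \<and> chain n Q M})"
    by (intro all_cong1 imp_cong refl) (simp add: ideal_depth_eq[OF max_idl_prime] prime_height_eq[OF max_idl_prime])
  finally show ?thesis unfolding cohen_macaulay_def using T noetherian_image[OF assms] by blast
qed

lemma krull_dim_eq: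
  "krull_dim T = Sup {Sup {enat n | n. \<exists>Q. J \<subseteq> Q \<and> chain n Q P} | P. prime_idl P \<and> J \<subseteq> P}"
proof -
  have "{prime_height T P | P. primeideal P T} = {prime_height T (\<pi> ` P) | P. prime_idl P \<and> J \<subseteq> P}"
    unfolding primeideal_iff by blast
  also have "\<dots> = {Sup {enat n | n. \<exists>Q. J \<subseteq> Q \<and> chain n Q P} | P. prime_idl P \<and> J \<subseteq> P}"
    by (intro Collect_cong ex_cong1) (auto simp: prime_height_eq)
  finally show ?thesis unfolding krull_dim_def by simp
qed

lemma minimal_prime_over_iff:
  assumes "idl A" "J \<subseteq> A"
  shows "minimal_prime_over T (\<pi> ` A) P \<longleftrightarrow>
    (\<exists>B. P = \<pi> ` B \<and> prime_idl B \<and> A \<subseteq> B \<and> (\<forall>Q. prime_idl Q \<and> A \<subseteq> Q \<and> Q \<subseteq> B \<longrightarrow> Q = B))"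
proof -
  have ex: "\<exists>B. prime_idl B \<and> A \<subseteq> B \<and> Q = \<pi> ` B" if Q: "primeideal Q T" "\<pi> ` A \<subseteq> Q" for Q
  proof -
    obtain B where B: "prime_idl B" "J \<subseteq> B" "Q = \<pi> ` B" using Q(1) primeideal_iff by blast
    then have "A \<subseteq> B" using image_mono_iff[OF assms prime_idl_idl[OF B(1)] B(2)] Q(2) by blast
    then show ?thesis using B by blast
  qed
  have pr: "primeideal (\<pi> ` B) T \<and> \<pi> ` A \<subseteq> \<pi> ` B" if B: "prime_idl B" "A \<subseteq> B" for B
    using primeideal_image_iff[OF prime_idl_idl[OF B(1)]] B assms(2) by (simp add: image_mono subset_trans[of J A B])
  have mono: "\<pi> ` Q \<subseteq> \<pi> ` B \<longleftrightarrow> Q \<subseteq> B" and eq: "\<pi> ` Q = \<pi> ` B \<longleftrightarrow> Q = B" if "prime_idl Q" "A \<subseteq> Q" "prime_idl B" "A \<subseteq> B" for Q B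
    using image_mono_iff[OF prime_idl_idl _ prime_idl_idl, of Q B] image_eq_iff[OF prime_idl_idl _ prime_idl_idl, of Q B]
      that assms(2) by blast+
  have key: "minimal_prime_over T (\<pi> ` A) (\<pi> ` B) \<longleftrightarrow> (\<forall>Q. prime_idl Q \<and> A \<subseteq> Q \<and> Q \<subseteq> B \<longrightarrow> Q = B)"
    if B: "prime_idl B" "A \<subseteq> B" for B
  proof
    assume m: "minimal_prime_over T (\<pi> ` A) (\<pi> ` B)"
    show "\<forall>Q. prime_idl Q \<and> A \<subseteq> Q \<and> Q \<subseteq> B \<longrightarrow> Q = B"
    proof (intro allI impI, elim conjE)
      fix Q assume Q: "prime_idl Q" "A \<subseteq> Q" "Q \<subseteq> B"
      note pr[OF Q(1,2)]
      moreover have "\<pi> ` Q \<subseteq> \<pi> ` B" using Q(3) by (rule image_mono)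
      ultimately have "\<pi> ` Q = \<pi> ` B" using m unfolding minimal_prime_over_def by metis
      then show "Q = B" using eq[OF Q(1,2) B] by blast
    qed
  next
    assume m: "\<forall>Q. prime_idl Q \<and> A \<subseteq> Q \<and> Q \<subseteq> B \<longrightarrow> Q = B"
    have "Q = \<pi> ` B" if Q: "primeideal Q T" "\<pi> ` A \<subseteq> Q" "Q \<subseteq> \<pi> ` B" for Q
    proof -
      obtain C where C: "prime_idl C" "A \<subseteq> C" "Q = \<pi> ` C" using ex[OF Q(1,2)] by blast
      then have "C \<subseteq> B" using mono[OF C(1,2) B] Q(3) by blast
      then show ?thesis using m C by blast
    qed
    moreover note pr[OF B]
    ultimately show "minimal_prime_over T (\<pi> ` A) (\<pi> ` B)" unfolding minimal_prime_over_def by metis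
  qed
  show ?thesis
  proof
    assume m: "minimal_prime_over T (\<pi> ` A) P"
    then have P: "primeideal P T" "\<pi> ` A \<subseteq> P" unfolding minimal_prime_over_def by metis+
    obtain B where B: "prime_idl B" "A \<subseteq> B" "P = \<pi> ` B" using ex[OF P] by blast
    then show "\<exists>B. P = \<pi> ` B \<and> prime_idl B \<and> A \<subseteq> B \<and> (\<forall>Q. prime_idl Q \<and> A \<subseteq> Q \<and> Q \<subseteq> B \<longrightarrow> Q = B)"
      using key[OF B(1,2)] m unfolding B(3) by (intro exI[of _ B]) (simp add: B(1,2))
  next
    assume "\<exists>B. P = \<pi> ` B \<and> prime_idl B \<and> A \<subseteq> B \<and> (\<forall>Q. prime_idl Q \<and> A \<subseteq> Q \<and> Q \<subseteq> B \<longrightarrow> Q = B)"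
    then obtain B where B: "P = \<pi> ` B" "prime_idl B" "A \<subseteq> B" "\<forall>Q. prime_idl Q \<and> A \<subseteq> Q \<and> Q \<subseteq> B \<longrightarrow> Q = B" by metis
    show "minimal_prime_over T (\<pi> ` A) P" unfolding B(1) key[OF B(2,3)] by (rule B(4))
  qed
qed

end

lemma poly_ring_simps [simp]:
  "carrier (poly_ring V) = polys V" "mult (poly_ring V) = (*)" "one (poly_ring V) = 1" "zero (poly_ring V) = 0" "add (poly_ring V) = (+)"
  by (simp_all add: poly_ring_def polys_def)

lemma cring_poly_ring: "cring (poly_ring V :: ('v, 'k::field) mpoly ring)"
proof (rule cringI)
  show "abelian_group (poly_ring V :: ('v, 'k) mpoly ring)"
  proof (rule abelian_groupI)
    fix x :: "('v, 'k) mpoly" assume "x \<in> carrier (poly_ring V)"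
    then show "\<exists>y\<in>carrier (poly_ring V). y \<oplus>\<^bsub>poly_ring V\<^esub> x = \<zero>\<^bsub>poly_ring V\<^esub>"
      by (intro bexI[of _ "- x"]) auto
  qed (auto simp: add_ac)
  show "Group.comm_monoid (poly_ring V :: ('v, 'k) mpoly ring)"
    by (rule comm_monoidI) (auto simp: mult_ac)
qed (auto simp: distrib_right)

lemma ring_image_poly: "ring_image (polys V) (poly_ring V :: ('v, 'k::field) mpoly ring) (\<lambda>a. a) {0}"
  by (intro ring_image.intro ring_image_axioms.intro subring_polys polys.idl_zero_set cring_poly_ring) auto

lemma ring_image_Quot:
  assumes J: "polys.idl V (J :: ('v, 'k::field) mpoly set)"
  shows "ring_image (polys V) (poly_ring V Quot J) (\<lambda>a. J +>\<^bsub>poly_ring V\<^esub> a) J"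
proof -
  interpret I: ring_image "polys V" "poly_ring V" "\<lambda>a :: ('v, 'k) mpoly. a" "{0}" by (rule ring_image_poly)
  have ide: "ideal J (poly_ring V)" using I.ideal_image[OF J] by simp
  interpret ideal J "poly_ring V" by (rule ide)
  have co: "J +>\<^bsub>poly_ring V\<^esub> a = {b. b - a \<in> J}" for a
  proof -
    have "b = (b - a) + a" for b by simp
    then show ?thesis unfolding a_r_coset_def' by (auto intro: UN_I[of "_ - a"])
  qed
  show ?thesis
  proof (intro ring_image.intro ring_image_axioms.intro subring_polys J)
    show "cring (poly_ring V Quot J)" by (rule quotient_is_cring[OF cring_poly_ring])
    show "carrier (poly_ring V Quot J) = (\<lambda>a. J +>\<^bsub>poly_ring V\<^esub> a) ` polys V"
      by (auto simp: FactRing_def A_RCOSETS_def')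
    show "J +>\<^bsub>poly_ring V\<^esub> (a + b) = (J +>\<^bsub>poly_ring V\<^esub> a) \<oplus>\<^bsub>poly_ring V Quot J\<^esub> (J +>\<^bsub>poly_ring V\<^esub> b)"
      if "a \<in> polys V" "b \<in> polys V" for a b
      using ring_hom_add[OF rcos_ring_hom, of a b] that by simp
    show "J +>\<^bsub>poly_ring V\<^esub> (a * b) = (J +>\<^bsub>poly_ring V\<^esub> a) \<otimes>\<^bsub>poly_ring V Quot J\<^esub> (J +>\<^bsub>poly_ring V\<^esub> b)"
      if "a \<in> polys V" "b \<in> polys V" for a b
      using ring_hom_mult[OF rcos_ring_hom, of a b] that by simp
    show "J +>\<^bsub>poly_ring V\<^esub> 1 = \<one>\<^bsub>poly_ring V Quot J\<^esub>"
      using ring_hom_one[OF rcos_ring_hom] by simp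
    show "J +>\<^bsub>poly_ring V\<^esub> a = J +>\<^bsub>poly_ring V\<^esub> b \<longleftrightarrow> a - b \<in> J" if "a \<in> polys V" "b \<in> polys V" for a b
    proof
      assume "J +>\<^bsub>poly_ring V\<^esub> a = J +>\<^bsub>poly_ring V\<^esub> b"
      then show "a - b \<in> J" unfolding co using polys.idl_zero[OF J] by (metis (mono_tags) diff_self mem_Collect_eq)
    next
      assume ab: "a - b \<in> J"
      have "c - a \<in> J \<longleftrightarrow> c - b \<in> J" for c
        using polys.idl_cong_mem[OF J, of "c - b" "c - a"] ab by simp
      then show "J +>\<^bsub>poly_ring V\<^esub> a = J +>\<^bsub>poly_ring V\<^esub> b" unfolding co by simp
    qed
  qed
qed

section \<open>Weakly connected convex collections\<close>

lemma cell_inject: "cell p = cell q \<longleftrightarrow> p = q"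
proof
  assume eq: "cell p = cell q"
  have le: "fst s \<le> fst r \<and> snd s \<le> snd r" if "r \<in> cell s" for r s
    using that by (auto simp: cell_alt top_corner_def)
  have "p \<in> cell q" "q \<in> cell p" using eq by (auto simp: cell_alt)
  then show "p = q" using le[of p q] le[of q p] by (simp add: prod_eq_iff)
qed simp

lemma cell_adjacent_near:
  assumes "cell_adjacent (cell (x, y)) (cell (x', y'))"
  shows "\<bar>x - x'\<bar> \<le> 1 \<and> \<bar>y - y'\<bar> \<le> 1"
proof -
  have edges: "e \<subseteq> cell p \<and> e \<noteq> {}" if "e \<in> cell_edges p" for e p
    using that by (cases p) (auto simp: cell_edges_def cell_def)
  have "cell (x, y) \<inter> cell (x', y') \<noteq> {}"
    using assms edges unfolding cell_adjacent_def cell_inject by blast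
  then show ?thesis by (auto simp: cell_def)
qed

definition corners :: "point set set \<Rightarrow> point set" where
  "corners \<C> = {p. cell p \<in> \<C>}"

lemma cell_corners: "\<forall>A\<in>\<C>. \<exists>p. A = cell p \<Longrightarrow> cell ` corners \<C> = \<C>"
  by (auto simp: corners_def)

lemma finite_corners: "finite \<C> \<Longrightarrow> finite (corners \<C>)"
  unfolding corners_def using finite_vimageI[of \<C> cell] by (simp add: vimage_def inj_def cell_inject)

lemma hv_convex_corners:
  assumes cells: "\<forall>A\<in>\<C>. \<exists>p. A = cell p" and conn: "weakly_connected \<C>" and conv: "convex_cells \<C>"
  shows "hv_convex (corners \<C>)"
proof
  fix i j k l :: int
  show "(i, j) \<in> corners \<C> \<Longrightarrow> (l, j) \<in> corners \<C> \<Longrightarrow> i \<le> k \<Longrightarrow> k \<le> l \<Longrightarrow> (k, j) \<in> corners \<C>"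
    using conv unfolding convex_cells_def row_convex_def corners_def by blast
  show "(i, j) \<in> corners \<C> \<Longrightarrow> (i, l) \<in> corners \<C> \<Longrightarrow> j \<le> k \<Longrightarrow> k \<le> l \<Longrightarrow> (i, k) \<in> corners \<C>"
    using conv unfolding convex_cells_def column_convex_def corners_def by blast
next
  fix T p q assume T: "T \<subseteq> corners \<C>" "p \<in> T" "q \<in> corners \<C>" "q \<notin> T"
  let ?r = "{(X, Y). X \<in> \<C> \<and> Y \<in> \<C> \<and> cell_adjacent X Y}"
  \<comment> \<open>On a path of cells that starts in \<open>T\<close>, the first step leaving
    \<open>T\<close> is the required king's move.\<close>
  have step: "Y \<in> cell ` T \<or> (\<exists>x y x' y'. (x, y) \<in> T \<and> (x', y') \<in> corners \<C> \<and> (x', y') \<notin> T \<and> \<bar>x - x'\<bar> \<le> 1 \<and> \<bar>y - y'\<bar> \<le> 1)"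
    (is "_ \<or> ?ex") if path: "(cell p, Y) \<in> ?r\<^sup>*" for Y
    using path
  proof (induction rule: rtrancl_induct)
    case base
    then show ?case using T(2) by blast
  next
    case (step X Y)
    show ?case
    proof (rule ccontr)
      assume n: "\<not> ?case"
      then have "X \<in> cell ` T" using step.IH by blast
      then obtain x y where X: "X = cell (x, y)" "(x, y) \<in> T" by auto
      obtain x' y' where Y: "Y = cell (x', y')" using step.hyps(2) cells by (metis (no_types, lifting) case_prodD mem_Collect_eq surj_pair)
      have adj: "cell_adjacent (cell (x, y)) (cell (x', y'))" "cell (x', y') \<in> \<C>" using step.hyps(2) X(1) Y by auto
      have "(x', y') \<notin> T" using n Y by blast
      moreover have "(x', y') \<in> corners \<C>" using adj(2) by (simp add: corners_def)
      ultimately have ?ex using X(2) cell_adjacent_near[OF adj(1)] by blast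
      then show False using n by blast
    qed
  qed
  have "(cell p, cell q) \<in> ?r\<^sup>*" using conn T unfolding weakly_connected_def corners_def by blast
  from step[OF this] show "\<exists>x y x' y'. (x, y) \<in> T \<and> (x', y') \<in> corners \<C> \<and> (x', y') \<notin> T \<and> \<bar>x - x'\<bar> \<le> 1 \<and> \<bar>y - y'\<bar> \<le> 1"
  proof
    assume "cell q \<in> cell ` T"
    then show ?thesis using T(4) by (auto simp: cell_inject)
  qed
qed

lemma mem_cell_iff: "(x, y) \<in> cell p \<longleftrightarrow> p = (x, y) \<or> p = (x - 1, y - 1) \<or> p = (x, y - 1) \<or> p = (x - 1, y)"
  by (cases p) (auto simp: cell_def)

lemma forbidden_iff:
  "(\<exists>T\<subseteq>\<C>. square_tetromino T \<or> X_pentomino T) \<longleftrightarrow> \<not> no_square (corners \<C>) \<or> \<not> no_cross (corners \<C>)"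
proof -
  have sq: "{A. (\<exists>p. A = cell p) \<and> (x, y) \<in> A} = {cell (x, y), cell (x - 1, y - 1), cell (x, y - 1), cell (x - 1, y)}" for x y
  proof -
    have "{A. (\<exists>p. A = cell p) \<and> (x, y) \<in> A} = cell ` {p. (x, y) \<in> cell p}" by blast
    also have "{p. (x, y) \<in> cell p} = {(x, y), (x - 1, y - 1), (x, y - 1), (x - 1, y)}" unfolding mem_cell_iff by blast
    finally show ?thesis by simp
  qed
  have "(\<exists>T\<subseteq>\<C>. square_tetromino T) \<longleftrightarrow> \<not> no_square (corners \<C>)"
  proof
    assume "\<exists>T\<subseteq>\<C>. square_tetromino T"
    then obtain v where v: "{A. (\<exists>p. A = cell p) \<and> v \<in> A} \<subseteq> \<C>" unfolding square_tetromino_def by blast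
    obtain x y where xy: "v = (x, y)" by (cases v)
    have "cell (x, y) \<in> \<C>" "cell (x - 1, y - 1) \<in> \<C>" "cell (x, y - 1) \<in> \<C>" "cell (x - 1, y) \<in> \<C>" using v unfolding xy sq by simp_all
    then show "\<not> no_square (corners \<C>)"
      using no_squareD[of "corners \<C>" "x - 1" "y - 1"] by (auto simp: corners_def)
  next
    assume "\<not> no_square (corners \<C>)"
    then obtain i j where ij: "cell (i, j) \<in> \<C>" "cell (i + 1, j) \<in> \<C>" "cell (i, j + 1) \<in> \<C>" "cell (i + 1, j + 1) \<in> \<C>"
      by (auto simp: no_square_def corners_def)
    have "{A. (\<exists>p. A = cell p) \<and> (i + 1, j + 1) \<in> A} \<subseteq> \<C>" unfolding sq using ij by simp
    then show "\<exists>T\<subseteq>\<C>. square_tetromino T" unfolding square_tetromino_def by blast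
  qed
  moreover have "(\<exists>T\<subseteq>\<C>. X_pentomino T) \<longleftrightarrow> \<not> no_cross (corners \<C>)"
  proof -
    have "(\<exists>T\<subseteq>\<C>. X_pentomino T) \<longleftrightarrow>
        (\<exists>i j. {cell (i, j), cell (i + 1, j), cell (i - 1, j), cell (i, j + 1), cell (i, j - 1)} \<subseteq> \<C>)"
      unfolding X_pentomino_def by metis
    also have "\<dots> \<longleftrightarrow> \<not> no_cross (corners \<C>)" unfolding no_cross_def corners_def by (simp only: mem_Collect_eq insert_subset empty_subsetI simp_thms not_all not_not)
    finally show ?thesis .
  qed
  ultimately show ?thesis by blast
qed

lemma vertices_corners: "\<forall>A\<in>\<C>. \<exists>p. A = cell p \<Longrightarrow> vertices \<C> = \<Union> (cell ` corners \<C>)"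
  using cell_corners by (metis vertices_def)

lemma Idl_poly_ring:
  assumes "X \<subseteq> polys V"
  shows "Idl\<^bsub>poly_ring V\<^esub> X = polys.gen V (X :: ('v, 'k::field) mpoly set)"
proof -
  interpret P: ring_image "polys V" "poly_ring V" "\<lambda>a :: ('v, 'k) mpoly. a" "{0}" by (rule ring_image_poly)
  show ?thesis using P.Idl_image[OF assms] polys.gen_insert_zero[OF assms] by simp
qed

lemma regular_sequence_poly_ring:
  assumes "set xs \<subseteq> polys V"
  shows "regular_sequence (poly_ring V) xs \<longleftrightarrow> polys.regs V {0} xs \<and> 1 \<notin> polys.gen V (set xs :: ('v, 'k::field) mpoly set)"
proof -
  interpret P: ring_image "polys V" "poly_ring V" "\<lambda>a :: ('v, 'k) mpoly. a" "{0}" by (rule ring_image_poly)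
  show ?thesis using P.regular_sequence_iff[OF assms] polys.gen_insert_zero[OF assms] by simp
qed

lemma Sup_enat_eq: "m \<in> A \<Longrightarrow> (\<And>n. n \<in> A \<Longrightarrow> n \<le> m) \<Longrightarrow> Sup A = (m :: enat)"
  by (intro antisym Sup_least Sup_upper)

lemma unmixed_iff:
  assumes "polys.idl V (I :: ('v, 'k::field) mpoly set)"
  shows "unmixed (poly_ring V) I \<longleftrightarrow> (\<forall>P Q. minimal_prime_over (poly_ring V) I P \<and> minimal_prime_over (poly_ring V) I Q \<longrightarrow>
      Sup {enat n | n. \<exists>Q. polys.chain V n Q P} = Sup {enat n | n. \<exists>P. polys.chain V n P Q})"
    and "minimal_prime_over (poly_ring V) I P \<longleftrightarrow> polys.prime_idl V P \<and> I \<subseteq> P \<and>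
      (\<forall>Q. polys.prime_idl V Q \<and> I \<subseteq> Q \<and> Q \<subseteq> P \<longrightarrow> Q = P)"
proof -
  interpret P: ring_image "polys V" "poly_ring V" "\<lambda>a :: ('v, 'k) mpoly. a" "{0}" by (rule ring_image_poly)
  have z: "{0} \<subseteq> P" if "polys.idl V P" for P :: "('v, 'k) mpoly set" using polys.idl_zero[OF that] by simp
  show m: "minimal_prime_over (poly_ring V) I P \<longleftrightarrow> polys.prime_idl V P \<and> I \<subseteq> P \<and>
      (\<forall>Q. polys.prime_idl V Q \<and> I \<subseteq> Q \<and> Q \<subseteq> P \<longrightarrow> Q = P)" for P
    using P.minimal_prime_over_iff[OF assms z[OF assms], of P] by simp
  have h: "prime_height (poly_ring V) P = Sup {enat n | n. \<exists>Q. polys.chain V n Q P}" if P: "polys.prime_idl V P" for P :: "('v, 'k) mpoly set"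
  proof -
    have "{0} \<subseteq> Q" if "polys.chain V n Q P" for n Q
      using z[of Q] polys.prime_idl_idl[of V Q] polys.chain_primes[OF that] by blast
    then have "(\<exists>Q. {0} \<subseteq> Q \<and> polys.chain V n Q P) \<longleftrightarrow> (\<exists>Q. polys.chain V n Q P)" for n by blast
    then show ?thesis using P.prime_height_eq[OF P z[OF polys.prime_idl_idl[OF P]]] by simp
  qed
  have "minimal_prime_over (poly_ring V) I P \<Longrightarrow> prime_height (poly_ring V) P = Sup {enat n | n. \<exists>Q. polys.chain V n Q P}" for P
    using h m by blast
  then show "unmixed (poly_ring V) I \<longleftrightarrow> (\<forall>P Q. minimal_prime_over (poly_ring V) I P \<and> minimal_prime_over (poly_ring V) I Q \<longrightarrow>
      Sup {enat n | n. \<exists>Q. polys.chain V n Q P} = Sup {enat n | n. \<exists>P. polys.chain V n P Q})"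
    unfolding unmixed_def by auto
qed

context regular_ideal begin

lemma complete_intersection_J: "1 \<notin> J \<Longrightarrow> complete_intersection (poly_ring V) J"
  unfolding complete_intersection_def
  using regular_sequence_poly_ring[OF fs_sub] Idl_poly_ring[OF fs_sub] regs J_def by metis

lemma unmixed_J: "unmixed (poly_ring V) J"
proof -
  have h: "Sup {enat n | n. \<exists>Q. polys.chain V n Q P} = enat N" if "minimal_prime_over (poly_ring V) J P" for P
  proof (rule Sup_enat_eq)
    have P: "polys.prime_idl V P" "J \<subseteq> P" and min: "\<And>Q. polys.prime_idl V Q \<Longrightarrow> J \<subseteq> Q \<Longrightarrow> Q \<subseteq> P \<Longrightarrow> Q = P"
      using that unfolding unmixed_iff(2)[OF J_idl] by blast+
    show "enat N \<in> {enat n | n. \<exists>Q. polys.chain V n Q P}" using minimal_prime_chains(1)[OF P min] by blast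
    show "n \<le> enat N" if "n \<in> {enat n | n. \<exists>Q. polys.chain V n Q P}" for n
      using that minimal_prime_chains(2)[OF P min] by auto
  qed
  show ?thesis unfolding unmixed_iff(1)[OF J_idl]
  proof (intro allI impI, elim conjE)
    fix P Q assume "minimal_prime_over (poly_ring V) J P" "minimal_prime_over (poly_ring V) J Q"
    then show "Sup {enat n | n. \<exists>Q. polys.chain V n Q P} = Sup {enat n | n. \<exists>P. polys.chain V n P Q}" by (simp only: h)
  qed
qed

lemma height_J: "polys.max_idl V M \<Longrightarrow> J \<subseteq> M \<Longrightarrow> Sup {enat n | n. \<exists>Q. J \<subseteq> Q \<and> polys.chain V n Q M} = enat (card V - N)"
proof (rule Sup_enat_eq)
  assume M: "polys.max_idl V M" "J \<subseteq> M"
  show "enat (card V - N) \<in> {enat n | n. \<exists>Q. J \<subseteq> Q \<and> polys.chain V n Q M}" using max_chain[OF M] by blast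
  show "n \<le> enat (card V - N)" if n: "n \<in> {enat n | n. \<exists>Q. J \<subseteq> Q \<and> polys.chain V n Q M}" for n
  proof -
    obtain k Q where k: "n = enat k" "J \<subseteq> Q" "polys.chain V k Q M" using n by blast
    show ?thesis using chain_over_J[OF k(3,2)] k(1) by simp
  qed
qed

lemma cohen_macaulay_J: "cohen_macaulay (poly_ring V Quot J)"
proof -
  interpret Q: ring_image "polys V" "poly_ring V Quot J" "\<lambda>a. J +>\<^bsub>poly_ring V\<^esub> a" J by (rule ring_image_Quot[OF J_idl])
  have "Sup {enat (length ys) | ys. polys.regs V J ys \<and> set ys \<subseteq> M} = enat (card V - N)" if M: "polys.max_idl V M" "J \<subseteq> M" for M
  proof (rule Sup_enat_eq)
    obtain gs where gs: "set gs \<subseteq> M" "N + length gs = card V" "polys.regs V J gs" using max_regs[OF M] by blast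
    then have "card V - N = length gs" by linarith
    then show "enat (card V - N) \<in> {enat (length ys) | ys. polys.regs V J ys \<and> set ys \<subseteq> M}" using gs by auto
    show "n \<le> enat (card V - N)" if n: "n \<in> {enat (length ys) | ys. polys.regs V J ys \<and> set ys \<subseteq> M}" for n
    proof -
      obtain ys where ys: "n = enat (length ys)" "polys.regs V J ys" "set ys \<subseteq> M" using n by blast
      show ?thesis using regs_over_J[OF ys(2,3) polys.max_idl_prime[OF M(1)] M(2)] ys(1) by simp
    qed
  qed
  then show ?thesis unfolding Q.cohen_macaulay_iff[OF noeth] using height_J by simp
qed

lemma krull_dim_J:
  assumes "1 \<notin> J"
  shows "enat N + krull_dim (poly_ring V Quot J) = enat (card V)"
proof -
  interpret Q: ring_image "polys V" "poly_ring V Quot J" "\<lambda>a. J +>\<^bsub>poly_ring V\<^esub> a" J by (rule ring_image_Quot[OF J_idl])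
  obtain M where M: "polys.max_idl V M" "J \<subseteq> M" using polys.noeth_max_idl[OF noeth J_idl assms] by blast
  have Mp: "polys.prime_idl V M" using M(1) by (rule polys.max_idl_prime)
  have "krull_dim (poly_ring V Quot J) = enat (card V - N)"
    unfolding Q.krull_dim_eq
  proof (rule Sup_enat_eq)
    show "enat (card V - N) \<in> {Sup {enat n | n. \<exists>Q. J \<subseteq> Q \<and> polys.chain V n Q P} | P. polys.prime_idl V P \<and> J \<subseteq> P}"
      using height_J[OF M] Mp M(2) by (metis (mono_tags, lifting) mem_Collect_eq)
    fix h assume "h \<in> {Sup {enat n | n. \<exists>Q. J \<subseteq> Q \<and> polys.chain V n Q P} | P. polys.prime_idl V P \<and> J \<subseteq> P}"
    then obtain P where h: "h = Sup {enat n | n. \<exists>Q. J \<subseteq> Q \<and> polys.chain V n Q P}" by blast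
    show "h \<le> enat (card V - N)" unfolding h
    proof (rule Sup_least)
      fix n assume "n \<in> {enat n | n. \<exists>Q. J \<subseteq> Q \<and> polys.chain V n Q P}"
      then obtain k Q where k: "n = enat k" "J \<subseteq> Q" "polys.chain V k Q P" by blast
      show "n \<le> enat (card V - N)" using chain_over_J[OF k(3,2)] k(1) by simp
    qed
  qed
  moreover have "N \<le> card V" using chain_over_J[OF polys.chain_0[OF Mp] M(2)] by simp
  ultimately show ?thesis by simp
qed

end

context heavy_cells begin

lemma not_complete_intersection: "\<not> complete_intersection (poly_ring V) I"
proof
  assume "complete_intersection (poly_ring V) I"
  then obtain xs where xs: "regular_sequence (poly_ring V) xs" "I = Idl\<^bsub>poly_ring V\<^esub> (set xs)"
    unfolding complete_intersection_def by blast
  have sub: "set xs \<subseteq> polys V" using xs(1) by (simp add: regular_sequence_def)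
  show False
    using not_regular_gens[of xs] xs regular_sequence_poly_ring[OF sub] Idl_poly_ring[OF sub] by metis
qed

lemma not_unmixed: "\<not> unmixed (poly_ring V) I"
proof
  assume um: "unmixed (poly_ring V) I"
  \<comment> \<open>\<open>Q\<close> itself need not be minimal over the ideal; a minimal prime
    below it also has height less than \<open>card G\<close>.\<close>
  obtain P where P: "polys.prime_idl V P" "I \<subseteq> P" "P \<subseteq> Q"
    and min: "\<forall>P'. polys.prime_idl V P' \<and> I \<subseteq> P' \<and> P' \<subseteq> P \<longrightarrow> P' = P"
    using minimal_prime_below[OF finV primes(1) I_Q] by blast
  have "minimal_prime_over (poly_ring V) I P" unfolding unmixed_iff(2)[OF I_idl] using P min by blast
  moreover have "minimal_prime_over (poly_ring V) I L" unfolding unmixed_iff(2)[OF I_idl] using primes(3) I_L L_minimal by blast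
  ultimately have eq: "Sup {enat n | n. \<exists>Q. polys.chain V n Q P} = Sup {enat n | n. \<exists>Q. polys.chain V n Q L}"
    using um unfolding unmixed_iff(1)[OF I_idl] by blast
  have "enat (card G) \<le> Sup {enat n | n. \<exists>Q. polys.chain V n Q L}" using chain_L by (intro Sup_upper) blast
  moreover have "Sup {enat n | n. \<exists>Q. polys.chain V n Q P} \<le> enat (card G - 1)"
  proof (rule Sup_least)
    fix h assume "h \<in> {enat n | n. \<exists>Q. polys.chain V n Q P}"
    then obtain n Q' where n: "h = enat n" "polys.chain V n Q' P" by blast
    then show "h \<le> enat (card G - 1)" using below_Q[OF n(2) P(3)] by simp
  qed
  ultimately have "enat (card G) \<le> enat (card G - 1)" unfolding eq by (rule order_trans)
  moreover have "0 < card G" using below_Q[OF polys.chain_0[OF primes(1)]] by simp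
  ultimately show False by simp
qed

lemma not_cohen_macaulay: "\<not> cohen_macaulay (poly_ring V Quot I)"
proof
  interpret Q: ring_image "polys V" "poly_ring V Quot I" "\<lambda>a. I +>\<^bsub>poly_ring V\<^esub> a" I by (rule ring_image_Quot[OF I_idl])
  assume "cohen_macaulay (poly_ring V Quot I)"
  moreover have IM: "I \<subseteq> M" using I_L L_M by blast
  ultimately have eq: "Sup {enat (length ys) | ys. polys.regs V I ys \<and> set ys \<subseteq> M} = Sup {enat n | n. \<exists>Q. I \<subseteq> Q \<and> polys.chain V n Q M}"
    unfolding Q.cohen_macaulay_iff[OF noethV] using M_max by blast
  have "enat (card F) \<le> Sup {enat n | n. \<exists>Q. I \<subseteq> Q \<and> polys.chain V n Q M}" using chain_QM I_Q by (intro Sup_upper) blast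
  moreover have "Sup {enat (length ys) | ys. polys.regs V I ys \<and> set ys \<subseteq> M} \<le> enat (card F - 1)"
  proof (rule Sup_least)
    fix h assume "h \<in> {enat (length ys) | ys. polys.regs V I ys \<and> set ys \<subseteq> M}"
    then obtain ys where "h = enat (length ys)" "polys.regs V I ys" "set ys \<subseteq> M" by blast
    then show "h \<le> enat (card F - 1)" using depth_M[of ys] by simp
  qed
  ultimately have "enat (card F) \<le> enat (card F - 1)" unfolding eq by (rule order_trans)
  \<comment> \<open>The empty sequence already forces \<open>card F\<close> to be positive, so the
    truncated subtraction \<open>card F - 1\<close> is a genuine one.\<close>
  moreover have "0 < card F" using depth_M[of "[]"] by simp
  ultimately show False by simp
qed

end

text \<open>All minors vanish at the point with all coordinates 1. This supplies the properness that
  \<open>regs\<close> leaves out.\<close>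

lemma one_not_in_minors:
  assumes "\<And>p. p \<in> G \<Longrightarrow> cell p \<subseteq> V"
  shows "1 \<notin> polys.gen V (adj_minor ` G :: (point, 'k::field) mpoly set)"
proof
  interpret coeff_hom "id :: 'k \<Rightarrow> 'k" by (rule coeff_hom_id)
  have sub: "adj_minor ` G \<subseteq> (polys V :: (point, 'k) mpoly set)" using adj_minor_polys[OF assms] by blast
  have "ev id (\<lambda>_. 1 :: 'k) x = 0" if "x \<in> adj_minor ` G" for x
    using that by (auto simp: ev_adj_minor_eq_0 minor_eq_def)
  moreover assume "1 \<in> polys.gen V (adj_minor ` G :: (point, 'k) mpoly set)"
  ultimately have "ev id (\<lambda>_. 1 :: 'k) (1 :: (point, 'k) mpoly) = 0" by (rule ev_gen[OF sub])
  then show False by simp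
qed

theorem theorem0p2:
  fixes \<C> :: "point set set"
    and I :: "(point, 'k::field) mpoly set"
    and S :: "(point, 'k) mpoly ring"
  assumes cells: "\<forall>A\<in>\<C>. \<exists>p. A = cell p"
    and finite: "finite \<C>"
    and nonempty: "\<C> \<noteq> {}"
    and connected: "weakly_connected \<C>"
    and convex: "convex_cells \<C>"
    and S: "S = poly_ring (vertices \<C>)"
    and I: "I = adj_ideal \<C>"
  shows
    "(complete_intersection S I \<longleftrightarrow> \<not> (\<exists>T\<subseteq>\<C>. square_tetromino T \<or> X_pentomino T)) \<and>
     (gorenstein_algebra (vertices \<C>) I \<longleftrightarrow> \<not> (\<exists>T\<subseteq>\<C>. square_tetromino T \<or> X_pentomino T)) \<and>
     (level_algebra (vertices \<C>) I \<longleftrightarrow> \<not> (\<exists>T\<subseteq>\<C>. square_tetromino T \<or> X_pentomino T)) \<and>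
     (cohen_macaulay (S Quot I) \<longleftrightarrow> \<not> (\<exists>T\<subseteq>\<C>. square_tetromino T \<or> X_pentomino T)) \<and>
     (unmixed S I \<longleftrightarrow> \<not> (\<exists>T\<subseteq>\<C>. square_tetromino T \<or> X_pentomino T))"
proof -
  define G where "G = corners \<C>"
  define V where "V = \<Union> (cell ` G)"
  have G: "finite G" "hv_convex G" unfolding G_def by (rule finite_corners[OF finite] hv_convex_corners[OF cells connected convex])+
  have vert: "vertices \<C> = V" unfolding V_def G_def by (rule vertices_corners[OF cells])
  have cV: "cell p \<subseteq> V" if "p \<in> G" for p using that by (auto simp: V_def)
  have finV: "finite V" unfolding V_def using G(1) by (auto simp: cell_alt)
  have minors: "adj_minor ` G \<subseteq> (polys V :: (point, 'k) mpoly set)" using adj_minor_polys[OF cV] by blast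
  have e: "{adj_minor p | p. cell p \<in> \<C>} = adj_minor ` G" by (auto simp: G_def corners_def)
  have gen: "I = polys.gen V (adj_minor ` G)"
    unfolding I adj_ideal_def vert e by (rule Idl_poly_ring[OF minors])
  show ?thesis
  proof (cases "no_square G \<and> no_cross G")
    case True
    obtain ps where ps: "distinct ps" "set ps = G" using finite_distinct_list[OF G(1)] by blast
    let ?fs = "map adj_minor ps :: (point, 'k) mpoly list"
    have hall: "card {p\<in>G. edge_in W p} \<le> card W" if "W \<subseteq> V" for W
      using hall_cells[OF G(2) _ _ G(1) finite_subset[OF that finV]] True by blast
    have "polys.regs V {0} ?fs"
      by (rule good_regs[OF finV cV hall G(1) ps(1)]) (use ps(2) in auto)
    then interpret R: regular_ideal V ?fs by (intro regular_ideal.intro finV)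
    have J: "R.J = I" unfolding R.J_def gen using ps(2) by simp
    have one: "1 \<notin> R.J" unfolding J gen by (rule one_not_in_minors[OF cV])
    \<comment> \<open>Nonemptiness makes the Koszul complex of positive length, so that the
      coboundaries in the last degree are the image of a differential.\<close>
    have "G \<noteq> {}" using nonempty cell_corners[OF cells] by (auto simp: G_def)
    then have pos: "length ?fs > 0" using ps(2) by auto
    have hom: "homogeneous 2 (?fs ! k)" if "k < length ?fs" for k
    proof -
      have "monom_deg m = 2" if "m \<in> keys (adj_minor (ps ! k) :: (point, 'k) mpoly)" for m using that by (rule keys_adj_minor)
      then show ?thesis using that by (simp add: homogeneous_def)
    qed
    have "gorenstein_algebra V R.J \<and> level_algebra V R.J"
      by (rule R.gorenstein_level[OF pos hom R.cohen_macaulay_J R.krull_dim_J[OF one]])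
    moreover have "\<not> (\<exists>T\<subseteq>\<C>. square_tetromino T \<or> X_pentomino T)" using True unfolding forbidden_iff G_def by blast
    ultimately show ?thesis
      using R.complete_intersection_J[OF one] R.unmixed_J R.cohen_macaulay_J unfolding S vert J by blast
  next
    case False
    then obtain W where W: "heavy G W" using heavy_exists[OF G] by blast
    interpret H: heavy_cells G W V I
      using G(1) W by unfold_locales (simp_all add: V_def gen)
    have "\<exists>T\<subseteq>\<C>. square_tetromino T \<or> X_pentomino T" using False unfolding forbidden_iff G_def by blast
    \<comment> \<open>The Gorenstein and the level property contain the Cohen--Macaulay property by
      definition, so three refutations settle all five conditions.\<close>
    then show ?thesis
      using H.not_complete_intersection H.not_unmixed H.not_cohen_macaulay
      unfolding S vert gorenstein_algebra_def level_algebra_def by blast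
  qed
qed

end
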